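(* Let $Q$ be an affine monoid of *dimension $d$ and $\mathbb{K}$ a field. The following holds: (1) If $d \geq 2$, then ${}^{*}\mathrm{depth}\,\mathbb{K}[Q] = 1$ if and only if there is a $0$-*dimensional family of holes of $Q$. (2) $Q$ is locally normal if and only if there is no family of holes of $Q$ of positive *dimension. (3) $\mathbb{K}[Q]$ satisfies Serre's condition $(R_1)$ if and only if there is no family of holes of $Q$ of *dimension $d-1$. (4) $\mathbb{K}[Q]$ satisfies Serre's condition $(S_2)$ if and only if every family of holes of $Q$ has *dimension $d-1$.
   Context: An affine monoid $Q$ is a finitely generated submonoid of $\mathbb{Z}^N$ for some $N\in\mathbb{N}$; $\mathbb{Z}Q$ is the group generated by $Q$, $\mathbb{R}_+Q$ the convex cone generated by $Q$, $\overline{Q}=\mathbb{Z}Q\cap\mathbb{R}_+Q$ the normalization; $Q$ is normal if $Q=\overline{Q}$. A face of $Q$ is a nonempty subset $F\subseteq Q$ such that for $a,b\in Q$: $a+b\in F\Leftrightarrow a,b\in F$. $F_0$ denotes the unique minimal face (the invertible elements of $Q$). The *dimension of a face $F$ (including $F=Q$) is $\operatorname{rank}\mathbb{Z}F-\operatorname{rank}\mathbb{Z}F_0$. For a face $F$, $Q_F=\{q-f: q\in Q, f\in F\}$ is the localization; $Q$ is locally normal if $Q_F$ is normal for every face $F\neq F_0$. $\mathbb{K}[Q]$ is the monoid algebra, $\mathfrak{m}$ its maximal graded ideal with respect to the $\mathbb{Z}Q$-grading (spanned by monomials $\mathbf{x}^q$, $q\in Q\setminus F_0$), and ${}^{*}\mathrm{depth}\,\mathbb{K}[Q]$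 is the maximal length of a regular sequence in $\mathfrak{m}$ (equivalently, the depth of the localization $\mathbb{K}[Q]_{\mathfrak{m}}$). Families of holes: the set $\overline{Q}\setminus Q$ can be written as an irredundant finite union $\bigcup_i (q_i+\mathbb{Z}F_i)\cap\overline{Q}$ with $q_i\in\overline{Q}$ and faces $F_i$ of $Q$, and the collection of sets $q_i+\mathbb{Z}F_i$ is uniquely determined by $Q$. Each set $q_i+\mathbb{Z}F_i$ occurring is called a family of holes of $Q$, and its *dimension is the *dimension of $F_i$ (it is then called a $j$-*dimensional family of holes if this number is $j$). *)

theory Defs
  imports
    "HOL-Analysis.Analysis"
    "HOL-Library.Poly_Mapping"
    "HOL-Library.Extended_Nat"
    "HOL-Algebra.Ring_Divisibility"
begin

text \<open>The case \<open>N = 0\<close> of submonoids of \<open>\<int>\<^sup>N\<close> is covered by the zero submonoid of \<open>int ^ 'n\<close>.\<close>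

definition add_submonoid :: "'a::monoid_add set \<Rightarrow> bool" where
  "add_submonoid M \<longleftrightarrow> 0 \<in> M \<and> (\<forall>a\<in>M. \<forall>b\<in>M. a + b \<in> M)"

definition add_subgroup :: "'a::group_add set \<Rightarrow> bool" where
  "add_subgroup G \<longleftrightarrow> add_submonoid G \<and> (\<forall>a\<in>G. - a \<in> G)"

definition affine_monoid :: "(int ^ 'n) set \<Rightarrow> bool" where
  "affine_monoid Q \<longleftrightarrow> (\<exists>G. finite G \<and> Q = add_submonoid hull G)"

definition group_gen :: "(int ^ 'n) set \<Rightarrow> (int ^ 'n) set" where
  "group_gen Q = add_subgroup hull Q"

definition real_vec :: "int ^ 'n \<Rightarrow> real ^ 'n" where
  "real_vec q = (\<chi> i. real_of_int (q $ i))"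

definition normalization :: "(int ^ 'n) set \<Rightarrow> (int ^ 'n) set" where
  "normalization Q = {q \<in> group_gen Q. real_vec q \<in> convex_cone hull (real_vec ` Q)}"

definition normal_monoid :: "(int ^ 'n) set \<Rightarrow> bool" where
  "normal_monoid Q \<longleftrightarrow> Q = normalization Q"

definition face :: "(int ^ 'n) set \<Rightarrow> (int ^ 'n) set \<Rightarrow> bool" where
  "face Q F \<longleftrightarrow> F \<noteq> {} \<and> F \<subseteq> Q \<and> (\<forall>a\<in>Q. \<forall>b\<in>Q. a + b \<in> F \<longleftrightarrow> a \<in> F \<and> b \<in> F)"

text \<open>The invertible elements form the unique minimal face.\<close>
definition min_face :: "(int ^ 'n) set \<Rightarrow> (int ^ 'n) set" where
  "min_face Q = {q \<in> Q. - q \<in> Q}"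

text \<open>The rank of a subgroup of \<open>int ^ 'n\<close>: the largest size of a \<open>\<int>\<close>-linearly independent
  subset. The cardinalities in question are bounded by \<open>CARD('n)\<close>.\<close>
definition group_rank :: "(int ^ 'n) set \<Rightarrow> nat" where
  "group_rank G = Max (card ` {B. B \<subseteq> G \<and> finite B \<and> \<not> module.dependent (*s) B})"

text \<open>Integer-valued, so that \<open>star_dim Q Q - 1\<close> is not truncated.\<close>
definition star_dim :: "(int ^ 'n) set \<Rightarrow> (int ^ 'n) set \<Rightarrow> int" where
  "star_dim Q F = int (group_rank (group_gen F)) - int (group_rank (group_gen (min_face Q)))"

definition face_localization :: "(int ^ 'n) set \<Rightarrow> (int ^ 'n) set \<Rightarrow> (int ^ 'n) set" where
  "face_localization Q F = {q - f | q f. q \<in> Q \<and> f \<in> F}"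

definition locally_normal :: "(int ^ 'n) set \<Rightarrow> bool" where
  "locally_normal Q \<longleftrightarrow>
     (\<forall>F. face Q F \<and> F \<noteq> min_face Q \<longrightarrow> normal_monoid (face_localization Q F))"

definition hole_decomposition :: "(int ^ 'n) set \<Rightarrow> (int ^ 'n) set set \<Rightarrow> bool" where
  "hole_decomposition Q \<A> \<longleftrightarrow>
     finite \<A> \<and>
     (\<forall>A\<in>\<A>. \<exists>q F. q \<in> normalization Q \<and> face Q F \<and> A = (+) q ` group_gen F) \<and>
     (\<Union>A\<in>\<A>. A \<inter> normalization Q) = normalization Q - Q \<and>
     (\<forall>A\<in>\<A>. (\<Union>B\<in>\<A> - {A}. B \<inter> normalization Q) \<noteq> normalization Q - Q)"

text \<open>Every affine monoid \<open>Q\<close> has exactly one \<open>\<A>\<close> with \<open>hole_decomposition Q \<A>\<close>, so the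
  existential quantifier picks out the members of that \<open>\<A>\<close>.\<close>
definition family_of_holes :: "(int ^ 'n) set \<Rightarrow> (int ^ 'n) set \<Rightarrow> bool" where
  "family_of_holes Q A \<longleftrightarrow> (\<exists>\<A>. hole_decomposition Q \<A> \<and> A \<in> \<A>)"

text \<open>\<open>A\<close> is a \<open>j\<close>-*dimensional family of holes. The face \<open>F\<close> is determined by the set
  \<open>A = q + \<int>F\<close>, since \<open>\<int>F\<close> is the set of differences of \<open>A\<close> and \<open>F = Q \<inter> \<int>F\<close>.\<close>
definition family_of_holes_dim :: "(int ^ 'n) set \<Rightarrow> int \<Rightarrow> (int ^ 'n) set \<Rightarrow> bool" where
  "family_of_holes_dim Q j A \<longleftrightarrow> family_of_holes Q A \<and>
     (\<exists>q F. q \<in> normalization Q \<and> face Q F \<and> A = (+) q ` group_gen F \<and> star_dim Q F = j)"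

text \<open>The subring of the Laurent polynomial ring \<open>int ^ 'n \<Rightarrow>\<^sub>0 'k\<close> (with the convolution product)
  of elements supported on \<open>Q\<close>.\<close>
definition monoid_algebra ::
  "'k::field itself \<Rightarrow> (int ^ 'n) set \<Rightarrow> ((int ^ 'n) \<Rightarrow>\<^sub>0 'k) ring" where
  "monoid_algebra K Q =
     \<lparr>carrier = {p. Poly_Mapping.keys p \<subseteq> Q}, mult = (*), one = 1, zero = 0, add = (+)\<rparr>"

definition graded_max_ideal ::
  "'k::field itself \<Rightarrow> (int ^ 'n) set \<Rightarrow> ((int ^ 'n) \<Rightarrow>\<^sub>0 'k) set" where
  "graded_max_ideal K Q = {p. Poly_Mapping.keys p \<subseteq> Q - min_face Q}"

text \<open>\<open>xs ! i\<close> is a nonzerodivisor modulo the preceding entries, and the quotient by all entries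
  is not the zero ring.\<close>
definition regular_sequence :: "('a, 'm) ring_scheme \<Rightarrow> 'a list \<Rightarrow> bool" where
  "regular_sequence R xs \<longleftrightarrow>
     set xs \<subseteq> carrier R \<and>
     (\<forall>i<length xs. \<forall>a\<in>carrier R.
        xs ! i \<otimes>\<^bsub>R\<^esub> a \<in> genideal R (set (take i xs)) \<longrightarrow> a \<in> genideal R (set (take i xs))) \<and>
     genideal R (set xs) \<noteq> carrier R"

definition grade :: "('a, 'm) ring_scheme \<Rightarrow> 'a set \<Rightarrow> enat" where
  "grade R I = Sup {enat (length xs) | xs. set xs \<subseteq> I \<and> regular_sequence R xs}"

definition star_depth :: "'k::field itself \<Rightarrow> (int ^ 'n) set \<Rightarrow> enat" where
  "star_depth K Q = grade (monoid_algebra K Q) (graded_max_ideal K Q)"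

definition prime_chain :: "('a, 'm) ring_scheme \<Rightarrow> nat \<Rightarrow> (nat \<Rightarrow> 'a set) \<Rightarrow> bool" where
  "prime_chain R n C \<longleftrightarrow> (\<forall>i\<le>n. primeideal (C i) R) \<and> (\<forall>i<n. C i \<subset> C (Suc i))"

definition krull_dim :: "('a, 'm) ring_scheme \<Rightarrow> enat" where
  "krull_dim R = Sup {enat n | n. \<exists>C. prime_chain R n C}"

definition height :: "('a, 'm) ring_scheme \<Rightarrow> 'a set \<Rightarrow> enat" where
  "height R P = Sup {enat n | n. \<exists>C. prime_chain R n C \<and> C n = P}"

text \<open>The ring of fractions \<open>S\<inverse>R\<close> for a multiplicatively closed \<open>S\<close>; its elements are the
  equivalence classes of pairs \<open>(a, s)\<close>, and operations on classes are given by all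
  representatives.\<close>
definition frac_rel :: "('a, 'm) ring_scheme \<Rightarrow> 'a set \<Rightarrow> (('a \<times> 'a) \<times> ('a \<times> 'a)) set" where
  "frac_rel R S = {((a, s), (b, t)). a \<in> carrier R \<and> s \<in> S \<and> b \<in> carrier R \<and> t \<in> S \<and>
     (\<exists>u\<in>S. u \<otimes>\<^bsub>R\<^esub> (a \<otimes>\<^bsub>R\<^esub> t) = u \<otimes>\<^bsub>R\<^esub> (b \<otimes>\<^bsub>R\<^esub> s))}"

definition fraction_ring :: "('a, 'm) ring_scheme \<Rightarrow> 'a set \<Rightarrow> ('a \<times> 'a) set ring" where
  "fraction_ring R S =
     \<lparr>carrier = (carrier R \<times> S) // frac_rel R S,
      mult = (\<lambda>X Y. \<Union>(a, s)\<in>X. \<Union>(b, t)\<in>Y. frac_rel R S `` {(a \<otimes>\<^bsub>R\<^esub> b, s \<otimes>\<^bsub>R\<^esub> t)}),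
      one = frac_rel R S `` {(\<one>\<^bsub>R\<^esub>, \<one>\<^bsub>R\<^esub>)},
      zero = frac_rel R S `` {(\<zero>\<^bsub>R\<^esub>, \<one>\<^bsub>R\<^esub>)},
      add = (\<lambda>X Y. \<Union>(a, s)\<in>X. \<Union>(b, t)\<in>Y.
        frac_rel R S `` {((a \<otimes>\<^bsub>R\<^esub> t) \<oplus>\<^bsub>R\<^esub> (b \<otimes>\<^bsub>R\<^esub> s), s \<otimes>\<^bsub>R\<^esub> t)})\<rparr>"

definition localization_at :: "('a, 'm) ring_scheme \<Rightarrow> 'a set \<Rightarrow> ('a \<times> 'a) set ring" where
  "localization_at R P = fraction_ring R (carrier R - P)"

definition local_ring :: "('a, 'm) ring_scheme \<Rightarrow> bool" where
  "local_ring R \<longleftrightarrow> cring R \<and> (\<exists>!M. maximalideal M R)"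

definition local_max_ideal :: "('a, 'm) ring_scheme \<Rightarrow> 'a set" where
  "local_max_ideal R = (THE M. maximalideal M R)"

definition local_depth :: "('a, 'm) ring_scheme \<Rightarrow> enat" where
  "local_depth R = grade R (local_max_ideal R)"

text \<open>The minimal number of generators of the maximal ideal of a Noetherian local ring.\<close>
definition embedding_dim :: "('a, 'm) ring_scheme \<Rightarrow> nat" where
  "embedding_dim R =
     (LEAST n. \<exists>X. X \<subseteq> carrier R \<and> finite X \<and> card X = n \<and> genideal R X = local_max_ideal R)"

definition regular_local_ring :: "('a, 'm) ring_scheme \<Rightarrow> bool" where
  "regular_local_ring R \<longleftrightarrow>
     local_ring R \<and> noetherian_ring R \<and> enat (embedding_dim R) = krull_dim R"

definition serre_R :: "nat \<Rightarrow> ('a, 'm) ring_scheme \<Rightarrow> bool" where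
  "serre_R k R \<longleftrightarrow>
     (\<forall>P. primeideal P R \<and> height R P \<le> enat k \<longrightarrow> regular_local_ring (localization_at R P))"

definition serre_S :: "nat \<Rightarrow> ('a, 'm) ring_scheme \<Rightarrow> bool" where
  "serre_S k R \<longleftrightarrow>
     (\<forall>P. primeideal P R \<longrightarrow>
        min (enat k) (krull_dim (localization_at R P)) \<le> local_depth (localization_at R P))"

end

theory Submission
  imports Defs
begin

text \<open>
The link between the two sides is a \<^emph>\<open>socle point\<close>: a point \<open>p\<close> of the group \<open>\<int>Q\<close> together with a face
\<open>F\<close> such that \<open>p \<notin> Q\<^sub>F\<close>, while \<open>p + x \<in> Q\<close> for all \<open>x \<in> Q - F\<close>. Write \<open>P\<^sub>F\<close> for the prime ideal of
\<open>K[Q]\<close> spanned by the monomials of \<open>Q - F\<close>.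

\<^bold>\<open>Holes.\<close> Consider cosets \<open>q + \<int>F\<close> with \<open>q\<close> in the normalization. Such a coset avoids \<open>Q\<close> iff
\<open>q \<notin> Q\<^sub>F\<close>. The normalization is finitely generated over \<open>Q\<close> (Gordan), and the complement of an ideal of \<open>Q\<close> is a finite union of translates of faces, so
finitely many cosets avoiding \<open>Q\<close> cover the holes. Since a finite union of cosets that covers a
coset contains it in one member, the families of holes are precisely the maximal cosets avoiding
\<open>Q\<close> (\<open>family_of_holes_iff\<close>). Hence \<open>Q\<^sub>F\<close> is normal iff no family belongs to a face containing \<open>F\<close>,
which is part (2). By maximality a family along \<open>F\<close> yields a socle point (\<open>family_socle_point\<close>).

\<^bold>\<open>Depth.\<close> If \<open>p\<close> is a socle point for \<open>F\<close>, then \<open>x\<^sup>p f\<close> lies outside \<open>(f)\<close> for every nonzero \<open>f\<close> of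
\<open>P\<^sub>F\<close> but is carried into \<open>(f)\<close> by \<open>P\<^sub>F\<close>, also after localizing; so the depth at \<open>P\<^sub>F\<close> is at most one.
Conversely, a zero divisor modulo a monomial lies in some \<open>P\<^sub>F\<close> with \<open>F = {q \<in> Q. p + q \<notin> Q}\<close> and
\<open>p \<notin> Q\<close> (\<open>zero_divisor_socle\<close>). For the minimal face, if it is not all of \<open>Q\<close>, this says that the *depth
is one iff there is a socle point. If \<open>d \<ge> 2\<close>, such a point lies in the normalization: otherwise
some facet normal \<open>w\<close> is negative at \<open>p\<close>; the facet \<open>w = 0\<close> has elements that are not invertible,
and adding one of them to \<open>p\<close> does not lead into \<open>Q\<close>. The coset of a socle point in the normalization
modulo the minimal face is a family of holes; this gives part (1).

\<^bold>\<open>Primes.\<close> A prime containing a monomial contains \<open>P\<^sub>F\<close> for some facet \<open>F\<close>, and these have height one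
(\<open>below_facet_prime\<close>). The localization at \<open>P\<^sub>F\<close> is regular iff \<open>Q\<^sub>F\<close> is the set of all lattice points
of the half space above \<open>F\<close>, that is, iff \<open>Q\<^sub>F\<close> contains the normalization (\<open>normal_facet_dvr\<close>,
\<open>regular_facet_normal\<close>). A nonzero prime without monomials contains a prime element of the Laurent
polynomial ring \<open>K[\<int>Q]\<close>, which is factorial (\<open>laurent_factorial\<close>), and if its height is one, then its
localization is a discrete valuation ring. So \<open>(R\<^sub>1)\<close> only concerns facets, which is part (3).

For part (4), a family along a face \<open>F\<close> that is not a facet violates \<open>(S\<^sub>2)\<close> at \<open>P\<^sub>F\<close>, whose height is
at least two. If all families are parallel to facets, then so are all socle points
(\<open>socle_face_is_facet\<close>); a prime of height at least two that contains a monomial then contains, by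
prime avoidance, an element outside all \<open>P\<^sub>F\<close> with \<open>F\<close> a facet, and this element is a nonzerodivisor
modulo the monomial. In a prime without monomials the prime element takes the role of the monomial.
\<close>

section \<open>Submonoids and subgroups of a lattice\<close>

lemma add_submonoid_Inter: "(\<And>M. M \<in> \<M> \<Longrightarrow> add_submonoid M) \<Longrightarrow> add_submonoid (\<Inter>\<M>)"
  by (auto simp: add_submonoid_def)

lemma add_submonoid_hull: "add_submonoid (add_submonoid hull G)"
  unfolding hull_def by (rule add_submonoid_Inter) auto

lemma submonoid_zero: "add_submonoid M \<Longrightarrow> 0 \<in> M"
  and submonoid_add: "add_submonoid M \<Longrightarrow> a \<in> M \<Longrightarrow> b \<in> M \<Longrightarrow> a + b \<in> M"
  by (auto simp: add_submonoid_def)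

lemma submonoid_sum:
  assumes "add_submonoid (M :: 'a::comm_monoid_add set)" "\<And>i. i \<in> I \<Longrightarrow> f i \<in> M"
  shows "sum f I \<in> M"
  using assms(2) by (induction I rule: infinite_finite_induct)
    (auto intro: submonoid_zero submonoid_add assms(1))

lemma smult_Suc: "int (Suc n) *s x = x + int n *s (x :: int ^ 'n)"
  by (simp add: vec_eq_iff algebra_simps)

lemma submonoid_smult:
  assumes "add_submonoid (M :: (int ^ 'n) set)" "x \<in> M"
  shows "int n *s x \<in> M"
  by (induction n) (auto simp: smult_Suc simp del: of_nat_Suc
      intro: submonoid_zero submonoid_add assms)

lemma submonoid_smult_int:
  assumes "add_submonoid (M :: (int ^ 'n) set)" "x \<in> M" "k \<ge> 0"
  shows "k *s x \<in> M"
  using submonoid_smult[OF assms(1,2), of "nat k"] assms(3) by simp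

lemma affine_submonoid: "affine_monoid Q \<Longrightarrow> add_submonoid Q"
  unfolding affine_monoid_def using add_submonoid_hull by auto

lemma hull_finite_repr:
  assumes "finite G"
  shows "q \<in> add_submonoid hull G \<longleftrightarrow> (\<exists>k. q = (\<Sum>g\<in>G. int (k g) *s (g :: int ^ 'n)))"
proof
  assume "q \<in> add_submonoid hull G"
  then show "\<exists>k. q = (\<Sum>g\<in>G. int (k g) *s g)"
  proof (rule hull_induct)
    fix x assume "x \<in> G"
    then have "x = (\<Sum>g\<in>G. int (if g = x then 1 else 0) *s g)"
      using assms by (simp add: if_distrib[of int] if_distrib[of "\<lambda>c. c *s _"] cong: if_cong)
    then show "\<exists>k. x = (\<Sum>g\<in>G. int (k g) *s g)"
      by (intro exI[of _ "\<lambda>g. if g = x then 1 else 0"])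
  next
    show "add_submonoid {x. \<exists>k. x = (\<Sum>g\<in>G. int (k g) *s g)}"
      unfolding add_submonoid_def
    proof (intro conjI ballI)
      have "0 = (\<Sum>g\<in>G. int (0::nat) *s g)" by simp
      then show "0 \<in> {x. \<exists>k. x = (\<Sum>g\<in>G. int (k g) *s g)}"
        unfolding mem_Collect_eq by (intro exI[of _ "\<lambda>_. 0"])
      fix a b assume "a \<in> {x. \<exists>k. x = (\<Sum>g\<in>G. int (k g) *s g)}"
        "b \<in> {x. \<exists>k. x = (\<Sum>g\<in>G. int (k g) *s g)}"
      then obtain k l where "a = (\<Sum>g\<in>G. int (k g) *s g)" "b = (\<Sum>g\<in>G. int (l g) *s g)" by auto
      then have "a + b = (\<Sum>g\<in>G. int (k g + l g) *s g)"
        by (simp add: sum.distrib[symmetric] vector_sadd_rdistrib)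
      then show "a + b \<in> {x. \<exists>k. x = (\<Sum>g\<in>G. int (k g) *s g)}"
        unfolding mem_Collect_eq by (intro exI[of _ "\<lambda>g. k g + l g"])
    qed
  qed
next
  assume "\<exists>k. q = (\<Sum>g\<in>G. int (k g) *s g)"
  then show "q \<in> add_submonoid hull G"
    using hull_inc[of _ G add_submonoid]
    by (auto intro!: submonoid_sum[OF add_submonoid_hull] submonoid_smult[OF add_submonoid_hull])
qed

lemma group_gen_eq_diff:
  assumes "add_submonoid (Q :: (int ^ 'n) set)"
  shows "group_gen Q = {a - b | a b. a \<in> Q \<and> b \<in> Q}"
proof
  have "Q \<subseteq> {a - b | a b. a \<in> Q \<and> b \<in> Q}"
    using submonoid_zero[OF assms] diff_zero by (smt (verit) mem_Collect_eq subsetI)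
  moreover have "add_subgroup {a - b | a b. a \<in> Q \<and> b \<in> Q}"
    unfolding add_subgroup_def add_submonoid_def
  proof (intro conjI ballI)
    show "0 \<in> {a - b | a b. a \<in> Q \<and> b \<in> Q}" using submonoid_zero[OF assms] by auto
  next
    fix x y assume "x \<in> {a - b | a b. a \<in> Q \<and> b \<in> Q}" "y \<in> {a - b | a b. a \<in> Q \<and> b \<in> Q}"
    then obtain a b c d where "x = a - b" "y = c - d" "a \<in> Q" "b \<in> Q" "c \<in> Q" "d \<in> Q" by auto
    then have "x + y = (a + c) - (b + d)" "a + c \<in> Q" "b + d \<in> Q"
      using submonoid_add[OF assms] by auto
    then show "x + y \<in> {a - b | a b. a \<in> Q \<and> b \<in> Q}" by blast
  next
    fix x assume "x \<in> {a - b | a b. a \<in> Q \<and> b \<in> Q}"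
    then obtain a b where "x = a - b" "a \<in> Q" "b \<in> Q" by auto
    then have "- x = b - a" by simp
    with \<open>a \<in> Q\<close> \<open>b \<in> Q\<close> show "- x \<in> {a - b | a b. a \<in> Q \<and> b \<in> Q}" by blast
  qed
  ultimately show "group_gen Q \<subseteq> {a - b | a b. a \<in> Q \<and> b \<in> Q}"
    unfolding group_gen_def by (rule hull_minimal)
  show "{a - b | a b. a \<in> Q \<and> b \<in> Q} \<subseteq> group_gen Q"
  proof
    fix x assume "x \<in> {a - b | a b. a \<in> Q \<and> b \<in> Q}"
    then obtain a b where x: "x = a - b" "a \<in> Q" "b \<in> Q" by auto
    have "a + (- b) \<in> G" if "add_subgroup G" "Q \<subseteq> G" for G
      using that x unfolding add_subgroup_def add_submonoid_def by blast
    then show "x \<in> group_gen Q" unfolding group_gen_def hull_def using x by auto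
  qed
qed

lemma add_subgroup_group_gen: "add_subgroup (group_gen Q)"
  unfolding group_gen_def hull_def add_subgroup_def add_submonoid_def by auto

lemma subset_group_gen: "Q \<subseteq> group_gen Q"
  unfolding group_gen_def by (rule hull_subset)

lemma group_gen_mono: "P \<subseteq> Q \<Longrightarrow> group_gen P \<subseteq> group_gen Q"
  unfolding group_gen_def by (rule hull_mono)

lemma subgroup_submonoid: "add_subgroup G \<Longrightarrow> add_submonoid G"
  and subgroup_uminus: "add_subgroup G \<Longrightarrow> a \<in> G \<Longrightarrow> - a \<in> G"
  by (auto simp: add_subgroup_def)

lemma subgroup_diff:
  assumes "add_subgroup (G :: 'a::group_add set)" "a \<in> G" "b \<in> G" shows "a - b \<in> G"
  using submonoid_add[OF subgroup_submonoid[OF assms(1)] assms(2) subgroup_uminus[OF assms(1,3)]]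
  by simp

lemma subgroup_smult:
  assumes "add_subgroup (G :: (int ^ 'n) set)" "x \<in> G" shows "k *s x \<in> G"
proof (cases "k \<ge> 0")
  case True
  then show ?thesis using submonoid_smult_int[OF subgroup_submonoid] assms by blast
next
  case False
  then have "(-k) *s x \<in> G" using submonoid_smult_int[OF subgroup_submonoid] assms by force
  from subgroup_uminus[OF assms(1) this] show ?thesis
    by (simp add: vector_scalar_mult_def vec_eq_iff uminus_vec_def)
qed

lemma group_gen_zero: "0 \<in> group_gen Q"
  and group_gen_add: "a \<in> group_gen Q \<Longrightarrow> b \<in> group_gen Q \<Longrightarrow> a + b \<in> group_gen Q"
  and group_gen_diff: "a \<in> group_gen Q \<Longrightarrow> b \<in> group_gen Q \<Longrightarrow> a - b \<in> group_gen Q"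
  and group_gen_uminus: "a \<in> group_gen Q \<Longrightarrow> - a \<in> group_gen Q"
  and group_gen_smult: "a \<in> group_gen Q \<Longrightarrow> k *s a \<in> group_gen Q"
  using add_subgroup_group_gen[of Q]
  by (auto intro: subgroup_smult subgroup_diff subgroup_uminus submonoid_add submonoid_zero
      subgroup_submonoid)

text \<open>Clearing denominators: finitely many differences become elements of \<open>Q\<close> after one
  common shift.\<close>
lemma common_shift:
  assumes Q: "add_submonoid (Q :: (int ^ 'n) set)" and M: "add_submonoid M" "M \<subseteq> Q"
    and "finite S" "\<And>s. s \<in> S \<Longrightarrow> \<exists>q\<in>Q. \<exists>f\<in>M. s = q - f"
  shows "\<exists>c\<in>M. \<forall>s\<in>S. c + s \<in> Q"
  using assms(4,5)
proof (induction S rule: finite_induct)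
  case empty
  then show ?case using submonoid_zero[OF M(1)] by auto
next
  case (insert x S)
  then obtain c where c: "c \<in> M" "\<forall>s\<in>S. c + s \<in> Q" by auto
  obtain q f where qf: "q \<in> Q" "f \<in> M" "x = q - f" using insert.prems by blast
  have "(c + f) + s \<in> Q" if "s \<in> S" for s
    using submonoid_add[OF Q, of "c + s" f] c that qf(2) M(2) by (auto simp: algebra_simps)
  moreover have "(c + f) + x \<in> Q"
    using submonoid_add[OF Q, of c q] c qf M(2) by (auto simp: algebra_simps)
  ultimately show ?case using submonoid_add[OF M(1) c(1) qf(2)] by blast
qed

section \<open>Faces\<close>

lemma faceD:
  assumes "face Q F"
  shows "F \<subseteq> Q" "\<And>a b. a \<in> Q \<Longrightarrow> b \<in> Q \<Longrightarrow> a + b \<in> F \<Longrightarrow> a \<in> F"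
    "\<And>a b. a \<in> Q \<Longrightarrow> b \<in> Q \<Longrightarrow> a + b \<in> F \<Longrightarrow> b \<in> F" "\<And>a b. a \<in> F \<Longrightarrow> b \<in> F \<Longrightarrow> a + b \<in> F"
  using assms unfolding face_def by blast+

lemma face_submonoid:
  assumes "add_submonoid Q" "face Q F" shows "add_submonoid F"
proof -
  obtain f where "f \<in> F" using assms(2) unfolding face_def by blast
  then have "0 \<in> F" using faceD(2)[OF assms(2), of 0 f] faceD(1)[OF assms(2)]
      submonoid_zero[OF assms(1)] by auto
  then show ?thesis using faceD(4)[OF assms(2)] unfolding add_submonoid_def by blast
qed

lemma face_whole: "add_submonoid Q \<Longrightarrow> face Q Q"
  unfolding face_def add_submonoid_def by blast

lemma face_min_face:
  assumes "add_submonoid (Q :: (int ^ 'n) set)" shows "face Q (min_face Q)"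
  unfolding face_def
proof (intro conjI ballI iffI)
  show "min_face Q \<noteq> {}" using submonoid_zero[OF assms] by (auto simp: min_face_def)
  show "min_face Q \<subseteq> Q" by (auto simp: min_face_def)
next
  fix a b assume ab: "a \<in> Q" "b \<in> Q" "a + b \<in> min_face Q"
  then have *: "- (a + b) \<in> Q" by (auto simp: min_face_def)
  have "- a \<in> Q" using submonoid_add[OF assms * ab(2)] by simp
  moreover have "- b \<in> Q" using submonoid_add[OF assms * ab(1)] by simp
  ultimately show "a \<in> min_face Q" "b \<in> min_face Q" using ab by (auto simp: min_face_def)
next
  fix a b assume ab: "a \<in> Q" "b \<in> Q" "a \<in> min_face Q \<and> b \<in> min_face Q"
  then have "a \<in> Q" "b \<in> Q" "- a \<in> Q" "- b \<in> Q" by (auto simp: min_face_def)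
  then have "a + b \<in> Q" "(- a) + (- b) \<in> Q" using submonoid_add[OF assms] by blast+
  then show "a + b \<in> min_face Q" by (simp add: min_face_def algebra_simps)
qed

lemma min_face_subset:
  assumes "add_submonoid (Q :: (int ^ 'n) set)" "face Q F" shows "min_face Q \<subseteq> F"
proof
  fix x assume "x \<in> min_face Q"
  then have "x \<in> Q" "- x \<in> Q" by (auto simp: min_face_def)
  moreover have "x + - x \<in> F" using submonoid_zero[OF face_submonoid[OF assms]] by simp
  ultimately show "x \<in> F" using faceD(2)[OF assms(2)] by blast
qed

lemma face_Int_group_gen:
  assumes "add_submonoid (Q :: (int ^ 'n) set)" "face Q F" "q \<in> Q" "q \<in> group_gen F"
  shows "q \<in> F"
proof -
  obtain a b where "q = a - b" "a \<in> F" "b \<in> F"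
    using assms(4) unfolding group_gen_eq_diff[OF face_submonoid[OF assms(1,2)]] by auto
  then have "q + b \<in> F" "b \<in> Q" using faceD(1)[OF assms(2)] by auto
  then show ?thesis using faceD(2)[OF assms(2,3)] by blast
qed

lemma face_group_gen_inject:
  assumes "add_submonoid (Q :: (int ^ 'n) set)" "face Q F" "face Q F'" "group_gen F \<subseteq> group_gen F'"
  shows "F \<subseteq> F'"
  using face_Int_group_gen[OF assms(1,3)] faceD(1)[OF assms(2)] assms(4) subset_group_gen[of F]
  by blast

lemma face_smult:
  assumes "add_submonoid (Q :: (int ^ 'n) set)" "face Q F" "q \<in> Q" "int n *s q \<in> F" "n > 0"
  shows "q \<in> F"
proof -
  obtain m where "n = Suc m" using assms(5) by (cases n) auto
  then have "q + int m *s q \<in> F" using assms(4) by (simp add: smult_Suc del: of_nat_Suc)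
  then show ?thesis using faceD(2)[OF assms(2,3) submonoid_smult[OF assms(1,3)]] by blast
qed

lemma face_sum:
  assumes "add_submonoid (Q :: (int ^ 'n) set)" "face Q F" "finite I" "\<And>i. i \<in> I \<Longrightarrow> f i \<in> Q"
    "sum f I \<in> F" "i \<in> I"
  shows "f i \<in> F"
proof -
  have "sum f I = f i + sum f (I - {i})" using assms by (simp add: sum.remove)
  then show ?thesis using faceD(2)[OF assms(2), of "f i" "sum f (I - {i})"] assms
    by (auto intro: submonoid_sum)
qed

text \<open>A face is spanned by the generators of the monoid that it contains.\<close>
lemma face_eq_hull:
  assumes "finite G" "Q = add_submonoid hull G" "face Q (F :: (int ^ 'n) set)"
  shows "F = add_submonoid hull (G \<inter> F)"
proof
  have Q: "add_submonoid Q" using assms(2) add_submonoid_hull by auto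
  have GQ: "G \<subseteq> Q" using assms(2) by (simp add: hull_subset)
  show "add_submonoid hull (G \<inter> F) \<subseteq> F"
    by (rule hull_minimal) (auto intro: face_submonoid[OF Q assms(3)])
  show "F \<subseteq> add_submonoid hull (G \<inter> F)"
  proof
    fix x assume x: "x \<in> F"
    then have "x \<in> add_submonoid hull G" using faceD(1)[OF assms(3)] assms(2) by auto
    then obtain k where k: "x = (\<Sum>g\<in>G. int (k g) *s g)" using hull_finite_repr[OF assms(1)] by auto
    have "int (k g) *s g \<in> add_submonoid hull (G \<inter> F)" if "g \<in> G" for g
    proof (cases "k g = 0")
      case True
      then show ?thesis using submonoid_zero[OF add_submonoid_hull] by simp
    next
      case False
      have "int (k g) *s g \<in> F"
        by (rule face_sum[OF Q assms(3) assms(1), of "\<lambda>g. int (k g) *s g"])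
           (use GQ x k that submonoid_smult[OF Q] in auto)
      then have "g \<in> F" using face_smult[OF Q assms(3)] False that GQ by blast
      then have "g \<in> add_submonoid hull (G \<inter> F)" using that by (intro hull_inc) auto
      then show ?thesis by (rule submonoid_smult[OF add_submonoid_hull])
    qed
    then show "x \<in> add_submonoid hull (G \<inter> F)"
      unfolding k by (intro submonoid_sum add_submonoid_hull)
  qed
qed

lemma finite_faces:
  assumes "affine_monoid (Q :: (int ^ 'n) set)" shows "finite {F. face Q F}"
proof -
  obtain G where G: "finite G" "Q = add_submonoid hull G" using assms affine_monoid_def by blast
  have "{F. face Q F} \<subseteq> (\<lambda>H. add_submonoid hull H) ` Pow G"
  proof
    fix F assume "F \<in> {F. face Q F}"
    then have "F = add_submonoid hull (G \<inter> F)" using face_eq_hull[OF G] by simp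
    then show "F \<in> (\<lambda>H. add_submonoid hull H) ` Pow G" by (rule image_eqI) simp
  qed
  then show ?thesis using G(1) by (meson finite_Pow_iff finite_surj)
qed



text \<open>Every face has an element that lies in no smaller face.\<close>
lemma face_interior:
  assumes "affine_monoid (Q :: (int ^ 'n) set)" "face Q F"
  obtains f where "f \<in> F" "\<And>F'. face Q F' \<Longrightarrow> f \<in> F' \<Longrightarrow> F \<subseteq> F'"
proof -
  note Q = affine_submonoid[OF assms(1)]
  obtain G where G: "finite G" "Q = add_submonoid hull G" using assms affine_monoid_def by blast
  have "sum id (G \<inter> F) \<in> F"
    by (rule submonoid_sum[OF face_submonoid[OF Q assms(2)]]) auto
  moreover have "F \<subseteq> F'" if F': "face Q F'" "sum id (G \<inter> F) \<in> F'" for F'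
  proof -
    have "g \<in> F'" if "g \<in> G \<inter> F" for g
      using face_sum[OF Q F'(1) _ _ F'(2) that] G(1) faceD(1)[OF assms(2)] by auto
    then have "add_submonoid hull (G \<inter> F) \<subseteq> F'"
      by (intro hull_minimal face_submonoid[OF Q F'(1)]) auto
    then show ?thesis using face_eq_hull[OF G assms(2)] by simp
  qed
  ultimately show ?thesis using that by blast
qed

section \<open>Localization at a face\<close>

text \<open>Generated by the generators of \<open>Q\<close> and the negatives of those that lie in \<open>F\<close>.\<close>
lemma face_localization_affine:
  assumes "affine_monoid (Q :: (int ^ 'n) set)" "face Q F"
  shows "affine_monoid (face_localization Q F)"
proof -
  note Q = affine_submonoid[OF assms(1)]
  note F = face_submonoid[OF Q assms(2)]
  obtain G where G: "finite G" "Q = add_submonoid hull G" using assms affine_monoid_def by blast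
  let ?H = "G \<union> uminus ` (G \<inter> F)"
  have 1: "add_submonoid (face_localization Q F)" unfolding add_submonoid_def
  proof (intro conjI ballI)
    show "0 \<in> face_localization Q F" unfolding face_localization_def
      using submonoid_zero[OF F] submonoid_zero[OF Q] by force
    fix a b assume "a \<in> face_localization Q F" "b \<in> face_localization Q F"
    then obtain q f q' f' where "a = q - f" "b = q' - f'" "q \<in> Q" "f \<in> F" "q' \<in> Q" "f' \<in> F"
      unfolding face_localization_def by blast
    then have "a + b = (q + q') - (f + f')" "q + q' \<in> Q" "f + f' \<in> F"
      using submonoid_add[OF Q] submonoid_add[OF F] by auto
    then show "a + b \<in> face_localization Q F" unfolding face_localization_def by blast
  qed
  have "add_submonoid hull ?H \<subseteq> face_localization Q F"
  proof (rule hull_minimal)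
    show "add_submonoid (face_localization Q F)" by (rule 1)
    have "g \<in> face_localization Q F" if "g \<in> G" for g
    proof -
      have "g \<in> Q" using G that by (auto intro: hull_inc)
      then show ?thesis unfolding face_localization_def using submonoid_zero[OF F] by force
    qed
    moreover have "- g \<in> face_localization Q F" if "g \<in> F" for g
      unfolding face_localization_def using that submonoid_zero[OF Q] by force
    ultimately show "?H \<subseteq> face_localization Q F" by auto
  qed
  moreover have "face_localization Q F \<subseteq> add_submonoid hull ?H"
  proof
    fix x assume "x \<in> face_localization Q F"
    then obtain q f where x: "x = q - f" "q \<in> Q" "f \<in> F" unfolding face_localization_def by blast
    have q: "q \<in> add_submonoid hull ?H" using x(2) G(2) hull_mono[of G ?H add_submonoid] by auto
    have "f \<in> add_submonoid hull (G \<inter> F)" using face_eq_hull[OF G assms(2)] x(3) by simp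
    then have "- f \<in> add_submonoid hull ?H"
    proof (rule hull_induct)
      show "add_submonoid {x. - x \<in> add_submonoid hull ?H}"
        using add_submonoid_hull[of ?H] unfolding add_submonoid_def
        by (auto simp del: minus_add_distrib simp: minus_add)
    next
      fix x assume "x \<in> G \<inter> F"
      then show "- x \<in> add_submonoid hull ?H" by (intro hull_inc) auto
    qed
    then have "q + - f \<in> add_submonoid hull ?H"
      using q submonoid_add[OF add_submonoid_hull] by blast
    then show "x \<in> add_submonoid hull ?H" using x by simp
  qed
  ultimately show ?thesis unfolding affine_monoid_def using G(1)
    by (intro exI[of _ ?H]) auto
qed

lemma subset_face_localization:
  assumes "add_submonoid (Q :: (int ^ 'n) set)" "face Q F"
  shows "Q \<subseteq> face_localization Q F"
  unfolding face_localization_def using submonoid_zero[OF face_submonoid[OF assms]] by force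

lemma face_localization_subset_group:
  assumes "add_submonoid (Q :: (int ^ 'n) set)" "face Q F"
  shows "face_localization Q F \<subseteq> group_gen Q"
  unfolding face_localization_def group_gen_eq_diff[OF assms(1)] using faceD(1)[OF assms(2)] by blast

lemma group_gen_face_localization:
  assumes "add_submonoid (Q :: (int ^ 'n) set)" "face Q F"
  shows "group_gen (face_localization Q F) = group_gen Q"
proof
  show "group_gen (face_localization Q F) \<subseteq> group_gen Q"
    using face_localization_subset_group[OF assms] add_subgroup_group_gen
    unfolding group_gen_def[of "face_localization Q F"] by (intro hull_minimal) auto
  show "group_gen Q \<subseteq> group_gen (face_localization Q F)"
    by (intro group_gen_mono subset_face_localization assms)
qed

lemma in_face_localization_iff:
  assumes "add_submonoid (Q :: (int ^ 'n) set)" "face Q F"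
  shows "p \<in> face_localization Q F \<longleftrightarrow> (\<exists>f\<in>F. p + f \<in> Q)"
proof
  assume "p \<in> face_localization Q F"
  then show "\<exists>f\<in>F. p + f \<in> Q" unfolding face_localization_def by force
next
  assume "\<exists>f\<in>F. p + f \<in> Q"
  then obtain f where "f \<in> F" "p + f \<in> Q" by blast
  moreover have "p = (p + f) - f" by simp
  ultimately show "p \<in> face_localization Q F" unfolding face_localization_def by blast
qed

lemma face_localization_min_face:
  assumes "add_submonoid (Q :: (int ^ 'n) set)"
  shows "face_localization Q (min_face Q) = Q"
proof
  show "face_localization Q (min_face Q) \<subseteq> Q"
  proof
    fix x assume "x \<in> face_localization Q (min_face Q)"
    then obtain q f where x: "x = q - f" "q \<in> Q" "- f \<in> Q"
      unfolding face_localization_def min_face_def by auto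
    then show "x \<in> Q" using submonoid_add[OF assms x(2,3)] by simp
  qed
qed (rule subset_face_localization[OF assms face_min_face[OF assms]])

text \<open>A point \<open>q + f - g\<close> of the coset in \<open>Q\<close> exhibits \<open>q + f\<close> as an element of \<open>Q\<close>, and
  conversely \<open>q + f \<in> Q\<close> is a point of the coset.\<close>
lemma coset_disjoint_iff:
  assumes "add_submonoid (Q :: (int ^ 'n) set)" "face Q F"
  shows "(+) q ` group_gen F \<inter> Q = {} \<longleftrightarrow> q \<notin> face_localization Q F"
proof -
  note F = face_submonoid[OF assms]
  have "(\<exists>h\<in>group_gen F. q + h \<in> Q) \<longleftrightarrow> (\<exists>f\<in>F. q + f \<in> Q)"
  proof
    assume "\<exists>h\<in>group_gen F. q + h \<in> Q"
    then obtain a b where ab: "q + (a - b) \<in> Q" "a \<in> F" "b \<in> F"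
      unfolding group_gen_eq_diff[OF F] by auto
    have "q + (a - b) + b \<in> Q"
      by (rule submonoid_add[OF assms(1) ab(1)]) (use ab faceD(1)[OF assms(2)] in auto)
    then show "\<exists>f\<in>F. q + f \<in> Q" using ab(2) by (auto simp: add.assoc)
  next
    assume "\<exists>f\<in>F. q + f \<in> Q"
    then show "\<exists>h\<in>group_gen F. q + h \<in> Q" using subset_group_gen[of F] by blast
  qed
  then show ?thesis unfolding in_face_localization_iff[OF assms] by auto
qed

section \<open>Farkas' lemma over the integers and facets\<close>

definition idot :: "int ^ 'n \<Rightarrow> int ^ 'n \<Rightarrow> int" where
  "idot w x = (\<Sum>i\<in>UNIV. w $ i * x $ i)"

lemma idot_add_right: "idot w (x + y) = idot w x + idot w y"
  and idot_add_left: "idot (w + v) x = idot w x + idot v x"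
  and idot_smult_right: "idot w (k *s x) = k * idot w x"
  and idot_smult_left: "idot (k *s w) x = k * idot w x"
  and idot_uminus_right: "idot w (- x) = - idot w x"
  and idot_uminus_left: "idot (- w) x = - idot w x"
  and idot_diff_right: "idot w (x - y) = idot w x - idot w y"
  and idot_zero_right: "idot w 0 = 0"
  by (simp_all add: idot_def algebra_simps sum.distrib sum_distrib_left sum_negf sum_subtractf)

lemmas idot_simps = idot_add_right idot_add_left idot_smult_right idot_smult_left
  idot_uminus_right idot_uminus_left idot_diff_right idot_zero_right

lemma idot_sum_right: "idot w (sum f I) = (\<Sum>i\<in>I. idot w (f i))"
  by (induction I rule: infinite_finite_induct) (auto simp: idot_simps)

lemma idot_hull_nonneg:
  assumes "\<And>g. g \<in> G \<Longrightarrow> 0 \<le> idot w g" "x \<in> add_submonoid hull G"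
  shows "0 \<le> idot w x"
  using assms(2) by (rule hull_induct) (auto simp: assms(1) add_submonoid_def idot_simps)

text \<open>Induction on the number of generators, as in Fourier-Motzkin elimination: if the functional
  \<open>w\<close> obtained for \<open>G0\<close> is negative at the remaining generator \<open>h\<close>, project along \<open>h\<close> onto the
  hyperplane \<open>w = 0\<close> and apply the induction hypothesis again to the images. Working with integers
  keeps the conclusion inside the monoid.\<close>
lemma int_farkas:
  fixes p :: "int ^ 'n"
  assumes "finite G"
  shows "(\<exists>n>0. int n *s p \<in> add_submonoid hull G) \<or>
         (\<exists>w. (\<forall>g\<in>G. 0 \<le> idot w g) \<and> idot w p < 0)"
  using assms
proof (induction "card G" arbitrary: G p rule: less_induct)
  case less
  show ?case
  proof (cases "G = {}")
    case True
    show ?thesis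
    proof (cases "p = 0")
      case True
      then have "int 1 *s p \<in> add_submonoid hull G"
        using submonoid_zero[OF add_submonoid_hull] by simp
      then show ?thesis by (intro disjI1 exI[of _ 1]) simp
    next
      case False
      then obtain i where "p $ i \<noteq> 0" by (auto simp: vec_eq_iff)
      then have "0 < (\<Sum>i\<in>UNIV. p $ i * p $ i)"
        by (intro sum_pos2[of _ i]) (auto simp: zero_less_mult_iff)
      then have "idot (- p) p < 0" by (simp add: idot_def sum_negf)
      then show ?thesis using \<open>G = {}\<close> by blast
    qed
  next
    case False
    then obtain h G0 where hG: "G = insert h G0" "h \<notin> G0" by (metis Set.set_insert ex_in_conv)
    have fin: "finite G0" and lt: "card G0 < card G" using hG less.prems by auto
    from less.hyps[OF lt fin, of p] consider
      (a) n where "n > 0" "int n *s p \<in> add_submonoid hull G0" |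
      (b) w where "\<forall>g\<in>G0. 0 \<le> idot w g" "idot w p < 0" by blast
    then show ?thesis
    proof cases
      case a
      then show ?thesis using hull_mono[of G0 G add_submonoid] hG by blast
    next
      case b
      show ?thesis
      proof (cases "0 \<le> idot w h")
        case True
        then show ?thesis using b hG by blast
      next
        case False
        \<comment> \<open>project along \<open>h\<close> onto the hyperplane \<open>w = 0\<close>, scaled to stay integral\<close>
        define a where "a = - idot w h"
        have a: "a > 0" using False by (simp add: a_def)
        define T where "T = (\<lambda>x. a *s x + idot w x *s h)"
        have T_add: "T (x + y) = T x + T y" for x y
          by (simp add: T_def idot_simps vec_eq_iff algebra_simps)
        have "finite (T ` G0)" "card (T ` G0) < card G"
          using fin lt card_image_le[OF fin, of T] by auto
        from less.hyps[OF this(2,1), of "T p"] consider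
          (A) n where "n > 0" "int n *s T p \<in> add_submonoid hull (T ` G0)" |
          (B) v where "\<forall>g\<in>G0. 0 \<le> idot v (T g)" "idot v (T p) < 0"
          unfolding ball_simps by (elim disjE exE conjE)
        then show ?thesis
        proof cases
          case A
          have "add_submonoid hull (T ` G0) \<subseteq> T ` (add_submonoid hull G0)"
          proof (rule hull_minimal)
            show "T ` G0 \<subseteq> T ` (add_submonoid hull G0)" by (intro image_mono hull_subset)
            have "0 = T 0" by (simp add: T_def idot_simps)
            then have "0 \<in> T ` (add_submonoid hull G0)"
              using submonoid_zero[OF add_submonoid_hull] by (rule image_eqI)
            moreover have "T x + T y \<in> T ` (add_submonoid hull G0)"
              if "x \<in> add_submonoid hull G0" "y \<in> add_submonoid hull G0" for x y
              using submonoid_add[OF add_submonoid_hull that] unfolding T_add[symmetric]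
              by (rule imageI)
            ultimately show "add_submonoid (T ` (add_submonoid hull G0))"
              unfolding add_submonoid_def by (simp add: ball_simps)
          qed
          then obtain y where y: "y \<in> add_submonoid hull G0" "int n *s T p = T y"
            using A(2) by blast
          define m where "m = idot w y - int n * idot w p"
          have "0 \<le> idot w y" using idot_hull_nonneg[OF _ y(1)] b by blast
          moreover have "int n * idot w p \<le> 0" using b(2) A(1) by (simp add: mult_le_0_iff)
          ultimately have m: "m \<ge> 0" by (simp add: m_def)
          have "(int n * a) *s p = int n *s T p - (int n * idot w p) *s h"
            by (simp add: T_def vec_eq_iff algebra_simps)
          also have "\<dots> = a *s y + m *s h"
            unfolding y(2) by (simp add: m_def vec_eq_iff T_def algebra_simps)
          also have "\<dots> \<in> add_submonoid hull G"
          proof (intro submonoid_add[OF add_submonoid_hull] submonoid_smult_int[OF add_submonoid_hull])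
            show "y \<in> add_submonoid hull G" using y(1) hull_mono[of G0 G add_submonoid] hG by blast
            show "h \<in> add_submonoid hull G" using hG by (intro hull_inc) auto
          qed (use a m in auto)
          finally have "int (n * nat a) *s p \<in> add_submonoid hull G" using a by simp
          then show ?thesis using A(1) a by (intro disjI1 exI[of _ "n * nat a"]) auto
        next
          case B
          define u where "u = a *s v + idot v h *s w"
          have "idot u x = idot v (T x)" for x by (simp add: u_def T_def idot_simps)
          moreover have "idot u h = 0" by (simp add: u_def a_def idot_simps)
          ultimately show ?thesis using B hG by (intro disjI2 exI[of _ u]) auto
        qed
      qed
    qed
  qed
qed

text \<open>The last clause says that the hyperplane \<open>w = 0\<close> is spanned, up to finite index,
  by the elements of \<open>Q\<close> on it.\<close>
definition facet_normal :: "(int ^ 'n) set \<Rightarrow> int ^ 'n \<Rightarrow> bool" where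
  "facet_normal Q w \<longleftrightarrow> (\<forall>q\<in>Q. 0 \<le> idot w q) \<and> (\<exists>q\<in>Q. 0 < idot w q) \<and>
     (\<forall>x\<in>group_gen Q. idot w x = 0 \<longrightarrow>
        (\<exists>n>0. int n *s x \<in> group_gen {q\<in>Q. idot w q = 0}))"

definition facet :: "(int ^ 'n) set \<Rightarrow> int ^ 'n \<Rightarrow> (int ^ 'n) set" where
  "facet Q w = {q\<in>Q. idot w q = 0}"

lemma facet_face:
  assumes "add_submonoid Q" "facet_normal Q w" shows "face Q (facet Q w)"
  unfolding face_def facet_def
proof (intro conjI ballI)
  show "{q \<in> Q. idot w q = 0} \<noteq> {}" using submonoid_zero[OF assms(1)] by (auto simp: idot_simps)
  fix a b assume ab: "a \<in> Q" "b \<in> Q"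
  then have "0 \<le> idot w a" "0 \<le> idot w b" "a + b \<in> Q"
    using assms(2) submonoid_add[OF assms(1)] by (auto simp: facet_normal_def)
  then show "(a + b \<in> {q \<in> Q. idot w q = 0}) = (a \<in> {q \<in> Q. idot w q = 0} \<and> b \<in> {q \<in> Q. idot w q = 0})"
    using ab by (auto simp: idot_simps)
qed auto

lemma facet_neq: "facet_normal Q w \<Longrightarrow> facet Q w \<noteq> Q"
  unfolding facet_normal_def facet_def by force

lemma sat_subgroup:
  assumes "add_subgroup (H :: (int ^ 'n) set)"
  shows "add_subgroup {x. \<exists>n>0. int n *s x \<in> H}"
  unfolding add_subgroup_def add_submonoid_def
proof (intro conjI ballI)
  note H = subgroup_submonoid[OF assms]
  show "0 \<in> {x. \<exists>n>0. int n *s x \<in> H}" using submonoid_zero[OF H] by auto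
  fix a b assume "a \<in> {x. \<exists>n>0. int n *s x \<in> H}" "b \<in> {x. \<exists>n>0. int n *s x \<in> H}"
  then obtain n m where nm: "n > 0" "m > 0" "int n *s a \<in> H" "int m *s b \<in> H" by auto
  have "int (n * m) *s (a + b) = int m *s (int n *s a) + int n *s (int m *s b)"
    by (simp add: vec_eq_iff algebra_simps)
  also have "\<dots> \<in> H"
    by (rule submonoid_add[OF H subgroup_smult[OF assms nm(3)] subgroup_smult[OF assms nm(4)]])
  finally show "a + b \<in> {x. \<exists>n>0. int n *s x \<in> H}" using nm(1,2)
    by (intro CollectI exI[of _ "n * m"]) auto
next
  fix a assume "a \<in> {x. \<exists>n>0. int n *s x \<in> H}"
  then obtain n where n: "n > 0" "int n *s a \<in> H" by auto
  have "int n *s (- a) = - (int n *s a)" by (simp add: vec_eq_iff)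
  then show "- a \<in> {x. \<exists>n>0. int n *s x \<in> H}" using n subgroup_uminus[OF assms] by auto
qed

lemma group_gen_insert:
  "group_gen (insert p Z) \<subseteq> {z + k *s p | z k. z \<in> group_gen (Z :: (int ^ 'n) set)}"
  unfolding group_gen_def[of "insert p Z"]
proof (rule hull_minimal)
  show "insert p Z \<subseteq> {z + k *s p | z k. z \<in> group_gen Z}"
  proof
    fix x assume "x \<in> insert p Z"
    then consider "x = 0 + 1 *s p" | "x = x + 0 *s p" "x \<in> group_gen Z"
      using subset_group_gen[of Z] by auto
    then show "x \<in> {z + k *s p | z k. z \<in> group_gen Z}"
      using group_gen_zero[of Z] by cases blast+
  qed
  show "add_subgroup {z + k *s p | z k. z \<in> group_gen Z}"
    unfolding add_subgroup_def add_submonoid_def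
  proof (intro conjI ballI)
    have "0 = 0 + 0 *s p" by simp
    then show "0 \<in> {z + k *s p | z k. z \<in> group_gen Z}" using group_gen_zero[of Z] by blast
    fix a b assume "a \<in> {z + k *s p | z k. z \<in> group_gen Z}" "b \<in> {z + k *s p | z k. z \<in> group_gen Z}"
    then obtain z k z' k' where "a = z + k *s p" "b = z' + k' *s p" "z \<in> group_gen Z" "z' \<in> group_gen Z"
      by blast
    then have "a + b = (z + z') + (k + k') *s p" "z + z' \<in> group_gen Z"
      using group_gen_add by (auto simp: vec_eq_iff algebra_simps)
    then show "a + b \<in> {z + k *s p | z k. z \<in> group_gen Z}" by blast
  next
    fix a assume "a \<in> {z + k *s p | z k. z \<in> group_gen Z}"
    then obtain z k where "a = z + k *s p" "z \<in> group_gen Z" by blast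
    then have "- a = (- z) + (- k) *s p" "- z \<in> group_gen Z"
      using group_gen_uminus by (auto simp: vec_eq_iff algebra_simps)
    then show "- a \<in> {z + k *s p | z k. z \<in> group_gen Z}" by blast
  qed
qed

text \<open>Among the functionals that separate \<open>p\<close> from \<open>Q\<close>, take one that vanishes on as many
  generators as possible. If these and \<open>p\<close> did not span the group up to finite index, then Farkas'
  lemma would provide a direction in which the functional can be tilted further.\<close>
lemma exists_facet_normal:
  fixes Q :: "(int ^ 'n) set"
  assumes "affine_monoid Q" "p \<in> group_gen Q" "\<not> (\<exists>n>0. int n *s p \<in> Q)"
  shows "\<exists>w. facet_normal Q w \<and> idot w p < 0"
proof -
  note Q = affine_submonoid[OF assms(1)]
  obtain G where G: "finite G" "Q = add_submonoid hull G" using assms(1) affine_monoid_def by blast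
  have GQ: "G \<subseteq> Q" using G(2) by (simp add: hull_subset)
  define P where "P w \<longleftrightarrow> (\<forall>g\<in>G. 0 \<le> idot w g) \<and> idot w p < 0" for w
  define zs where "zs w = {g\<in>G. idot w g = 0}" for w
  obtain w0 where "P w0" using int_farkas[OF G(1), of p] assms(3) G(2) P_def by blast
  moreover have "card (zs w) < Suc (card G)" for w
    using card_mono[OF G(1), of "zs w"] by (auto simp: zs_def)
  ultimately obtain w where w: "P w" "\<And>v. P v \<Longrightarrow> card (zs v) \<le> card (zs w)"
    using ex_has_greatest_nat[of P w0 "\<lambda>w. card (zs w)" "Suc (card G)"] by (metis less_imp_le)
  let ?S = "insert p (zs w)"
  have claim: "\<exists>n>0. int n *s g \<in> add_submonoid hull (?S \<union> uminus ` ?S)" if "g \<in> G" for g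
  proof (rule ccontr)
    assume "\<not> ?thesis"
    moreover have "finite (?S \<union> uminus ` ?S)" using G(1) by (simp add: zs_def)
    ultimately obtain v where v: "\<forall>s\<in>?S \<union> uminus ` ?S. 0 \<le> idot v s" "idot v g < 0"
      using int_farkas[of "?S \<union> uminus ` ?S" g] by blast
    have v0: "idot v s = 0" if "s \<in> ?S" for s
      using v(1)[rule_format, of s] v(1)[rule_format, of "- s"] that by (auto simp: idot_simps)
    \<comment> \<open>tilt \<open>w\<close> towards \<open>v\<close> until it vanishes on one more generator\<close>
    define N where "N = {h\<in>G. idot v h < 0}"
    have N: "finite N" "N \<noteq> {}" using G(1) that v(2) by (auto simp: N_def)
    define r where "r h = real_of_int (idot w h) / real_of_int (- idot v h)" for h
    define h where "h = arg_min_on r N"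
    have h: "h \<in> N" "\<And>x. x \<in> N \<Longrightarrow> r h \<le> r x"
      using arg_min_if_finite[OF N, of r] unfolding h_def by (auto simp: not_less)
    define w' where "w' = (- idot v h) *s w + idot w h *s v"
    have w'_eq: "idot w' x = (- idot v h) * idot w x + idot w h * idot v x" for x
      by (simp add: w'_def idot_simps)
    have neg: "idot v h < 0" using h(1) by (simp add: N_def)
    have "0 \<le> idot w' x" if "x \<in> G" for x
    proof (cases "idot v x < 0")
      case True
      then have "r h \<le> r x" using h(2) that N_def by blast
      then have "real_of_int (idot w h) * real_of_int (- idot v x)
          \<le> real_of_int (idot w x) * real_of_int (- idot v h)"
        using True neg by (simp add: r_def field_simps)
      then have "idot w h * (- idot v x) \<le> idot w x * (- idot v h)"
        by (metis of_int_le_iff of_int_mult)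
      then show ?thesis by (simp add: w'_eq algebra_simps)
    next
      case False
      have "0 \<le> (- idot v h) * idot w x" "0 \<le> idot w h * idot v x"
        using False neg w(1) that h(1) by (auto simp: P_def N_def intro!: mult_nonpos_nonneg)
      then show ?thesis unfolding w'_eq by linarith
    qed
    moreover have "idot w' p < 0"
      using v0[of p] neg w(1) by (simp add: w'_eq P_def mult_neg_neg)
    ultimately have "P w'" by (simp add: P_def)
    moreover have "zs w \<subset> zs w'"
    proof
      show "zs w \<subseteq> zs w'" using v0 by (auto simp: zs_def w'_eq)
      have "h \<in> zs w'" using h(1) by (simp add: zs_def N_def w'_eq)
      moreover have "h \<notin> zs w" using v0[of h] neg by auto
      ultimately show "zs w \<noteq> zs w'" by blast
    qed
    then have "card (zs w) < card (zs w')" using G(1) by (intro psubset_card_mono) (auto simp: zs_def)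
    ultimately show False using w(2) by fastforce
  qed
  have "group_gen Q \<subseteq> {x. \<exists>n>0. int n *s x \<in> group_gen ?S}"
  proof -
    have sub: "add_subgroup {x. \<exists>n>0. int n *s x \<in> group_gen ?S}"
      by (rule sat_subgroup[OF add_subgroup_group_gen])
    have "add_submonoid hull (?S \<union> uminus ` ?S) \<subseteq> group_gen ?S"
      using subset_group_gen[of ?S] group_gen_uminus[of _ ?S]
        subgroup_submonoid[OF add_subgroup_group_gen[of ?S]]
      by (intro hull_minimal) auto
    then have "G \<subseteq> {x. \<exists>n>0. int n *s x \<in> group_gen ?S}" using claim by blast
    then have "Q \<subseteq> {x. \<exists>n>0. int n *s x \<in> group_gen ?S}"
      unfolding G(2) by (rule hull_minimal) (rule subgroup_submonoid[OF sub])
    then show ?thesis unfolding group_gen_def[of Q] using sub by (rule hull_minimal)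
  qed
  note span = this
  have nonneg: "0 \<le> idot w q" if "q \<in> Q" for q
    using idot_hull_nonneg[of G w q] w(1) that G(2) by (auto simp: P_def)
  have "\<exists>n>0. int n *s x \<in> group_gen {q\<in>Q. idot w q = 0}" if x: "x \<in> group_gen Q" "idot w x = 0" for x
  proof -
    obtain n where n: "n > 0" "int n *s x \<in> group_gen ?S" using span x by blast
    then obtain z k where zk: "int n *s x = z + k *s p" "z \<in> group_gen (zs w)"
      using group_gen_insert[of p "zs w"] by blast
    have sub: "zs w \<subseteq> {q\<in>Q. idot w q = 0}" using GQ by (auto simp: zs_def)
    have "idot w z = 0"
    proof -
      have "add_subgroup {z. idot w z = 0}"
        by (simp add: add_subgroup_def add_submonoid_def idot_simps)
      moreover have "zs w \<subseteq> {z. idot w z = 0}" by (auto simp: zs_def)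
      ultimately have "group_gen (zs w) \<subseteq> {z. idot w z = 0}"
        unfolding group_gen_def by (intro hull_minimal)
      then show ?thesis using zk(2) by blast
    qed
    then have "k * idot w p = 0" using arg_cong[OF zk(1), of "idot w"] x(2) by (simp add: idot_simps)
    then have "k = 0" using w(1) by (auto simp: P_def)
    then show ?thesis using zk n(1) group_gen_mono[OF sub] by (intro exI[of _ n]) auto
  qed
  moreover have "\<exists>q\<in>Q. 0 < idot w q"
  proof -
    obtain a b where "p = a - b" "a \<in> Q" "b \<in> Q" using assms(2) group_gen_eq_diff[OF Q] by auto
    moreover from this have "0 < idot w b" using nonneg[of a] w(1) by (simp add: P_def idot_simps)
    ultimately show ?thesis by blast
  qed
  ultimately show ?thesis using nonneg w(1) unfolding facet_normal_def P_def by blast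
qed

text \<open>For \<open>q \<in> Q - F\<close> no multiple of \<open>- q\<close> lies in \<open>Q\<^sub>F\<close>, so a facet normal of \<open>Q\<^sub>F\<close> separates
  them. It vanishes on \<open>F\<close>, because \<open>Q\<^sub>F\<close> contains \<open>F\<close> and \<open>- F\<close>.\<close>
lemma proper_face_in_facet:
  fixes Q :: "(int ^ 'n) set"
  assumes "affine_monoid Q" "face Q F" "F \<noteq> Q"
  shows "\<exists>w. facet_normal Q w \<and> F \<subseteq> facet Q w"
proof -
  note Q = affine_submonoid[OF assms(1)]
  let ?L = "face_localization Q F"
  note L = face_localization_affine[OF assms(1,2)]
  note gL = group_gen_face_localization[OF Q assms(2)]
  obtain q where q: "q \<in> Q" "q \<notin> F" using assms(2,3) faceD(1) by blast
  have "- q \<in> group_gen ?L" using q(1) gL subset_group_gen group_gen_uminus by blast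
  moreover have "\<not> (\<exists>n>0. int n *s (- q) \<in> ?L)"
  proof
    assume "\<exists>n>0. int n *s (- q) \<in> ?L"
    then obtain n q' f where n: "n > 0" "int n *s (- q) = q' - f" "q' \<in> Q" "f \<in> F"
      unfolding face_localization_def by blast
    then have "int n *s q + q' = f" by (simp add: vec_eq_iff algebra_simps)
    then have "int n *s q \<in> F"
      using faceD(2)[OF assms(2) submonoid_smult[OF Q q(1)] n(3)] n(4) by auto
    then show False using face_smult[OF Q assms(2) q(1)] n(1) q(2) by blast
  qed
  ultimately obtain w where w: "facet_normal ?L w" "idot w (- q) < 0"
    using exists_facet_normal[OF L] by blast
  have QL: "Q \<subseteq> ?L" by (rule subset_face_localization[OF Q assms(2)])
  have w0: "idot w f = 0" if "f \<in> F" for f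
  proof -
    have "0 - f \<in> ?L" unfolding face_localization_def using that submonoid_zero[OF Q] by blast
    then have "- f \<in> ?L" by simp
    moreover have "f \<in> ?L" using that QL faceD(1)[OF assms(2)] by blast
    ultimately have "0 \<le> idot w (- f)" "0 \<le> idot w f" using w(1) by (auto simp: facet_normal_def)
    then show ?thesis by (simp add: idot_simps)
  qed
  have "group_gen {y\<in>?L. idot w y = 0} \<subseteq> group_gen {y\<in>Q. idot w y = 0}"
    unfolding group_gen_def[of "{y\<in>?L. idot w y = 0}"]
  proof (rule hull_minimal)
    show "add_subgroup (group_gen {y\<in>Q. idot w y = 0})" by (rule add_subgroup_group_gen)
    show "{y\<in>?L. idot w y = 0} \<subseteq> group_gen {y\<in>Q. idot w y = 0}"
    proof
    fix y assume y: "y \<in> {y\<in>?L. idot w y = 0}"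
    then obtain q f where qf: "y = q - f" "q \<in> Q" "f \<in> F" unfolding face_localization_def by blast
    then have "f \<in> {y\<in>Q. idot w y = 0}" using w0 faceD(1)[OF assms(2)] by auto
    moreover have "q \<in> {y\<in>Q. idot w y = 0}" using qf w0[OF qf(3)] y by (simp add: idot_simps)
    ultimately show "y \<in> group_gen {y\<in>Q. idot w y = 0}" unfolding qf(1)
      by (intro group_gen_diff subsetD[OF subset_group_gen])
    qed
  qed
  note gsub = this
  have wL: "\<forall>x\<in>?L. 0 \<le> idot w x"
    "\<forall>x\<in>group_gen Q. idot w x = 0 \<longrightarrow> (\<exists>n>0. int n *s x \<in> group_gen {y\<in>?L. idot w y = 0})"
    using w(1) unfolding facet_normal_def gL by (rule conjunct1, rule conjunct2[OF conjunct2])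
  have "facet_normal Q w" unfolding facet_normal_def
  proof (intro conjI)
    show "\<forall>x\<in>Q. 0 \<le> idot w x" using QL wL(1) by blast
    show "\<exists>q\<in>Q. 0 < idot w q" using q(1) w(2) by (intro bexI[of _ q]) (auto simp: idot_simps)
    show "\<forall>x\<in>group_gen Q. idot w x = 0 \<longrightarrow> (\<exists>n>0. int n *s x \<in> group_gen {q \<in> Q. idot w q = 0})"
      using wL(2) gsub by (meson subsetD)
  qed
  moreover have "F \<subseteq> facet Q w" using w0 faceD(1)[OF assms(2)] by (auto simp: facet_def)
  ultimately show ?thesis by blast
qed

section \<open>Linear dependence over a domain and ranks\<close>

text \<open>More vectors than coordinates are linearly dependent over any domain \<open>A\<close>; eliminating
  one coordinate crosswise avoids fractions.\<close>
lemma more_vectors_than_coordinates_dependent: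
  fixes A :: "'a::comm_ring_1 set" and v :: "'i \<Rightarrow> 'j \<Rightarrow> 'a"
  assumes A: "1 \<in> A" "\<And>a b. a \<in> A \<Longrightarrow> b \<in> A \<Longrightarrow> a - b \<in> A" "\<And>a b. a \<in> A \<Longrightarrow> b \<in> A \<Longrightarrow> a * b \<in> A"
    "\<And>a b. a \<in> A \<Longrightarrow> b \<in> A \<Longrightarrow> a * b = 0 \<Longrightarrow> a = 0 \<or> b = 0"
  assumes "finite J" "finite I" "card J < card I" "\<And>i j. i \<in> I \<Longrightarrow> j \<in> J \<Longrightarrow> v i j \<in> A"
  shows "\<exists>c. (\<forall>i\<in>I. c i \<in> A) \<and> (\<exists>i\<in>I. c i \<noteq> 0) \<and> (\<forall>j\<in>J. (\<Sum>i\<in>I. c i * v i j) = 0)"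
  using assms(5-)
proof (induction J arbitrary: I v rule: finite_induct)
  case empty
  then have "I \<noteq> {}" by auto
  then obtain i where "i \<in> I" by blast
  then show ?case using A(1) by (intro exI[of _ "\<lambda>_. 1"]) auto
next
  case (insert j J)
  have zero: "0 \<in> A" using A(2)[OF A(1) A(1)] by simp
  have sumA: "sum f S \<in> A" if "\<And>i. i \<in> S \<Longrightarrow> f i \<in> A" for f :: "'i \<Rightarrow> 'a" and S
  proof -
    have "a + b \<in> A" if "a \<in> A" "b \<in> A" for a b
      using A(2)[OF that(1) A(2)[OF zero that(2)]] by simp
    then show ?thesis using that zero by (induction S rule: infinite_finite_induct) auto
  qed
  show ?case
  proof (cases "\<forall>i\<in>I. v i j = 0")
    case True
    have "\<exists>c. (\<forall>i\<in>I. c i \<in> A) \<and> (\<exists>i\<in>I. c i \<noteq> 0) \<and> (\<forall>j\<in>J. (\<Sum>i\<in>I. c i * v i j) = 0)"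
      by (rule insert.IH) (use insert in auto)
    then show ?thesis using True by auto
  next
    case False
    then obtain k where k: "k \<in> I" "v k j \<noteq> 0" by blast
    define w where "w i l = v k j * v i l - v i j * v k l" for i l
    have vA: "v i l \<in> A" if "i \<in> I" "l \<in> insert j J" for i l using insert.prems that by blast
    have "\<exists>c. (\<forall>i\<in>I - {k}. c i \<in> A) \<and> (\<exists>i\<in>I - {k}. c i \<noteq> 0) \<and>
        (\<forall>l\<in>J. (\<Sum>i\<in>I - {k}. c i * w i l) = 0)"
      by (rule insert.IH) (use insert.prems insert.hyps k in \<open>auto simp: w_def intro!: A(2,3) vA\<close>)
    then obtain c where c: "\<And>i. i \<in> I - {k} \<Longrightarrow> c i \<in> A" "\<exists>i\<in>I - {k}. c i \<noteq> 0"
      "\<And>l. l \<in> J \<Longrightarrow> (\<Sum>i\<in>I - {k}. c i * w i l) = 0" by blast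
    define c' where "c' i = (if i = k then - (\<Sum>i\<in>I - {k}. c i * v i j) else c i * v k j)" for i
    have sum_eq: "(\<Sum>i\<in>I. c' i * v i l) = (\<Sum>i\<in>I - {k}. c i * w i l)" for l
    proof -
      have "(\<Sum>i\<in>I. c' i * v i l) = c' k * v k l + (\<Sum>i\<in>I - {k}. c' i * v i l)"
        using k(1) insert.prems(1) by (simp add: sum.remove)
      also have "(\<Sum>i\<in>I - {k}. c' i * v i l) = (\<Sum>i\<in>I - {k}. c i * v k j * v i l)"
        by (intro sum.cong) (auto simp: c'_def)
      also have "c' k * v k l + \<dots> = (\<Sum>i\<in>I - {k}. c i * w i l)"
        by (simp add: c'_def w_def sum_distrib_right sum_distrib_left sum_subtractf algebra_simps)
      finally show ?thesis .
    qed
    have "(\<Sum>i\<in>I. c' i * v i l) = 0" if "l \<in> insert j J" for l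
    proof (cases "l = j")
      case True
      then show ?thesis by (simp add: sum_eq w_def algebra_simps)
    qed (use c(3) that sum_eq in auto)
    moreover have "c' i \<in> A" if "i \<in> I" for i
    proof -
      have "0 - (\<Sum>i\<in>I - {k}. c i * v i j) \<in> A"
        by (rule A(2)[OF zero sumA]) (auto intro!: A(3) c(1) vA)
      then show ?thesis using that k(1) c(1) vA A(3) by (auto simp: c'_def)
    qed
    moreover have "\<exists>i\<in>I. c' i \<noteq> 0"
    proof -
      obtain i where "i \<in> I - {k}" "c i \<noteq> 0" using c(2) by blast
      then have "c' i \<noteq> 0" using A(4)[OF c(1) vA] k by (auto simp: c'_def)
      then show ?thesis using \<open>i \<in> I - {k}\<close> by blast
    qed
    ultimately show ?thesis by blast
  qed
qed

interpretation intvec: Modules.module "(*s) :: int \<Rightarrow> int ^ 'n \<Rightarrow> int ^ 'n"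
  by unfold_locales (auto simp: vec_eq_iff algebra_simps)

definition int_indep :: "(int ^ 'n) set \<Rightarrow> bool" where
  "int_indep B \<longleftrightarrow> finite B \<and> (\<forall>u. (\<Sum>b\<in>B. u b *s b) = 0 \<longrightarrow> (\<forall>b\<in>B. u b = 0))"

lemma int_indep_iff: "finite B \<and> \<not> module.dependent (*s) B \<longleftrightarrow> int_indep B"
  unfolding int_indep_def using intvec.dependent_finite[of B] by blast

lemma group_rank_eq: "group_rank H = Max (card ` {B. B \<subseteq> H \<and> int_indep B})"
  unfolding group_rank_def int_indep_iff[symmetric] ..

text \<open>Membership in the rational span, with denominators cleared.\<close>
definition int_spans :: "(int ^ 'n) set \<Rightarrow> int ^ 'n \<Rightarrow> bool" where
  "int_spans B x \<longleftrightarrow> (\<exists>n>0. \<exists>u. int n *s x = (\<Sum>b\<in>B. u b *s b))"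

lemma int_indep_card_le:
  assumes "finite B" "\<And>h. h \<in> H \<Longrightarrow> int_spans B h" "B' \<subseteq> H" "int_indep (B' :: (int ^ 'n) set)"
  shows "card B' \<le> card B"
proof (rule ccontr)
  assume neg: "\<not> ?thesis"
  have "\<forall>h\<in>B'. \<exists>n u. n > 0 \<and> int n *s h = (\<Sum>b\<in>B. u b *s b)"
    using assms(2,3) unfolding int_spans_def by blast
  then obtain n u where nu: "\<And>h. h \<in> B' \<Longrightarrow> n h > 0 \<and> int (n h) *s h = (\<Sum>b\<in>B. u h b *s b)" by metis
  have "\<exists>c. (\<forall>i\<in>B'. c i \<in> (UNIV::int set)) \<and> (\<exists>i\<in>B'. c i \<noteq> 0) \<and> (\<forall>j\<in>B. (\<Sum>i\<in>B'. c i * u i j) = 0)"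
    by (rule more_vectors_than_coordinates_dependent)
       (use assms neg in \<open>auto simp: int_indep_def\<close>)
  then obtain c where c: "\<exists>i\<in>B'. c i \<noteq> 0" "\<forall>j\<in>B. (\<Sum>i\<in>B'. c i * u i j) = 0" by blast
  have "(\<Sum>h\<in>B'. (c h * int (n h)) *s h) = (\<Sum>h\<in>B'. c h *s (\<Sum>b\<in>B. u h b *s b))"
    using nu by (intro sum.cong) (simp_all add: vector_smult_assoc[symmetric])
  also have "\<dots> = (\<Sum>h\<in>B'. \<Sum>b\<in>B. (c h * u h b) *s b)"
    by (simp add: intvec.scale_sum_right vector_smult_assoc)
  also have "\<dots> = (\<Sum>b\<in>B. \<Sum>h\<in>B'. (c h * u h b) *s b)" by (rule sum.swap)
  also have "\<dots> = (\<Sum>b\<in>B. (\<Sum>h\<in>B'. c h * u h b) *s b)" by (simp add: intvec.scale_sum_left)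
  also have "\<dots> = 0" using c(2) by simp
  finally have "\<forall>h\<in>B'. c h * int (n h) = 0"
    using assms(4)[unfolded int_indep_def, THEN conjunct2, rule_format, of "\<lambda>h. c h * int (n h)"] by blast
  then show False using c(1) nu by fastforce
qed

lemma int_indep_card_le_dim:
  assumes "int_indep (B :: (int ^ 'n) set)" shows "card B \<le> CARD('n)"
proof -
  define E :: "(int ^ 'n) set" where "E = (\<lambda>i. axis i 1) ` UNIV"
  have "int_spans E h" for h
  proof -
    have inj: "inj (\<lambda>i. axis i (1::int) :: int ^ 'n)" by (auto simp: inj_on_def axis_eq_axis)
    have "int 1 *s h = (\<Sum>i\<in>UNIV. (h $ i) *s axis i 1)"
      by (simp add: vec_eq_iff axis_def if_distrib[of "\<lambda>c. _ * c"] cong: if_cong)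
    also have "\<dots> = (\<Sum>b\<in>E. (h $ (inv_into UNIV (\<lambda>i. axis i (1::int)) b)) *s b)"
      unfolding E_def by (subst sum.reindex[OF inj]) (simp add: inv_f_f[OF inj])
    finally show ?thesis unfolding int_spans_def by (intro exI[of _ 1] conjI exI[of _ "\<lambda>b. h $ (inv_into UNIV (\<lambda>i. axis i (1::int)) b)"]) auto
  qed
  then have "card B \<le> card E" using int_indep_card_le[of E UNIV B] assms E_def by auto
  also have "\<dots> \<le> CARD('n)" unfolding E_def by (rule card_image_le) simp
  finally show ?thesis .
qed

lemma finite_indep_cards: "finite (card ` {B. B \<subseteq> (H :: (int ^ 'n) set) \<and> int_indep B})"
  by (rule finite_subset[of _ "{..CARD('n)}"]) (auto intro: int_indep_card_le_dim)

lemma card_le_group_rank: "B \<subseteq> H \<Longrightarrow> int_indep B \<Longrightarrow> card B \<le> group_rank H"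
  unfolding group_rank_eq by (rule Max_ge[OF finite_indep_cards]) auto

lemma group_rank_mono: "H \<subseteq> H' \<Longrightarrow> group_rank H \<le> group_rank H'"
  unfolding group_rank_eq by (rule Max_mono) (use finite_indep_cards in \<open>auto simp: int_indep_def\<close>)

lemma group_rank_basis: obtains B where "B \<subseteq> H" "int_indep B" "card B = group_rank H"
proof -
  have "group_rank H \<in> card ` {B. B \<subseteq> H \<and> int_indep B}" unfolding group_rank_eq
    by (rule Max_in[OF finite_indep_cards]) (auto simp: int_indep_def intro!: exI[of _ "{}"])
  then show ?thesis using that by auto
qed

lemma int_spans_of_maximal:
  assumes "B \<subseteq> H" "int_indep B" "card B = group_rank H" "h \<in> H"
  shows "int_spans B h"
proof (cases "h \<in> B")
  case True
  have "finite B" using assms(2) by (simp add: int_indep_def)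
  then have "int 1 *s h = (\<Sum>b\<in>B. (if b = h then 1 else 0) *s b)"
    using True by (simp add: if_distrib[of "\<lambda>c. c *s _"] cong: if_cong)
  then show ?thesis unfolding int_spans_def by (intro exI[of _ 1] conjI exI[of _ "\<lambda>b. if b = h then 1 else 0"]) auto
next
  case False
  have fin: "finite B" using assms(2) by (simp add: int_indep_def)
  have "\<not> int_indep (insert h B)"
    using card_le_group_rank[of "insert h B" H] assms False fin by auto
  then obtain u where u: "(\<Sum>b\<in>insert h B. u b *s b) = 0" "\<exists>b\<in>insert h B. u b \<noteq> 0"
    using fin by (auto simp: int_indep_def)
  have eq: "u h *s h = (\<Sum>b\<in>B. (- u b) *s b)"
    using u(1) False fin by (simp add: vec_eq_iff sum_negf eq_neg_iff_add_eq_0)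
  have "u h \<noteq> 0"
  proof
    assume "u h = 0"
    then have "(\<Sum>b\<in>B. u b *s b) = 0" using u(1) False fin by simp
    then have "\<forall>b\<in>B. u b = 0" using assms(2) by (auto simp: int_indep_def)
    then show False using u(2) \<open>u h = 0\<close> by auto
  qed
  have "int (nat \<bar>u h\<bar>) *s h = sgn (u h) *s (u h *s h)"
  proof -
    have "int (nat \<bar>u h\<bar>) = \<bar>u h\<bar>" by simp
    also have "\<dots> = sgn (u h) * u h" by (simp only: abs_sgn mult.commute)
    finally show ?thesis by (simp only: vector_smult_assoc)
  qed
  also have "\<dots> = (\<Sum>b\<in>B. (- sgn (u h) * u b) *s b)"
    unfolding eq by (simp add: intvec.scale_sum_right vector_smult_assoc)
  finally have "int (nat \<bar>u h\<bar>) *s h = (\<Sum>b\<in>B. (- sgn (u h) * u b) *s b)" .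
  moreover have "nat \<bar>u h\<bar> > 0" using \<open>u h \<noteq> 0\<close> by simp
  ultimately show ?thesis unfolding int_spans_def
    by (intro exI[of _ "nat \<bar>u h\<bar>"] conjI exI[of _ "\<lambda>b. - sgn (u h) * u b"])
qed

lemma group_gen_sum_smult: "(\<And>b. b \<in> B \<Longrightarrow> b \<in> group_gen H) \<Longrightarrow> (\<Sum>b\<in>B. u b *s b) \<in> group_gen (H :: (int ^ 'n) set)"
  by (intro submonoid_sum subgroup_submonoid add_subgroup_group_gen group_gen_smult)

lemma group_rank_eq_imp_sat:
  assumes "group_gen F \<subseteq> group_gen F'" "group_rank (group_gen F) = group_rank (group_gen F')"
    "x \<in> group_gen (F' :: (int ^ 'n) set)"
  shows "\<exists>n>0. int n *s x \<in> group_gen F"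
proof -
  obtain B where B: "B \<subseteq> group_gen F" "int_indep B" "card B = group_rank (group_gen F)"
    by (rule group_rank_basis)
  have "int_spans B x" using int_spans_of_maximal[of B "group_gen F'" x] B assms by auto
  then show ?thesis using group_gen_sum_smult[of B F] B(1) unfolding int_spans_def by (metis subsetD)
qed

lemma face_eq_if_rank_eq:
  fixes Q :: "(int ^ 'n) set"
  assumes "add_submonoid Q" "face Q F" "face Q F'" "F \<subseteq> F'"
    "group_rank (group_gen F) = group_rank (group_gen F')"
  shows "F = F'"
proof
  show "F' \<subseteq> F"
  proof
    fix x assume x: "x \<in> F'"
    then obtain n where "n > 0" "int n *s x \<in> group_gen F"
      using group_rank_eq_imp_sat[OF group_gen_mono[OF assms(4)] assms(5)] subset_group_gen by blast
    moreover have "x \<in> Q" using x faceD(1)[OF assms(3)] by blast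
    ultimately show "x \<in> F"
      using face_Int_group_gen[OF assms(1,2) submonoid_smult[OF assms(1)]] face_smult[OF assms(1,2)]
      by blast
  qed
qed (rule assms(4))

text \<open>A basis of the group of the facet becomes a basis of \<open>\<int>Q\<close>, up to finite index, by adjoining any
  element of positive height: subtracting a multiple of that element moves every point, after
  scaling, into the hyperplane.\<close>
lemma facet_rank:
  fixes Q :: "(int ^ 'n) set"
  assumes Q: "add_submonoid Q" and w: "facet_normal Q w"
  shows "group_rank (group_gen Q) = Suc (group_rank (group_gen (facet Q w)))"
proof -
  obtain B where B: "B \<subseteq> group_gen (facet Q w)" "int_indep B" "card B = group_rank (group_gen (facet Q w))"
    by (rule group_rank_basis)
  obtain q where q: "q \<in> Q" "0 < idot w q" using w by (auto simp: facet_normal_def)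
  have "add_subgroup {z. idot w z = 0}"
    by (simp add: add_subgroup_def add_submonoid_def idot_simps)
  then have "group_gen (facet Q w) \<subseteq> {z. idot w z = 0}"
    unfolding group_gen_def by (intro hull_minimal) (auto simp: facet_def)
  then have B0: "idot w b = 0" if "b \<in> B" for b using B(1) that by blast
  have qB: "q \<notin> B" using B0 q(2) by force
  have fin: "finite B" using B(2) by (simp add: int_indep_def)
  have "int_indep (insert q B)" unfolding int_indep_def
  proof (intro conjI allI impI)
    fix u assume u: "(\<Sum>b\<in>insert q B. u b *s b) = 0"
    have "0 = (\<Sum>b\<in>insert q B. u b * idot w b)"
      using arg_cong[OF u, of "idot w"] by (simp add: idot_simps idot_sum_right)
    also have "\<dots> = u q * idot w q" using qB fin B0 by simp
    finally have "u q = 0" using q(2) by simp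
    then have "(\<Sum>b\<in>B. u b *s b) = 0" using u qB fin by simp
    then show "\<forall>b\<in>insert q B. u b = 0" using \<open>u q = 0\<close> B(2) by (auto simp: int_indep_def)
  qed (use fin in simp)
  moreover have "insert q B \<subseteq> group_gen Q"
    using q(1) subset_group_gen B(1) group_gen_mono[of "facet Q w" Q] by (auto simp: facet_def)
  ultimately have "Suc (card B) \<le> group_rank (group_gen Q)"
    using card_le_group_rank[of "insert q B" "group_gen Q"] qB fin by simp
  moreover have "int_spans (insert q B) x" if "x \<in> group_gen Q" for x
  proof -
    let ?y = "idot w q *s x - idot w x *s q"
    have "?y \<in> group_gen Q" using that q(1) subset_group_gen by (intro group_gen_diff group_gen_smult) auto
    moreover have "idot w ?y = 0" by (simp add: idot_simps)
    ultimately obtain n where n: "n > 0" "int n *s ?y \<in> group_gen (facet Q w)"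
      using w unfolding facet_normal_def facet_def by blast
    then obtain m u where m: "m > 0" "int m *s (int n *s ?y) = (\<Sum>b\<in>B. u b *s b)"
      using int_spans_of_maximal[OF B n(2)] unfolding int_spans_def by blast
    define k where "k = m * n * nat (idot w q)"
    have k: "int k = int m * int n * idot w q" using q(2) by (simp add: k_def)
    define u' where "u' b = (if b = q then int m * int n * idot w x else u b)" for b
    have "(\<Sum>b\<in>B. u' b *s b) = (\<Sum>b\<in>B. u b *s b)" by (intro sum.cong) (use qB in \<open>auto simp: u'_def\<close>)
    then have "int k *s x = (\<Sum>b\<in>insert q B. u' b *s b)"
      using qB fin m(2)[symmetric] by (simp add: k u'_def vec_eq_iff algebra_simps)
    moreover have "k > 0" using m(1) n(1) q(2) by (simp add: k_def)
    ultimately show ?thesis unfolding int_spans_def by (intro exI[of _ k] conjI exI[of _ u'])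
  qed
  moreover obtain C where "C \<subseteq> group_gen Q" "int_indep C" "card C = group_rank (group_gen Q)"
    by (rule group_rank_basis)
  ultimately have "group_rank (group_gen Q) \<le> card (insert q B)"
    using int_indep_card_le[of "insert q B" "group_gen Q" C] fin by simp
  moreover note \<open>Suc (card B) \<le> group_rank (group_gen Q)\<close>
  ultimately show ?thesis using B(3) qB fin by simp
qed

text \<open>A face of codimension one lies in a facet, which has the same rank and hence equals it.\<close>
lemma star_dim_eq_codim_one_iff:
  fixes Q :: "(int ^ 'n) set"
  assumes Q: "affine_monoid Q" and F: "face Q F"
  shows "star_dim Q F = star_dim Q Q - 1 \<longleftrightarrow> (\<exists>w. facet_normal Q w \<and> F = facet Q w)"
proof
  note Q' = affine_submonoid[OF Q]
  show "star_dim Q F = star_dim Q Q - 1" if ex: "\<exists>w. facet_normal Q w \<and> F = facet Q w"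
  proof -
    obtain w where w: "facet_normal Q w" "F = facet Q w" using ex by (elim exE conjE)
    from facet_rank[OF Q' w(1)] show ?thesis unfolding star_dim_def w(2) by linarith
  qed
  assume *: "star_dim Q F = star_dim Q Q - 1"
  have "F \<noteq> Q"
  proof
    assume "F = Q"
    then show False using * by simp
  qed
  from proper_face_in_facet[OF Q F this]
  obtain w where w: "facet_normal Q w" "F \<subseteq> facet Q w" by (elim exE conjE)
  have "group_rank (group_gen F) = group_rank (group_gen (facet Q w))"
    using * facet_rank[OF Q' w(1)] unfolding star_dim_def by linarith
  from face_eq_if_rank_eq[OF Q' F facet_face[OF Q' w(1)] w(2) this]
  show "\<exists>w. facet_normal Q w \<and> F = facet Q w" using w(1) by blast
qed

lemma star_dim_nonneg:
  fixes Q :: "(int ^ 'n) set"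
  assumes "add_submonoid Q" "face Q F" shows "0 \<le> star_dim Q F"
  unfolding star_dim_def using group_rank_mono[OF group_gen_mono[OF min_face_subset[OF assms]]] by simp

lemma star_dim_eq_0_iff:
  fixes Q :: "(int ^ 'n) set"
  assumes "add_submonoid Q" "face Q F"
  shows "star_dim Q F = 0 \<longleftrightarrow> F = min_face Q"
  using face_eq_if_rank_eq[OF assms(1) face_min_face[OF assms(1)] assms(2) min_face_subset[OF assms]]
  by (auto simp: star_dim_def)

section \<open>The normalization\<close>

lemma inner_real_vec: "real_vec w \<bullet> real_vec x = real_of_int (idot w x)"
  by (simp add: real_vec_def idot_def inner_vec_def)

text \<open>A point of the group without a multiple in \<open>Q\<close> is separated from \<open>Q\<close> by an integral
  functional, which also separates it from the real cone.\<close>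
lemma normalization_eq:
  fixes Q :: "(int ^ 'n) set"
  assumes "affine_monoid Q"
  shows "normalization Q = {p \<in> group_gen Q. \<exists>n>0. int n *s p \<in> Q}"
proof (intro equalityI subsetI)
  fix p assume "p \<in> normalization Q"
  then have p: "p \<in> group_gen Q" "real_vec p \<in> convex_cone hull (real_vec ` Q)"
    by (auto simp: normalization_def)
  have "\<exists>n>0. int n *s p \<in> Q"
  proof (rule ccontr)
    assume "\<not> ?thesis"
    from exists_facet_normal[OF assms p(1) this]
    obtain w where w: "facet_normal Q w" "idot w p < 0" by (elim exE conjE)
    have "convex_cone {x. 0 \<le> real_vec w \<bullet> x}"
      by (auto simp: convex_cone_iff inner_add_right intro: exI[of _ 0])
    moreover have "real_vec ` Q \<subseteq> {x. 0 \<le> real_vec w \<bullet> x}"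
      using w(1) by (auto simp: inner_real_vec facet_normal_def)
    ultimately have "convex_cone hull (real_vec ` Q) \<subseteq> {x. 0 \<le> real_vec w \<bullet> x}"
      by (intro hull_minimal)
    then have "0 \<le> real_vec w \<bullet> real_vec p" using p(2) by blast
    then show False using w(2) by (simp add: inner_real_vec)
  qed
  then show "p \<in> {p \<in> group_gen Q. \<exists>n>0. int n *s p \<in> Q}" using p(1) by simp
next
  fix p assume "p \<in> {p \<in> group_gen Q. \<exists>n>0. int n *s p \<in> Q}"
  then obtain n where p: "p \<in> group_gen Q" "n > 0" "int n *s p \<in> Q" by auto
  have "real_vec p = (1 / real n) *\<^sub>R real_vec (int n *s p)"
    using p(2) by (simp add: real_vec_def vec_eq_iff)
  also have "\<dots> \<in> convex_cone hull (real_vec ` Q)"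
    using p(3) by (intro convex_cone_hull_mul hull_inc imageI) auto
  finally show "p \<in> normalization Q" using p(1) by (simp add: normalization_def)
qed

lemma subset_normalization:
  fixes Q :: "(int ^ 'n) set"
  assumes "affine_monoid Q" shows "Q \<subseteq> normalization Q"
proof
  fix x assume "x \<in> Q"
  then have "x \<in> group_gen Q" "int 1 *s x \<in> Q" using subset_group_gen by auto
  then show "x \<in> normalization Q" unfolding normalization_eq[OF assms] by (auto intro: exI[of _ 1])
qed

lemma normalization_add:
  fixes Q :: "(int ^ 'n) set"
  assumes "affine_monoid Q" "p \<in> normalization Q" "q \<in> Q"
  shows "p + q \<in> normalization Q"
proof -
  note Q = affine_submonoid[OF assms(1)]
  obtain n where n: "n > 0" "int n *s p \<in> Q" "p \<in> group_gen Q"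
    using assms(2) unfolding normalization_eq[OF assms(1)] by auto
  have "int n *s (p + q) = int n *s p + int n *s q" by (simp add: vec_eq_iff algebra_simps)
  also have "\<dots> \<in> Q" by (rule submonoid_add[OF Q n(2) submonoid_smult[OF Q assms(3)]])
  finally show ?thesis unfolding normalization_eq[OF assms(1)]
    using n group_gen_add[OF n(3) subsetD[OF subset_group_gen assms(3)]] by auto
qed

lemma finite_int_box: "finite {c :: int ^ 'n. \<forall>i. \<bar>c $ i\<bar> \<le> N}"
proof -
  have "{c :: int ^ 'n. \<forall>i. \<bar>c $ i\<bar> \<le> N} \<subseteq> vec_lambda ` (PiE UNIV (\<lambda>_. {-N..N}))"
  proof
    fix c :: "int ^ 'n" assume "c \<in> {c. \<forall>i. \<bar>c $ i\<bar> \<le> N}"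
    then have "vec_nth c \<in> PiE UNIV (\<lambda>_. {-N..N})" by (auto simp: PiE_UNIV_domain abs_le_iff minus_le_iff)
    then have "vec_lambda (vec_nth c) \<in> vec_lambda ` (PiE UNIV (\<lambda>_. {-N..N}))" by (rule imageI)
    then show "c \<in> vec_lambda ` (PiE UNIV (\<lambda>_. {-N..N}))" by simp
  qed
  moreover have "finite (PiE (UNIV :: 'n set) (\<lambda>_. {-N..N}))" by (intro finite_PiE) auto
  ultimately show ?thesis by (meson finite_imageI finite_subset)
qed

text \<open>Gordan's lemma: splitting off integral parts of the coefficients leaves only the finitely
  many lattice points of a bounded box.\<close>
lemma normalization_finitely_generated:
  fixes Q :: "(int ^ 'n) set"
  assumes "affine_monoid Q"
  obtains C where "finite C" "C \<subseteq> normalization Q" "\<And>p. p \<in> normalization Q \<Longrightarrow> \<exists>c\<in>C. \<exists>q\<in>Q. p = c + q"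
proof -
  note Q = affine_submonoid[OF assms(1)]
  obtain G where G: "finite G" "Q = add_submonoid hull G" using assms affine_monoid_def by blast
  define N where "N = (\<Sum>g\<in>G. \<Sum>i\<in>UNIV. \<bar>g $ i\<bar>)"
  define C where "C = normalization Q \<inter> {c. \<forall>i. \<bar>c $ i\<bar> \<le> N}"
  have "\<exists>c\<in>C. \<exists>q\<in>Q. p = c + q" if "p \<in> normalization Q" for p
  proof -
    have "p \<in> group_gen Q" "\<exists>n>0. int n *s p \<in> Q"
      using \<open>p \<in> normalization Q\<close> unfolding normalization_eq[OF assms(1)] by auto
    then obtain n where n: "n > 0" "int n *s p \<in> Q" "p \<in> group_gen Q" by blast
    then obtain k where k: "int n *s p = (\<Sum>g\<in>G. int (k g) *s g)"
      using hull_finite_repr[OF G(1)] G(2) by auto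
    define q where "q = (\<Sum>g\<in>G. int (k g div n) *s g)"
    define r where "r = (\<Sum>g\<in>G. int (k g mod n) *s g)"
    have q: "q \<in> Q" unfolding q_def G(2)
      by (intro submonoid_sum submonoid_smult add_submonoid_hull hull_inc)
    have rQ: "r \<in> Q" unfolding r_def G(2)
      by (intro submonoid_sum submonoid_smult add_submonoid_hull hull_inc)
    have eq: "int (k g) = int n * int (k g div n) + int (k g mod n)" for g
      by (metis div_mult_mod_eq mult.commute of_nat_add of_nat_mult)
    have "int n *s q + r = (\<Sum>g\<in>G. (int n * int (k g div n) + int (k g mod n)) *s g)"
      by (simp only: q_def r_def intvec.scale_sum_right vector_smult_assoc sum.distrib[symmetric]
          vector_sadd_rdistrib[symmetric])
    then have "int n *s p = int n *s q + r" by (simp only: k eq[symmetric])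
    then have r: "int n *s (p - q) = r" by (simp add: vec_eq_iff algebra_simps)
    have "\<bar>(p - q) $ i\<bar> \<le> N" for i
    proof -
      have "int n * \<bar>(p - q) $ i\<bar> = \<bar>(int n *s (p - q)) $ i\<bar>"
        unfolding vector_smult_component by (simp add: abs_mult)
      also have "\<dots> \<le> (\<Sum>g\<in>G. int (k g mod n) * \<bar>g $ i\<bar>)"
        unfolding r r_def by (auto simp: sum_component abs_mult intro: order_trans[OF sum_abs])
      also have "\<dots> \<le> (\<Sum>g\<in>G. int n * (\<Sum>i\<in>UNIV. \<bar>g $ i\<bar>))"
      proof (rule sum_mono)
        fix g assume "g \<in> G"
        have "\<bar>g $ i\<bar> \<le> (\<Sum>i\<in>UNIV. \<bar>g $ i\<bar>)" by (rule member_le_sum) auto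
        moreover have "int (k g mod n) \<le> int n" using n(1) by (simp add: less_imp_le)
        ultimately show "int (k g mod n) * \<bar>g $ i\<bar> \<le> int n * (\<Sum>i\<in>UNIV. \<bar>g $ i\<bar>)"
          by (intro mult_mono) auto
      qed
      also have "\<dots> = int n * N" by (simp add: N_def sum_distrib_left)
      finally show ?thesis using n(1) by simp
    qed
    moreover have "p - q \<in> normalization Q" unfolding normalization_eq[OF assms(1)]
      using n(1,3) r rQ q group_gen_diff[OF n(3) subsetD[OF subset_group_gen q]] by auto
    ultimately have "p - q \<in> C" by (simp add: C_def)
    then show ?thesis using q by (intro bexI[of _ "p - q"] bexI[of _ q]) auto
  qed
  moreover have "finite C" unfolding C_def using finite_int_box by (rule finite_Int[OF disjI2])
  ultimately show ?thesis using that[of C] by (auto simp: C_def)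
qed

section \<open>Ascending chains of ideals of a monoid\<close>

lemma nat_seq_mono_subseq: "\<exists>f :: nat \<Rightarrow> nat. strict_mono f \<and> mono (\<lambda>i. (s :: nat \<Rightarrow> nat) (f i))"
proof -
  obtain f :: "nat \<Rightarrow> nat" where f: "strict_mono f" "monoseq (\<lambda>n. s (f n))" using seq_monosub[of s] by blast
  show ?thesis
  proof (cases "\<forall>m. \<forall>n\<ge>m. s (f m) \<le> s (f n)")
    case True
    then show ?thesis using f(1) by (intro exI[of _ f]) (auto simp: mono_def)
  next
    case False
    then have dec: "\<forall>m. \<forall>n\<ge>m. s (f n) \<le> s (f m)" using f(2) unfolding monoseq_def by blast
    obtain m where m: "\<And>n. s (f m) \<le> s (f n)"
      using ex_has_least_nat[of "\<lambda>_. True" 0 "\<lambda>i. s (f i)"] by blast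
    have "s (f (m + i)) = s (f m)" for i using dec m[of "m + i"] by (simp add: order_antisym)
    moreover have "strict_mono (\<lambda>i. f (m + i))" using f(1) by (auto simp: strict_mono_def)
    ultimately show ?thesis by (intro exI[of _ "\<lambda>i. f (m + i)"]) (auto simp: mono_def)
  qed
qed

text \<open>Dickson's lemma.\<close>
lemma dickson_subseq:
  fixes k :: "nat \<Rightarrow> 'a \<Rightarrow> nat"
  assumes "finite G"
  shows "\<exists>r :: nat \<Rightarrow> nat. strict_mono r \<and> (\<forall>g\<in>G. mono (\<lambda>i. k (r i) g))"
  using assms
proof (induction G rule: finite_induct)
  case empty
  then show ?case by (intro exI[of _ id]) (auto simp: strict_mono_def)
next
  case (insert h G)
  then obtain r :: "nat \<Rightarrow> nat" where r: "strict_mono r" "\<forall>g\<in>G. mono (\<lambda>i. k (r i) g)" by blast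
  obtain f :: "nat \<Rightarrow> nat" where f: "strict_mono f" "mono (\<lambda>i. k (r (f i)) h)"
    using nat_seq_mono_subseq[of "\<lambda>i. k (r i) h"] by blast
  have "strict_mono (r \<circ> f)" using r(1) f(1) by (rule strict_mono_o)
  moreover have "\<forall>g\<in>insert h G. mono (\<lambda>i. k ((r \<circ> f) i) g)"
    using r(2) f by (auto simp: mono_def strict_mono_less_eq)
  ultimately show ?case by blast
qed

definition monoid_ideal :: "(int ^ 'n) set \<Rightarrow> (int ^ 'n) set \<Rightarrow> bool" where
  "monoid_ideal Q I \<longleftrightarrow> I \<subseteq> Q \<and> (\<forall>x\<in>I. \<forall>q\<in>Q. x + q \<in> I)"

text \<open>Monoid ideals satisfy the ascending chain condition: from a strictly ascending chain choose
  elements that are new at each step, and write them in the generators; Dickson's lemma finds two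
  of them whose difference lies in \<open>Q\<close>.\<close>
lemma monoid_ideal_maximal:
  fixes Q :: "(int ^ 'n) set"
  assumes "affine_monoid Q" "I0 \<in> \<I>" "\<And>I. I \<in> \<I> \<Longrightarrow> monoid_ideal Q I"
  shows "\<exists>M. M \<in> \<I> \<and> (\<forall>I. I \<in> \<I> \<longrightarrow> M \<subseteq> I \<longrightarrow> I = M)"
proof (rule ccontr)
  assume contra: "\<not> ?thesis"
  have step: "\<exists>J. J \<in> \<I> \<and> I \<subset> J" if "I \<in> \<I>" for I using contra that by blast
  have "\<exists>f. \<forall>n. f n \<in> \<I> \<and> f n \<subset> f (Suc n)"
    by (rule dependent_nat_choice[of "\<lambda>_ I. I \<in> \<I>" "\<lambda>_ I J. I \<subset> J"]) (use assms(2) step in auto)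
  then obtain f where "\<forall>n. f n \<in> \<I> \<and> f n \<subset> f (Suc n)" by (elim exE)
  then have f: "\<And>n. f n \<in> \<I>" "\<And>n. f n \<subset> f (Suc n)" by simp_all
  obtain G where G: "finite G" "Q = add_submonoid hull G" using assms affine_monoid_def by blast
  have "\<forall>n. \<exists>x. x \<in> f (Suc n) - f n" using f(2) by blast
  then obtain x where "\<forall>n. x n \<in> f (Suc n) - f n" unfolding choice_iff by (elim exE)
  then have x: "\<And>n. x n \<in> f (Suc n) - f n" by blast
  have "x n \<in> Q" for n using x[of n] assms(3)[OF f(1)] by (auto simp: monoid_ideal_def)
  then have "\<forall>n. \<exists>k. x n = (\<Sum>g\<in>G. int (k g) *s g)" using hull_finite_repr[OF G(1)] G(2) by auto
  then obtain k where k: "\<And>n. x n = (\<Sum>g\<in>G. int (k n g) *s g)" by metis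
  obtain r :: "nat \<Rightarrow> nat" where r: "strict_mono r" "\<forall>g\<in>G. mono (\<lambda>i. k (r i) g)" using dickson_subseq[OF G(1)] by blast
  define y where "y = (\<Sum>g\<in>G. int (k (r 1) g - k (r 0) g) *s g)"
  have le: "k (r 0) g \<le> k (r 1) g" if "g \<in> G" for g using r(2) that by (auto simp: mono_def)
  have "x (r 1) = x (r 0) + y"
    unfolding k y_def sum.distrib[symmetric]
  proof (rule sum.cong[OF refl])
    fix g assume "g \<in> G"
    then have "int (k (r 1) g) = int (k (r 0) g) + int (k (r 1) g - k (r 0) g)" using le by simp
    then show "int (k (r 1) g) *s g = int (k (r 0) g) *s g + int (k (r 1) g - k (r 0) g) *s g"
      by (simp only: vector_sadd_rdistrib)
  qed
  moreover have "y \<in> Q" unfolding G(2) y_def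
    by (intro submonoid_sum submonoid_smult add_submonoid_hull hull_inc)
  moreover have "x (r 0) \<in> f (Suc (r 0))" using x by blast
  ultimately have "x (r 1) \<in> f (Suc (r 0))" using assms(3)[OF f(1)] unfolding monoid_ideal_def by metis
  moreover have "f (Suc (r 0)) \<subseteq> f (r 1)"
  proof (rule lift_Suc_mono_le)
    show "f n \<subseteq> f (Suc n)" for n using f(2) by blast
    show "Suc (r 0) \<le> r 1" using r(1) by (simp add: strict_mono_def Suc_leI)
  qed
  ultimately show False using x[of "r 1"] by blast
qed

text \<open>The combinatorial form of the existence of associated primes: if the ideal
  \<open>{q. p + s + q \<in> T}\<close> is maximal among all such ideals, it is prime, and its complement is a face.\<close>
lemma exists_face_colon:
  fixes Q :: "(int ^ 'n) set"
  assumes "affine_monoid Q" "\<And>t q. t \<in> T \<Longrightarrow> q \<in> Q \<Longrightarrow> t + q \<in> T" "p \<notin> T"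
  obtains s where "s \<in> Q" "p + s \<notin> T" "face Q {q\<in>Q. p + s + q \<notin> T}"
proof -
  note Q = affine_submonoid[OF assms(1)]
  define col where "col x = {q\<in>Q. x + q \<in> T}" for x
  define \<I> where "\<I> = {col (p + s) | s. s \<in> Q \<and> p + s \<notin> T}"
  have "col (p + 0) \<in> \<I>" unfolding \<I>_def using submonoid_zero[OF Q] assms(3) by force
  moreover have "monoid_ideal Q I" if "I \<in> \<I>" for I
    using that assms(2) submonoid_add[OF Q]
    by (auto simp: monoid_ideal_def \<I>_def col_def add.assoc[symmetric])
  ultimately obtain M where M: "M \<in> \<I>" "\<And>I. I \<in> \<I> \<Longrightarrow> M \<subseteq> I \<Longrightarrow> I = M"
    using monoid_ideal_maximal[OF assms(1), of "col (p + 0)" \<I>] by auto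
  then obtain s where s: "M = col (p + s)" "s \<in> Q" "p + s \<notin> T" by (auto simp: \<I>_def)
  have "face Q {q\<in>Q. p + s + q \<notin> T}" unfolding face_def
  proof (intro conjI ballI iffI)
    show "{q \<in> Q. p + s + q \<notin> T} \<noteq> {}" using submonoid_zero[OF Q] s(3) by force
  next
    fix a b assume ab: "a \<in> Q" "b \<in> Q" "a + b \<in> {q \<in> Q. p + s + q \<notin> T}"
    then show "a \<in> {q \<in> Q. p + s + q \<notin> T}" "b \<in> {q \<in> Q. p + s + q \<notin> T}"
      using assms(2)[of "p + s + a" b] assms(2)[of "p + s + b" a] by (auto simp: ac_simps)
  next
    fix a b assume ab: "a \<in> Q" "b \<in> Q" "a \<in> {q \<in> Q. p + s + q \<notin> T} \<and> b \<in> {q \<in> Q. p + s + q \<notin> T}"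
    have "col (p + (s + a)) \<in> \<I>"
      unfolding \<I>_def using ab submonoid_add[OF Q s(2), of a]
      by (intro CollectI exI[of _ "s + a"]) (auto simp: add.assoc[symmetric])
    moreover have "M \<subseteq> col (p + (s + a))"
      using assms(2) ab(1) by (fastforce simp: s(1) col_def ac_simps)
    ultimately have "col (p + (s + a)) = M" by (rule M(2))
    then show "a + b \<in> {q \<in> Q. p + s + q \<notin> T}"
      using ab submonoid_add[OF Q] by (auto simp: s(1) col_def add.assoc)
  qed auto
  then show ?thesis using that s by blast
qed

text \<open>Noetherian induction: a maximal counterexample \<open>M\<close> becomes decomposable after adjoining the
  ideal generated by a point whose colon ideal is the complement of a face \<open>F\<close>, and this adds just
  one translate of \<open>F\<close>.\<close>
lemma ideal_complement_decomposition:
  fixes Q :: "(int ^ 'n) set"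
  assumes "affine_monoid Q" "monoid_ideal Q I"
  shows "\<exists>\<S>. finite \<S> \<and> (\<forall>(s, F)\<in>\<S>. s \<in> Q \<and> face Q F) \<and> Q - I = (\<Union>(s, F)\<in>\<S>. (+) s ` F)"
proof (rule ccontr)
  assume *: "\<not> ?thesis"
  note Q = affine_submonoid[OF assms(1)]
  define dec where "dec I \<longleftrightarrow> (\<exists>\<S>. finite \<S> \<and> (\<forall>(s, F)\<in>\<S>. s \<in> Q \<and> face Q F) \<and>
    Q - I = (\<Union>(s, F)\<in>\<S>. (+) s ` F))" for I
  define \<I> where "\<I> = {I. monoid_ideal Q I \<and> \<not> dec I}"
  have "I \<in> \<I>" using * assms(2) by (simp add: dec_def \<I>_def)
  moreover have "\<And>J. J \<in> \<I> \<Longrightarrow> monoid_ideal Q J" by (simp add: \<I>_def)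
  ultimately have "\<exists>M. M \<in> \<I> \<and> (\<forall>I. I \<in> \<I> \<longrightarrow> M \<subseteq> I \<longrightarrow> I = M)"
    by (rule monoid_ideal_maximal[OF assms(1)])
  then obtain M where "M \<in> \<I> \<and> (\<forall>I. I \<in> \<I> \<longrightarrow> M \<subseteq> I \<longrightarrow> I = M)" by (elim exE)
  then have M: "M \<in> {I. monoid_ideal Q I \<and> \<not> dec I}"
    "\<And>I. monoid_ideal Q I \<Longrightarrow> \<not> dec I \<Longrightarrow> M \<subseteq> I \<Longrightarrow> I = M"
    unfolding \<I>_def mem_Collect_eq by simp_all
  have M_add: "\<And>t q. t \<in> M \<Longrightarrow> q \<in> Q \<Longrightarrow> t + q \<in> M" and MQ: "M \<subseteq> Q"
    using M(1) by (auto simp: monoid_ideal_def)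
  have "dec Q" unfolding dec_def by (intro exI[of _ "{}"]) auto
  then obtain t where t: "t \<in> Q" "t \<notin> M" using M(1) MQ by (metis (mono_tags) mem_Collect_eq subsetI subset_antisym)
  obtain s where s: "s \<in> Q" "t + s \<notin> M" "face Q {q\<in>Q. t + s + q \<notin> M}"
    using exists_face_colon[OF assms(1) M_add t(2)] by blast
  let ?F = "{q\<in>Q. t + s + q \<notin> M}"
  let ?J = "M \<union> (+) (t + s) ` Q"
  have ts: "t + s \<in> Q" by (rule submonoid_add[OF Q t(1) s(1)])
  have "monoid_ideal Q ?J" unfolding monoid_ideal_def
  proof (intro conjI ballI)
    show "?J \<subseteq> Q" using MQ submonoid_add[OF Q ts] by auto
    fix x q assume "x \<in> ?J" "q \<in> Q"
    then show "x + q \<in> ?J" using M_add submonoid_add[OF Q] by (auto simp: add.assoc)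
  qed
  moreover have "?J \<noteq> M" using s(2) submonoid_zero[OF Q] by force
  ultimately have "dec ?J" using M(2)[of ?J] by blast
  then obtain \<S> where S: "finite \<S>" "\<forall>(s, F)\<in>\<S>. s \<in> Q \<and> face Q F" "Q - ?J = (\<Union>(s, F)\<in>\<S>. (+) s ` F)"
    unfolding dec_def by blast
  have "Q - M = (Q - ?J) \<union> (+) (t + s) ` ?F" using submonoid_add[OF Q ts] by auto
  also have "\<dots> = (\<Union>(s, F)\<in>insert (t + s, ?F) \<S>. (+) s ` F)" unfolding S(3) by auto
  finally have "dec M" unfolding dec_def using S(1,2) ts s(3)
    by (intro exI[of _ "insert (t + s, ?F) \<S>"]) auto
  then show False using M(1) by simp
qed

section \<open>Families of holes\<close>

definition hole_coset :: "(int ^ 'n) set \<Rightarrow> (int ^ 'n) set \<Rightarrow> bool" where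
  "hole_coset Q A \<longleftrightarrow> (\<exists>q F. q \<in> normalization Q \<and> face Q F \<and> A = (+) q ` group_gen F \<and> A \<inter> Q = {})"

lemma coset_eq:
  assumes "x \<in> (+) q ` group_gen (F :: (int ^ 'n) set)"
  shows "(+) q ` group_gen F = (+) x ` group_gen F"
proof -
  obtain h where h: "x = q + h" "h \<in> group_gen F" using assms by auto
  show ?thesis
  proof (intro equalityI subsetI)
    fix y assume "y \<in> (+) q ` group_gen F"
    then obtain g where "y = q + g" "g \<in> group_gen F" by auto
    then have "y = x + (g - h)" "g - h \<in> group_gen F" using h group_gen_diff by auto
    then show "y \<in> (+) x ` group_gen F" by blast
  next
    fix y assume "y \<in> (+) x ` group_gen F"
    then obtain g where "y = x + g" "g \<in> group_gen F" by auto
    then have "y = q + (h + g)" "h + g \<in> group_gen F" using h group_gen_add by (auto simp: add.assoc)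
    then show "y \<in> (+) q ` group_gen F" by blast
  qed
qed

lemma coset_subset_imp_face_subset:
  assumes "add_submonoid (Q :: (int ^ 'n) set)" "face Q F" "face Q F'"
    "(+) q ` group_gen F \<subseteq> (+) q' ` group_gen F'"
  shows "F \<subseteq> F'"
proof -
  have "q \<in> (+) q' ` group_gen F'" using assms(4) group_gen_zero[of F] by force
  then have "(+) q ` group_gen F \<subseteq> (+) q ` group_gen F'" using coset_eq assms(4) by metis
  then have "group_gen F \<subseteq> group_gen F'" by auto
  then show ?thesis by (rule face_group_gen_inject[OF assms(1-3)])
qed

text \<open>A finite cover of a coset by cosets contains it in one member: two of the points
  \<open>q + n f\<close>, with \<open>f\<close> in the interior of \<open>F\<close>, lie in the same member.\<close>
lemma coset_finite_cover:
  fixes Q :: "(int ^ 'n) set"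
  assumes Q: "affine_monoid Q" and "q \<in> normalization Q" "face Q F" "finite \<A>"
    "\<And>A. A \<in> \<A> \<Longrightarrow> \<exists>q F. face Q F \<and> A = (+) q ` group_gen F"
    "(+) q ` group_gen F \<inter> normalization Q \<subseteq> \<Union>\<A>"
  obtains A where "A \<in> \<A>" "(+) q ` group_gen F \<subseteq> A"
proof -
  note Q' = affine_submonoid[OF Q]
  obtain f where f: "f \<in> F" "\<And>F'. face Q F' \<Longrightarrow> f \<in> F' \<Longrightarrow> F \<subseteq> F'"
    using face_interior[OF Q assms(3)] by blast
  have fQ: "f \<in> Q" using f(1) faceD(1)[OF assms(3)] by blast
  have "q + int n *s f \<in> \<Union>\<A>" for n
  proof -
    have "int n *s f \<in> group_gen F" using f(1) subset_group_gen by (intro group_gen_smult) auto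
    moreover have "q + int n *s f \<in> normalization Q"
      by (rule normalization_add[OF Q assms(2) submonoid_smult[OF Q' fQ]])
    ultimately show ?thesis using assms(6) by blast
  qed
  then have "\<forall>n. \<exists>A. A \<in> \<A> \<and> q + int n *s f \<in> A" by blast
  then obtain h where h: "\<And>n. h n \<in> \<A>" "\<And>n. q + int n *s f \<in> h n" by metis
  have "finite (h ` UNIV)" using h(1) assms(4) by (meson finite_subset image_subsetI)
  then obtain n0 where inf: "infinite {n \<in> UNIV. h n = h n0}"
    using pigeonhole_infinite[of "UNIV :: nat set" h] by auto
  then obtain m where "m > n0" "h m = h n0" unfolding infinite_nat_iff_unbounded by blast
  then obtain n where nm: "h n = h n0" "h m = h n0" "n < m" by blast
  obtain q' F' where A: "face Q F'" "h n0 = (+) q' ` group_gen F'" using assms(5)[OF h(1)] by blast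
  obtain a where a: "q + int n *s f = q' + a" "a \<in> group_gen F'" using h(2)[of n] nm(1) A(2) by auto
  obtain b where b: "q + int m *s f = q' + b" "b \<in> group_gen F'" using h(2)[of m] nm(2) A(2) by auto
  have "int (m - n) *s f = (q + int m *s f) - (q + int n *s f)"
    using nm(3) by (simp add: of_nat_diff vec_eq_iff algebra_simps)
  also have "\<dots> = b - a" using a b by simp
  finally have "int (m - n) *s f \<in> group_gen F'" using group_gen_diff a b by metis
  then have "int (m - n) *s f \<in> F'"
    by (rule face_Int_group_gen[OF Q' A(1) submonoid_smult[OF Q' fQ]])
  from face_smult[OF Q' A(1) fQ this] have fF': "f \<in> F'" using nm(3) by simp
  then have "group_gen F \<subseteq> group_gen F'" by (intro group_gen_mono f(2) A(1))
  moreover have "q \<in> (+) q' ` group_gen F'"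
  proof -
    have "q = q' + (a - int n *s f)" using a(1) by (simp add: algebra_simps)
    moreover have "int n *s f \<in> group_gen F'" using fF' subset_group_gen by (intro group_gen_smult) auto
    ultimately show ?thesis using group_gen_diff[OF a(2)] by blast
  qed
  ultimately have "(+) q ` group_gen F \<subseteq> h n0" unfolding A(2) using coset_eq[of q q' F'] by auto
  then show ?thesis using that h(1) by blast
qed

text \<open>The normalization is the union of finitely many \<open>c + Q\<close>. In each of them the holes correspond to
  the complement of a monoid ideal of \<open>Q\<close>, hence to finitely many translates of faces.\<close>
lemma finite_hole_cover:
  fixes Q :: "(int ^ 'n) set"
  assumes Q: "affine_monoid Q"
  shows "\<exists>\<B>. finite \<B> \<and> (\<forall>B\<in>\<B>. hole_coset Q B) \<and> normalization Q - Q \<subseteq> \<Union>\<B>"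
proof -
  note Q' = affine_submonoid[OF Q]
  obtain C where C: "finite C" "C \<subseteq> normalization Q"
    "\<And>p. p \<in> normalization Q \<Longrightarrow> \<exists>c\<in>C. \<exists>q\<in>Q. p = c + q"
    using normalization_finitely_generated[OF Q] by blast
  have "\<exists>\<B>. finite \<B> \<and> (\<forall>B\<in>\<B>. hole_coset Q B) \<and> ((+) c ` Q) - Q \<subseteq> \<Union>\<B>" if c: "c \<in> C" for c
  proof -
    define I where "I = {q\<in>Q. c + q \<in> Q}"
    have "monoid_ideal Q I"
      unfolding monoid_ideal_def I_def using submonoid_add[OF Q'] by (auto simp: add.assoc[symmetric])
    from ideal_complement_decomposition[OF Q this]
    obtain \<S> where S: "finite \<S>" "\<forall>(s, F)\<in>\<S>. s \<in> Q \<and> face Q F" "Q - I = (\<Union>(s, F)\<in>\<S>. (+) s ` F)"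
      by blast
    let ?B = "(\<lambda>(s, F). (+) (c + s) ` group_gen F) ` \<S>"
    have "hole_coset Q ((+) (c + s) ` group_gen F)" if "(s, F) \<in> \<S>" for s F
    proof -
      have sF: "s \<in> Q" "face Q F" using S(2) that by auto
      have "c + s \<notin> face_localization Q F"
      proof
        assume "c + s \<in> face_localization Q F"
        then obtain f where "f \<in> F" "c + s + f \<in> Q" using in_face_localization_iff[OF Q' sF(2)] by blast
        then have "s + f \<in> I" using sF faceD(1)[OF sF(2)] submonoid_add[OF Q'] by (auto simp: I_def add.assoc)
        moreover have "s + f \<in> Q - I" unfolding S(3) using that \<open>f \<in> F\<close> by force
        ultimately show False by blast
      qed
      then have "(+) (c + s) ` group_gen F \<inter> Q = {}" using coset_disjoint_iff[OF Q' sF(2)] by blast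
      moreover have "c + s \<in> normalization Q" using normalization_add[OF Q _ sF(1)] C(2) c by blast
      ultimately show ?thesis unfolding hole_coset_def using sF(2) by blast
    qed
    then have "\<forall>B\<in>?B. hole_coset Q B" by auto
    moreover have "((+) c ` Q) - Q \<subseteq> \<Union>?B"
    proof
      fix x assume "x \<in> ((+) c ` Q) - Q"
      then obtain q where q: "x = c + q" "q \<in> Q - I" by (auto simp: I_def)
      then obtain s F f where "(s, F) \<in> \<S>" "q = s + f" "f \<in> F" unfolding S(3) by auto
      then show "x \<in> \<Union>?B" using q(1) subset_group_gen[of F] by (force simp: add.assoc)
    qed
    ultimately show ?thesis using S(1) by (intro exI[of _ ?B]) auto
  qed
  then obtain \<B> where B: "\<And>c. c \<in> C \<Longrightarrow> finite (\<B> c) \<and> (\<forall>B\<in>\<B> c. hole_coset Q B) \<and> ((+) c ` Q) - Q \<subseteq> \<Union>(\<B> c)"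
    by metis
  have "normalization Q - Q \<subseteq> \<Union>(\<Union>(\<B> ` C))"
  proof
    fix x assume x: "x \<in> normalization Q - Q"
    then obtain c q where "c \<in> C" "q \<in> Q" "x = c + q" using C(3) by blast
    then show "x \<in> \<Union>(\<Union>(\<B> ` C))" using B[of c] x by blast
  qed
  then show ?thesis using B C(1) by (intro exI[of _ "\<Union>(\<B> ` C)"]) auto
qed

text \<open>Keep the maximal cosets of a finite cover. None of these is redundant, because a coset covered
  by others is contained in one of them.\<close>
lemma hole_decomposition_exists:
  fixes Q :: "(int ^ 'n) set"
  assumes Q: "affine_monoid Q"
  shows "\<exists>\<A>. hole_decomposition Q \<A>"
proof -
  obtain \<B> where B: "finite \<B>" "\<forall>B\<in>\<B>. hole_coset Q B" "normalization Q - Q \<subseteq> \<Union>\<B>"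
    using finite_hole_cover[OF Q] by blast
  define \<A> where "\<A> = {A\<in>\<B>. \<forall>B\<in>\<B>. A \<subseteq> B \<longrightarrow> A = B}"
  have finA: "finite \<A>" using B(1) by (simp add: \<A>_def)
  have hcA: "hole_coset Q A" if "A \<in> \<A>" for A using that B(2) by (auto simp: \<A>_def)
  have un: "(\<Union>A\<in>\<A>. A \<inter> normalization Q) = normalization Q - Q"
  proof
    show "(\<Union>A\<in>\<A>. A \<inter> normalization Q) \<subseteq> normalization Q - Q"
      using hcA unfolding hole_coset_def by blast
    show "normalization Q - Q \<subseteq> (\<Union>A\<in>\<A>. A \<inter> normalization Q)"
    proof
      fix x assume x: "x \<in> normalization Q - Q"
      then obtain B where "B \<in> \<B>" "x \<in> B" using B(3) by blast
      then obtain m where "m \<in> \<B>" "B \<subseteq> m" "\<forall>b\<in>\<B>. m \<subseteq> b \<longrightarrow> m = b"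
        using finite_has_maximal2[OF B(1)] by metis
      then show "x \<in> (\<Union>A\<in>\<A>. A \<inter> normalization Q)" using x \<open>x \<in> B\<close> by (auto simp: \<A>_def)
    qed
  qed
  have "(\<Union>B\<in>\<A> - {A}. B \<inter> normalization Q) \<noteq> normalization Q - Q" if A: "A \<in> \<A>" for A
  proof
    assume eq: "(\<Union>B\<in>\<A> - {A}. B \<inter> normalization Q) = normalization Q - Q"
    obtain q F where qF: "q \<in> normalization Q" "face Q F" "A = (+) q ` group_gen F" "A \<inter> Q = {}"
      using hcA[OF A] unfolding hole_coset_def by blast
    have sub: "(+) q ` group_gen F \<inter> normalization Q \<subseteq> \<Union>(\<A> - {A})"
    proof -
      have "(+) q ` group_gen F \<inter> normalization Q \<subseteq> normalization Q - Q" using qF by blast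
      also have "\<dots> \<subseteq> \<Union>(\<A> - {A})" unfolding eq[symmetric] by blast
      finally show ?thesis .
    qed
    have cos: "\<exists>q F. face Q F \<and> B = (+) q ` group_gen F" if "B \<in> \<A> - {A}" for B
    proof -
      have "hole_coset Q B" using that hcA by blast
      then show ?thesis unfolding hole_coset_def by blast
    qed
    have "finite (\<A> - {A})" using finA by simp
    from coset_finite_cover[OF Q qF(1,2) this cos sub]
    obtain B where "B \<in> \<A> - {A}" "A \<subseteq> B" unfolding qF(3) .
    then show False using A by (auto simp: \<A>_def)
  qed
  note irr = this
  have "\<exists>q F. q \<in> normalization Q \<and> face Q F \<and> A = (+) q ` group_gen F" if "A \<in> \<A>" for A
    using hcA[OF that] unfolding hole_coset_def by blast
  then have "hole_decomposition Q \<A>" unfolding hole_decomposition_def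
    using finA un irr by simp
  then show ?thesis by blast
qed

lemma hole_decomposition_cosets:
  assumes "affine_monoid Q" "hole_decomposition Q \<A>" "A \<in> \<A>"
  shows "hole_coset Q A"
proof -
  have cos: "\<forall>A\<in>\<A>. \<exists>q F. q \<in> normalization Q \<and> face Q F \<and> A = (+) q ` group_gen F"
    and un: "(\<Union>A\<in>\<A>. A \<inter> normalization Q) = normalization Q - Q"
    using assms(2) unfolding hole_decomposition_def by simp_all
  obtain q F where qF: "q \<in> normalization Q" "face Q F" "A = (+) q ` group_gen F"
    using bspec[OF cos assms(3)] by (elim exE conjE)
  have "A \<inter> normalization Q \<subseteq> normalization Q - Q"
    unfolding un[symmetric] using assms(3) by blast
  then have "A \<inter> Q = {}" using subset_normalization[OF assms(1)] by blast
  then show ?thesis unfolding hole_coset_def using qF by blast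
qed

text \<open>Any coset avoiding \<open>Q\<close> is covered by the finitely many members of a decomposition, hence
  contained in one of them.\<close>
lemma family_of_holes_iff:
  fixes Q :: "(int ^ 'n) set"
  assumes Q: "affine_monoid Q"
  shows "family_of_holes Q A \<longleftrightarrow> hole_coset Q A \<and> (\<forall>B. hole_coset Q B \<longrightarrow> A \<subseteq> B \<longrightarrow> B = A)"
    and hole_coset_in_family: "hole_coset Q B \<Longrightarrow> \<exists>A. family_of_holes Q A \<and> B \<subseteq> A"
proof -
  have cover: "\<exists>A\<in>\<A>. B \<subseteq> A" if dec: "hole_decomposition Q \<A>" and B: "hole_coset Q B" for \<A> B
  proof -
    obtain q F where qF: "q \<in> normalization Q" "face Q F" "B = (+) q ` group_gen F" "B \<inter> Q = {}"
      using B unfolding hole_coset_def by blast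
    have fin: "finite \<A>" and un: "(\<Union>A\<in>\<A>. A \<inter> normalization Q) = normalization Q - Q"
      using dec by (auto simp: hole_decomposition_def)
    have cos: "\<exists>q F. face Q F \<and> A = (+) q ` group_gen F" if "A \<in> \<A>" for A
      using hole_decomposition_cosets[OF Q dec that] unfolding hole_coset_def by blast
    have "(+) q ` group_gen F \<inter> normalization Q \<subseteq> normalization Q - Q" using qF by blast
    also have "\<dots> \<subseteq> \<Union>\<A>" unfolding un[symmetric] by blast
    finally have "(+) q ` group_gen F \<inter> normalization Q \<subseteq> \<Union>\<A>" .
    from coset_finite_cover[OF Q qF(1,2) fin cos this] obtain A where "A \<in> \<A>" "B \<subseteq> A"
      unfolding qF(3) .
    then show ?thesis ..
  qed
  show "\<exists>A. family_of_holes Q A \<and> B \<subseteq> A" if "hole_coset Q B"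
    using hole_decomposition_exists[OF Q] cover[OF _ that] unfolding family_of_holes_def by blast
  show "family_of_holes Q A \<longleftrightarrow> hole_coset Q A \<and> (\<forall>B. hole_coset Q B \<longrightarrow> A \<subseteq> B \<longrightarrow> B = A)"
  proof
    assume "family_of_holes Q A"
    then obtain \<A> where A: "hole_decomposition Q \<A>" "A \<in> \<A>" unfolding family_of_holes_def by blast
    have "B = A" if B: "hole_coset Q B" "A \<subseteq> B" for B
    proof -
      obtain C where C: "C \<in> \<A>" "B \<subseteq> C" using cover[OF A(1) B(1)] by blast
      have "C = A"
      proof (rule ccontr)
        assume "C \<noteq> A"
        then have "(\<Union>B\<in>\<A> - {A}. B \<inter> normalization Q) = (\<Union>B\<in>\<A>. B \<inter> normalization Q)"
          using C B(2) A(2) by blast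
        moreover have "(\<Union>B\<in>\<A> - {A}. B \<inter> normalization Q) \<noteq> normalization Q - Q"
          "(\<Union>B\<in>\<A>. B \<inter> normalization Q) = normalization Q - Q"
          using A unfolding hole_decomposition_def by simp_all
        ultimately show False by simp
      qed
      then show ?thesis using C B by blast
    qed
    then show "hole_coset Q A \<and> (\<forall>B. hole_coset Q B \<longrightarrow> A \<subseteq> B \<longrightarrow> B = A)"
      using hole_decomposition_cosets[OF Q A] by blast
  next
    assume A: "hole_coset Q A \<and> (\<forall>B. hole_coset Q B \<longrightarrow> A \<subseteq> B \<longrightarrow> B = A)"
    obtain \<A> where dec: "hole_decomposition Q \<A>" using hole_decomposition_exists[OF Q] by blast
    obtain C where C: "C \<in> \<A>" "A \<subseteq> C" using cover[OF dec conjunct1[OF A]] by (elim bexE)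
    have "C = A" using A hole_decomposition_cosets[OF Q dec C(1)] C(2) by simp
    then show "family_of_holes Q A" unfolding family_of_holes_def using dec C(1) by (intro exI) simp
  qed
qed

lemma hole_cosetI:
  fixes Q :: "(int ^ 'n) set"
  assumes "affine_monoid Q" "face Q F" "q \<in> normalization Q" "q \<notin> face_localization Q F"
  shows "hole_coset Q ((+) q ` group_gen F)"
  unfolding hole_coset_def
  using assms coset_disjoint_iff[OF affine_submonoid[OF assms(1)] assms(2), of q] by blast

lemma generator_outside_face:
  fixes Q :: "(int ^ 'n) set"
  assumes "Q = add_submonoid hull G" "face Q F" "x \<in> Q" "x \<notin> F"
  shows "\<exists>g\<in>G - F. \<exists>y\<in>Q. x = g + y"
proof -
  have Q: "add_submonoid Q" using assms(1) add_submonoid_hull by auto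
  have GQ: "G \<subseteq> Q" using assms(1) by (simp add: hull_subset)
  let ?P = "{x\<in>Q. x \<in> F \<or> (\<exists>g\<in>G - F. \<exists>y\<in>Q. x = g + y)}"
  have "add_submonoid hull G \<subseteq> ?P"
  proof (rule hull_minimal)
    show "G \<subseteq> ?P" using GQ submonoid_zero[OF Q] by force
    show "add_submonoid ?P" unfolding add_submonoid_def
    proof (intro conjI ballI)
      show "0 \<in> ?P" using submonoid_zero[OF Q] submonoid_zero[OF face_submonoid[OF Q assms(2)]] by simp
      fix a b assume ab: "a \<in> ?P" "b \<in> ?P"
      then have abQ: "a \<in> Q" "b \<in> Q" by auto
      have "a + b \<in> F \<or> (\<exists>g\<in>G - F. \<exists>y\<in>Q. a + b = g + y)"
      proof (cases "a \<in> F \<and> b \<in> F")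
        case True
        then show ?thesis using faceD(4)[OF assms(2)] by blast
      next
        case False
        then consider g y where "g \<in> G - F" "y \<in> Q" "a = g + y" | g y where "g \<in> G - F" "y \<in> Q" "b = g + y"
          using ab by blast
        then show ?thesis
        proof cases
          case 1
          then have "a + b = g + (y + b)" "y + b \<in> Q" using submonoid_add[OF Q] abQ by (auto simp: add.assoc)
          then show ?thesis using 1 by blast
        next
          case 2
          then have "a + b = g + (y + a)" "y + a \<in> Q" using submonoid_add[OF Q] abQ by (auto simp: ac_simps)
          then show ?thesis using 2 by blast
        qed
      qed
      then show "a + b \<in> ?P" using submonoid_add[OF Q abQ] by simp
    qed
  qed
  then show ?thesis using assms by blast
qed

text \<open>Among the translates \<open>q + s\<close> outside \<open>Q\<^sub>F\<close> there is one for which the elements of \<open>Q\<close> that keep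
  it outside \<open>Q\<^sub>F\<close> form a face. This face contains \<open>F\<close>, and \<open>q\<close> still avoids the localization at it,
  so by maximality of the family it is \<open>F\<close> itself. All other elements move the point into \<open>Q\<^sub>F\<close>, and
  since it suffices to consider generators, one shift by an element of \<open>F\<close> moves it into \<open>Q\<close>.\<close>
lemma family_socle_point:
  fixes Q :: "(int ^ 'n) set"
  assumes Q: "affine_monoid Q" and fam: "family_of_holes Q A" and F: "face Q F"
    and A: "A = (+) q ` group_gen F" "q \<in> normalization Q"
  shows "\<exists>p\<in>group_gen Q. p \<notin> face_localization Q F \<and> (\<forall>x\<in>Q. x \<notin> F \<longrightarrow> p + x \<in> Q)"
proof -
  note Q' = affine_submonoid[OF Q]
  obtain G where G: "finite G" "Q = add_submonoid hull G" using Q affine_monoid_def by blast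
  have GQ: "G \<subseteq> Q" using G(2) by (simp add: hull_subset)
  let ?T = "face_localization Q F"
  note T' = affine_submonoid[OF face_localization_affine[OF Q F]]
  have QT: "Q \<subseteq> ?T" by (rule subset_face_localization[OF Q' F])
  have max: "hole_coset Q A" "\<And>B. hole_coset Q B \<Longrightarrow> A \<subseteq> B \<Longrightarrow> B = A"
    using fam unfolding family_of_holes_iff[OF Q] by blast+
  have "q \<notin> ?T" using max(1) A coset_disjoint_iff[OF Q' F, of q] unfolding hole_coset_def by blast
  moreover have "t + x \<in> ?T" if "t \<in> ?T" "x \<in> Q" for t x
    using submonoid_add[OF T'] that QT by blast
  ultimately obtain s where s: "s \<in> Q" "q + s \<notin> ?T" "face Q {x\<in>Q. q + s + x \<notin> ?T}"
    using exists_face_colon[OF Q, of ?T q] by blast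
  let ?F' = "{x\<in>Q. q + s + x \<notin> ?T}"
  have "F \<subseteq> ?F'"
  proof
    fix f assume f: "f \<in> F"
    have "q + s + f \<notin> ?T"
    proof
      assume "q + s + f \<in> ?T"
      then obtain f' where "f' \<in> F" "q + s + f + f' \<in> Q" using in_face_localization_iff[OF Q' F] by blast
      then have "q + s \<in> ?T" using in_face_localization_iff[OF Q' F, of "q + s"] faceD(4)[OF F f]
        by (metis add.assoc)
      then show False using s(2) by blast
    qed
    then show "f \<in> ?F'" using f faceD(1)[OF F] by blast
  qed
  have "q \<notin> face_localization Q ?F'"
  proof
    assume "q \<in> face_localization Q ?F'"
    then obtain x where x: "x \<in> ?F'" "q + x \<in> Q" using in_face_localization_iff[OF Q' s(3)] by blast
    have "q + x + s \<in> Q" by (rule submonoid_add[OF Q' x(2) s(1)])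
    then have "q + x + s \<in> ?T" using QT by blast
    moreover have "q + x + s = q + s + x" by (simp add: ac_simps)
    ultimately show False using x(1) by simp
  qed
  from hole_cosetI[OF Q s(3) A(2) this]
  have hc: "hole_coset Q ((+) q ` group_gen ?F')" .
  have "A \<subseteq> (+) q ` group_gen ?F'" unfolding A(1) by (intro image_mono group_gen_mono \<open>F \<subseteq> ?F'\<close>)
  from max(2)[OF hc this] have "(+) q ` group_gen ?F' \<subseteq> (+) q ` group_gen F"
    unfolding A(1) by (rule equalityD1)
  then have F'F: "?F' \<subseteq> F" by (rule coset_subset_imp_face_subset[OF Q' s(3) F])
  have col: "q + s + g \<in> ?T" if "g \<in> Q" "g \<notin> F" for g
  proof (rule ccontr)
    assume "q + s + g \<notin> ?T"
    then have "g \<in> ?F'" using that(1) by simp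
    from subsetD[OF F'F this] show False using that(2) by simp
  qed
  have "\<exists>c\<in>F. \<forall>t\<in>(+) (q + s) ` (G - F). c + t \<in> Q"
  proof (rule common_shift[OF Q' face_submonoid[OF Q' F] faceD(1)[OF F]])
    show "finite ((+) (q + s) ` (G - F))" using G(1) by simp
    fix t assume "t \<in> (+) (q + s) ` (G - F)"
    then obtain g where g: "t = q + s + g" "g \<in> G - F" by (rule imageE)
    have "q + s + g \<in> ?T" by (rule col) (use g(2) GQ in auto)
    then show "\<exists>q\<in>Q. \<exists>f\<in>F. t = q - f" unfolding face_localization_def g(1)
      by (elim CollectE exE conjE) (intro bexI)
  qed
  then obtain c where c1: "c \<in> F" "\<forall>t\<in>(+) (q + s) ` (G - F). c + t \<in> Q" by (elim bexE)
  have c: "c \<in> F" "\<And>g. g \<in> G - F \<Longrightarrow> c + (q + s + g) \<in> Q"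
    by (rule c1(1), rule bspec[OF c1(2) imageI])
  show ?thesis
  proof (intro bexI[of _ "c + (q + s)"] conjI ballI impI)
    have "q \<in> group_gen Q" using A(2) by (simp add: normalization_def)
    moreover have "s \<in> group_gen Q" "c \<in> group_gen Q"
      using s(1) c(1) faceD(1)[OF F] subset_group_gen[of Q] by blast+
    ultimately show "c + (q + s) \<in> group_gen Q" by (intro group_gen_add)
    show "c + (q + s) \<notin> ?T"
    proof
      assume "c + (q + s) \<in> ?T"
      then obtain f where "f \<in> F" "c + (q + s) + f \<in> Q" using in_face_localization_iff[OF Q' F] by blast
      moreover have "c + (q + s) + f = q + s + (c + f)" by (simp add: ac_simps)
      ultimately have "q + s + (c + f) \<in> Q" "c + f \<in> F" using faceD(4)[OF F c(1)] by simp_all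
      then show False using s(2) in_face_localization_iff[OF Q' F] by blast
    qed
    fix x assume "x \<in> Q" "x \<notin> F"
    then obtain g y where gy: "g \<in> G - F" "y \<in> Q" "x = g + y" using generator_outside_face[OF G(2) F] by blast
    have "c + (q + s + g) + y \<in> Q" by (rule submonoid_add[OF Q' c(2)[OF gy(1)] gy(2)])
    then show "c + (q + s) + x \<in> Q" by (simp add: gy(3) ac_simps)
  qed
qed

text \<open>The coset of \<open>F\<close> through \<open>q\<close> avoids \<open>Q\<close> and therefore lies in a family, which is the coset of a
  larger face through the same point.\<close>
lemma family_through:
  fixes Q :: "(int ^ 'n) set"
  assumes Q: "affine_monoid Q" and F: "face Q F" and q: "q \<in> normalization Q" "q \<notin> face_localization Q F"
  obtains F' where "face Q F'" "F \<subseteq> F'" "family_of_holes Q ((+) q ` group_gen F')"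
    "q \<notin> face_localization Q F'"
proof -
  note Q' = affine_submonoid[OF Q]
  obtain A where A: "family_of_holes Q A" "(+) q ` group_gen F \<subseteq> A"
    using hole_coset_in_family[OF Q hole_cosetI[OF Q F q]] by blast
  then obtain q' F' where qF: "face Q F'" "A = (+) q' ` group_gen F'" "A \<inter> Q = {}"
    unfolding family_of_holes_iff[OF Q] hole_coset_def by blast
  have "q \<in> A" using A(2) group_gen_zero[of F] by force
  then have eq: "A = (+) q ` group_gen F'" using coset_eq qF(2) by blast
  moreover have "F \<subseteq> F'"
    using coset_subset_imp_face_subset[OF Q' F qF(1), of q q] A(2) eq by simp
  moreover have "q \<notin> face_localization Q F'" using coset_disjoint_iff[OF Q' qF(1)] eq qF(3) by blast
  ultimately show ?thesis using that qF(1) A(1) by blast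
qed

section \<open>Facets and the normalization\<close>

text \<open>The point \<open>p\<close> avoids the localization at some facet: either a facet normal is negative at \<open>p\<close>, or
  \<open>p\<close> is a hole and lies in a family, which is parallel to a facet. Elements of this facet do not
  carry \<open>p\<close> into \<open>Q\<close>, so the facet is contained in \<open>F\<close>; as \<open>F\<close> also lies in a facet, all three agree.\<close>
lemma socle_face_is_facet:
  fixes Q :: "(int ^ 'n) set"
  assumes Q: "affine_monoid Q" and F: "face Q F" "F \<noteq> Q"
    and p: "p \<in> group_gen Q" "p \<notin> Q" "\<And>x. x \<in> Q \<Longrightarrow> x \<notin> F \<Longrightarrow> p + x \<in> Q"
    and fam: "\<And>A. family_of_holes Q A \<Longrightarrow> family_of_holes_dim Q (star_dim Q Q - 1) A"
  shows "\<exists>w. facet_normal Q w \<and> F = facet Q w"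
proof -
  note Q' = affine_submonoid[OF Q]
  \<comment> \<open>a facet whose localization misses \<open>p\<close> lies inside \<open>F\<close>\<close>
  have key: "F = facet Q w" if w: "facet_normal Q w" and miss: "\<And>x. x \<in> facet Q w \<Longrightarrow> p + x \<notin> Q" for w
  proof -
    have "facet Q w \<subseteq> F"
    proof
      fix x assume x: "x \<in> facet Q w"
      show "x \<in> F"
      proof (rule ccontr)
        assume "x \<notin> F"
        then have "p + x \<in> Q" using p(3) x by (auto simp: facet_def)
        then show False using miss[OF x] by blast
      qed
    qed
    moreover obtain v where v: "facet_normal Q v" "F \<subseteq> facet Q v"
      using proper_face_in_facet[OF Q F] by (elim exE conjE)
    ultimately have "facet Q w \<subseteq> facet Q v" by blast
    moreover have "group_rank (group_gen (facet Q w)) = group_rank (group_gen (facet Q v))"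
      using facet_rank[OF Q' w] facet_rank[OF Q' v(1)] by simp
    ultimately have "facet Q w = facet Q v"
      by (rule face_eq_if_rank_eq[OF Q' facet_face[OF Q' w] facet_face[OF Q' v(1)]])
    then show ?thesis using \<open>facet Q w \<subseteq> F\<close> v(2) by blast
  qed
  show ?thesis
  proof (cases "\<exists>n>0. int n *s p \<in> Q")
    case False
    from exists_facet_normal[OF Q p(1) this]
    obtain w where w: "facet_normal Q w" "idot w p < 0" by (elim exE conjE)
    have "p + x \<notin> Q" if "x \<in> facet Q w" for x
    proof
      assume "p + x \<in> Q"
      then have "0 \<le> idot w (p + x)" using w(1) by (simp add: facet_normal_def)
      then show False using w(2) that by (simp add: idot_simps facet_def)
    qed
    then show ?thesis using key[OF w(1)] w(1) by blast
  next
    case True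
    then have pn: "p \<in> normalization Q" using p(1) unfolding normalization_eq[OF Q] by simp
    have "p \<notin> face_localization Q (min_face Q)" using p(2) face_localization_min_face[OF Q'] by simp
    then obtain F' where F': "face Q F'" "family_of_holes Q ((+) p ` group_gen F')"
      "p \<notin> face_localization Q F'"
      using family_through[OF Q face_min_face[OF Q'] pn] by metis
    from fam[OF F'(2)] obtain q F'' where *: "face Q F''" "(+) p ` group_gen F' = (+) q ` group_gen F''"
      "star_dim Q F'' = star_dim Q Q - 1" unfolding family_of_holes_dim_def by (elim conjE exE)
    have "F' = F''"
      using coset_subset_imp_face_subset[OF Q' F'(1) *(1), of p q]
        coset_subset_imp_face_subset[OF Q' *(1) F'(1), of q p] *(2) by simp
    then obtain w where w: "facet_normal Q w" "F' = facet Q w"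
      using *(3) star_dim_eq_codim_one_iff[OF Q F'(1)] by metis
    have "p + x \<notin> Q" if "x \<in> facet Q w" for x
      using F'(3) in_face_localization_iff[OF Q' F'(1)] that w(2) by blast
    then show ?thesis using key[OF w(1)] w(1) by blast
  qed
qed

lemma normalization_face_localization:
  fixes Q :: "(int ^ 'n) set"
  assumes Q: "affine_monoid Q" and F: "face Q F" and p: "p \<in> normalization (face_localization Q F)"
  shows "\<exists>f\<in>F. p + f \<in> normalization Q"
proof -
  note Q' = affine_submonoid[OF Q]
  note F' = face_submonoid[OF Q' F]
  have pG: "p \<in> group_gen Q" and "\<exists>n>0. int n *s p \<in> face_localization Q F"
    using p unfolding normalization_eq[OF face_localization_affine[OF Q F]]
      group_gen_face_localization[OF Q' F] by auto
  then obtain n f where nf: "n > 0" "f \<in> F" "int n *s p + f \<in> Q"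
    using in_face_localization_iff[OF Q' F] by blast
  obtain m where m: "n = Suc m" using nf(1) by (cases n) auto
  have fQ: "f \<in> Q" using nf(2) faceD(1)[OF F] by blast
  have "int n *s (p + f) = (int n *s p + f) + int m *s f"
    by (simp add: m vec_eq_iff algebra_simps)
  also have "\<dots> \<in> Q" by (rule submonoid_add[OF Q' nf(3) submonoid_smult[OF Q' fQ]])
  finally have "int n *s (p + f) \<in> Q" .
  then have "p + f \<in> normalization Q" unfolding normalization_eq[OF Q]
    using pG fQ nf(1) group_gen_add[OF pG subsetD[OF subset_group_gen fQ]] by blast
  then show ?thesis using nf(2) by blast
qed

lemma normalization_mono:
  assumes "P \<subseteq> Q" shows "normalization P \<subseteq> normalization Q"
  using group_gen_mono[OF assms] hull_mono[OF image_mono[OF assms], of convex_cone real_vec]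
  unfolding normalization_def by blast

text \<open>Every element of the normalization of \<open>Q\<^sub>F\<close> differs from one of the normalization of \<open>Q\<close> by an
  element of \<open>F\<close>, which is invertible in \<open>Q\<^sub>F\<close>.\<close>
lemma normal_face_localization_iff:
  fixes Q :: "(int ^ 'n) set"
  assumes Q: "affine_monoid Q" and F: "face Q F"
  shows "normal_monoid (face_localization Q F) \<longleftrightarrow> normalization Q \<subseteq> face_localization Q F"
proof
  note Q' = affine_submonoid[OF Q]
  show "normalization Q \<subseteq> face_localization Q F" if "normal_monoid (face_localization Q F)"
    using normalization_mono[OF subset_face_localization[OF Q' F]] that
    unfolding normal_monoid_def by simp
  assume sub: "normalization Q \<subseteq> face_localization Q F"
  have "normalization (face_localization Q F) \<subseteq> face_localization Q F"
  proof
    fix p assume "p \<in> normalization (face_localization Q F)"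
    then obtain f where f: "f \<in> F" "p + f \<in> normalization Q"
      using normalization_face_localization[OF Q F] by blast
    then obtain g where g: "g \<in> F" "p + f + g \<in> Q" using sub in_face_localization_iff[OF Q' F] by blast
    have "f + g \<in> F" using faceD(4)[OF F f(1) g(1)] .
    moreover have "p + (f + g) \<in> Q" using g(2) by (simp add: add.assoc)
    ultimately show "p \<in> face_localization Q F" using in_face_localization_iff[OF Q' F] by blast
  qed
  then show "normal_monoid (face_localization Q F)"
    using subset_normalization[OF face_localization_affine[OF Q F]] unfolding normal_monoid_def by blast
qed

text \<open>If \<open>Q\<^sub>F\<close> is not normal, some hole avoids it and lies in a family along a face containing \<open>F\<close>;
  conversely a family along \<open>F\<close> consists of points outside \<open>Q\<^sub>F\<close>.\<close>
theorem locally_normal_iff: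
  fixes Q :: "(int ^ 'n) set"
  assumes Q: "affine_monoid Q"
  shows "locally_normal Q \<longleftrightarrow> \<not> (\<exists>A j. j > 0 \<and> family_of_holes_dim Q j A)"
proof
  note Q' = affine_submonoid[OF Q]
  assume ln: "locally_normal Q"
  show "\<not> (\<exists>A j. j > 0 \<and> family_of_holes_dim Q j A)"
  proof
    assume "\<exists>A j. j > 0 \<and> family_of_holes_dim Q j A"
    then obtain A j where j: "j > 0" "family_of_holes_dim Q j A" by (elim exE conjE)
    then obtain q F where *: "family_of_holes Q A" "q \<in> normalization Q" "face Q F"
      "A = (+) q ` group_gen F" "star_dim Q F = j" unfolding family_of_holes_dim_def by (elim exE conjE)
    then have "F \<noteq> min_face Q" using star_dim_eq_0_iff[OF Q' *(3)] j(1) by simp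
    then have "normal_monoid (face_localization Q F)" using ln *(3) unfolding locally_normal_def by simp
    then have "q \<in> face_localization Q F" using normal_face_localization_iff[OF Q *(3)] *(2) by blast
    moreover have "A \<inter> Q = {}" using *(1) unfolding family_of_holes_iff[OF Q] hole_coset_def by blast
    ultimately show False using coset_disjoint_iff[OF Q' *(3)] *(4) by simp
  qed
next
  note Q' = affine_submonoid[OF Q]
  assume no: "\<not> (\<exists>A j. j > 0 \<and> family_of_holes_dim Q j A)"
  show "locally_normal Q" unfolding locally_normal_def
  proof (intro allI impI, elim conjE)
    fix F assume F: "face Q F" "F \<noteq> min_face Q"
    show "normal_monoid (face_localization Q F)" unfolding normal_face_localization_iff[OF Q F(1)]
    proof (rule ccontr)
      assume "\<not> normalization Q \<subseteq> face_localization Q F"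
      then obtain q where q: "q \<in> normalization Q" "q \<notin> face_localization Q F" by blast
      obtain F' where F': "face Q F'" "F \<subseteq> F'" "family_of_holes Q ((+) q ` group_gen F')"
        by (rule family_through[OF Q F(1) q])
      have "F' \<noteq> min_face Q" using F'(2) F(2) min_face_subset[OF Q' F(1)] by blast
      then have "star_dim Q F' > 0"
        using star_dim_eq_0_iff[OF Q' F'(1)] star_dim_nonneg[OF Q' F'(1)] by simp
      moreover have "family_of_holes_dim Q (star_dim Q F') ((+) q ` group_gen F')"
        unfolding family_of_holes_dim_def using F'(1,3) q(1) by (intro conjI exI) auto
      ultimately show False using no by blast
    qed
  qed
qed

text \<open>A hole outside the localization at a facet lies in a family along a face containing the facet.
  The only larger face is \<open>Q\<close>, whose group contains all holes and meets \<open>Q\<close>.\<close>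
lemma codim_one_family_iff:
  fixes Q :: "(int ^ 'n) set"
  assumes Q: "affine_monoid Q"
  shows "(\<exists>A. family_of_holes_dim Q (star_dim Q Q - 1) A) \<longleftrightarrow>
    (\<exists>w. facet_normal Q w \<and> \<not> normalization Q \<subseteq> face_localization Q (facet Q w))"
proof
  note Q' = affine_submonoid[OF Q]
  assume "\<exists>A. family_of_holes_dim Q (star_dim Q Q - 1) A"
  then obtain A q F where *: "family_of_holes Q A" "q \<in> normalization Q" "face Q F"
    "A = (+) q ` group_gen F" "star_dim Q F = star_dim Q Q - 1"
    unfolding family_of_holes_dim_def by (elim exE conjE)
  obtain w where w: "facet_normal Q w" "F = facet Q w" using *(5) star_dim_eq_codim_one_iff[OF Q *(3)] by metis
  have "A \<inter> Q = {}" using *(1) unfolding family_of_holes_iff[OF Q] hole_coset_def by blast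
  then have "q \<notin> face_localization Q F" using coset_disjoint_iff[OF Q' *(3)] *(4) by simp
  then show "\<exists>w. facet_normal Q w \<and> \<not> normalization Q \<subseteq> face_localization Q (facet Q w)"
    using w *(2) by blast
next
  note Q' = affine_submonoid[OF Q]
  assume "\<exists>w. facet_normal Q w \<and> \<not> normalization Q \<subseteq> face_localization Q (facet Q w)"
  then obtain w q where w: "facet_normal Q w" and q: "q \<in> normalization Q" "q \<notin> face_localization Q (facet Q w)"
    by blast
  note F = facet_face[OF Q' w]
  obtain F' where F': "face Q F'" "facet Q w \<subseteq> F'" "family_of_holes Q ((+) q ` group_gen F')"
    "q \<notin> face_localization Q F'" by (rule family_through[OF Q F q])
  have "F' \<noteq> Q"
  proof
    assume "F' = Q"
    have "q \<in> group_gen Q" using q(1) by (simp add: normalization_def)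
    then have "q \<in> face_localization Q Q" unfolding group_gen_eq_diff[OF Q'] face_localization_def .
    then show False using F'(4) \<open>F' = Q\<close> by simp
  qed
  have "star_dim Q F' = star_dim Q Q - 1"
  proof -
    have "star_dim Q F' \<noteq> star_dim Q Q"
      using face_eq_if_rank_eq[OF Q' F'(1) face_whole[OF Q'] faceD(1)[OF F'(1)]] \<open>F' \<noteq> Q\<close>
      by (auto simp: star_dim_def)
    moreover have "star_dim Q F' \<le> star_dim Q Q"
      unfolding star_dim_def using group_rank_mono[OF group_gen_mono[OF faceD(1)[OF F'(1)]]] by simp
    moreover have "star_dim Q (facet Q w) \<le> star_dim Q F'"
      unfolding star_dim_def using group_rank_mono[OF group_gen_mono[OF F'(2)]] by simp
    moreover have "star_dim Q (facet Q w) = star_dim Q Q - 1"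
      using star_dim_eq_codim_one_iff[OF Q F] w by blast
    ultimately show ?thesis by linarith
  qed
  then show "\<exists>A. family_of_holes_dim Q (star_dim Q Q - 1) A"
    unfolding family_of_holes_dim_def using F' q(1) by (intro exI conjI) auto
qed

section \<open>Ideals, regular sequences and grade\<close>

lemma (in cring) ideal_iff:
  "ideal I R \<longleftrightarrow> I \<subseteq> carrier R \<and> \<zero> \<in> I \<and> (\<forall>a\<in>I. \<forall>b\<in>I. a \<oplus> b \<in> I) \<and>
     (\<forall>a\<in>I. \<forall>x\<in>carrier R. x \<otimes> a \<in> I)"
proof
  assume "ideal I R"
  then interpret ideal I R .
  show "I \<subseteq> carrier R \<and> \<zero> \<in> I \<and> (\<forall>a\<in>I. \<forall>b\<in>I. a \<oplus> b \<in> I) \<and> (\<forall>a\<in>I. \<forall>x\<in>carrier R. x \<otimes> a \<in> I)"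
    using a_subset I_l_closed by auto
next
  assume *: "I \<subseteq> carrier R \<and> \<zero> \<in> I \<and> (\<forall>a\<in>I. \<forall>b\<in>I. a \<oplus> b \<in> I) \<and>
     (\<forall>a\<in>I. \<forall>x\<in>carrier R. x \<otimes> a \<in> I)"
  show "ideal I R"
  proof (rule idealI)
    show "ring R" by (rule ring_axioms)
    show "subgroup I (add_monoid R)"
    proof (rule subgroup.intro)
      fix x assume x: "x \<in> I"
      then have "x \<in> carrier R" using * by blast
      then have "\<ominus> x = (\<ominus> \<one>) \<otimes> x" by (simp add: l_minus)
      also have "\<dots> \<in> I" using * x by simp
      finally show "inv\<^bsub>add_monoid R\<^esub> x \<in> I" by (simp add: a_inv_def)
    qed (use * in auto)
    fix a x assume "a \<in> I" "x \<in> carrier R"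
    moreover from this have "a \<in> carrier R" using * by blast
    ultimately show "x \<otimes> a \<in> I" "a \<otimes> x \<in> I" using * m_comm[of a x] by auto
  qed
qed

lemma (in cring) primeideal_iff:
  "primeideal I R \<longleftrightarrow> ideal I R \<and> \<one> \<notin> I \<and>
     (\<forall>a\<in>carrier R. \<forall>b\<in>carrier R. a \<otimes> b \<in> I \<longrightarrow> a \<in> I \<or> b \<in> I)"
proof
  assume "primeideal I R"
  then interpret p: primeideal I R .
  show "ideal I R \<and> \<one> \<notin> I \<and> (\<forall>a\<in>carrier R. \<forall>b\<in>carrier R. a \<otimes> b \<in> I \<longrightarrow> a \<in> I \<or> b \<in> I)"
    using p.I_notcarr p.one_imp_carrier p.I_prime p.is_ideal by blast
next
  assume *: "ideal I R \<and> \<one> \<notin> I \<and> (\<forall>a\<in>carrier R. \<forall>b\<in>carrier R. a \<otimes> b \<in> I \<longrightarrow> a \<in> I \<or> b \<in> I)"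
  then interpret i: ideal I R by simp
  show "primeideal I R"
    using * i.is_ideal one_closed is_cring by (intro primeidealI) auto
qed

lemma (in cring) genideal_empty: "genideal R {} = {\<zero>}"
proof
  show "genideal R {} \<subseteq> {\<zero>}" by (rule genideal_minimal[OF zeroideal]) simp
  show "{\<zero>} \<subseteq> genideal R {}"
    using ideal_iff[of "genideal R {}"] genideal_ideal[of "{}"] by simp
qed

lemma (in cring) in_genideal_single_iff:
  assumes "a \<in> carrier R"
  shows "x \<in> genideal R {a} \<longleftrightarrow> (\<exists>c\<in>carrier R. x = c \<otimes> a)"
  unfolding cgenideal_eq_genideal[OF assms, symmetric] cgenideal_def by auto

lemma grade_ge:
  assumes "set xs \<subseteq> I" "regular_sequence R xs" shows "enat (length xs) \<le> grade R I"
  unfolding grade_def using assms by (intro Sup_upper CollectI exI[of _ xs]) simp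

lemma (in cring) one_le_grade:
  assumes "ideal I R" "\<one> \<notin> I" "f \<in> I" "\<And>a. a \<in> carrier R \<Longrightarrow> f \<otimes> a = \<zero> \<Longrightarrow> a = \<zero>"
  shows "1 \<le> grade R I"
proof -
  have "f \<in> carrier R" by (rule ideal.Icarr[OF assms(1,3)])
  have "genideal R {f} \<subseteq> I" by (rule genideal_minimal[OF assms(1)]) (use assms(3) in simp)
  then have "\<one> \<notin> genideal R {f}" using assms(2) by (rule contra_subsetD)
  then have "genideal R {f} \<noteq> carrier R" using one_closed by metis
  then have "regular_sequence R [f]" unfolding regular_sequence_def
    using \<open>f \<in> carrier R\<close> assms(4) by (simp add: genideal_empty)
  then show ?thesis using grade_ge[of "[f]" I R] assms(3) by (simp add: one_enat_def)
qed

lemma (in cring) two_le_grade: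
  assumes "ideal I R" "\<one> \<notin> I" "f \<in> I" "g \<in> I" "\<And>a. a \<in> carrier R \<Longrightarrow> f \<otimes> a = \<zero> \<Longrightarrow> a = \<zero>"
    "\<And>a. a \<in> carrier R \<Longrightarrow> g \<otimes> a \<in> genideal R {f} \<Longrightarrow> a \<in> genideal R {f}"
  shows "2 \<le> grade R I"
proof -
  have fg: "f \<in> carrier R" "g \<in> carrier R" by (rule ideal.Icarr[OF assms(1)], rule assms)+
  have "genideal R {f, g} \<subseteq> I" by (rule genideal_minimal[OF assms(1)]) (use assms(3,4) in simp)
  then have "\<one> \<notin> genideal R {f, g}" using assms(2) by (rule contra_subsetD)
  then have "genideal R {f, g} \<noteq> carrier R" using one_closed by metis
  moreover have "[f, g] ! i \<otimes> a \<in> genideal R (set (take i [f, g])) \<longrightarrow> a \<in> genideal R (set (take i [f, g]))"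
    if "i < length [f, g]" "a \<in> carrier R" for i a
  proof -
    have "i = 0 \<or> i = 1" using that(1) by auto
    then show ?thesis
    proof
      assume "i = 0"
      then show ?thesis using assms(5)[OF that(2)] by (simp add: genideal_empty)
    next
      assume "i = 1"
      then show ?thesis using assms(6)[OF that(2)] by simp
    qed
  qed
  ultimately have "regular_sequence R [f, g]" unfolding regular_sequence_def
    using fg by simp
  then show ?thesis using grade_ge[of "[f, g]" I R] assms(3,4)
    by (simp add: numeral_eq_enat numeral_2_eq_2)
qed

text \<open>The first entry \<open>f\<close> of a regular sequence is nonzero, and the element \<open>h\<close> shows that each element
  of \<open>I\<close> is a zero divisor modulo \<open>f\<close>.\<close>
lemma (in cring) grade_le_one:
  assumes "\<one> \<noteq> \<zero>"
    "\<And>f. f \<in> I \<Longrightarrow> f \<in> carrier R \<Longrightarrow> f \<noteq> \<zero> \<Longrightarrow> \<exists>h\<in>carrier R. h \<notin> genideal R {f} \<and> (\<forall>g\<in>I. g \<otimes> h \<in> genideal R {f})"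
  shows "grade R I \<le> 1"
  unfolding grade_def
proof (rule Sup_least, clarify)
  fix xs assume xs: "set xs \<subseteq> I" "regular_sequence R xs"
  have "length xs \<le> 1"
  proof (rule ccontr)
    assume "\<not> length xs \<le> 1"
    then obtain f g ys where [simp]: "xs = f # g # ys" by (metis One_nat_def length_0_conv length_Cons
          le_Suc_eq le_numeral_extra(4) list.exhaust not_less_eq_eq zero_le)
    have reg: "\<And>i a. i < length xs \<Longrightarrow> a \<in> carrier R \<Longrightarrow> xs ! i \<otimes> a \<in> genideal R (set (take i xs)) \<Longrightarrow>
        a \<in> genideal R (set (take i xs))" and fc: "f \<in> carrier R"
      using xs(2) unfolding regular_sequence_def by auto
    have reg0: "f \<otimes> \<one> \<in> {\<zero>} \<Longrightarrow> \<one> \<in> {\<zero>}" using reg[of 0 \<one>] by (simp add: genideal_empty)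
    have "f \<noteq> \<zero>"
    proof
      assume "f = \<zero>"
      then show False using reg0 assms(1) by simp
    qed
    moreover have "f \<in> I" "g \<in> I" using xs(1) by simp_all
    ultimately have "\<exists>h\<in>carrier R. h \<notin> genideal R {f} \<and> (\<forall>g\<in>I. g \<otimes> h \<in> genideal R {f})"
      using assms(2)[of f] fc by simp
    then obtain h where h: "h \<in> carrier R" "h \<notin> genideal R {f}" "\<forall>g\<in>I. g \<otimes> h \<in> genideal R {f}"
      by (elim bexE conjE)
    have "g \<otimes> h \<in> genideal R {f}" using h(3) \<open>g \<in> I\<close> by (rule bspec)
    then have "h \<in> genideal R {f}" using reg[of 1 h] h(1) by simp
    then show False using h(2) by simp
  qed
  then show "enat (length xs) \<le> 1" by (simp add: one_enat_def)
qed

section \<open>Subdomains of a commutative ring\<close>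

definition subring_of :: "'a::comm_ring_1 set \<Rightarrow> 'a ring" where
  "subring_of A = \<lparr>carrier = A, mult = (*), one = 1, zero = 0, add = (+)\<rparr>"

lemma subring_of_simps [simp]:
  "carrier (subring_of A) = A" "mult (subring_of A) = (*)" "one (subring_of A) = 1"
  "zero (subring_of A) = 0" "add (subring_of A) = (+)"
  by (simp_all add: subring_of_def)

locale subdomain =
  fixes A :: "'a::comm_ring_1 set"
  assumes one_in: "1 \<in> A"
    and diff_in: "a \<in> A \<Longrightarrow> b \<in> A \<Longrightarrow> a - b \<in> A"
    and mult_in: "a \<in> A \<Longrightarrow> b \<in> A \<Longrightarrow> a * b \<in> A"
    and zero_divisor_free: "a \<in> A \<Longrightarrow> b \<in> A \<Longrightarrow> a * b = 0 \<Longrightarrow> a = 0 \<or> b = 0"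
begin

lemma zero_in: "0 \<in> A" using diff_in[OF one_in one_in] by simp
lemma uminus_in: "a \<in> A \<Longrightarrow> - a \<in> A" using diff_in[OF zero_in] by simp
lemma add_in: "a \<in> A \<Longrightarrow> b \<in> A \<Longrightarrow> a + b \<in> A" using diff_in[OF _ uminus_in] by force
lemma power_in: "a \<in> A \<Longrightarrow> a ^ n \<in> A" by (induction n) (auto intro: one_in mult_in)
lemma sum_in: "(\<And>i. i \<in> I \<Longrightarrow> f i \<in> A) \<Longrightarrow> sum f I \<in> A"
  by (induction I rule: infinite_finite_induct) (auto intro: zero_in add_in)

lemma mult_cancel: "a \<in> A \<Longrightarrow> b \<in> A \<Longrightarrow> c \<in> A \<Longrightarrow> c \<noteq> 0 \<Longrightarrow> c * a = c * b \<longleftrightarrow> a = b"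
  using zero_divisor_free[of c "a - b"] diff_in[of a b] by (auto simp: right_diff_distrib)

lemma is_cring: "cring (subring_of A)"
proof (rule cringI)
  show "abelian_group (subring_of A)"
    by (rule abelian_groupI)
       (auto simp: zero_in add.assoc add.commute add.left_commute intro: add_in uminus_in
          intro!: bexI[of _ "- _"])
  show "Group.comm_monoid (subring_of A)"
    by (rule comm_monoidI) (auto simp: mult.assoc mult.commute one_in mult_in)
qed (auto simp: algebra_simps)

sublocale R: cring "subring_of A" by (rule is_cring)

text \<open>Prime ideals of \<open>A\<close>, written with the operations of the ambient ring.\<close>
definition prime_set :: "'a set \<Rightarrow> bool" where
  "prime_set P \<longleftrightarrow> P \<subseteq> A \<and> 0 \<in> P \<and> (\<forall>a\<in>P. \<forall>b\<in>P. a + b \<in> P) \<and> (\<forall>a\<in>P. \<forall>c\<in>A. c * a \<in> P) \<and>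
     1 \<notin> P \<and> (\<forall>a\<in>A. \<forall>b\<in>A. a * b \<in> P \<longrightarrow> a \<in> P \<or> b \<in> P)"

lemma primeideal_iff_prime_set: "primeideal P (subring_of A) \<longleftrightarrow> prime_set P"
  unfolding R.primeideal_iff R.ideal_iff prime_set_def by simp

lemma prime_setD:
  assumes "prime_set P"
  shows "P \<subseteq> A" "0 \<in> P" "\<And>a b. a \<in> P \<Longrightarrow> b \<in> P \<Longrightarrow> a + b \<in> P" "\<And>a c. a \<in> P \<Longrightarrow> c \<in> A \<Longrightarrow> c * a \<in> P"
    "1 \<notin> P" "\<And>a b. a \<in> A \<Longrightarrow> b \<in> A \<Longrightarrow> a * b \<in> P \<Longrightarrow> a \<in> P \<or> b \<in> P"
  using assms unfolding prime_set_def by blast+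

lemma prime_set_power: "prime_set P \<Longrightarrow> a \<in> A \<Longrightarrow> a ^ n \<in> P \<Longrightarrow> a \<in> P"
  by (induction n) (auto dest: prime_setD(5) prime_setD(6)[OF _ _ power_in])

lemma prime_set_zero: "prime_set {0}"
  unfolding prime_set_def using zero_in zero_divisor_free by auto

lemma height_le_oneD:
  assumes "height (subring_of A) P \<le> enat 1" "prime_set P" "prime_set P'" "P' \<subset> P"
  shows "P' = {0}"
proof (rule ccontr)
  assume ne: "P' \<noteq> {0}"
  define C where "C i = (if i = 0 then {0} else if i = 1 then P' else P)" for i :: nat
  have "{0} \<subset> P'" using ne prime_setD(2)[OF assms(3)] by blast
  then have "C i \<subset> C (Suc i)" if "i < 2" for i
    using that assms(4) by (cases "i = 0") (auto simp: C_def less_2_cases_iff)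
  moreover have "primeideal (C i) (subring_of A)" if "i \<le> 2" for i
    unfolding primeideal_iff_prime_set C_def using assms prime_set_zero by simp
  ultimately have "prime_chain (subring_of A) 2 C" unfolding prime_chain_def by blast
  moreover have "C 2 = P" by (simp add: C_def)
  ultimately have "enat 2 \<le> height (subring_of A) P" unfolding height_def by (intro Sup_upper) blast
  then have "enat 2 \<le> enat 1" using assms(1) by (rule order_trans)
  then show False by simp
qed

lemma height_le_oneI:
  assumes "\<And>P'. prime_set P' \<Longrightarrow> P' \<subset> P \<Longrightarrow> P' = {0}"
  shows "height (subring_of A) P \<le> enat 1"
  unfolding height_def
proof (rule Sup_least, clarify)
  fix n C assume C: "prime_chain (subring_of A) n C" "P = C n"
  have "n \<le> 1"
  proof (rule ccontr)
    assume "\<not> n \<le> 1"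
    then obtain m where n: "n = Suc (Suc m)" by (metis One_nat_def le_Suc_eq le_numeral_extra(4) not0_implies_Suc not_less_eq_eq zero_le)
    have pr: "prime_set (C m)" "prime_set (C (Suc m))" "C m \<subset> C (Suc m)" "C (Suc m) \<subset> C n"
      using C(1) unfolding prime_chain_def primeideal_iff_prime_set n by auto
    then have "C (Suc m) = {0}" using assms C(2) by blast
    then show False using pr(3) prime_setD(2)[OF pr(1)] by auto
  qed
  then show "enat n \<le> enat 1" by simp
qed

end

section \<open>Localization at a prime\<close>

locale localized_domain = subdomain A for A :: "'a::comm_ring_1 set" +
  fixes P :: "'a set"
  assumes prime: "prime_set P"
begin

abbreviation S where "S \<equiv> A - P"
abbreviation L where "L \<equiv> localization_at (subring_of A) P"
definition fr where "fr a s = frac_rel (subring_of A) S `` {(a, s)}"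

lemma one_S: "1 \<in> S" using one_in prime_setD(5)[OF prime] by simp
lemma mult_S: "s \<in> S \<Longrightarrow> t \<in> S \<Longrightarrow> s * t \<in> S" using prime_setD(6)[OF prime] mult_in by blast
lemma S_A: "s \<in> S \<Longrightarrow> s \<in> A" by simp
lemma S_nz: "s \<in> S \<Longrightarrow> s \<noteq> 0" using prime_setD(2)[OF prime] by auto
lemma frac_rel_iff:
  "((a, s), (b, t)) \<in> frac_rel (subring_of A) S \<longleftrightarrow> a \<in> A \<and> s \<in> S \<and> b \<in> A \<and> t \<in> S \<and> a * t = b * s"
proof -
  have "(\<exists>u\<in>S. u * (a * t) = u * (b * s)) \<longleftrightarrow> a * t = b * s" if "a \<in> A" "s \<in> S" "b \<in> A" "t \<in> S"
    using mult_cancel[of "a * t" "b * s"] that S_nz one_S by (auto intro: mult_in)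
  then show ?thesis unfolding frac_rel_def by auto
qed

lemma equiv_frac_rel: "equiv (A \<times> S) (frac_rel (subring_of A) S)"
proof (rule equivI)
  show "frac_rel (subring_of A) S \<subseteq> (A \<times> S) \<times> (A \<times> S)" by (auto simp: frac_rel_iff)
  show "refl_on (A \<times> S) (frac_rel (subring_of A) S)" by (auto simp: refl_on_def frac_rel_iff)
  show "sym (frac_rel (subring_of A) S)" by (auto simp: sym_def frac_rel_iff)
  show "trans (frac_rel (subring_of A) S)"
  proof (rule transI, clarify)
    fix a s b t c u assume "((a, s), (b, t)) \<in> frac_rel (subring_of A) S" "((b, t), (c, u)) \<in> frac_rel (subring_of A) S"
    then have *: "a \<in> A" "s \<in> S" "b \<in> A" "t \<in> S" "c \<in> A" "u \<in> S" "a * t = b * s" "b * u = c * t"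
      unfolding frac_rel_iff by blast+
    have "t * (a * u) = (a * t) * u" by (simp add: ac_simps)
    also have "\<dots> = (b * u) * s" unfolding *(7) by (simp add: ac_simps)
    also have "\<dots> = t * (c * s)" unfolding *(8) by (simp add: ac_simps)
    finally have "a * u = c * s" using mult_cancel[of "a * u" "c * s" t] * S_nz by (auto intro: mult_in)
    then show "((a, s), (c, u)) \<in> frac_rel (subring_of A) S" unfolding frac_rel_iff using * by blast
  qed
qed

lemma fr_eq_iff:
  assumes "a \<in> A" "s \<in> S" "b \<in> A" "t \<in> S"
  shows "fr a s = fr b t \<longleftrightarrow> a * t = b * s"
  unfolding fr_def using eq_equiv_class_iff[OF equiv_frac_rel, of "(a, s)" "(b, t)"] assms frac_rel_iff
  by auto

lemma in_fr_iff: "(b, t) \<in> fr a s \<longleftrightarrow> a \<in> A \<and> s \<in> S \<and> b \<in> A \<and> t \<in> S \<and> a * t = b * s"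
  by (simp add: fr_def frac_rel_iff)

lemma carrier_L: "carrier L = {fr a s | a s. a \<in> A \<and> s \<in> S}"
  unfolding localization_at_def fraction_ring_def quotient_def fr_def by auto

lemma one_L: "\<one>\<^bsub>L\<^esub> = fr 1 1" and zero_L: "\<zero>\<^bsub>L\<^esub> = fr 0 1"
  unfolding localization_at_def fraction_ring_def fr_def by auto

lemma carrierE:
  assumes "x \<in> carrier L" obtains a s where "x = fr a s" "a \<in> A" "s \<in> S"
  using assms unfolding carrier_L by blast

lemma fr_closed: "a \<in> A \<Longrightarrow> s \<in> S \<Longrightarrow> fr a s \<in> carrier L" unfolding carrier_L by blast

lemma mult_L:
  assumes "a \<in> A" "s \<in> S" "b \<in> A" "t \<in> S"
  shows "fr a s \<otimes>\<^bsub>L\<^esub> fr b t = fr (a * b) (s * t)"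
proof -
  have "fr (a' * b') (s' * t') = fr (a * b) (s * t)" if "(a', s') \<in> fr a s" "(b', t') \<in> fr b t" for a' s' b' t'
  proof (subst fr_eq_iff)
    have *: "a' \<in> A" "s' \<in> S" "b' \<in> A" "t' \<in> S" "a * s' = a' * s" "b * t' = b' * t"
      using that unfolding in_fr_iff by blast+
    show "a' * b' \<in> A" "s' * t' \<in> S" "a * b \<in> A" "s * t \<in> S"
      by (rule mult_in mult_S; fact)+
    have "a' * b' * (s * t) = (a' * s) * (b' * t)" by (simp add: ac_simps)
    also have "\<dots> = (a * s') * (b * t')" by (simp only: *)
    finally show "a' * b' * (s * t) = a * b * (s' * t')" by (simp add: ac_simps)
  qed
  note wd = this
  have ne: "(a, s) \<in> fr a s" "(b, t) \<in> fr b t" using assms by (auto simp: in_fr_iff)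
  have "fr a s \<otimes>\<^bsub>L\<^esub> fr b t = (\<Union>(a, s)\<in>fr a s. \<Union>(b, t)\<in>fr b t. fr (a * b) (s * t))"
    unfolding localization_at_def fraction_ring_def fr_def by simp
  also have "\<dots> = fr (a * b) (s * t)"
  proof (rule UN_constant_eq[OF ne(1)], rule ballI)
    fix y assume y: "y \<in> fr a s"
    obtain a' s' where y': "y = (a', s')" by (cases y)
    show "(case y of (a, s) \<Rightarrow> \<Union>(b, t)\<in>fr b t. fr (a * b) (s * t)) = fr (a * b) (s * t)"
      unfolding y' prod.case
      by (rule UN_constant_eq[OF ne(2)]) (use y y' wd in auto)
  qed
  finally show ?thesis .
qed

lemma add_L:
  assumes "a \<in> A" "s \<in> S" "b \<in> A" "t \<in> S"
  shows "fr a s \<oplus>\<^bsub>L\<^esub> fr b t = fr (a * t + b * s) (s * t)"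
proof -
  have "fr (a' * t' + b' * s') (s' * t') = fr (a * t + b * s) (s * t)"
    if "(a', s') \<in> fr a s" "(b', t') \<in> fr b t" for a' s' b' t'
  proof (subst fr_eq_iff)
    have *: "a' \<in> A" "s' \<in> S" "b' \<in> A" "t' \<in> S" "a * s' = a' * s" "b * t' = b' * t"
      using that unfolding in_fr_iff by blast+
    show "a' * t' + b' * s' \<in> A" "a * t + b * s \<in> A"
      using * assms by (auto intro: mult_in add_in)
    show "s' * t' \<in> S" "s * t \<in> S" by (rule mult_S; fact)+
    have "(a' * t' + b' * s') * (s * t) = (a' * s) * (t' * t) + (b' * t) * (s' * s)" by (simp add: algebra_simps)
    also have "\<dots> = (a * s') * (t' * t) + (b * t') * (s' * s)" by (simp only: *)
    finally show "(a' * t' + b' * s') * (s * t) = (a * t + b * s) * (s' * t')" by (simp add: algebra_simps)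
  qed
  note wd = this
  have ne: "(a, s) \<in> fr a s" "(b, t) \<in> fr b t" using assms by (auto simp: in_fr_iff)
  have "fr a s \<oplus>\<^bsub>L\<^esub> fr b t = (\<Union>(a, s)\<in>fr a s. \<Union>(b, t)\<in>fr b t. fr (a * t + b * s) (s * t))"
    unfolding localization_at_def fraction_ring_def fr_def by simp
  also have "\<dots> = fr (a * t + b * s) (s * t)"
  proof (rule UN_constant_eq[OF ne(1)], rule ballI)
    fix y assume y: "y \<in> fr a s"
    obtain a' s' where y': "y = (a', s')" by (cases y)
    show "(case y of (a, s) \<Rightarrow> \<Union>(b, t)\<in>fr b t. fr (a * t + b * s) (s * t)) = fr (a * t + b * s) (s * t)"
      unfolding y' prod.case
      by (rule UN_constant_eq[OF ne(2)]) (use y y' wd in auto)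
  qed
  finally show ?thesis .
qed

lemmas fr_in = mult_in add_in mult_S S_A

lemma cring_L: "cring L"
proof (rule cringI)
  show "abelian_group L"
  proof (rule abelian_groupI)
    fix x y assume "x \<in> carrier L" "y \<in> carrier L"
    then show "x \<oplus>\<^bsub>L\<^esub> y \<in> carrier L"
      by (elim carrierE) (simp add: add_L fr_closed fr_in del: Diff_iff)
  next
    show "\<zero>\<^bsub>L\<^esub> \<in> carrier L" unfolding zero_L by (rule fr_closed[OF zero_in one_S])
  next
    fix x y z assume "x \<in> carrier L" "y \<in> carrier L" "z \<in> carrier L"
    then show "x \<oplus>\<^bsub>L\<^esub> y \<oplus>\<^bsub>L\<^esub> z = x \<oplus>\<^bsub>L\<^esub> (y \<oplus>\<^bsub>L\<^esub> z)"
      by (elim carrierE) (simp add: add_L fr_in fr_eq_iff algebra_simps del: Diff_iff)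
  next
    fix x y assume "x \<in> carrier L" "y \<in> carrier L"
    then show "x \<oplus>\<^bsub>L\<^esub> y = y \<oplus>\<^bsub>L\<^esub> x"
      by (elim carrierE) (simp add: add_L fr_in fr_eq_iff algebra_simps del: Diff_iff)
  next
    fix x assume "x \<in> carrier L"
    then show "\<zero>\<^bsub>L\<^esub> \<oplus>\<^bsub>L\<^esub> x = x"
      by (elim carrierE) (simp add: zero_L one_S zero_in add_L fr_in fr_eq_iff algebra_simps del: Diff_iff)
  next
    fix x assume "x \<in> carrier L"
    then obtain a s where x: "x = fr a s" "a \<in> A" "s \<in> S" by (rule carrierE)
    have "fr (- a) s \<oplus>\<^bsub>L\<^esub> x = \<zero>\<^bsub>L\<^esub>"
      using x by (simp add: zero_L one_S zero_in uminus_in add_L fr_in fr_eq_iff algebra_simps del: Diff_iff)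
    then show "\<exists>y\<in>carrier L. y \<oplus>\<^bsub>L\<^esub> x = \<zero>\<^bsub>L\<^esub>"
      using fr_closed[OF uminus_in[OF x(2)] x(3)] by blast
  qed
  show "Group.comm_monoid L"
  proof (rule comm_monoidI)
    fix x y assume "x \<in> carrier L" "y \<in> carrier L"
    then show "x \<otimes>\<^bsub>L\<^esub> y \<in> carrier L"
      by (elim carrierE) (simp add: mult_L fr_closed fr_in del: Diff_iff)
  next
    show "\<one>\<^bsub>L\<^esub> \<in> carrier L" unfolding one_L by (rule fr_closed[OF one_in one_S])
  next
    fix x y z assume "x \<in> carrier L" "y \<in> carrier L" "z \<in> carrier L"
    then show "x \<otimes>\<^bsub>L\<^esub> y \<otimes>\<^bsub>L\<^esub> z = x \<otimes>\<^bsub>L\<^esub> (y \<otimes>\<^bsub>L\<^esub> z)"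
      by (elim carrierE) (simp add: mult_L fr_in fr_eq_iff algebra_simps del: Diff_iff)
  next
    fix x y assume "x \<in> carrier L" "y \<in> carrier L"
    then show "x \<otimes>\<^bsub>L\<^esub> y = y \<otimes>\<^bsub>L\<^esub> x"
      by (elim carrierE) (simp add: mult_L fr_in fr_eq_iff algebra_simps del: Diff_iff)
  next
    fix x assume "x \<in> carrier L"
    then show "\<one>\<^bsub>L\<^esub> \<otimes>\<^bsub>L\<^esub> x = x"
      by (elim carrierE) (simp add: one_L one_S one_in mult_L fr_in fr_eq_iff algebra_simps del: Diff_iff)
  qed
next
  fix x y z assume "x \<in> carrier L" "y \<in> carrier L" "z \<in> carrier L"
  then show "(x \<oplus>\<^bsub>L\<^esub> y) \<otimes>\<^bsub>L\<^esub> z = x \<otimes>\<^bsub>L\<^esub> z \<oplus>\<^bsub>L\<^esub> y \<otimes>\<^bsub>L\<^esub> z"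
    by (elim carrierE) (simp add: mult_L add_L fr_in fr_eq_iff algebra_simps del: Diff_iff)
qed

sublocale L: cring L by (rule cring_L)

lemma fr_eq_zero_iff: "a \<in> A \<Longrightarrow> s \<in> S \<Longrightarrow> fr a s = \<zero>\<^bsub>L\<^esub> \<longleftrightarrow> a = 0"
  unfolding zero_L using fr_eq_iff[of a s 0 1] one_S zero_in by simp

text \<open>The ideals \<open>ext P'\<close> and \<open>contr I\<close> are extension and contraction along \<open>A \<rightarrow> L\<close>.\<close>
definition ext :: "'a set \<Rightarrow> ('a \<times> 'a) set set" where
  "ext P' = {fr a s | a s. a \<in> P' \<and> s \<in> S}"

lemma fr_in_ext_iff:
  assumes "prime_set P'" "P' \<subseteq> P" "a \<in> A" "s \<in> S"
  shows "fr a s \<in> ext P' \<longleftrightarrow> a \<in> P'"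
proof
  assume "fr a s \<in> ext P'"
  then obtain b t where bt: "fr a s = fr b t" "b \<in> P'" "t \<in> S" unfolding ext_def by blast
  then have "a * t = b * s" using fr_eq_iff assms prime_setD(1)[OF assms(1)] by blast
  then have "a * t \<in> P'" using prime_setD(4)[OF assms(1) bt(2), of s] assms(4) by (simp add: mult.commute)
  then show "a \<in> P'" using prime_setD(6)[OF assms(1,3), of t] bt(3) assms(2) by blast
next
  assume "a \<in> P'" then show "fr a s \<in> ext P'" unfolding ext_def using assms(4) by blast
qed

lemma ext_subset: "P' \<subseteq> A \<Longrightarrow> ext P' \<subseteq> carrier L"
  unfolding ext_def using fr_closed by blast

lemma ext_prime:
  assumes "prime_set P'" "P' \<subseteq> P"
  shows "primeideal (ext P') L"
  unfolding L.primeideal_iff L.ideal_iff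
proof (intro conjI ballI impI)
  note P' = prime_setD[OF assms(1)] and mem = fr_in_ext_iff[OF assms]
  show "ext P' \<subseteq> carrier L" by (rule ext_subset[OF P'(1)])
  show "\<zero>\<^bsub>L\<^esub> \<in> ext P'" unfolding zero_L using mem[OF zero_in one_S] P'(2) by simp
  show "\<one>\<^bsub>L\<^esub> \<notin> ext P'" unfolding one_L using mem[OF one_in one_S] P'(5) by simp
  fix x assume x: "x \<in> ext P'"
  then obtain a s where as: "x = fr a s" "a \<in> P'" "s \<in> S" unfolding ext_def by blast
  have aA: "a \<in> A" using as(2) P'(1) by blast
  {
    fix y assume "y \<in> ext P'"
    then obtain b t where bt: "y = fr b t" "b \<in> P'" "t \<in> S" unfolding ext_def by blast
    have bA: "b \<in> A" using bt(2) P'(1) by blast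
    have "t * a + s * b \<in> P'" using P'(3)[OF P'(4)[OF as(2)] P'(4)[OF bt(2)]] as(3) bt(3) by simp
    then have "a * t + b * s \<in> P'" by (simp add: mult.commute)
    then show "x \<oplus>\<^bsub>L\<^esub> y \<in> ext P'" unfolding as(1) bt(1) add_L[OF aA as(3) bA bt(3)]
      using mult_S[OF as(3) bt(3)] by (auto simp: ext_def)
  }
  {
    fix y assume "y \<in> carrier L"
    then obtain b t where bt: "y = fr b t" "b \<in> A" "t \<in> S" by (rule carrierE)
    show "y \<otimes>\<^bsub>L\<^esub> x \<in> ext P'" unfolding as(1) bt(1) mult_L[OF bt(2,3) aA as(3)]
      using mult_S[OF bt(3) as(3)] P'(4)[OF as(2) bt(2)] by (auto simp: ext_def)
  }
next
  note P' = prime_setD[OF assms(1)] and mem = fr_in_ext_iff[OF assms]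
  fix x y assume "x \<in> carrier L" "y \<in> carrier L" and xy: "x \<otimes>\<^bsub>L\<^esub> y \<in> ext P'"
  then obtain a s b t where *: "x = fr a s" "a \<in> A" "s \<in> S" "y = fr b t" "b \<in> A" "t \<in> S"
    by (elim carrierE)
  have "a * b \<in> P'" using xy mem[OF mult_in[OF *(2,5)] mult_S[OF *(3,6)]] mult_L[OF *(2,3,5,6)] *(1,4) by simp
  then show "x \<in> ext P' \<or> y \<in> ext P'" using P'(6)[OF *(2,5)] mem *  by blast
qed

lemma ideal_not_in_max:
  assumes "ideal I L" "\<not> I \<subseteq> ext P" shows "I = carrier L"
proof -
  have I: "I \<subseteq> carrier L" "\<And>a x. a \<in> I \<Longrightarrow> x \<in> carrier L \<Longrightarrow> x \<otimes>\<^bsub>L\<^esub> a \<in> I"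
    using assms(1) unfolding L.ideal_iff by blast+
  obtain x where x: "x \<in> I" "x \<notin> ext P" using assms(2) by blast
  then obtain a s where as: "x = fr a s" "a \<in> A" "s \<in> S" using I(1) carrierE by blast
  then have aS: "a \<in> S" using x(2) by (auto simp: ext_def)
  have "fr s a \<otimes>\<^bsub>L\<^esub> x \<in> I" using I(2)[OF x(1) fr_closed[OF _ aS]] as(3) by simp
  also have "fr s a \<otimes>\<^bsub>L\<^esub> x = \<one>\<^bsub>L\<^esub>"
    unfolding as(1) one_L using as aS one_S
    by (subst mult_L) (simp_all add: fr_eq_iff fr_in one_in mult.commute del: Diff_iff)
  finally show ?thesis using ideal.one_imp_carrier[OF assms(1)] by simp
qed

lemma maximalideal_ext: "maximalideal (ext P) L"
proof (rule maximalidealI)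
  have pr: "primeideal (ext P) L" by (rule ext_prime[OF prime]) simp
  then show id: "ideal (ext P) L" by (rule primeideal.axioms(1))
  show "carrier L \<noteq> ext P" using pr by (rule primeideal.I_notcarr)
  fix J assume "ideal J L" "ext P \<subseteq> J" "J \<subseteq> carrier L"
  then show "J = ext P \<or> J = carrier L" using ideal_not_in_max by blast
qed

lemma maximalideal_unique: "maximalideal M L \<Longrightarrow> M = ext P"
proof -
  assume M: "maximalideal M L"
  then have "ideal M L" "carrier L \<noteq> M" by (auto simp: maximalideal_def maximalideal_axioms_def)
  then have "M \<subseteq> ext P" using ideal_not_in_max by blast
  moreover have "ideal (ext P) L" "ext P \<noteq> carrier L" "ext P \<subseteq> carrier L"
    using maximalideal_ext ext_subset[OF prime_setD(1)[OF prime]]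
    by (auto simp: maximalideal_def maximalideal_axioms_def)
  ultimately show ?thesis using maximalideal.I_maximal[OF M] by blast
qed

lemma local_ring_L: "local_ring L"
  unfolding local_ring_def
  by (intro conjI cring_L ex1I[of _ "ext P"] maximalideal_ext) (rule maximalideal_unique)

lemma local_max_ideal_L: "local_max_ideal L = ext P"
  unfolding local_max_ideal_def
  by (rule the_equality) (rule maximalideal_ext, rule maximalideal_unique)

lemma fr_in_max_iff: "a \<in> A \<Longrightarrow> s \<in> S \<Longrightarrow> fr a s \<in> ext P \<longleftrightarrow> a \<in> P"
  using fr_in_ext_iff[OF prime] by blast

lemma prime_subset_max: "primeideal I L \<Longrightarrow> I \<subseteq> ext P"
  using ideal_not_in_max[OF primeideal.axioms(1)[of I L]] primeideal.I_notcarr[of I L] by auto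

definition contr :: "('a \<times> 'a) set set \<Rightarrow> 'a set" where
  "contr I = {a\<in>A. fr a 1 \<in> I}"

lemma fr_in_prime_iff:
  assumes "primeideal I L" "a \<in> A" "s \<in> S" shows "fr a s \<in> I \<longleftrightarrow> a \<in> contr I"
proof -
  note I = primeideal.axioms(1)[OF assms(1)]
  have cl: "\<And>a x. a \<in> I \<Longrightarrow> x \<in> carrier L \<Longrightarrow> x \<otimes>\<^bsub>L\<^esub> a \<in> I"
    using I unfolding L.ideal_iff by blast
  have 1: "fr s 1 \<otimes>\<^bsub>L\<^esub> fr a s = fr a 1"
    unfolding mult_L[OF S_A[OF assms(3)] one_S assms(2,3)]
      fr_eq_iff[OF mult_in[OF S_A[OF assms(3)] assms(2)] mult_S[OF one_S assms(3)] assms(2) one_S]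
    by simp
  have 2: "fr 1 s \<otimes>\<^bsub>L\<^esub> fr a 1 = fr a s"
    unfolding mult_L[OF one_in assms(3,2) one_S]
      fr_eq_iff[OF mult_in[OF one_in assms(2)] mult_S[OF assms(3) one_S] assms(2,3)]
    by simp
  show ?thesis
    using cl[of "fr a s" "fr s 1"] cl[of "fr a 1" "fr 1 s"] 1 2 assms fr_closed one_S one_in
    by (auto simp: contr_def)
qed

lemma contr_prime:
  assumes "primeideal I L" shows "prime_set (contr I)" "contr I \<subseteq> P"
proof -
  have I: "I \<subseteq> carrier L" "\<zero>\<^bsub>L\<^esub> \<in> I" "\<And>a b. a \<in> I \<Longrightarrow> b \<in> I \<Longrightarrow> a \<oplus>\<^bsub>L\<^esub> b \<in> I"
    "\<And>a x. a \<in> I \<Longrightarrow> x \<in> carrier L \<Longrightarrow> x \<otimes>\<^bsub>L\<^esub> a \<in> I" "\<one>\<^bsub>L\<^esub> \<notin> I"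
    "\<And>a b. a \<in> carrier L \<Longrightarrow> b \<in> carrier L \<Longrightarrow> a \<otimes>\<^bsub>L\<^esub> b \<in> I \<Longrightarrow> a \<in> I \<or> b \<in> I"
    using assms unfolding L.primeideal_iff L.ideal_iff by blast+
  show "contr I \<subseteq> P"
    using prime_subset_max[OF assms] fr_in_max_iff[OF _ one_S] by (auto simp: contr_def)
  have m: "fr (a * b) 1 = fr a 1 \<otimes>\<^bsub>L\<^esub> fr b 1" if "a \<in> A" "b \<in> A" for a b
    using mult_L[OF that(1) one_S that(2) one_S] by simp
  have p: "fr (a + b) 1 = fr a 1 \<oplus>\<^bsub>L\<^esub> fr b 1" if "a \<in> A" "b \<in> A" for a b
    using add_L[OF that(1) one_S that(2) one_S] by simp
  show "prime_set (contr I)" unfolding prime_set_def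
  proof (intro conjI ballI impI)
    show "contr I \<subseteq> A" "0 \<in> contr I" "1 \<notin> contr I"
      using I(2,5) zero_in by (auto simp: contr_def zero_L one_L)
    show "a + b \<in> contr I" if "a \<in> contr I" "b \<in> contr I" for a b
      using that I(3) add_in by (simp add: contr_def p)
    show "c * a \<in> contr I" if "a \<in> contr I" "c \<in> A" for a c
      using that I(4) mult_in fr_closed[OF _ one_S] by (simp add: contr_def m)
    show "a \<in> contr I \<or> b \<in> contr I" if "a \<in> A" "b \<in> A" "a * b \<in> contr I" for a b
      using that I(6)[OF fr_closed[OF that(1) one_S] fr_closed[OF that(2) one_S]] by (simp add: contr_def m)
  qed
qed

lemma contr_strict:
  assumes "primeideal I L" "primeideal J L" "I \<subset> J" shows "contr I \<subset> contr J"
proof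
  show "contr I \<subseteq> contr J" using assms(3) by (auto simp: contr_def)
  obtain x where x: "x \<in> J" "x \<notin> I" using assms(3) by blast
  from ideal.Icarr[OF primeideal.axioms(1)[OF assms(2)] x(1)] have "x \<in> carrier L" .
  then obtain a s where "x = fr a s" "a \<in> A" "s \<in> S" by (rule carrierE)
  then show "contr I \<noteq> contr J" using x fr_in_prime_iff[OF assms(1)] fr_in_prime_iff[OF assms(2)] by auto
qed

text \<open>Extension and contraction of primes turn chains below \<open>P\<close> into chains of \<open>L\<close> and back. The last
  member of a contracted chain is replaced by \<open>P\<close>, because \<open>height\<close> requires it to be \<open>P\<close>.\<close>
lemma krull_dim_L: "krull_dim L = height (subring_of A) P"
proof (rule antisym)
  show "krull_dim L \<le> height (subring_of A) P" unfolding krull_dim_def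
  proof (rule Sup_least, clarify)
    fix n C assume C: "prime_chain L n C"
    define D where "D i = (if i = n then P else contr (C i))" for i
    have pr: "primeideal (C i) L" if "i \<le> n" for i using C that by (simp add: prime_chain_def)
    have "prime_chain (subring_of A) n D" unfolding prime_chain_def primeideal_iff_prime_set
    proof (intro conjI allI impI)
      show "prime_set (D i)" if "i \<le> n" for i
        using prime contr_prime(1)[OF pr[OF that]] by (simp add: D_def)
      show "D i \<subset> D (Suc i)" if "i < n" for i
      proof -
        have "contr (C i) \<subset> contr (C (Suc i))"
          using C that by (intro contr_strict pr) (auto simp: prime_chain_def)
        moreover have "contr (C (Suc i)) \<subseteq> P" using contr_prime(2)[OF pr] that by simp
        ultimately show ?thesis using that by (auto simp: D_def)
      qed
    qed
    moreover have "D n = P" by (simp add: D_def)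
    ultimately show "enat n \<le> height (subring_of A) P" unfolding height_def by (intro Sup_upper) blast
  qed
  show "height (subring_of A) P \<le> krull_dim L" unfolding height_def
  proof (rule Sup_least)
    fix x assume "x \<in> {enat n |n. \<exists>C. prime_chain (subring_of A) n C \<and> C n = P}"
    then obtain n C where x: "x = enat n" and C: "prime_chain (subring_of A) n C" "P = C n" by blast
    have pr: "prime_set (C i)" if "i \<le> n" for i
      using C that by (simp add: prime_chain_def primeideal_iff_prime_set)
    have sub: "C i \<subseteq> P" if "i \<le> n" for i
      unfolding C(2) using that
    proof (induction rule: inc_induct)
      case (step m)
      then show ?case using C(1) unfolding prime_chain_def by blast
    qed simp
    have "prime_chain L n (\<lambda>i. ext (C i))" unfolding prime_chain_def
    proof (intro conjI allI impI)
      show "primeideal (ext (C i)) L" if "i \<le> n" for i using ext_prime[OF pr[OF that] sub[OF that]] .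
      show "ext (C i) \<subset> ext (C (Suc i))" if "i < n" for i
      proof
        have i: "i \<le> n" "Suc i \<le> n" using that by auto
        have ss: "C i \<subset> C (Suc i)" using C(1) that unfolding prime_chain_def by blast
        then show "ext (C i) \<subseteq> ext (C (Suc i))" unfolding ext_def by blast
        obtain a where a: "a \<in> C (Suc i)" "a \<notin> C i" using ss by blast
        then have "a \<in> A" using prime_setD(1)[OF pr[OF i(2)]] by blast
        then have "fr a 1 \<in> ext (C (Suc i))" "fr a 1 \<notin> ext (C i)"
          using fr_in_ext_iff[OF pr[OF i(1)] sub[OF i(1)] _ one_S]
            fr_in_ext_iff[OF pr[OF i(2)] sub[OF i(2)] _ one_S] a by blast+
        then show "ext (C i) \<noteq> ext (C (Suc i))" by blast
      qed
    qed
    then show "x \<le> krull_dim L" unfolding krull_dim_def x by (intro Sup_upper) blast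
  qed
qed

lemma ext_ideal: "ideal (ext P) L" and one_notin_ext: "\<one>\<^bsub>L\<^esub> \<notin> ext P"
  using ext_prime[OF prime order_refl] unfolding L.primeideal_iff by blast+

lemma fr_in_genideal_iff:
  assumes "a \<in> A" "s \<in> S" "b \<in> A" "t \<in> S"
  shows "fr b t \<in> genideal L {fr a s} \<longleftrightarrow> (\<exists>u\<in>S. \<exists>c\<in>A. u * b = c * a)"
proof -
  have "fr b t \<in> genideal L {fr a s} \<longleftrightarrow> (\<exists>c\<in>A. \<exists>u\<in>S. fr b t = fr (c * a) (u * s))"
    unfolding L.in_genideal_single_iff[OF fr_closed[OF assms(1,2)]] carrier_L
    using mult_L[OF _ _ assms(1,2)] by blast
  also have "\<dots> \<longleftrightarrow> (\<exists>c\<in>A. \<exists>u\<in>S. b * (u * s) = c * a * t)"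
    using fr_eq_iff[OF assms(3,4) mult_in[OF _ assms(1)] mult_S[OF _ assms(2)]] by blast
  also have "\<dots> \<longleftrightarrow> (\<exists>u\<in>S. \<exists>c\<in>A. u * b = c * a)"
  proof
    assume "\<exists>c\<in>A. \<exists>u\<in>S. b * (u * s) = c * a * t"
    then obtain c u where cu: "c \<in> A" "u \<in> S" "b * (u * s) = c * a * t" by blast
    have "(u * s) * b = (c * t) * a" using cu(3) by (simp add: ac_simps)
    then show "\<exists>u\<in>S. \<exists>c\<in>A. u * b = c * a"
      using mult_S[OF cu(2) assms(2)] mult_in[OF cu(1) S_A[OF assms(4)]] by blast
  next
    assume "\<exists>u\<in>S. \<exists>c\<in>A. u * b = c * a"
    then obtain u c where uc: "u \<in> S" "c \<in> A" "u * b = c * a" by blast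
    have "b * ((t * u) * s) = s * t * (u * b)" by (simp add: ac_simps)
    also have "\<dots> = (s * c) * a * t" unfolding uc(3) by (simp add: ac_simps)
    finally show "\<exists>c\<in>A. \<exists>u\<in>S. b * (u * s) = c * a * t"
      using mult_S[OF assms(4) uc(1)] mult_in[OF S_A[OF assms(2)] uc(2)] by blast
  qed
  finally show ?thesis .
qed

lemma fr_nonzerodivisor:
  assumes "f \<in> A" "f \<noteq> 0" "a \<in> carrier L" "fr f 1 \<otimes>\<^bsub>L\<^esub> a = \<zero>\<^bsub>L\<^esub>" shows "a = \<zero>\<^bsub>L\<^esub>"
proof -
  obtain b t where bt: "a = fr b t" "b \<in> A" "t \<in> S" using assms(3) by (rule carrierE)
  have "f * b = 0"
    using assms(4) fr_eq_zero_iff[OF mult_in[OF assms(1) bt(2)] mult_S[OF one_S bt(3)]]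
      mult_L[OF assms(1) one_S bt(2,3)] bt(1) by simp
  then show ?thesis using zero_divisor_free[OF assms(1) bt(2)] assms(2) fr_eq_zero_iff[OF bt(2,3)] bt(1) by simp
qed

lemma one_le_local_depth:
  assumes "P \<noteq> {0}" shows "1 \<le> local_depth L"
proof -
  obtain f where f: "f \<in> P" "f \<noteq> 0" using assms prime_setD(2)[OF prime] by blast
  have fA: "f \<in> A" using f(1) prime_setD(1)[OF prime] by blast
  show ?thesis unfolding local_depth_def local_max_ideal_L
    by (rule L.one_le_grade[OF ext_ideal one_notin_ext, of "fr f 1"])
       (use fr_in_max_iff[OF fA one_S] f fr_nonzerodivisor[OF fA f(2)] in auto)
qed

text \<open>The hypothesis says that \<open>g\<close> is a nonzerodivisor modulo \<open>f\<close> in the localization.\<close>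
lemma two_le_local_depth:
  assumes "f \<in> P" "g \<in> P" "f \<noteq> 0"
    "\<And>a c. a \<in> A \<Longrightarrow> c \<in> A \<Longrightarrow> g * a = c * f \<Longrightarrow> \<exists>u\<in>S. \<exists>c\<in>A. u * a = c * f"
  shows "2 \<le> local_depth L"
  unfolding local_depth_def local_max_ideal_L
proof (rule L.two_le_grade[OF ext_ideal one_notin_ext, of "fr f 1" "fr g 1"])
  have fA: "f \<in> A" and gA: "g \<in> A" using assms(1,2) prime_setD(1)[OF prime] by blast+
  show "fr f 1 \<in> ext P" "fr g 1 \<in> ext P" using fr_in_max_iff[OF _ one_S] fA gA assms by blast+
  show "a = \<zero>\<^bsub>L\<^esub>" if "a \<in> carrier L" "fr f 1 \<otimes>\<^bsub>L\<^esub> a = \<zero>\<^bsub>L\<^esub>" for a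
    using fr_nonzerodivisor[OF fA assms(3) that] .
  fix a assume "a \<in> carrier L" and ga: "fr g 1 \<otimes>\<^bsub>L\<^esub> a \<in> genideal L {fr f 1}"
  then obtain b t where bt: "a = fr b t" "b \<in> A" "t \<in> S" by (elim carrierE)
  have "fr (g * b) (1 * t) \<in> genideal L {fr f 1}" using ga mult_L[OF gA one_S bt(2,3)] bt(1) by simp
  then obtain u c where uc: "u \<in> S" "c \<in> A" "u * (g * b) = c * f"
    using fr_in_genideal_iff[OF fA one_S mult_in[OF gA bt(2)] mult_S[OF one_S bt(3)]] by blast
  have "g * (u * b) = c * f" using uc(3) by (simp add: ac_simps)
  then obtain v d where vd: "v \<in> S" "d \<in> A" "v * (u * b) = d * f"
    using assms(4)[of "u * b" c] uc(1,2) bt(2) mult_in by blast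
  then have "(v * u) * b = d * f" by (simp add: ac_simps)
  then show "a \<in> genideal L {fr f 1}" unfolding bt(1) fr_in_genideal_iff[OF fA one_S bt(2,3)]
    using mult_S[OF vd(1) uc(1)] vd(2) by blast
qed

lemma local_depth_le_one:
  assumes "\<And>f. f \<in> P \<Longrightarrow> f \<noteq> 0 \<Longrightarrow>
    \<exists>h\<in>A. (\<forall>u\<in>S. \<forall>c\<in>A. u * h \<noteq> c * f) \<and> (\<forall>g\<in>P. \<exists>c\<in>A. g * h = c * f)"
  shows "local_depth L \<le> 1"
  unfolding local_depth_def local_max_ideal_L
proof (rule L.grade_le_one)
  show "\<one>\<^bsub>L\<^esub> \<noteq> \<zero>\<^bsub>L\<^esub>" unfolding one_L using fr_eq_zero_iff[OF one_in one_S] by simp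
  fix x assume "x \<in> ext P" "x \<in> carrier L" "x \<noteq> \<zero>\<^bsub>L\<^esub>"
  then obtain f s where fs: "x = fr f s" "f \<in> A" "s \<in> S" "f \<noteq> 0" "f \<in> P"
    using fr_eq_zero_iff fr_in_max_iff by (elim carrierE) blast
  obtain h where h: "h \<in> A" "\<And>u c. u \<in> S \<Longrightarrow> c \<in> A \<Longrightarrow> u * h \<noteq> c * f" "\<And>g. g \<in> P \<Longrightarrow> \<exists>c\<in>A. g * h = c * f"
    using assms[OF fs(5,4)] by blast
  show "\<exists>h\<in>carrier L. h \<notin> genideal L {x} \<and> (\<forall>g\<in>ext P. g \<otimes>\<^bsub>L\<^esub> h \<in> genideal L {x})"
  proof (intro bexI[of _ "fr h 1"] conjI ballI)
    show "fr h 1 \<in> carrier L" using fr_closed[OF h(1) one_S] .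
    show "fr h 1 \<notin> genideal L {x}" unfolding fs(1) fr_in_genideal_iff[OF fs(2,3) h(1) one_S] using h(2) by blast
    fix y assume "y \<in> ext P"
    then obtain g t where gt: "y = fr g t" "g \<in> P" "t \<in> S" unfolding ext_def by blast
    have gA: "g \<in> A" using gt(2) prime_setD(1)[OF prime] by blast
    obtain c where c: "c \<in> A" "g * h = c * f" using h(3)[OF gt(2)] by blast
    have "1 * (g * h) = c * f" using c by simp
    then show "y \<otimes>\<^bsub>L\<^esub> fr h 1 \<in> genideal L {x}" unfolding gt(1) mult_L[OF gA gt(3) h(1) one_S] fs(1)
        fr_in_genideal_iff[OF fs(2,3) mult_in[OF gA h(1)] mult_S[OF gt(3) one_S]]
      using one_S c(1) by blast
  qed
qed

lemma height_zero:
  assumes "P = {0}" shows "height (subring_of A) P = 0"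
proof -
  have "height (subring_of A) P \<le> enat 0" unfolding height_def
  proof (rule Sup_least, clarify)
    fix n C assume C: "prime_chain (subring_of A) n C" "P = C n"
    have "n = 0"
    proof (rule ccontr)
      assume "n \<noteq> 0"
      then obtain m where m: "n = Suc m" using not0_implies_Suc by blast
      then have "prime_set (C m)" "C m \<subset> P"
        using C unfolding prime_chain_def primeideal_iff_prime_set by auto
      then show False using prime_setD(2)[of "C m"] assms by auto
    qed
    then show "enat n \<le> enat 0" by simp
  qed
  then show ?thesis unfolding zero_enat_def[symmetric] by simp
qed

text \<open>The localization at the zero ideal is a field, of dimension and embedding dimension zero.\<close>
lemma regular_at_zero:
  assumes "P = {0}" shows "regular_local_ring L"
proof -
  have M: "ext P = {\<zero>\<^bsub>L\<^esub>}"
  proof (intro equalityI subsetI)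
    fix x assume "x \<in> ext P"
    then obtain a s where as: "x = fr a s" "a \<in> P" "s \<in> S" unfolding ext_def by blast
    then have "a = 0" using assms by simp
    then show "x \<in> {\<zero>\<^bsub>L\<^esub>}" using as(1) fr_eq_zero_iff[OF zero_in as(3)] by simp
  next
    fix x assume "x \<in> {\<zero>\<^bsub>L\<^esub>}"
    then show "x \<in> ext P" using fr_in_max_iff[OF zero_in one_S] prime_setD(2)[OF prime] zero_L by simp
  qed
  note height_zero[OF assms]
  moreover have "embedding_dim L = 0"
    unfolding embedding_dim_def local_max_ideal_L M
    by (rule Least_eq_0) (intro exI[of _ "{}"], simp add: L.genideal_empty)
  moreover have "noetherian_ring L"
  proof (rule L.noetherian_ringI)
    fix I assume I: "ideal I L"
    show "\<exists>B\<subseteq>carrier L. finite B \<and> I = genideal L B"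
    proof (cases "I \<subseteq> ext P")
      case True
      then have "I = {\<zero>\<^bsub>L\<^esub>}" using I M unfolding L.ideal_iff by blast
      then show ?thesis by (intro exI[of _ "{}"]) (simp add: L.genideal_empty)
    next
      case False
      then have "I = carrier L" by (rule ideal_not_in_max[OF I])
      then show ?thesis using L.genideal_one by (intro exI[of _ "{\<one>\<^bsub>L\<^esub>}"]) auto
    qed
  qed
  ultimately show ?thesis unfolding regular_local_ring_def krull_dim_L using local_ring_L
    by (simp add: zero_enat_def)
qed

text \<open>The hypothesis says that every nonzero element is a unit of \<open>L\<close> times a power of \<open>\<pi>\<close>. Then the
  nonzero ideals of \<open>L\<close> are generated by powers of \<open>\<pi>\<close>, so \<open>L\<close> is a discrete valuation ring.\<close>
lemma dvr_criterion:
  assumes pi: "\<pi> \<in> P" "\<pi> \<noteq> 0" and fac: "\<And>a. a \<in> A \<Longrightarrow> a \<noteq> 0 \<Longrightarrow> \<exists>k. \<exists>s\<in>S. \<exists>b\<in>S. s * a = \<pi> ^ k * b"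
  shows "regular_local_ring L" "height (subring_of A) P \<le> enat 1"
proof -
  have piA: "\<pi> \<in> A" using pi(1) prime_setD(1)[OF prime] by blast
  have pw: "\<pi> ^ k \<in> A" for k using power_in[OF piA] .
  have ht: "P' = {0}" if P': "prime_set P'" "P' \<subset> P" for P'
  proof (rule ccontr)
    assume "P' \<noteq> {0}"
    then obtain a where a: "a \<in> P'" "a \<noteq> 0" using prime_setD(2)[OF P'(1)] by blast
    then have aA: "a \<in> A" using prime_setD(1)[OF P'(1)] by blast
    obtain k s b where ksb: "s \<in> S" "b \<in> S" "s * a = \<pi> ^ k * b" using fac[OF aA a(2)] by blast
    have "\<pi> ^ k * b \<in> P'" using prime_setD(4)[OF P'(1) a(1) S_A[OF ksb(1)]] ksb(3) by simp
    then have "\<pi> ^ k \<in> P'" using prime_setD(6)[OF P'(1) pw S_A[OF ksb(2)]] ksb(2) P'(2) by blast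
    then have piP': "\<pi> \<in> P'" by (rule prime_set_power[OF P'(1) piA])
    have "P \<subseteq> P'"
    proof
      fix x assume x: "x \<in> P"
      show "x \<in> P'"
      proof (cases "x = 0")
        case True then show ?thesis using prime_setD(2)[OF P'(1)] by simp
      next
        case False
        have xA: "x \<in> A" using x prime_setD(1)[OF prime] by blast
        obtain k s b where *: "s \<in> S" "b \<in> S" "s * x = \<pi> ^ k * b" using fac[OF xA False] by blast
        have "k \<noteq> 0"
        proof
          assume "k = 0"
          then have "b \<in> P" using *(3) prime_setD(4)[OF prime x S_A[OF *(1)]] by simp
          then show False using *(2) by blast
        qed
        then obtain m where m: "k = Suc m" using not0_implies_Suc by blast
        have "s * x = (\<pi> ^ m * b) * \<pi>" using *(3) m by (simp add: ac_simps)
        also have "\<dots> \<in> P'" using prime_setD(4)[OF P'(1) piP'] mult_in[OF pw S_A[OF *(2)]] by blast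
        finally show ?thesis using prime_setD(6)[OF P'(1) S_A[OF *(1)] xA] *(1) P'(2) by blast
      qed
    qed
    then show False using P'(2) by blast
  qed
  then show hle: "height (subring_of A) P \<le> enat 1" by (rule height_le_oneI)
  have "P \<noteq> {0}" using pi by blast
  then have hge: "enat 1 \<le> height (subring_of A) P"
  proof -
    assume ne: "P \<noteq> {0}"
    define C where "C i = (if i = 0 then {0} else P)" for i :: nat
    have "{0} \<subset> P" using ne prime_setD(2)[OF prime] by blast
    then have "prime_chain (subring_of A) 1 C"
      unfolding prime_chain_def primeideal_iff_prime_set C_def using prime prime_set_zero by auto
    moreover have "C 1 = P" by (simp add: C_def)
    ultimately show ?thesis unfolding height_def by (intro Sup_upper) blast
  qed
  \<comment> \<open>a nonzero ideal is generated by the least power of \<open>\<pi>\<close> that it contains\<close>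
  have pid: "\<exists>k. I = genideal L {fr (\<pi> ^ k) 1}" if I: "ideal I L" "I \<noteq> {\<zero>\<^bsub>L\<^esub>}" for I
  proof -
    have Ic: "I \<subseteq> carrier L" "\<zero>\<^bsub>L\<^esub> \<in> I" "\<And>a x. a \<in> I \<Longrightarrow> x \<in> carrier L \<Longrightarrow> x \<otimes>\<^bsub>L\<^esub> a \<in> I"
      using I(1) unfolding L.ideal_iff by blast+
    have mem: "\<exists>k. fr (\<pi> ^ k) 1 \<in> I \<and> (\<exists>u\<in>S. \<exists>c\<in>A. u * a = c * \<pi> ^ k)"
      if a: "fr a t \<in> I" "a \<in> A" "t \<in> S" "a \<noteq> 0" for a t
    proof -
      obtain k s b where ksb: "s \<in> S" "b \<in> S" "s * a = \<pi> ^ k * b" using fac[OF a(2,4)] by blast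
      have "fr (s * t) b \<otimes>\<^bsub>L\<^esub> fr a t \<in> I"
        by (rule Ic(3)[OF a(1) fr_closed[OF mult_in[OF S_A[OF ksb(1)] S_A[OF a(3)]] ksb(2)]])
      also have "fr (s * t) b \<otimes>\<^bsub>L\<^esub> fr a t = fr (s * t * a) (b * t)"
        by (rule mult_L[OF mult_in[OF S_A[OF ksb(1)] S_A[OF a(3)]] ksb(2) a(2,3)])
      also have "\<dots> = fr (\<pi> ^ k) 1"
      proof (subst fr_eq_iff)
        show "s * t * a \<in> A" by (intro mult_in S_A[OF ksb(1)] S_A[OF a(3)] a(2))
        show "b * t \<in> S" by (rule mult_S[OF ksb(2) a(3)])
        show "\<pi> ^ k \<in> A" "1 \<in> S" by (rule pw, rule one_S)
        have "s * t * a * 1 = t * (s * a)" by (simp add: ac_simps)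
        also have "\<dots> = \<pi> ^ k * (b * t)" unfolding ksb(3) by (simp add: ac_simps)
        finally show "s * t * a * 1 = \<pi> ^ k * (b * t)" .
      qed
      finally have "fr (\<pi> ^ k) 1 \<in> I" .
      moreover have "s * a = b * \<pi> ^ k" using ksb(3) by (simp add: mult.commute)
      ultimately show ?thesis using ksb(1) S_A[OF ksb(2)] by blast
    qed
    obtain x where x: "x \<in> I" "x \<noteq> \<zero>\<^bsub>L\<^esub>" using I(2) Ic(2) by blast
    then have "x \<in> carrier L" using Ic(1) by blast
    then obtain a t where at: "x = fr a t" "a \<in> A" "t \<in> S" by (rule carrierE)
    have "a \<noteq> 0" using x(2) at fr_eq_zero_iff by blast
    then obtain k0 where k0: "fr (\<pi> ^ k0) 1 \<in> I" using mem[of a t] at x(1) by blast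
    define k where "k = (LEAST k. fr (\<pi> ^ k) 1 \<in> I)"
    have k: "fr (\<pi> ^ k) 1 \<in> I" unfolding k_def by (rule LeastI[of _ k0]) (rule k0)
    have kmin: "k \<le> m" if "fr (\<pi> ^ m) 1 \<in> I" for m unfolding k_def by (rule Least_le) (rule that)
    have "I \<subseteq> genideal L {fr (\<pi> ^ k) 1}"
    proof
      fix y assume y: "y \<in> I"
      then have "y \<in> carrier L" using Ic(1) by blast
      then obtain b t where bt: "y = fr b t" "b \<in> A" "t \<in> S" by (rule carrierE)
      show "y \<in> genideal L {fr (\<pi> ^ k) 1}" unfolding bt(1) fr_in_genideal_iff[OF pw one_S bt(2,3)]
      proof (cases "b = 0")
        case True
        then show "\<exists>u\<in>S. \<exists>c\<in>A. u * b = c * \<pi> ^ k" using one_S zero_in by (intro bexI[of _ 1] bexI[of _ 0]) auto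
      next
        case False
        then obtain m u c where m: "fr (\<pi> ^ m) 1 \<in> I" "u \<in> S" "c \<in> A" "u * b = c * \<pi> ^ m"
          using mem[of b t] bt y by blast
        then obtain j where j: "m = j + k" using kmin le_Suc_ex by (metis add.commute)
        have "u * b = (c * \<pi> ^ j) * \<pi> ^ k" using m(4) by (simp add: j power_add ac_simps)
        then show "\<exists>u\<in>S. \<exists>c\<in>A. u * b = c * \<pi> ^ k" using m(2) mult_in[OF m(3) pw] by blast
      qed
    qed
    moreover have "genideal L {fr (\<pi> ^ k) 1} \<subseteq> I" using k by (intro L.genideal_minimal[OF I(1)]) simp
    ultimately show ?thesis by blast
  qed
  have noeth: "noetherian_ring L"
  proof (rule L.noetherian_ringI)
    fix I assume I: "ideal I L"
    show "\<exists>B\<subseteq>carrier L. finite B \<and> I = genideal L B"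
    proof (cases "I = {\<zero>\<^bsub>L\<^esub>}")
      case True
      then show ?thesis by (intro exI[of _ "{}"]) (simp add: L.genideal_empty)
    next
      case False
      then obtain k where "I = genideal L {fr (\<pi> ^ k) 1}" using pid[OF I] by blast
      then show ?thesis using fr_closed[OF pw one_S] by (intro exI[of _ "{fr (\<pi> ^ k) 1}"]) auto
    qed
  qed
  have M0: "ext P \<noteq> {\<zero>\<^bsub>L\<^esub>}"
    using fr_in_max_iff[OF piA one_S] fr_eq_zero_iff[OF piA one_S] pi by blast
  have emb: "embedding_dim L = 1"
    unfolding embedding_dim_def local_max_ideal_L
  proof (rule Least_equality)
    obtain k where k: "ext P = genideal L {fr (\<pi> ^ k) 1}" using pid[OF ext_ideal M0] by blast
    then show "\<exists>X\<subseteq>carrier L. finite X \<and> card X = 1 \<and> genideal L X = ext P"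
      using fr_closed[OF pw one_S] by (intro exI[of _ "{fr (\<pi> ^ k) 1}"]) auto
    fix n assume "\<exists>X\<subseteq>carrier L. finite X \<and> card X = n \<and> genideal L X = ext P"
    then obtain X where X: "finite X" "card X = n" "genideal L X = ext P" by blast
    show "1 \<le> n"
    proof (rule ccontr)
      assume "\<not> 1 \<le> n"
      then have "card X = 0" using X(2) by simp
      then have "X = {}" using X(1) by simp
      then show False using X(3) M0 L.genideal_empty by simp
    qed
  qed
  have "krull_dim L = enat 1" unfolding krull_dim_L using hle hge by (rule antisym)
  then show "regular_local_ring L" unfolding regular_local_ring_def using local_ring_L noeth emb by simp
qed

text \<open>The embedding dimension is at most one, and the maximal ideal is not zero.\<close>
lemma regular_imp_principal:
  assumes "regular_local_ring L" "height (subring_of A) P \<le> enat 1" "P \<noteq> {0}"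
  obtains \<pi> where "\<pi> \<in> P" "\<And>a. a \<in> P \<Longrightarrow> \<exists>u\<in>S. \<exists>c\<in>A. u * a = c * \<pi>"
proof -
  have emb: "embedding_dim L \<le> 1"
    using assms(1,2) unfolding regular_local_ring_def krull_dim_L by (metis enat_ord_simps(1))
  interpret N: noetherian_ring L using assms(1) unfolding regular_local_ring_def by simp
  define Pr where "Pr n \<longleftrightarrow> (\<exists>X\<subseteq>carrier L. finite X \<and> card X = n \<and> genideal L X = ext P)" for n
  obtain B where "B \<subseteq> carrier L" "finite B" "ext P = genideal L B" using N.finetely_gen[OF ext_ideal] by blast
  then have "Pr (card B)" unfolding Pr_def by blast
  then have "Pr (embedding_dim L)" unfolding embedding_dim_def local_max_ideal_L Pr_def[symmetric] by (rule LeastI)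
  then obtain X where X: "X \<subseteq> carrier L" "finite X" "card X = embedding_dim L" "genideal L X = ext P"
    unfolding Pr_def by blast
  obtain f where f: "f \<in> P" "f \<noteq> 0" using assms(3) prime_setD(2)[OF prime] by blast
  have fA: "f \<in> A" using f(1) prime_setD(1)[OF prime] by blast
  have "X \<noteq> {}"
  proof
    assume "X = {}"
    then have "ext P = {\<zero>\<^bsub>L\<^esub>}" using X(4) L.genideal_empty by simp
    then show False using fr_in_max_iff[OF fA one_S] fr_eq_zero_iff[OF fA one_S] f by blast
  qed
  then have "card X = 1" using X(2,3) emb card_gt_0_iff[of X] by simp
  then obtain x where x: "X = {x}" by (rule card_1_singletonE)
  then have "x \<in> carrier L" using X(1) by blast
  then obtain \<pi> s where ps: "x = fr \<pi> s" "\<pi> \<in> A" "s \<in> S" by (rule carrierE)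
  have "x \<in> ext P" using L.genideal_self[OF X(1)] X(4) x by blast
  then have "\<pi> \<in> P" using fr_in_max_iff ps by blast
  moreover have "\<exists>u\<in>S. \<exists>c\<in>A. u * a = c * \<pi>" if a: "a \<in> P" for a
  proof -
    have aA: "a \<in> A" using a prime_setD(1)[OF prime] by blast
    then have "fr a 1 \<in> genideal L {fr \<pi> s}" using fr_in_max_iff[OF aA one_S] a X(4) x ps(1) by simp
    then show ?thesis using fr_in_genideal_iff[OF ps(2,3) aA one_S] by blast
  qed
  ultimately show ?thesis using that by blast
qed

end

section \<open>Laurent polynomials\<close>

definition part :: "'a set \<Rightarrow> ('a \<Rightarrow>\<^sub>0 'k::zero) \<Rightarrow> 'a \<Rightarrow>\<^sub>0 'k" where
  "part X f = Poly_Mapping.mapp (\<lambda>x c. if x \<in> X then c else 0) f"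

lemma lookup_part: "Poly_Mapping.lookup (part X f) x = (if x \<in> X then Poly_Mapping.lookup f x else 0)"
  by (auto simp: part_def lookup_mapp when_def in_keys_iff)

lemma keys_part: "Poly_Mapping.keys (part X f) = Poly_Mapping.keys f \<inter> X"
  by (auto simp: in_keys_iff lookup_part split: if_splits)

lemma part_split: "f = part X f + part (- X) (f :: 'a \<Rightarrow>\<^sub>0 'k::comm_ring_1)"
  by (rule poly_mapping_eqI) (simp add: lookup_part lookup_add)

lemma part_add_eq:
  assumes "Poly_Mapping.keys x \<subseteq> X" "Poly_Mapping.keys y \<subseteq> - X"
  shows "part X (x + y) = (x :: 'a \<Rightarrow>\<^sub>0 'k::comm_ring_1)"
proof (rule poly_mapping_eqI)
  fix k show "Poly_Mapping.lookup (part X (x + y)) k = Poly_Mapping.lookup x k"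
  proof (cases "k \<in> X")
    case True
    then have "k \<notin> Poly_Mapping.keys y" using assms(2) by blast
    then show ?thesis using True by (simp add: lookup_part lookup_add in_keys_iff)
  next
    case False
    then have "k \<notin> Poly_Mapping.keys x" using assms(1) by blast
    then show ?thesis using False by (simp add: lookup_part in_keys_iff)
  qed
qed

lemma keys_diff_subset:
  "Poly_Mapping.keys (f - g) \<subseteq> Poly_Mapping.keys f \<union> Poly_Mapping.keys (g :: 'a \<Rightarrow>\<^sub>0 'k::comm_ring_1)"
  by (auto simp: in_keys_iff lookup_minus)

lemma keys_mult_in:
  assumes "Poly_Mapping.keys f \<subseteq> X" "Poly_Mapping.keys g \<subseteq> Y" "\<And>x y. x \<in> X \<Longrightarrow> y \<in> Y \<Longrightarrow> x + y \<in> Z"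
  shows "Poly_Mapping.keys (f * g) \<subseteq> Z"
  using keys_mult[of f g] assms by blast

lemma finite_keys_eq_zero: "Poly_Mapping.keys f = {} \<longleftrightarrow> (f :: 'a \<Rightarrow>\<^sub>0 'k::zero) = 0"
  by (metis keys_zero poly_mapping_eqI in_keys_iff empty_iff lookup_zero)

abbreviation monom :: "int ^ 'n \<Rightarrow> (int ^ 'n) \<Rightarrow>\<^sub>0 'k::field" where
  "monom a \<equiv> Poly_Mapping.single a 1"

lemma monom_mult: "monom a * monom b = monom (a + b)" by (simp add: mult_single)
lemma monom_cancel: "monom (- a) * (monom a * f) = f" "monom a * (monom (- a) * f) = f"
  by (simp_all add: mult.assoc[symmetric] monom_mult)

lemma keys_monom_mult:
  fixes f :: "(int ^ 'n) \<Rightarrow>\<^sub>0 'k::field"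
  shows "Poly_Mapping.keys (monom a * f) = (+) a ` Poly_Mapping.keys f"
proof -
  have sub: "Poly_Mapping.keys (monom a * f) \<subseteq> (+) a ` Poly_Mapping.keys f" for a and f :: "(int ^ 'n) \<Rightarrow>\<^sub>0 'k"
    by (rule keys_mult_in[of _ "{a}" _ "Poly_Mapping.keys f"]) auto
  moreover have "(+) a ` Poly_Mapping.keys f \<subseteq> Poly_Mapping.keys (monom a * f)"
  proof
    fix x assume "x \<in> (+) a ` Poly_Mapping.keys f"
    then obtain y where y: "x = a + y" "y \<in> Poly_Mapping.keys f" by blast
    then have "y \<in> Poly_Mapping.keys (monom (- a) * (monom a * f))" by (simp only: monom_cancel)
    then have "y \<in> (+) (- a) ` Poly_Mapping.keys (monom a * f)" using sub by blast
    then show "x \<in> Poly_Mapping.keys (monom a * f)" using y(1) by auto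
  qed
  ultimately show ?thesis by blast
qed

text \<open>Lattices have unique products: filter both supports successively by maximal coordinates.\<close>
lemma unique_sum:
  fixes A B :: "(int ^ 'n) set"
  assumes "finite A" "finite B" "A \<noteq> {}" "B \<noteq> {}"
  shows "\<exists>a\<in>A. \<exists>b\<in>B. \<forall>x\<in>A. \<forall>y\<in>B. x + y = a + b \<longrightarrow> x = a \<and> y = b"
proof -
  have "\<exists>A' B'. A' \<subseteq> A \<and> B' \<subseteq> B \<and> A' \<noteq> {} \<and> B' \<noteq> {} \<and>
      (\<forall>x\<in>A'. \<forall>y\<in>A'. \<forall>i\<in>J. x $ i = y $ i) \<and> (\<forall>x\<in>B'. \<forall>y\<in>B'. \<forall>i\<in>J. x $ i = y $ i) \<and>
      (\<forall>a\<in>A. \<forall>b\<in>B. \<forall>a'\<in>A'. \<forall>b'\<in>B'. a + b = a' + b' \<longrightarrow> a \<in> A' \<and> b \<in> B')"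
    if "finite J" for J :: "'n set"
    using that
  proof (induction J rule: finite_induct)
    case empty
    then show ?case using assms by (intro exI[of _ A] exI[of _ B]) auto
  next
    case (insert j J)
    then obtain A' B' where IH: "A' \<subseteq> A" "B' \<subseteq> B" "A' \<noteq> {}" "B' \<noteq> {}"
      "\<forall>x\<in>A'. \<forall>y\<in>A'. \<forall>i\<in>J. x $ i = y $ i" "\<forall>x\<in>B'. \<forall>y\<in>B'. \<forall>i\<in>J. x $ i = y $ i"
      "\<forall>a\<in>A. \<forall>b\<in>B. \<forall>a'\<in>A'. \<forall>b'\<in>B'. a + b = a' + b' \<longrightarrow> a \<in> A' \<and> b \<in> B'"
      by (elim exE conjE)
    define m where "m = Max ((\<lambda>x. x $ j) ` A')"
    define n where "n = Max ((\<lambda>x. x $ j) ` B')"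
    have fin: "finite A'" "finite B'" using IH(1,2) assms(1,2) finite_subset by blast+
    have mle: "x $ j \<le> m" if "x \<in> A'" for x unfolding m_def using fin that by (intro Max_ge) auto
    have nle: "x $ j \<le> n" if "x \<in> B'" for x unfolding n_def using fin that by (intro Max_ge) auto
    let ?A = "{x\<in>A'. x $ j = m}" and ?B = "{x\<in>B'. x $ j = n}"
    have "m \<in> (\<lambda>x. x $ j) ` A'" unfolding m_def using fin IH(3) by (intro Max_in) auto
    then have 3: "?A \<noteq> {}" by force
    have "n \<in> (\<lambda>x. x $ j) ` B'" unfolding n_def using fin IH(4) by (intro Max_in) auto
    then have 4: "?B \<noteq> {}" by force
    have 7: "\<forall>a\<in>A. \<forall>b\<in>B. \<forall>a'\<in>?A. \<forall>b'\<in>?B. a + b = a' + b' \<longrightarrow> a \<in> ?A \<and> b \<in> ?B"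
    proof (intro ballI impI)
      fix a b a' b' assume that: "a \<in> A" "b \<in> B" "a' \<in> ?A" "b' \<in> ?B" "a + b = a' + b'"
      have ab: "a \<in> A'" "b \<in> B'" using IH(7) that by auto
      have "(a + b) $ j = (a' + b') $ j" using that(5) by simp
      then have "a $ j + b $ j = m + n" using that(3,4) by simp
      then show "a \<in> ?A \<and> b \<in> ?B" using ab mle[OF ab(1)] nle[OF ab(2)] by auto
    qed
    have 1: "?A \<subseteq> A" "?B \<subseteq> B" using IH(1,2) by auto
    have 5: "\<forall>x\<in>?A. \<forall>y\<in>?A. \<forall>i\<in>insert j J. x $ i = y $ i" using IH(5) by simp
    have 6: "\<forall>x\<in>?B. \<forall>y\<in>?B. \<forall>i\<in>insert j J. x $ i = y $ i" using IH(6) by simp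
    show ?case by (rule exI[of _ ?A], rule exI[of _ ?B], intro conjI 1 3 4 5 6 7)
  qed
  from this[OF finite[of UNIV]] show ?thesis
  proof (elim exE conjE)
    fix A' B' assume *: "A' \<subseteq> A" "B' \<subseteq> B" "A' \<noteq> {}" "B' \<noteq> {}"
      "\<forall>x\<in>A'. \<forall>y\<in>A'. \<forall>i\<in>UNIV. x $ i = y $ i" "\<forall>x\<in>B'. \<forall>y\<in>B'. \<forall>i\<in>UNIV. x $ i = y $ i"
      "\<forall>a\<in>A. \<forall>b\<in>B. \<forall>a'\<in>A'. \<forall>b'\<in>B'. a + b = a' + b' \<longrightarrow> a \<in> A' \<and> b \<in> B'"
  from *(3) obtain a where a: "a \<in> A'" unfolding ex_in_conv[symmetric] ..
  from *(4) obtain b where b: "b \<in> B'" unfolding ex_in_conv[symmetric] ..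
  note ab = a b
  have xa: "x = a" if "x \<in> A'" for x
    unfolding vec_eq_iff using *(5)[rule_format, OF that ab(1)] by simp
  have yb: "y = b" if "y \<in> B'" for y
    unfolding vec_eq_iff using *(6)[rule_format, OF that ab(2)] by simp
  have "x = a \<and> y = b" if "x \<in> A" "y \<in> B" "x + y = a + b" for x y
    using *(7)[rule_format, OF that(1,2) ab that(3)] xa yb by simp
  moreover have "a \<in> A" "b \<in> B" using ab *(1,2) by auto
  ultimately show ?thesis by blast
  qed
qed

text \<open>The coefficient of the product at a uniquely represented sum of exponents is the product of two
  nonzero coefficients.\<close>
lemma laurent_mult_nonzero:
  fixes f g :: "(int ^ 'n) \<Rightarrow>\<^sub>0 'k::field"
  assumes "f \<noteq> 0" "g \<noteq> 0" shows "f * g \<noteq> 0"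
proof -
  have ne: "Poly_Mapping.keys f \<noteq> {}" "Poly_Mapping.keys g \<noteq> {}"
    using assms by (simp_all add: finite_keys_eq_zero)
  obtain a b where ab: "a \<in> Poly_Mapping.keys f" "b \<in> Poly_Mapping.keys g"
    and u: "\<And>x y. x \<in> Poly_Mapping.keys f \<Longrightarrow> y \<in> Poly_Mapping.keys g \<Longrightarrow> x + y = a + b \<Longrightarrow> x = a \<and> y = b"
    using unique_sum[OF finite_keys finite_keys ne] by metis
  let ?c = "Poly_Mapping.lookup f a" and ?d = "Poly_Mapping.lookup g b"
  have f: "f = Poly_Mapping.single a ?c + part (- {a}) f"
    by (rule poly_mapping_eqI) (auto simp: lookup_add lookup_part lookup_single when_def)
  have g: "g = Poly_Mapping.single b ?d + part (- {b}) g"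
    by (rule poly_mapping_eqI) (auto simp: lookup_add lookup_part lookup_single when_def)
  have "f * g = Poly_Mapping.single a ?c * g + part (- {a}) f * g"
    by (subst f) (simp add: distrib_right)
  also have "Poly_Mapping.single a ?c * g = Poly_Mapping.single a ?c * Poly_Mapping.single b ?d
      + Poly_Mapping.single a ?c * part (- {b}) g"
    by (subst g) (simp add: distrib_left)
  finally have fg: "f * g = Poly_Mapping.single (a + b) (?c * ?d)
      + Poly_Mapping.single a ?c * part (- {b}) g + part (- {a}) f * g"
    by (simp add: mult_single)
  have "a + b \<notin> Poly_Mapping.keys (Poly_Mapping.single a ?c * part (- {b}) g)"
  proof
    assume "a + b \<in> Poly_Mapping.keys (Poly_Mapping.single a ?c * part (- {b}) g)"
    then have "a + b \<in> (+) a ` (Poly_Mapping.keys g \<inter> - {b})"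
      using keys_mult[of "Poly_Mapping.single a ?c" "part (- {b}) g"]
      by (auto simp: keys_part split: if_splits)
    then show False by auto
  qed
  moreover have "a + b \<notin> Poly_Mapping.keys (part (- {a}) f * g)"
  proof
    assume "a + b \<in> Poly_Mapping.keys (part (- {a}) f * g)"
    then obtain x y where "x \<in> Poly_Mapping.keys f \<inter> - {a}" "y \<in> Poly_Mapping.keys g" "a + b = x + y"
      using keys_mult[of "part (- {a}) f" g] unfolding keys_part by blast
    then show False using u[of x y] by auto
  qed
  ultimately have "Poly_Mapping.lookup (f * g) (a + b) = ?c * ?d"
    unfolding fg lookup_add by (simp add: in_keys_iff)
  also have "\<dots> \<noteq> 0" using ab by (simp add: in_keys_iff)
  finally show ?thesis by auto
qed

lemma laurent_mult_cancel:
  fixes f g h :: "(int ^ 'n) \<Rightarrow>\<^sub>0 'k::field"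
  assumes "f \<noteq> 0" "f * g = f * h" shows "g = h"
  using laurent_mult_nonzero[of f "g - h"] assms by (auto simp: right_diff_distrib)

abbreviation supported :: "(int ^ 'n) set \<Rightarrow> ((int ^ 'n) \<Rightarrow>\<^sub>0 'k::field) set" where
  "supported M \<equiv> {p. Poly_Mapping.keys p \<subseteq> M}"

lemma subdomain_supported:
  assumes "add_submonoid M" shows "subdomain (supported M :: ((int ^ 'n) \<Rightarrow>\<^sub>0 'k::field) set)"
proof
  show "1 \<in> (supported M :: ((int ^ 'n) \<Rightarrow>\<^sub>0 'k) set)" using submonoid_zero[OF assms] by simp
  fix a b :: "(int ^ 'n) \<Rightarrow>\<^sub>0 'k" assume ab: "a \<in> supported M" "b \<in> supported M"
  show "a - b \<in> supported M" using ab keys_diff_subset[of a b] by blast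
  show "a * b \<in> supported M"
    using keys_mult_in[of a M b M M] submonoid_add[OF assms] ab by blast
  show "a * b = 0 \<Longrightarrow> a = 0 \<or> b = 0" using laurent_mult_nonzero by blast
qed

text \<open>Multiplication by \<open>b\<close> respects the decomposition of exponents into cosets of \<open>G\<close>, so the part of \<open>c\<close>
  outside \<open>G\<close> is annihilated by \<open>b\<close>.\<close>
lemma supported_dvd_closed:
  assumes "add_subgroup (G :: (int ^ 'n) set)" "b \<in> supported G" "b \<noteq> 0" "b * c \<in> supported G"
  shows "c \<in> (supported G :: ((int ^ 'n) \<Rightarrow>\<^sub>0 'k::field) set)"
proof -
  note G = subgroup_submonoid[OF assms(1)]
  have 1: "Poly_Mapping.keys (b * part G c) \<subseteq> G"
    by (rule keys_mult_in[of _ G _ G]) (use assms(2) submonoid_add[OF G] in \<open>auto simp: keys_part\<close>)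
  have 2: "Poly_Mapping.keys (b * part (- G) c) \<subseteq> - G"
  proof (rule keys_mult_in[of _ G _ "- G"])
    fix x y assume xy: "x \<in> G" "y \<in> - G"
    show "x + y \<in> - G"
    proof
      assume "x + y \<in> G"
      then have "(x + y) - x \<in> G" using subgroup_diff[OF assms(1)] xy(1) by blast
      then show False using xy(2) by simp
    qed
  qed (use assms(2) in \<open>auto simp: keys_part\<close>)
  have "b * c = b * part G c + b * part (- G) c"
    by (subst part_split[of c G]) (simp add: distrib_left)
  then have "b * part (- G) c = b * c - b * part G c" by simp
  also have "Poly_Mapping.keys \<dots> \<subseteq> G" using keys_diff_subset[of "b * c" "b * part G c"] 1 assms(4) by blast
  finally have "Poly_Mapping.keys (b * part (- G) c) = {}" using 2 by blast
  then have "part (- G) c = 0"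
    using laurent_mult_nonzero[OF assms(3)] by (auto simp: finite_keys_eq_zero)
  then have "c = part G c" using part_split[of c G] by simp
  then have "Poly_Mapping.keys c \<subseteq> G" using keys_part[of G c] by auto
  then show ?thesis by simp
qed

section \<open>Prime factorization\<close>

text \<open>The divisibility below is that of the ambient ring; it agrees with divisibility in \<open>A\<close>.\<close>
locale dvd_closed_subdomain = subdomain A for A :: "'a::comm_ring_1 set" +
  assumes dvd_closed: "b \<in> A \<Longrightarrow> b \<noteq> 0 \<Longrightarrow> b * c \<in> A \<Longrightarrow> c \<in> A"
begin

definition prime_in :: "'a \<Rightarrow> bool" where
  "prime_in p \<longleftrightarrow> p \<in> A \<and> p \<noteq> 0 \<and> \<not> p dvd 1 \<and> (\<forall>a\<in>A. \<forall>b\<in>A. p dvd a * b \<longrightarrow> p dvd a \<or> p dvd b)"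

text \<open>A product of \<open>n\<close> prime elements and a unit; the number \<open>n\<close> serves for inductions.\<close>
fun factors :: "nat \<Rightarrow> 'a \<Rightarrow> bool" where
  "factors 0 a \<longleftrightarrow> a \<in> A \<and> a dvd 1"
| "factors (Suc n) a \<longleftrightarrow> (\<exists>p b. prime_in p \<and> b \<in> A \<and> a = p * b \<and> factors n b)"

definition factorial :: bool where
  "factorial \<longleftrightarrow> (\<forall>a\<in>A. a \<noteq> 0 \<longrightarrow> (\<exists>n. factors n a))"

lemma prime_in_D: "prime_in p \<Longrightarrow> p \<in> A" "prime_in p \<Longrightarrow> p \<noteq> 0" "prime_in p \<Longrightarrow> \<not> p dvd 1"
  "prime_in p \<Longrightarrow> a \<in> A \<Longrightarrow> b \<in> A \<Longrightarrow> p dvd a * b \<Longrightarrow> p dvd a \<or> p dvd b"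
  unfolding prime_in_def by blast+

lemma factors_in: "factors n a \<Longrightarrow> a \<in> A"
  by (induction n arbitrary: a) (auto intro: mult_in prime_in_D)

lemma unit_inverse:
  assumes "a \<in> A" "a dvd 1" obtains c where "c \<in> A" "a * c = 1"
proof -
  obtain c where c: "1 = a * c" using assms(2) by (rule dvdE)
  then have "a \<noteq> 0" by auto
  then show ?thesis using that dvd_closed[OF assms(1), of c] c one_in by simp
qed

lemma factors_mult: "factors n a \<Longrightarrow> factors m b \<Longrightarrow> factors (n + m) (a * b)"
proof (induction n arbitrary: a)
  case 0
  then have a: "a \<in> A" "a dvd 1" by auto
  show ?case using 0(2)
  proof (induction m arbitrary: b)
    case 0
    then have "b \<in> A" "b dvd 1" by auto
    then show ?case using a mult_in mult_dvd_mono[of a 1 b 1] by simp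
  next
    case (Suc m)
    then obtain p c where p: "prime_in p" "c \<in> A" "b = p * c" "factors m c" by auto
    then have "factors (0 + m) (a * c)" using Suc.IH by blast
    moreover have "a * b = p * (a * c)" using p(3) by (simp add: ac_simps)
    ultimately show ?case using p(1,2) mult_in[OF a(1)] by auto
  qed
next
  case (Suc n)
  then obtain p c where p: "prime_in p" "c \<in> A" "a = p * c" "factors n c" by auto
  have "factors (n + m) (c * b)" using Suc.IH[OF p(4) Suc.prems(2)] .
  moreover have "a * b = p * (c * b)" using p(3) by (simp add: ac_simps)
  ultimately show ?case using p(1,2) mult_in factors_in[OF Suc.prems(2)] by auto
qed

text \<open>Divisors of products of primes are such products: the saturation needed for Kaplansky's criterion.\<close>
lemma factors_saturated:
  assumes "factors n (a * b)" "a \<in> A" "b \<in> A"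
  shows "\<exists>m. factors m a"
  using assms
proof (induction n arbitrary: a b)
  case 0
  then have "a dvd 1" using dvd_mult_left by auto
  then show ?case using 0 by (intro exI[of _ 0]) simp
next
  case (Suc n)
  then obtain p c where p: "prime_in p" "c \<in> A" "a * b = p * c" "factors n c" by auto
  have "p dvd a * b" using p(3) by simp
  then consider "p dvd a" | "p dvd b" using prime_in_D(4)[OF p(1) Suc.prems(2,3)] by blast
  then show ?case
  proof cases
    case 1
    then obtain d where d: "a = p * d" by (rule dvdE)
    then have dA: "d \<in> A" using dvd_closed prime_in_D[OF p(1)] Suc.prems(2) by blast
    have "p * (d * b) = p * c" using p(3) d by (simp add: ac_simps)
    then have "d * b = c"
      using mult_cancel[OF mult_in[OF dA Suc.prems(3)] p(2) prime_in_D(1)[OF p(1)] prime_in_D(2)[OF p(1)]] by simp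
    then obtain m where "factors m d" using Suc.IH[of d b] p(4) dA Suc.prems(3) by blast
    then show ?thesis using d dA p(1) by (intro exI[of _ "Suc m"]) auto
  next
    case 2
    then obtain d where d: "b = p * d" by (rule dvdE)
    then have dA: "d \<in> A" using dvd_closed prime_in_D[OF p(1)] Suc.prems(3) by blast
    have "p * (a * d) = p * c" using p(3) d by (simp add: ac_simps)
    then have "a * d = c"
      using mult_cancel[OF mult_in[OF Suc.prems(2) dA] p(2) prime_in_D(1)[OF p(1)] prime_in_D(2)[OF p(1)]] by simp
    then show ?thesis using Suc.IH[of a d] p(4) dA Suc.prems(2) by blast
  qed
qed

lemma factors_cancel:
  assumes "factors n (q * b)" "prime_in q" "b \<in> A"
  shows "\<exists>m. n = Suc m \<and> factors m b"
  using assms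
proof (induction n arbitrary: b)
  case 0
  then have "q dvd 1" using dvd_mult_left by auto
  then show ?case using prime_in_D(3)[OF assms(2)] by blast
next
  case (Suc n)
  note qA = prime_in_D(1)[OF assms(2)] and q0 = prime_in_D(2)[OF assms(2)]
  obtain p c where p: "prime_in p" "c \<in> A" "q * b = p * c" "factors n c" using Suc.prems(1) by auto
  note pA = prime_in_D(1)[OF p(1)] and p0 = prime_in_D(2)[OF p(1)]
  have "q dvd p * c" using p(3)[symmetric] by simp
  then consider "q dvd p" | "q dvd c" using prime_in_D(4)[OF assms(2) pA p(2)] by blast
  then show ?case
  proof cases
    case 1
    then obtain d where d: "p = q * d" by (rule dvdE)
    then have dA: "d \<in> A" using dvd_closed qA q0 pA by blast
    have "p dvd q \<or> p dvd d" using prime_in_D(4)[OF p(1) qA dA] d by simp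
    then have du: "d dvd 1"
    proof
      assume "p dvd q"
      then obtain e where e: "q = p * e" by (rule dvdE)
      then have eA: "e \<in> A" using dvd_closed pA p0 qA by blast
      have "p * (e * d) = p * 1" using d e by (simp add: ac_simps)
      then have "e * d = 1" using mult_cancel[OF mult_in[OF eA dA] one_in pA p0] by simp
      then show ?thesis using dvd_triv_right[of d e] by simp
    next
      assume "p dvd d"
      then obtain e where e: "d = p * e" by (rule dvdE)
      then have eA: "e \<in> A" using dvd_closed pA p0 dA by blast
      have "p * (q * e) = p * 1" using d e by (metis mult.left_commute mult_1_right)
      then have "q * e = 1" using mult_cancel[OF mult_in[OF qA eA] one_in pA p0] by simp
      then have "q dvd 1" using dvd_triv_left[of q e] by simp
      then show ?thesis using prime_in_D(3)[OF assms(2)] by blast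
    qed
    have "q * b = q * (d * c)" using p(3) d by (simp add: ac_simps)
    then have "b = d * c" using mult_cancel[OF Suc.prems(3) mult_in[OF dA p(2)] qA q0] by simp
    moreover have "factors (0 + n) (d * c)" by (rule factors_mult) (use dA du p(4) in auto)
    ultimately show ?thesis by simp
  next
    case 2
    then obtain d where d: "c = q * d" by (rule dvdE)
    then have dA: "d \<in> A" using dvd_closed qA q0 p(2) by blast
    obtain m where m: "n = Suc m" "factors m d" using Suc.IH[of d] p(4) d assms(2) dA by blast
    have "q * b = q * (p * d)" using p(3) d by (simp add: ac_simps)
    then have "b = p * d" using mult_cancel[OF Suc.prems(3) mult_in[OF pA dA] qA q0] by simp
    then show ?thesis using m p(1) dA by auto
  qed
qed

text \<open>Kaplansky's criterion. If \<open>a\<close> is not a product of primes, neither is any multiple of it. An ideal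
  containing \<open>a\<close> and maximal among those avoiding the products of primes is a nonzero prime, hence
  contains a prime element, a contradiction.\<close>
lemma kaplansky:
  assumes "\<And>P. prime_set P \<Longrightarrow> P \<noteq> {0} \<Longrightarrow> \<exists>p\<in>P. prime_in p"
  shows factorial
  unfolding factorial_def
proof (intro ballI impI, rule ccontr)
  fix a assume a: "a \<in> A" "a \<noteq> 0" "\<not> (\<exists>n. factors n a)"
  define X where "X = {s. \<exists>n. factors n s}"
  define id where "id I \<longleftrightarrow> I \<subseteq> A \<and> a \<in> I \<and> (\<forall>x\<in>I. \<forall>y\<in>I. x + y \<in> I) \<and> (\<forall>x\<in>I. \<forall>c\<in>A. c * x \<in> I) \<and> I \<inter> X = {}" for I
  have "id {a * b | b. b \<in> A}" unfolding id_def
  proof (intro conjI ballI)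
    show "{a * b | b. b \<in> A} \<subseteq> A" using mult_in[OF a(1)] by blast
    show "a \<in> {a * b | b. b \<in> A}" using one_in by force
    show "x + y \<in> {a * b | b. b \<in> A}" if "x \<in> {a * b | b. b \<in> A}" "y \<in> {a * b | b. b \<in> A}" for x y
      using that add_in by (auto simp: distrib_left[symmetric])
    show "c * x \<in> {a * b | b. b \<in> A}" if "x \<in> {a * b | b. b \<in> A}" "c \<in> A" for x c
      using that mult_in by (auto simp: mult.left_commute[of c])
    show "{a * b | b. b \<in> A} \<inter> X = {}" using factors_saturated[OF _ a(1)] a(3) by (auto simp: X_def)
  qed
  then have ne: "{I. id I} \<noteq> {}" by blast
  have ch: "\<Union>C \<in> {I. id I}" if "C \<noteq> {}" "subset.chain {I. id I} C" for C
  proof -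
    have idC: "\<And>I. I \<in> C \<Longrightarrow> id I" and tot: "\<And>I J. I \<in> C \<Longrightarrow> J \<in> C \<Longrightarrow> I \<subseteq> J \<or> J \<subseteq> I"
      using that(2) unfolding subset.chain_def by auto
    show ?thesis unfolding mem_Collect_eq id_def
    proof (intro conjI ballI)
      show "\<Union>C \<subseteq> A" using idC unfolding id_def by blast
      show "a \<in> \<Union>C" using idC that(1) unfolding id_def by blast
      show "\<Union>C \<inter> X = {}" using idC unfolding id_def by blast
      show "c * x \<in> \<Union>C" if "x \<in> \<Union>C" "c \<in> A" for x c using that idC unfolding id_def by blast
      fix x y assume "x \<in> \<Union>C" "y \<in> \<Union>C"
      then obtain I J where "I \<in> C" "J \<in> C" "x \<in> I" "y \<in> J" by blast
      then obtain K where "K \<in> C" "x \<in> K" "y \<in> K" using tot by blast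
      then show "x + y \<in> \<Union>C" using idC[of K] unfolding id_def by blast
    qed
  qed
  obtain M where M: "id M" "\<And>I. id I \<Longrightarrow> M \<subseteq> I \<Longrightarrow> I = M"
    using subset_Zorn_nonempty[OF ne ch] by auto
  have MA: "M \<subseteq> A" and aM: "a \<in> M" and Madd: "\<And>x y. x \<in> M \<Longrightarrow> y \<in> M \<Longrightarrow> x + y \<in> M"
    and Mmult: "\<And>x c. x \<in> M \<Longrightarrow> c \<in> A \<Longrightarrow> c * x \<in> M" and MX: "M \<inter> X = {}"
    using M(1) unfolding id_def by blast+
  have X1: "1 \<in> X" unfolding X_def using one_in by (auto intro!: exI[of _ 0])
  have Xm: "s * t \<in> X" if "s \<in> X" "t \<in> X" for s t using that factors_mult unfolding X_def by blast
  have XA: "s \<in> A" if "s \<in> X" for s using that factors_in unfolding X_def by blast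
  have M0: "0 \<in> M" using Mmult[OF aM zero_in] by simp
  have meet: "\<exists>m\<in>M. \<exists>b\<in>A. m + x * b \<in> X" if x: "x \<in> A" "x \<notin> M" for x
  proof (rule ccontr)
    assume no: "\<not> ?thesis"
    let ?I = "{m + x * b | m b. m \<in> M \<and> b \<in> A}"
    have "id ?I" unfolding id_def
    proof (intro conjI ballI)
      show "?I \<subseteq> A" using MA mult_in[OF x(1)] add_in by blast
      have "a = a + x * 0" by simp
      then show "a \<in> ?I" using aM zero_in by blast
      show "?I \<inter> X = {}" using no by blast
    next
      fix u v assume "u \<in> ?I" "v \<in> ?I"
      then obtain m b n c where "u = m + x * b" "v = n + x * c" "m \<in> M" "n \<in> M" "b \<in> A" "c \<in> A" by blast
      then have "u + v = (m + n) + x * (b + c)" "m + n \<in> M" "b + c \<in> A"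
        using Madd add_in by (auto simp: algebra_simps)
      then show "u + v \<in> ?I" by blast
    next
      fix u c assume "u \<in> ?I" "c \<in> A"
      then obtain m b where "u = m + x * b" "m \<in> M" "b \<in> A" by blast
      then have "c * u = c * m + x * (c * b)" by (simp add: algebra_simps)
      moreover have "c * m \<in> M" "c * b \<in> A"
        using Mmult[OF \<open>m \<in> M\<close> \<open>c \<in> A\<close>] mult_in[OF \<open>c \<in> A\<close> \<open>b \<in> A\<close>] by auto
      ultimately show "c * u \<in> ?I" by blast
    qed
    moreover have "M \<subseteq> ?I"
    proof
      fix m assume "m \<in> M"
      moreover have "m = m + x * 0" by simp
      ultimately show "m \<in> ?I" using zero_in by blast
    qed
    ultimately have "?I = M" by (rule M(2))
    moreover have "x \<in> ?I"
    proof -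
      have "x = 0 + x * 1" by simp
      then show ?thesis using M0 one_in by blast
    qed
    ultimately show False using x(2) by simp
  qed
  have "prime_set M" unfolding prime_set_def
  proof (intro conjI ballI impI)
    show "1 \<notin> M" using X1 MX by blast
    fix x y assume xy: "x \<in> A" "y \<in> A" "x * y \<in> M"
    show "x \<in> M \<or> y \<in> M"
    proof (rule ccontr)
      assume "\<not> (x \<in> M \<or> y \<in> M)"
      then obtain m b n c where *: "m \<in> M" "b \<in> A" "m + x * b \<in> X" "n \<in> M" "c \<in> A" "n + y * c \<in> X"
        using meet xy(1,2) by metis
      have "(n + y * c) * m + ((x * b) * n + (b * c) * (x * y)) \<in> M"
        by (rule Madd[OF Mmult[OF *(1) XA[OF *(6)]]
            Madd[OF Mmult[OF *(4) mult_in[OF xy(1) *(2)]] Mmult[OF xy(3) mult_in[OF *(2,5)]]]])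
      also have "(n + y * c) * m + ((x * b) * n + (b * c) * (x * y)) = (m + x * b) * (n + y * c)"
        by (simp add: algebra_simps)
      finally show False using Xm[OF *(3,6)] MX by blast
    qed
  qed (use MA M0 Madd Mmult in auto)
  moreover have "M \<noteq> {0}" using aM a(2) by blast
  ultimately obtain p where p: "p \<in> M" "prime_in p" using assms by blast
  have "factors 1 p" unfolding One_nat_def factors.simps
    using p(2) one_in by (intro exI[of _ p] exI[of _ 1]) auto
  then have "p \<in> X" unfolding X_def by (intro CollectI exI)
  then show False using p(1) MX by auto
qed

lemma factors_prime_set:
  assumes "prime_set P" "factors n a" "a \<in> P" shows "\<exists>p\<in>P. prime_in p"
  using assms(2,3)
proof (induction n arbitrary: a)
  case 0
  then obtain c where "c \<in> A" "a * c = 1" using unit_inverse by auto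
  then have "1 \<in> P" using prime_setD(4)[OF assms(1) 0(2)] by (metis mult.commute)
  then show ?case using prime_setD(5)[OF assms(1)] by blast
next
  case (Suc n)
  then obtain p b where p: "prime_in p" "b \<in> A" "a = p * b" "factors n b" by auto
  then show ?case using prime_setD(6)[OF assms(1) prime_in_D(1)[OF p(1)] p(2)] Suc by blast
qed

end

section \<open>Laurent polynomial rings are factorial\<close>

text \<open>One step of the induction on the coordinates: \<open>G1 = G0 + \<int> t\<close>, with levels measured by the
  coordinate \<open>j\<close>. If \<open>t\<close> is not in \<open>G0\<close>, then \<open>K[G1]\<close> is the Laurent polynomial ring in the variable
  \<open>x\<^sup>t\<close> over \<open>K[G0]\<close>; otherwise both rings agree, and the arguments remain valid.\<close>
locale lattice_step =
  fixes G0 G1 :: "(int ^ 'n) set" and j :: 'n and t :: "int ^ 'n" and K :: "'k::field itself"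
  assumes G1: "add_subgroup G1" and G0_eq: "G0 = {x\<in>G1. x $ j = 0}"
    and t: "t \<in> G1" and levels: "\<And>x. x \<in> G1 \<Longrightarrow> \<exists>k. x $ j = k * t $ j"
begin

lemma G0: "add_subgroup G0"
  using G1 unfolding G0_eq add_subgroup_def add_submonoid_def by auto

lemma G0I: "x \<in> G1 \<Longrightarrow> x $ j = 0 \<Longrightarrow> x \<in> G0" unfolding G0_eq by simp

abbreviation A :: "((int ^ 'n) \<Rightarrow>\<^sub>0 'k) set" where "A \<equiv> supported G0"
abbreviation B :: "((int ^ 'n) \<Rightarrow>\<^sub>0 'k) set" where "B \<equiv> supported G1"

sublocale A: dvd_closed_subdomain A
  using subdomain_supported[OF subgroup_submonoid[OF G0]] supported_dvd_closed[OF G0]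
  unfolding dvd_closed_subdomain_def dvd_closed_subdomain_axioms_def by auto

sublocale B: dvd_closed_subdomain B
  using subdomain_supported[OF subgroup_submonoid[OF G1]] supported_dvd_closed[OF G1]
  unfolding dvd_closed_subdomain_def dvd_closed_subdomain_axioms_def by auto

lemma A_B: "A \<subseteq> B" unfolding G0_eq by auto

definition lev :: "int \<Rightarrow> (int ^ 'n) set" where "lev k = {x. x $ j = k}"
definition hi :: "((int ^ 'n) \<Rightarrow>\<^sub>0 'k) \<Rightarrow> int" where "hi f = Max ((\<lambda>x. x $ j) ` Poly_Mapping.keys f)"
definition lo :: "((int ^ 'n) \<Rightarrow>\<^sub>0 'k) \<Rightarrow> int" where "lo f = Min ((\<lambda>x. x $ j) ` Poly_Mapping.keys f)"
definition top_part :: "((int ^ 'n) \<Rightarrow>\<^sub>0 'k) \<Rightarrow> (int ^ 'n) \<Rightarrow>\<^sub>0 'k" where "top_part f = part (lev (hi f)) f"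

lemma le_hi: "x \<in> Poly_Mapping.keys f \<Longrightarrow> x $ j \<le> hi f" unfolding hi_def by (intro Max_ge) auto
lemma lo_le: "x \<in> Poly_Mapping.keys f \<Longrightarrow> lo f \<le> x $ j" unfolding lo_def by (intro Min_le) auto

lemma hi_attained:
  assumes "f \<noteq> 0" obtains x where "x \<in> Poly_Mapping.keys f" "x $ j = hi f"
proof -
  have "hi f \<in> (\<lambda>x. x $ j) ` Poly_Mapping.keys f"
    unfolding hi_def using assms by (intro Max_in) (auto simp: finite_keys_eq_zero)
  then show ?thesis using that by auto
qed

lemma lo_attained:
  assumes "f \<noteq> 0" obtains x where "x \<in> Poly_Mapping.keys f" "x $ j = lo f"
proof -
  have "lo f \<in> (\<lambda>x. x $ j) ` Poly_Mapping.keys f"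
    unfolding lo_def using assms by (intro Min_in) (auto simp: finite_keys_eq_zero)
  then show ?thesis using that by auto
qed

lemma top_part_nonzero: assumes "f \<noteq> 0" shows "top_part f \<noteq> 0"
proof -
  obtain x where "x \<in> Poly_Mapping.keys f" "x $ j = hi f" using hi_attained[OF assms] .
  then have "x \<in> Poly_Mapping.keys (top_part f)" by (simp add: top_part_def keys_part lev_def)
  then show ?thesis by auto
qed

lemma part_mult_level_zero:
  fixes u c :: "(int ^ 'n) \<Rightarrow>\<^sub>0 'k"
  assumes "Poly_Mapping.keys u \<subseteq> lev 0" shows "part (lev k) (u * c) = u * part (lev k) c"
proof -
  have "u * c = u * part (lev k) c + u * part (- lev k) c"
    by (subst part_split[of c "lev k"]) (simp add: distrib_left)
  moreover have "Poly_Mapping.keys (u * part (lev k) c) \<subseteq> lev k"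
    by (rule keys_mult_in[OF assms, of _ "lev k"]) (auto simp: keys_part lev_def)
  moreover have "Poly_Mapping.keys (u * part (- lev k) c) \<subseteq> - lev k"
    by (rule keys_mult_in[OF assms, of _ "- lev k"]) (auto simp: keys_part lev_def)
  ultimately show ?thesis using part_add_eq by metis
qed

lemma top_part_mult: "part (lev (hi f + hi g)) (f * g) = top_part f * top_part g"
proof -
  let ?f = "part (- lev (hi f)) f" and ?g = "part (- lev (hi g)) g"
  have low: "x $ j < hi f" if "x \<in> Poly_Mapping.keys (part (- lev (hi f)) f)" for x f
    using that le_hi[of x f] by (auto simp: keys_part lev_def)
  have "f * g = top_part f * top_part g + (top_part f * ?g + ?f * g)"
  proof -
    have f: "f = top_part f + ?f" and g: "g = top_part g + ?g"
      unfolding top_part_def by (rule part_split)+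
    have "f * g = top_part f * g + ?f * g" by (subst f) (rule distrib_right)
    also have "top_part f * g = top_part f * top_part g + top_part f * ?g" by (subst g) (rule distrib_left)
    finally show ?thesis by (simp add: add.assoc)
  qed
  moreover have "Poly_Mapping.keys (top_part f * top_part g) \<subseteq> lev (hi f + hi g)"
    by (rule keys_mult_in[of _ "lev (hi f)" _ "lev (hi g)"]) (auto simp: top_part_def keys_part lev_def)
  moreover have "Poly_Mapping.keys (top_part f * ?g + ?f * g) \<subseteq> - lev (hi f + hi g)"
  proof -
    have "Poly_Mapping.keys (top_part f * ?g) \<subseteq> - lev (hi f + hi g)"
      by (rule keys_mult_in[of _ "lev (hi f)" _ "{x. x $ j < hi g}"])
         (use low in \<open>auto simp: top_part_def keys_part lev_def\<close>)
    moreover have "Poly_Mapping.keys (?f * g) \<subseteq> - lev (hi f + hi g)"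
      by (rule keys_mult_in[of _ "{x. x $ j < hi f}" _ "{x. x $ j \<le> hi g}"])
         (use low le_hi in \<open>auto simp: lev_def\<close>)
    ultimately show ?thesis using keys_add[of "top_part f * ?g" "?f * g"] by blast
  qed
  ultimately show ?thesis using part_add_eq by metis
qed

text \<open>The leading coefficient, moved to level zero.\<close>
lemma lead_exists:
  assumes "f \<in> B" "f \<noteq> 0"
  shows "\<exists>k. hi f = k * t $ j \<and> monom (- (k *s t)) * top_part f \<in> A"
proof -
  obtain x where "x \<in> Poly_Mapping.keys f" "x $ j = hi f" using hi_attained[OF assms(2)] .
  then obtain k where k: "hi f = k * t $ j" using levels[of x] assms(1) by auto
  have "y \<in> G0" if y: "y \<in> Poly_Mapping.keys (monom (- (k *s t)) * top_part f)" for y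
  proof -
    obtain z where z: "y = - (k *s t) + z" "z \<in> Poly_Mapping.keys f" "z $ j = hi f"
      using y unfolding keys_monom_mult top_part_def keys_part lev_def by auto
    have "z \<in> G1" using z(2) assms(1) by auto
    then have "z - k *s t \<in> G1" using subgroup_diff[OF G1 _ subgroup_smult[OF G1 t]] by blast
    then show ?thesis unfolding G0_eq using z k by simp
  qed
  then show ?thesis using k by auto
qed

definition lk :: "((int ^ 'n) \<Rightarrow>\<^sub>0 'k) \<Rightarrow> int" where
  "lk f = (SOME k. hi f = k * t $ j \<and> monom (- (k *s t)) * top_part f \<in> A)"
definition lc :: "((int ^ 'n) \<Rightarrow>\<^sub>0 'k) \<Rightarrow> (int ^ 'n) \<Rightarrow>\<^sub>0 'k" where
  "lc f = monom (- (lk f *s t)) * top_part f"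

lemma lk_lc: assumes "f \<in> B" "f \<noteq> 0"
  shows "hi f = lk f * t $ j" "lc f \<in> A" "top_part f = monom (lk f *s t) * lc f" "lc f \<noteq> 0"
proof -
  have "hi f = lk f * t $ j \<and> monom (- (lk f *s t)) * top_part f \<in> A"
    unfolding lk_def by (rule someI_ex[OF lead_exists[OF assms]])
  then show "hi f = lk f * t $ j" "lc f \<in> A" unfolding lc_def by blast+
  show eq: "top_part f = monom (lk f *s t) * lc f" unfolding lc_def by (simp only: monom_cancel)
  show "lc f \<noteq> 0" using eq top_part_nonzero[OF assms(2)] by auto
qed

lemma monom_t_in: "monom (k *s t) \<in> B" using subgroup_smult[OF G1 t] by simp

lemma A_level: "a \<in> A \<Longrightarrow> Poly_Mapping.keys a \<subseteq> lev 0" unfolding G0_eq lev_def by auto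

text \<open>Gauss's lemma. If \<open>p\<close> divides \<open>f g\<close>, it divides the product of the leading coefficients and hence
  the top part of \<open>f\<close> or of \<open>g\<close>. That part can be removed, which reduces the number of terms.\<close>
lemma gauss:
  assumes p: "A.prime_in p" shows "B.prime_in p"
proof -
  note pA = A.prime_in_D(1)[OF p]
  have main: "p dvd f \<or> p dvd g" if "f \<in> B" "g \<in> B" "p dvd f * g" for f g
    using that
  proof (induction "card (Poly_Mapping.keys f) + card (Poly_Mapping.keys g)" arbitrary: f g rule: less_induct)
    case less
    show ?case
    proof (cases "f = 0 \<or> g = 0")
      case True then show ?thesis by auto
    next
      case False
      then have nz: "f \<noteq> 0" "g \<noteq> 0" by auto
      note f = lk_lc[OF less.prems(1) nz(1)] and g = lk_lc[OF less.prems(2) nz(2)]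
      obtain c where c: "f * g = p * c" using less.prems(3) by (rule dvdE)
      have "top_part f * top_part g = p * part (lev (hi f + hi g)) c"
        unfolding top_part_mult[symmetric] c by (rule part_mult_level_zero[OF A_level[OF pA]])
      then have "p dvd top_part f * top_part g" by simp
      then have "p dvd (monom (- (lk f *s t)) * monom (- (lk g *s t))) * (top_part f * top_part g)"
        by (rule dvd_mult)
      then have "p dvd lc f * lc g" unfolding lc_def by (simp only: ac_simps)
      then have "p dvd lc f \<or> p dvd lc g" by (rule A.prime_in_D(4)[OF p f(2) g(2)])
      then have "p dvd top_part f \<or> p dvd top_part g" unfolding f(3) g(3) by auto
      then show ?thesis
      proof
        assume d: "p dvd top_part f"
        let ?f = "part (- lev (hi f)) f"
        have split: "f = top_part f + ?f" unfolding top_part_def by (rule part_split)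
        have eq: "?f * g = f * g - top_part f * g"
          by (subst (2) split) (simp add: distrib_right)
        have "p dvd ?f * g" unfolding eq using less.prems(3) d by (intro dvd_diff) auto
        moreover have "card (Poly_Mapping.keys ?f) < card (Poly_Mapping.keys f)"
        proof (rule psubset_card_mono)
          obtain x where "x \<in> Poly_Mapping.keys f" "x $ j = hi f" using hi_attained[OF nz(1)] .
          then show "Poly_Mapping.keys ?f \<subset> Poly_Mapping.keys f" unfolding keys_part lev_def by auto
        qed simp
        moreover have "?f \<in> B" using less.prems(1) by (auto simp: keys_part)
        ultimately have "p dvd ?f \<or> p dvd g" using less.hyps[of ?f g] less.prems(2) by simp
        then show ?thesis using d split by (metis dvd_add)
      next
        assume d: "p dvd top_part g"
        let ?g = "part (- lev (hi g)) g"
        have split: "g = top_part g + ?g" unfolding top_part_def by (rule part_split)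
        have eq: "f * ?g = f * g - f * top_part g"
          by (subst (2) split) (simp add: distrib_left)
        have "p dvd f * ?g" unfolding eq using less.prems(3) d by (intro dvd_diff) auto
        moreover have "card (Poly_Mapping.keys ?g) < card (Poly_Mapping.keys g)"
        proof (rule psubset_card_mono)
          obtain x where "x \<in> Poly_Mapping.keys g" "x $ j = hi g" using hi_attained[OF nz(2)] .
          then show "Poly_Mapping.keys ?g \<subset> Poly_Mapping.keys g" unfolding keys_part lev_def by auto
        qed simp
        moreover have "?g \<in> B" using less.prems(2) by (auto simp: keys_part)
        ultimately have "p dvd f \<or> p dvd ?g" using less.hyps[of f ?g] less.prems(1) by simp
        then show ?thesis using d split by (metis dvd_add)
      qed
    qed
  qed
  show ?thesis unfolding B.prime_in_def
    using pA A_B A.prime_in_D(2,3)[OF p] main by blast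
qed

definition span :: "((int ^ 'n) \<Rightarrow>\<^sub>0 'k) \<Rightarrow> nat" where "span f = nat (hi f - lo f)"

lemma lo_le_hi: "f \<noteq> 0 \<Longrightarrow> lo f \<le> hi f" using lo_attained le_hi by metis

lemma span_less:
  assumes "f \<noteq> 0" "g \<noteq> 0" "\<And>x. x \<in> Poly_Mapping.keys f \<Longrightarrow> x $ j < hi g \<and> lo g \<le> x $ j"
  shows "span f < span g"
proof -
  obtain x where "x \<in> Poly_Mapping.keys f" "x $ j = hi f" using hi_attained[OF assms(1)] .
  then have 1: "hi f < hi g" using assms(3) by metis
  obtain y where "y \<in> Poly_Mapping.keys f" "y $ j = lo f" using lo_attained[OF assms(1)] .
  then have 2: "lo g \<le> lo f" using assms(3) by metis
  show ?thesis using 1 2 lo_le_hi[OF assms(1)] unfolding span_def by linarith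
qed

text \<open>Pseudo-division by an element \<open>f\<close> of minimal length: cancelling the top part of a multiple of \<open>g\<close>
  by \<open>lc f\<close> against a multiple of \<open>f\<close> leaves an element of the prime that is shorter than \<open>g\<close>.\<close>
lemma pseudo_division:
  assumes P: "B.prime_set P" and f: "f \<in> P" "f \<noteq> 0" "\<And>g. g \<in> P \<Longrightarrow> g \<noteq> 0 \<Longrightarrow> span f \<le> span g"
    and g: "g \<in> P"
  shows "\<exists>a\<in>A. a \<noteq> 0 \<and> f dvd a * g"
  using g
proof (induction "span g" arbitrary: g rule: less_induct)
  case less
  show ?case
  proof (cases "g = 0")
    case True
    then show ?thesis using A.one_in by (intro bexI[of _ 1]) auto
  next
    case False
    have fB: "f \<in> B" and gB: "g \<in> B" using f(1) less.prems B.prime_setD(1)[OF P] by blast+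
    note lf = lk_lc[OF fB f(2)] and lg = lk_lc[OF gB False]
    let ?m = "monom ((lk g - lk f) *s t) :: (int ^ 'n) \<Rightarrow>\<^sub>0 'k"
    define h where "h = lc f * g - (lc g * ?m) * f"
    have lcB: "lc f \<in> B" "lc g \<in> B" using lf(2) lg(2) A_B by blast+
    have mB: "lc g * ?m \<in> B" by (rule B.mult_in[OF lcB(2) monom_t_in])
    have "lc f * g \<in> P" by (rule B.prime_setD(4)[OF P less.prems lcB(1)])
    moreover have "(- (lc g * ?m)) * f \<in> P" by (rule B.prime_setD(4)[OF P f(1) B.uminus_in[OF mB]])
    ultimately have "lc f * g + (- (lc g * ?m)) * f \<in> P" by (rule B.prime_setD(3)[OF P])
    then have hP: "h \<in> P" unfolding h_def by simp
    have fg: "hi f - lo f \<le> hi g - lo g"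
      using f(3)[OF less.prems False] lo_le_hi[OF f(2)] lo_le_hi[OF False] unfolding span_def by linarith
    have shift: "((lk g - lk f) *s t) $ j = hi g - hi f" using lf(1) lg(1) by (simp add: algebra_simps)
    have k1: "x $ j \<le> hi g \<and> lo g \<le> x $ j" if x: "x \<in> Poly_Mapping.keys (lc f * g)" for x
    proof -
      obtain a b where ab: "x = a + b" "a \<in> Poly_Mapping.keys (lc f)" "b \<in> Poly_Mapping.keys g"
        using x keys_mult[of "lc f" g] by blast
      have "a $ j = 0" using ab(2) A_level[OF lf(2)] unfolding lev_def by blast
      then show ?thesis using ab le_hi lo_le by simp
    qed
    have k2: "x $ j \<le> hi g \<and> lo g \<le> x $ j" if x: "x \<in> Poly_Mapping.keys ((lc g * ?m) * f)" for x
    proof -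
      have "(lc g * ?m) * f = ?m * (lc g * f)" by (simp add: ac_simps)
      then have "x \<in> (+) ((lk g - lk f) *s t) ` Poly_Mapping.keys (lc g * f)"
        using x keys_monom_mult by metis
      then obtain y where y: "x = (lk g - lk f) *s t + y" "y \<in> Poly_Mapping.keys (lc g * f)" by blast
      obtain a b where ab: "y = a + b" "a \<in> Poly_Mapping.keys (lc g)" "b \<in> Poly_Mapping.keys f"
        using y(2) keys_mult[of "lc g" f] by blast
      have "a $ j = 0" using ab(2) A_level[OF lg(2)] unfolding lev_def by blast
      then have "x $ j = hi g - hi f + b $ j" using y(1) ab(1) shift by simp
      then show ?thesis using le_hi[OF ab(3)] lo_le[OF ab(3)] fg by linarith
    qed
    have "part (lev (hi g)) h = 0"
    proof -
      have "part (lev (hi g)) (lc f * g) = lc f * top_part g"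
        unfolding top_part_def by (rule part_mult_level_zero[OF A_level[OF lf(2)]])
      moreover have "part (lev (hi g)) (lc g * (?m * f)) = lc g * part (lev (hi g)) (?m * f)"
        by (rule part_mult_level_zero[OF A_level[OF lg(2)]])
      moreover have "part (lev (hi g)) (?m * f) = ?m * top_part f"
      proof -
        have "?m * f = ?m * top_part f + ?m * part (- lev (hi f)) f"
          unfolding top_part_def by (subst part_split[of f "lev (hi f)"]) (rule distrib_left)
        moreover have "Poly_Mapping.keys (?m * top_part f) \<subseteq> lev (hi g)"
          unfolding keys_monom_mult top_part_def keys_part using shift by (auto simp: lev_def)
        moreover have "Poly_Mapping.keys (?m * part (- lev (hi f)) f) \<subseteq> - lev (hi g)"
          unfolding keys_monom_mult keys_part using shift by (auto simp: lev_def)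
        ultimately show ?thesis using part_add_eq by metis
      qed
      moreover have "part X (u - v) = part X u - part X v" for X and u v :: "(int ^ 'n) \<Rightarrow>\<^sub>0 'k"
        by (rule poly_mapping_eqI) (simp add: lookup_part lookup_minus)
      ultimately have "part (lev (hi g)) h = lc f * top_part g - lc g * (?m * top_part f)"
        unfolding h_def by (simp add: mult.assoc)
      also have "?m * top_part f = monom (lk g *s t) * lc f"
        unfolding lf(3) mult.assoc[symmetric] monom_mult
        by (simp add: vector_sadd_rdistrib[symmetric])
      also have "lc f * top_part g = lc g * (monom (lk g *s t) * lc f)"
        unfolding lg(3) by (simp add: ac_simps)
      finally show ?thesis by simp
    qed
    then have top0: "x \<notin> Poly_Mapping.keys h" if "x $ j = hi g" for x
      using that keys_part[of "lev (hi g)" h] by (auto simp: lev_def)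
    have hk: "x $ j < hi g \<and> lo g \<le> x $ j" if x: "x \<in> Poly_Mapping.keys h" for x
    proof -
      have "x $ j \<le> hi g \<and> lo g \<le> x $ j"
        using x keys_diff_subset[of "lc f * g" "(lc g * ?m) * f"] k1[of x] k2[of x] unfolding h_def by blast
      moreover have "x $ j \<noteq> hi g" using top0 x by blast
      ultimately show ?thesis by linarith
    qed
    have eq: "lc f * g = h + (lc g * ?m) * f" unfolding h_def by simp
    show ?thesis
    proof (cases "h = 0")
      case True
      then have "f dvd lc f * g" using eq by simp
      then show ?thesis using lf(2,4) by blast
    next
      case hn: False
      have "span h < span g" by (rule span_less[OF hn False hk])
      then obtain a where a: "a \<in> A" "a \<noteq> 0" "f dvd a * h" using less.hyps[OF _ hP] by blast
      have "(a * lc f) * g = a * h + (a * (lc g * ?m)) * f"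
        using arg_cong[OF eq, of "(*) a"] by (simp add: algebra_simps)
      then have "f dvd (a * lc f) * g" using a(3) by simp
      moreover have "a * lc f \<noteq> 0" using laurent_mult_nonzero[OF a(2) lf(4)] .
      ultimately show ?thesis using A.mult_in[OF a(1) lf(2)] by blast
    qed
  qed
qed

text \<open>If the prime meets the base ring, it contains a prime factor of a common element, which stays
  prime by Gauss's lemma. Otherwise choose a primitive element \<open>f\<close> of minimal length: \<open>f\<close> divides
  each element up to a factor from the base ring, whose prime factors do not divide \<open>f\<close> and cancel.
  So \<open>f\<close> generates the prime.\<close>
lemma prime_contains_prime_element:
  assumes fac: "A.factorial" and P: "B.prime_set P" "P \<noteq> {0}"
  shows "\<exists>p\<in>P. B.prime_in p"
proof (cases "\<exists>a\<in>P \<inter> A. a \<noteq> 0")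
  case True
  then obtain a where a: "a \<in> P" "a \<in> A" "a \<noteq> 0" by blast
  then obtain n where n: "A.factors n a" using fac unfolding A.factorial_def by blast
  have "B.factors n a" using n
  proof (induction n arbitrary: a)
    case 0
    then show ?case using A_B by auto
  next
    case (Suc n)
    then obtain p b where p: "A.prime_in p" "b \<in> A" "a = p * b" "A.factors n b" by auto
    have "b \<in> B" using p(2) A_B by blast
    then show ?case using gauss[OF p(1)] p(3) Suc.IH[OF p(4)]
      unfolding B.factors.simps by (intro exI[of _ p] exI[of _ b] conjI)
  qed
  then show ?thesis using B.factors_prime_set[OF P(1) _ a(1)] by blast
next
  case False
  have PB: "P \<subseteq> B" by (rule B.prime_setD(1)[OF P(1)])
  obtain f0 where f0: "f0 \<in> P" "f0 \<noteq> 0" using P(2) B.prime_setD(2)[OF P(1)] by auto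
  \<comment> \<open>a nonzero element of minimal length and, among these, with the fewest prime factors in its
    leading coefficient\<close>
  define s where "s = (LEAST s. \<exists>f\<in>P. f \<noteq> 0 \<and> span f = s)"
  have ex_s: "\<exists>f\<in>P. f \<noteq> 0 \<and> span f = s" unfolding s_def by (rule LeastI[of _ "span f0"]) (use f0 in blast)
  have s_le: "s \<le> span f" if "f \<in> P" "f \<noteq> 0" for f unfolding s_def by (rule Least_le) (use that in blast)
  define N where "N = (LEAST n. \<exists>f\<in>P. f \<noteq> 0 \<and> span f = s \<and> A.factors n (lc f))"
  obtain f1 where f1: "f1 \<in> P" "f1 \<noteq> 0" "span f1 = s" using ex_s by blast
  obtain n1 where n1: "A.factors n1 (lc f1)"
    using fac lk_lc(2,4)[of f1] f1 PB unfolding A.factorial_def by blast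
  have "\<exists>f\<in>P. f \<noteq> 0 \<and> span f = s \<and> A.factors N (lc f)" unfolding N_def
    by (rule LeastI[of _ n1]) (use f1 n1 in blast)
  then obtain f where f: "f \<in> P" "f \<noteq> 0" "span f = s" "A.factors N (lc f)" by blast
  have N_le: "N \<le> n" if "f \<in> P" "f \<noteq> 0" "span f = s" "A.factors n (lc f)" for f n
    unfolding N_def by (rule Least_le) (use that in blast)
  have fB: "f \<in> B" using f(1) PB by blast
  have primitive: "\<not> p dvd f" if p: "A.prime_in p" for p
  proof
    assume "p dvd f"
    then obtain g where g: "f = p * g" by (rule dvdE)
    note pA = A.prime_in_D(1)[OF p] and p0 = A.prime_in_D(2)[OF p]
    have pB: "p \<in> B" using pA A_B by blast
    have gB: "g \<in> B" using B.dvd_closed[OF pB p0] g fB by blast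
    have "p \<notin> P" using False pA p0 by blast
    then have gP: "g \<in> P" using B.prime_setD(6)[OF P(1) pB gB] g f(1) by blast
    have g0: "g \<noteq> 0" using g f(2) by auto
    have keys_pg: "Poly_Mapping.keys (p * g) \<subseteq> {x. lo g \<le> x $ j \<and> x $ j \<le> hi g}"
    proof (rule keys_mult_in[OF A_level[OF pA], of _ "{x. lo g \<le> x $ j \<and> x $ j \<le> hi g}"])
      show "Poly_Mapping.keys g \<subseteq> {x. lo g \<le> x $ j \<and> x $ j \<le> hi g}" using lo_le le_hi by blast
    qed (auto simp: lev_def)
    have top: "part (lev (hi g)) f = p * top_part g"
      unfolding g top_part_def by (rule part_mult_level_zero[OF A_level[OF pA]])
    have "hi f = hi g"
    proof (rule antisym)
      obtain x where "x \<in> Poly_Mapping.keys f" "x $ j = hi f" using hi_attained[OF f(2)] .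
      then show "hi f \<le> hi g" using keys_pg g by auto
      have "p * top_part g \<noteq> 0" by (rule laurent_mult_nonzero[OF p0 top_part_nonzero[OF g0]])
      then obtain x where "x \<in> Poly_Mapping.keys (part (lev (hi g)) f)"
        unfolding top by (metis finite_keys_eq_zero ex_in_conv)
      then show "hi g \<le> hi f" using le_hi[of x f] by (auto simp: keys_part lev_def)
    qed
    have "span f \<ge> span g"
    proof -
      obtain x where "x \<in> Poly_Mapping.keys f" "x $ j = lo f" using lo_attained[OF f(2)] .
      then have "lo g \<le> lo f" using keys_pg g by auto
      have "lo f \<le> lo g"
      proof -
        have e: "part (lev (lo g)) f = p * part (lev (lo g)) g"
          unfolding g by (rule part_mult_level_zero[OF A_level[OF pA]])
        obtain x where "x \<in> Poly_Mapping.keys g" "x $ j = lo g" using lo_attained[OF g0] .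
        then have "x \<in> Poly_Mapping.keys (part (lev (lo g)) g)" by (simp add: keys_part lev_def)
        then have "part (lev (lo g)) g \<noteq> 0" by auto
        then have "p * part (lev (lo g)) g \<noteq> 0" by (rule laurent_mult_nonzero[OF p0])
        then obtain x where "x \<in> Poly_Mapping.keys (part (lev (lo g)) f)"
          unfolding e by (metis finite_keys_eq_zero ex_in_conv)
        then show ?thesis using lo_le[of x f] by (auto simp: keys_part lev_def)
      qed
      then show ?thesis using \<open>hi f = hi g\<close> unfolding span_def by simp
    qed
    then have sg: "span g = s" using s_le[OF gP g0] f(3) by simp
    have tf: "top_part f = p * top_part g" using top \<open>hi f = hi g\<close> unfolding top_part_def by simp
    have "lk f * t $ j = hi f" by (rule lk_lc(1)[OF fB f(2), symmetric])
    also have "\<dots> = lk g * t $ j" unfolding \<open>hi f = hi g\<close> by (rule lk_lc(1)[OF gB g0])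
    finally have tj: "lk f * t $ j = lk g * t $ j" .
    have lc_eq: "lc f = monom (- (lk f *s t)) * monom (lk g *s t) * (p * lc g)"
      unfolding lc_def[of f] tf lk_lc(3)[OF gB g0] by (simp add: ac_simps)
    let ?u = "monom (- (lk f *s t)) * monom (lk g *s t) :: (int ^ 'n) \<Rightarrow>\<^sub>0 'k"
    have tj0: "(lk g *s t - lk f *s t) $ j = 0"
      unfolding vector_minus_component vector_smult_component tj by simp
    have "lk g *s t - lk f *s t \<in> G1" by (intro subgroup_diff[OF G1] subgroup_smult[OF G1 t])
    then have "lk g *s t - lk f *s t \<in> G0" using tj0 by (rule G0I)
    then have uA: "?u \<in> A" unfolding monom_mult by simp
    have "?u dvd 1"
    proof (rule dvdI)
      show "1 = ?u * (monom (lk f *s t) * monom (- (lk g *s t)))"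
        unfolding monom_mult by simp
    qed
    then have "?u * lc g \<in> A" and fc: "lc f = p * (?u * lc g)"
      using A.mult_in[OF uA lk_lc(2)[OF gB g0]] lc_eq by (auto simp: ac_simps)
    have "\<exists>m. N = Suc m \<and> A.factors m (?u * lc g)"
      by (rule A.factors_cancel[OF f(4)[unfolded fc] p \<open>?u * lc g \<in> A\<close>])
    then obtain m where m: "N = Suc m" "A.factors m (?u * lc g)" by blast
    obtain v where v: "v \<in> A" "?u * v = 1" using A.unit_inverse[OF uA \<open>?u dvd 1\<close>] .
    have "v dvd 1" unfolding v(2)[symmetric] by (rule dvd_triv_right)
    then have "A.factors (0 + m) (v * (?u * lc g))" by (intro A.factors_mult m(2)) (use v(1) in simp)
    moreover have "v * (?u * lc g) = (?u * v) * lc g" by (simp only: ac_simps)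
    then have "v * (?u * lc g) = lc g" unfolding v(2) by simp
    ultimately have "A.factors m (lc g)" by simp
    then have "N \<le> m" by (rule N_le[OF gP g0 sg])
    then show False using m(1) by simp
  qed
  have dvd: "f dvd g" if g: "g \<in> P" for g
  proof -
    obtain a where a: "a \<in> A" "a \<noteq> 0" "f dvd a * g"
      using pseudo_division[OF P(1) f(1,2) _ g] s_le f(3) by metis
    then obtain n where "A.factors n a" using fac unfolding A.factorial_def by blast
    then show ?thesis using a(3)
    proof (induction n arbitrary: a)
      case 0
      then obtain v where "v \<in> A" "a * v = 1" using A.unit_inverse by auto
      then have "g = v * (a * g)" by (metis mult.assoc mult.commute mult_1_left)
      then show ?case using 0(2) by (metis dvd_mult)
    next
      case (Suc n)
      then obtain p b where p: "A.prime_in p" "b \<in> A" "a = p * b" "A.factors n b" by auto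
      note pB = gauss[OF p(1)]
      obtain h where h: "a * g = f * h" using Suc.prems(2) by (rule dvdE)
      have aB: "a \<in> B" using A.factors_in[OF Suc.prems(1)] A_B by blast
      have gB: "g \<in> B" using g PB by blast
      have "f * h \<in> B" using h B.mult_in[OF aB gB] by simp
      then have hB: "h \<in> B" by (rule B.dvd_closed[OF fB f(2)])
      have "p dvd f * h" using h[symmetric] p(3) by (simp add: mult.assoc)
      then have "p dvd h" using B.prime_in_D(4)[OF pB fB hB] primitive[OF p(1)] by blast
      then obtain h' where h': "h = p * h'" by (rule dvdE)
      have "p * (b * g) = p * (f * h')" using h p(3) h' by (simp add: ac_simps)
      then have "b * g = f * h'" by (rule laurent_mult_cancel[OF A.prime_in_D(2)[OF p(1)]])
      then have "f dvd b * g" by simp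
      then show ?case by (rule Suc.IH[OF p(4)])
    qed
  qed
  have "B.prime_in f" unfolding B.prime_in_def
  proof (intro conjI ballI impI)
    show "\<not> f dvd 1"
    proof
      assume "f dvd 1"
      then obtain v where "v \<in> B" "f * v = 1" using B.unit_inverse[OF fB] by blast
      then have "1 \<in> P" using B.prime_setD(4)[OF P(1) f(1), of v] by (simp add: mult.commute)
      then show False using B.prime_setD(5)[OF P(1)] by blast
    qed
    fix a b assume ab: "a \<in> B" "b \<in> B" "f dvd a * b"
    then obtain c where c: "a * b = f * c" by (elim dvdE)
    then have "c \<in> B" using B.dvd_closed[OF fB f(2)] B.mult_in[OF ab(1,2)] by metis
    then have "a * b \<in> P" using B.prime_setD(4)[OF P(1) f(1)] c by (metis mult.commute)
    then show "f dvd a \<or> f dvd b" using B.prime_setD(6)[OF P(1) ab(1,2)] dvd by blast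
  qed (use fB f(2) in auto)
  then show ?thesis using f(1) by blast
qed

lemma factorial_step: "A.factorial \<Longrightarrow> B.factorial"
  using B.kaplansky prime_contains_prime_element by blast

end

lemma dvd_closed_supported:
  assumes "add_subgroup (G :: (int ^ 'n) set)"
  shows "dvd_closed_subdomain (supported G :: ((int ^ 'n) \<Rightarrow>\<^sub>0 'k::field) set)"
  using subdomain_supported[OF subgroup_submonoid[OF assms]] supported_dvd_closed[OF assms]
  unfolding dvd_closed_subdomain_def dvd_closed_subdomain_axioms_def by auto

text \<open>The element \<open>t\<close> has least positive \<open>j\<close>-coordinate; if that coordinate vanishes on \<open>G1\<close>, take zero.\<close>
lemma lattice_step_exists:
  fixes G1 :: "(int ^ 'n) set"
  assumes "add_subgroup G1" shows "\<exists>t. lattice_step {x\<in>G1. x $ j = 0} G1 j t"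
proof (cases "\<exists>x\<in>G1. x $ j \<noteq> 0")
  case False
  then have "lattice_step {x\<in>G1. x $ j = 0} G1 j 0"
    using assms submonoid_zero[OF subgroup_submonoid[OF assms]] by unfold_locales auto
  then show ?thesis by blast
next
  case True
  then obtain x where x: "x \<in> G1" "x $ j \<noteq> 0" by blast
  have "\<exists>y\<in>G1. y $ j > 0"
  proof (cases "x $ j > 0")
    case True then show ?thesis using x(1) by blast
  next
    case False
    then have "(- x) $ j > 0" using x(2) by simp
    then show ?thesis using subgroup_uminus[OF assms x(1)] by blast
  qed
  then obtain y where y: "y \<in> G1" "y $ j > 0" by blast
  define m where "m = (LEAST n. \<exists>t\<in>G1. t $ j > 0 \<and> nat (t $ j) = n)"
  have "\<exists>t\<in>G1. t $ j > 0 \<and> nat (t $ j) = m" unfolding m_def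
    by (rule LeastI[of _ "nat (y $ j)"]) (use y in blast)
  then obtain t where t: "t \<in> G1" "t $ j > 0" "nat (t $ j) = m" by blast
  have min: "m \<le> nat (z $ j)" if "z \<in> G1" "z $ j > 0" for z
    unfolding m_def by (rule Least_le) (use that in blast)
  have "\<exists>k. z $ j = k * t $ j" if z: "z \<in> G1" for z
  proof -
    let ?k = "z $ j div t $ j"
    have mem: "z - ?k *s t \<in> G1" by (intro subgroup_diff[OF assms] z subgroup_smult[OF assms] t(1))
    have eq: "(z - ?k *s t) $ j = z $ j mod t $ j" by (simp add: minus_div_mult_eq_mod)
    have "z $ j mod t $ j = 0"
    proof (rule ccontr)
      assume "z $ j mod t $ j \<noteq> 0"
      then have "z $ j mod t $ j > 0" using t(2) by (simp add: order_less_le)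
      then have "m \<le> nat (z $ j mod t $ j)" using min[OF mem] eq by simp
      moreover have "z $ j mod t $ j < t $ j" using t(2) by simp
      ultimately show False using t(2,3) by linarith
    qed
    then show ?thesis by (intro exI[of _ ?k]) (metis add.right_neutral div_mult_mod_eq)
  qed
  then have "lattice_step {x\<in>G1. x $ j = 0} G1 j t" using assms t(1) by unfold_locales auto
  then show ?thesis by blast
qed

text \<open>Induction on the set of coordinates that may be nonzero. Over the trivial group the ring is a
  field; Kaplansky's criterion performs the step.\<close>
theorem laurent_factorial:
  fixes G :: "(int ^ 'n) set"
  assumes G: "add_subgroup G"
  shows "dvd_closed_subdomain.factorial (supported G :: ((int ^ 'n) \<Rightarrow>\<^sub>0 'k::field) set)"
proof -
  have "dvd_closed_subdomain.factorial (supported {x\<in>G. \<forall>i. i \<notin> J \<longrightarrow> x $ i = 0} :: ((int ^ 'n) \<Rightarrow>\<^sub>0 'k) set)"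
    if "finite J" for J :: "'n set"
    using that
  proof (induction J rule: finite_induct)
    case empty
    let ?G = "{x\<in>G. \<forall>i. i \<notin> {} \<longrightarrow> x $ i = 0}"
    have G0: "?G = {0}"
      using submonoid_zero[OF subgroup_submonoid[OF G]] by (auto simp: vec_eq_iff)
    have "add_subgroup {0 :: int ^ 'n}" by (auto simp: add_subgroup_def add_submonoid_def)
    then interpret dvd_closed_subdomain "supported {0} :: ((int ^ 'n) \<Rightarrow>\<^sub>0 'k) set"
      by (rule dvd_closed_supported)
    have "a dvd 1" if a: "a \<in> supported {0}" "a \<noteq> 0" for a :: "(int ^ 'n) \<Rightarrow>\<^sub>0 'k"
    proof (rule dvdI)
      let ?c = "Poly_Mapping.lookup a 0"
      have eq: "a = Poly_Mapping.single 0 ?c"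
        by (rule poly_mapping_eqI) (use a(1) in \<open>auto simp: lookup_single when_def in_keys_iff\<close>)
      then have "?c \<noteq> 0" using a(2) by (metis single_zero)
      then have "Poly_Mapping.single 0 ?c * Poly_Mapping.single 0 (inverse ?c) = (1 :: (int ^ 'n) \<Rightarrow>\<^sub>0 'k)"
        by (simp add: mult_single)
      then show "1 = a * Poly_Mapping.single 0 (inverse ?c)" using eq by simp
    qed
    then have "factorial" unfolding factorial_def by (intro ballI impI exI[of _ 0]) auto
    then show ?case unfolding G0 .
  next
    case (insert j J)
    let ?G1 = "{x\<in>G. \<forall>i. i \<notin> insert j J \<longrightarrow> x $ i = 0}"
    have sub: "add_subgroup ?G1" using G by (auto simp: add_subgroup_def add_submonoid_def)
    have eq: "{x\<in>?G1. x $ j = 0} = {x\<in>G. \<forall>i. i \<notin> J \<longrightarrow> x $ i = 0}"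
      using insert.hyps(2) by auto
    obtain t where "lattice_step {x\<in>?G1. x $ j = 0} ?G1 j t" using lattice_step_exists[OF sub] by blast
    then interpret lattice_step "{x\<in>?G1. x $ j = 0}" ?G1 j t "TYPE('k)" .
    show ?case by (rule factorial_step) (use insert.IH in \<open>simp only: eq\<close>)
  qed
  from this[OF finite[of UNIV]] show ?thesis by simp
qed

section \<open>Monoid algebras\<close>

lemma monoid_algebra_eq: "monoid_algebra K Q = subring_of (supported Q)"
  by (simp add: monoid_algebra_def subring_of_def)

lemma poly_mapping_sum_single:
  "(\<Sum>x\<in>Poly_Mapping.keys f. Poly_Mapping.single x (Poly_Mapping.lookup f x)) = f"
  by (rule poly_mapping_eqI) (simp add: lookup_sum lookup_single when_def in_keys_iff)

lemma monom_power: "monom a ^ k = monom (int k *s a)"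
  by (induction k) (simp_all add: monom_mult vec_eq_iff algebra_simps)

lemma monom_nonzero: "monom a \<noteq> (0 :: (int ^ 'n) \<Rightarrow>\<^sub>0 'k::field)"
  by (metis keys_zero keys_single insert_not_empty zero_neq_one)

locale affine_algebra =
  fixes Q :: "(int ^ 'n) set" and K :: "'k::field itself"
  assumes Q: "affine_monoid Q"
begin

lemma Q': "add_submonoid Q" by (rule affine_submonoid[OF Q])

abbreviation A :: "((int ^ 'n) \<Rightarrow>\<^sub>0 'k) set" where "A \<equiv> supported Q"
abbreviation KG :: "((int ^ 'n) \<Rightarrow>\<^sub>0 'k) set" where "KG \<equiv> supported (group_gen Q)"
text \<open>The monomial prime ideal of a face.\<close>
definition PF :: "(int ^ 'n) set \<Rightarrow> ((int ^ 'n) \<Rightarrow>\<^sub>0 'k) set" where "PF F = supported (Q - F)"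

sublocale subdomain A by (rule subdomain_supported[OF Q'])
sublocale G: dvd_closed_subdomain KG by (rule dvd_closed_supported[OF add_subgroup_group_gen])

lemma A_KG: "A \<subseteq> KG" using subset_group_gen[of Q] by auto

lemma PF_iff: "a \<in> PF F \<longleftrightarrow> a \<in> A \<and> Poly_Mapping.keys a \<inter> F = {}"
  unfolding PF_def by auto

lemma monom_A: "q \<in> Q \<Longrightarrow> monom q \<in> A" by simp
lemma monom_PF_iff: "q \<in> Q \<Longrightarrow> monom q \<in> PF F \<longleftrightarrow> q \<notin> F" by (simp add: PF_iff)

text \<open>Every element of the Laurent polynomial ring is an element of \<open>K[Q]\<close> divided by a monomial.\<close>
lemma KG_shift:
  assumes "v \<in> KG" obtains q where "q \<in> Q" "monom q * v \<in> A"
proof -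
  have "\<exists>c\<in>Q. \<forall>s\<in>Poly_Mapping.keys v. c + s \<in> Q"
  proof (rule common_shift[OF Q' Q' order_refl finite_keys])
    fix s assume "s \<in> Poly_Mapping.keys v"
    then have "s \<in> group_gen Q" using assms by blast
    then show "\<exists>q\<in>Q. \<exists>f\<in>Q. s = q - f" unfolding group_gen_eq_diff[OF Q'] by blast
  qed
  then obtain c where "c \<in> Q" "\<forall>s\<in>Poly_Mapping.keys v. c + s \<in> Q" by blast
  then show ?thesis using that[of c] unfolding mem_Collect_eq keys_monom_mult by blast
qed

text \<open>Restriction of supports to \<open>F\<close> is multiplicative, with kernel \<open>PF F\<close> and values in a domain.\<close>
lemma PF_prime:
  assumes F: "face Q F" shows "prime_set (PF F)"
  unfolding prime_set_def
proof (intro conjI ballI impI)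
  note FQ = faceD(1)[OF F]
  have F0: "0 \<in> F" by (rule submonoid_zero[OF face_submonoid[OF Q' F]])
  show "PF F \<subseteq> A" "0 \<in> PF F" unfolding PF_def by auto
  show "1 \<notin> PF F" unfolding PF_def using F0 by simp
  show "a + b \<in> PF F" if "a \<in> PF F" "b \<in> PF F" for a b
    using that keys_add[of a b] unfolding PF_def by blast
  show "c * a \<in> PF F" if "a \<in> PF F" "c \<in> A" for a c
  proof -
    have "Poly_Mapping.keys (c * a) \<subseteq> Q - F"
      by (rule keys_mult_in[of _ Q _ "Q - F"])
         (use that submonoid_add[OF Q'] faceD(3)[OF F] in \<open>auto simp: PF_def\<close>)
    then show ?thesis by (simp add: PF_def)
  qed
  fix a b assume ab: "a \<in> A" "b \<in> A" "a * b \<in> PF F"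
  show "a \<in> PF F \<or> b \<in> PF F"
  proof (rule ccontr)
    assume n: "\<not> (a \<in> PF F \<or> b \<in> PF F)"
    have nz: "part F c \<noteq> 0" if "c \<in> A" "c \<notin> PF F" for c :: "(int ^ 'n) \<Rightarrow>\<^sub>0 'k"
    proof
      assume "part F c = 0"
      then have "Poly_Mapping.keys c \<inter> F = {}" using keys_part[of F c] by simp
      then show False using that by (simp add: PF_iff)
    qed
    let ?r = "part F a * part (- F) b + part (- F) a * b"
    have "a * b = part F a * part F b + ?r"
    proof -
      have "a * b = part F a * b + part (- F) a * b"
        by (subst part_split[of a F]) (rule distrib_right)
      also have "part F a * b = part F a * part F b + part F a * part (- F) b"
        by (subst part_split[of b F]) (rule distrib_left)
      finally show ?thesis by (simp add: add.assoc)
    qed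
    moreover have "Poly_Mapping.keys (part F a * part F b) \<subseteq> F"
      by (rule keys_mult_in[of _ F _ F]) (use faceD(4)[OF F] in \<open>auto simp: keys_part\<close>)
    moreover have "Poly_Mapping.keys ?r \<subseteq> - F"
    proof -
      have "Poly_Mapping.keys (part F a * part (- F) b) \<subseteq> - F"
        by (rule keys_mult_in[of _ Q _ "Q - F"])
           (use ab faceD(3)[OF F] in \<open>auto simp: keys_part\<close>)
      moreover have "Poly_Mapping.keys (part (- F) a * b) \<subseteq> - F"
        by (rule keys_mult_in[of _ "Q - F" _ Q])
           (use ab faceD(2)[OF F] in \<open>auto simp: keys_part\<close>)
      ultimately show ?thesis using keys_add[of "part F a * part (- F) b" "part (- F) a * b"] by blast
    qed
    ultimately have "part F (a * b) = part F a * part F b" using part_add_eq by metis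
    then have "part F (a * b) \<noteq> 0" using laurent_mult_nonzero nz ab n by metis
    moreover have "Poly_Mapping.keys (part F (a * b)) = {}" using ab(3) by (auto simp: keys_part PF_iff)
    ultimately show False by (simp add: finite_keys_eq_zero)
  qed
qed

lemma PF_subset_prime:
  assumes P: "prime_set P" and mon: "\<And>q. q \<in> Q \<Longrightarrow> q \<notin> F \<Longrightarrow> monom q \<in> P"
  shows "PF F \<subseteq> P"
proof
  fix a assume a: "a \<in> PF F"
  have "(\<Sum>x\<in>X. Poly_Mapping.single x (Poly_Mapping.lookup a x)) \<in> P"
    if "finite X" "X \<subseteq> Poly_Mapping.keys a" for X
    using that
  proof (induction X rule: finite_induct)
    case empty
    then show ?case using prime_setD(2)[OF P] by simp
  next
    case (insert x X)
    have "x \<in> Q" "x \<notin> F" using insert.prems a by (auto simp: PF_def)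
    then have "monom x \<in> P" by (rule mon)
    then have "Poly_Mapping.single 0 (Poly_Mapping.lookup a x) * monom x \<in> P"
      using prime_setD(4)[OF P] submonoid_zero[OF Q'] by simp
    then have "Poly_Mapping.single x (Poly_Mapping.lookup a x) \<in> P" by (simp add: mult_single)
    then show ?case using insert prime_setD(3)[OF P] by simp
  qed
  from this[OF finite_keys order_refl] show "a \<in> P" unfolding poly_mapping_sum_single .
qed

text \<open>The smallest face \<open>F\<close> with \<open>PF F \<subseteq> P\<close>.\<close>
definition mon_face :: "((int ^ 'n) \<Rightarrow>\<^sub>0 'k) set \<Rightarrow> (int ^ 'n) set" where
  "mon_face P = {q\<in>Q. monom q \<notin> P}"

lemma mon_face_face:
  assumes P: "prime_set P" shows "face Q (mon_face P)"
  unfolding face_def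
proof (intro conjI ballI)
  show "mon_face P \<noteq> {}" "mon_face P \<subseteq> Q"
    using submonoid_zero[OF Q'] prime_setD(5)[OF P] by (auto simp: mon_face_def intro!: exI[of _ 0])
  fix a b assume ab: "a \<in> Q" "b \<in> Q"
  have "monom (a + b) \<in> P \<longleftrightarrow> monom a \<in> P \<or> monom b \<in> P"
    using prime_setD(6)[OF P monom_A[OF ab(1)] monom_A[OF ab(2)]]
      prime_setD(4)[OF P _ monom_A[OF ab(1)], of "monom b"]
      prime_setD(4)[OF P _ monom_A[OF ab(2)], of "monom a"]
    by (auto simp: monom_mult add.commute)
  then show "(a + b \<in> mon_face P) = (a \<in> mon_face P \<and> b \<in> mon_face P)"
    using ab submonoid_add[OF Q' ab] by (simp add: mon_face_def)
qed

lemma PF_mon_face: "prime_set P \<Longrightarrow> PF (mon_face P) \<subseteq> P"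
  by (rule PF_subset_prime) (auto simp: mon_face_def)

lemma PF_inj:
  assumes "face Q F" "face Q F'" "PF F \<subseteq> PF F'" shows "F' \<subseteq> F"
proof
  fix x assume x: "x \<in> F'"
  then have xQ: "x \<in> Q" using faceD(1)[OF assms(2)] by blast
  show "x \<in> F"
  proof (rule ccontr)
    assume "x \<notin> F"
    then have "monom x \<in> PF F'" using assms(3) monom_PF_iff[OF xQ, of F] by blast
    then show False using monom_PF_iff[OF xQ] x by blast
  qed
qed

text \<open>The combinatorial core of the theory of associated primes: if \<open>g\<close> multiplies
  an element outside \<open>K[Q]\<close> into \<open>K[Q]\<close>, then \<open>g\<close> lies in the prime of the face of a socle point.
  After a shift that leaves as few monomials outside \<open>Q\<close> as possible, all of these have the same
  face, and the part of \<open>g\<close> on that face annihilates them.\<close>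
lemma zero_divisor_socle:
  assumes g: "g \<in> A" and v: "v \<in> KG" "v \<notin> A" and gv: "g * v \<in> A"
  obtains p where "p \<in> group_gen Q" "p \<notin> Q" "face Q {q\<in>Q. p + q \<notin> Q}" "g \<in> PF {q\<in>Q. p + q \<notin> Q}"
proof -
  define S where "S q = {x\<in>Poly_Mapping.keys v. q + x \<notin> Q}" for q
  have S0: "S 0 \<noteq> {}" using v(2) by (auto simp: S_def)
  have finS: "finite (S q)" for q unfolding S_def by simp
  define N where "N = (LEAST n. \<exists>q\<in>Q. S q \<noteq> {} \<and> card (S q) = n)"
  have "\<exists>q\<in>Q. S q \<noteq> {} \<and> card (S q) = N" unfolding N_def
    by (rule LeastI[of _ "card (S 0)"]) (use S0 submonoid_zero[OF Q'] in blast)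
  then obtain q1 where q1: "q1 \<in> Q" "S q1 \<noteq> {}" "card (S q1) = N" by blast
  have N_le: "N \<le> card (S q)" if "q \<in> Q" "S q \<noteq> {}" for q
    unfolding N_def by (rule Least_le) (use that in blast)
  have S_anti: "S (q + r) \<subseteq> S q" if "r \<in> Q" for q r
  proof
    fix x assume "x \<in> S (q + r)"
    then have x: "x \<in> Poly_Mapping.keys v" "q + r + x \<notin> Q" by (auto simp: S_def)
    have "q + x \<notin> Q"
    proof
      assume "q + x \<in> Q"
      from submonoid_add[OF Q' this that] show False using x(2) by (simp add: ac_simps)
    qed
    then show "x \<in> S q" using x(1) by (simp add: S_def)
  qed
  have S_min: "S (q1 + r) = S q1" if "r \<in> Q" "S (q1 + r) \<noteq> {}" for r
  proof (rule card_subset_eq[OF finS S_anti[OF that(1)]])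
    have "N \<le> card (S (q1 + r))" by (rule N_le[OF submonoid_add[OF Q' q1(1) that(1)] that(2)])
    moreover have "card (S (q1 + r)) \<le> card (S q1)" by (rule card_mono[OF finS S_anti[OF that(1)]])
    ultimately show "card (S (q1 + r)) = card (S q1)" using q1(3) by simp
  qed
  obtain x0 where x0: "x0 \<in> S q1" using q1(2) by auto
  then have "q1 + x0 \<notin> Q" by (simp add: S_def)
  have cl: "t + r \<in> Q" if "t \<in> Q" "r \<in> Q" for t r by (rule submonoid_add[OF Q' that])
  obtain s where s: "s \<in> Q" "q1 + x0 + s \<notin> Q" "face Q {q\<in>Q. q1 + x0 + s + q \<notin> Q}"
    by (rule exists_face_colon[OF Q cl \<open>q1 + x0 \<notin> Q\<close>])
  define q2 where "q2 = q1 + s"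
  define F where "F = {q\<in>Q. q1 + x0 + s + q \<notin> Q}"
  have q2: "q2 \<in> Q" unfolding q2_def by (rule submonoid_add[OF Q' q1(1) s(1)])
  have "x0 \<in> S q2" using s(2) x0 by (simp add: S_def q2_def ac_simps)
  then have S2: "S q2 = S q1" unfolding q2_def using S_min[OF s(1)] by blast
  have F_iff: "r \<in> F \<longleftrightarrow> q2 + x + r \<notin> Q" if r: "r \<in> Q" and x: "x \<in> S q2" for r x
  proof -
    have sr: "s + r \<in> Q" by (rule submonoid_add[OF Q' s(1) r])
    have eq: "q1 + (s + r) = q2 + r" by (simp add: q2_def ac_simps)
    have "S (q2 + r) = {} \<or> S (q2 + r) = S q2" using S_min[OF sr] S2 unfolding eq by blast
    moreover have "r \<in> F \<longleftrightarrow> x0 \<in> S (q2 + r)"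
      using r \<open>x0 \<in> S q2\<close> by (simp add: F_def S_def q2_def ac_simps)
    moreover have "x \<in> S (q2 + r) \<longleftrightarrow> q2 + x + r \<notin> Q" using x by (simp add: S_def ac_simps)
    ultimately show ?thesis using x \<open>x0 \<in> S q2\<close> by auto
  qed
  define w where "w = monom q2 * part (S q2) v"
  define w' where "w' = monom q2 * part (- S q2) v"
  have kw: "Poly_Mapping.keys w = (+) q2 ` (S q2)"
    unfolding w_def keys_monom_mult keys_part by (auto simp: S_def)
  have w'A: "w' \<in> A" unfolding w'_def mem_Collect_eq keys_monom_mult keys_part by (auto simp: S_def)
  have sum: "monom q2 * v = w + w'" unfolding w_def w'_def
    by (subst part_split[of v "S q2"]) (rule distrib_left)
  have gw: "g * w \<in> A"
  proof -
    have "g * w = monom q2 * (g * v) - g * w'"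
      using arg_cong[OF sum, of "\<lambda>z. g * z"] by (simp add: algebra_simps)
    also have "\<dots> \<in> A" by (rule diff_in[OF mult_in[OF monom_A[OF q2] gv] mult_in[OF g w'A]])
    finally show ?thesis .
  qed
  have g'w: "part (- F) g * w \<in> A"
  proof -
    have "Poly_Mapping.keys (part (- F) g * w) \<subseteq> Q"
    proof (rule keys_mult_in[of _ "Q - F" _ "(+) q2 ` (S q2)"])
      show "Poly_Mapping.keys (part (- F) g) \<subseteq> Q - F" using g by (auto simp: keys_part)
      show "Poly_Mapping.keys w \<subseteq> (+) q2 ` S q2" using kw by simp
      fix r y assume "r \<in> Q - F" "y \<in> (+) q2 ` S q2"
      then obtain x where x: "y = q2 + x" "x \<in> S q2" "r \<in> Q" "r \<notin> F" by blast
      then have "q2 + x + r \<in> Q" using F_iff[OF x(3,2)] by blast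
      then show "r + y \<in> Q" by (simp add: x(1) ac_simps)
    qed
    then show ?thesis by simp
  qed
  have "part F g * w = 0"
  proof -
    have "g * w = part F g * w + part (- F) g * w"
      by (subst part_split[of g F]) (rule distrib_right)
    then have "part F g * w = g * w - part (- F) g * w" by simp
    also have "\<dots> \<in> A" by (rule diff_in[OF gw g'w])
    finally have "Poly_Mapping.keys (part F g * w) \<subseteq> Q" by simp
    moreover have "Poly_Mapping.keys (part F g * w) \<subseteq> - Q"
    proof (rule keys_mult_in[of _ F _ "(+) q2 ` (S q2)"])
      show "Poly_Mapping.keys w \<subseteq> (+) q2 ` S q2" using kw by simp
      fix r y assume "r \<in> F" "y \<in> (+) q2 ` S q2"
      then obtain x where x: "y = q2 + x" "x \<in> S q2" "r \<in> F" by blast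
      then have "r \<in> Q" by (simp add: F_def)
      then have "q2 + x + r \<notin> Q" using F_iff[OF _ x(2)] x(3) by blast
      then show "r + y \<in> - Q" by (simp add: x(1) ac_simps)
    qed (auto simp: keys_part)
    ultimately have "Poly_Mapping.keys (part F g * w) = {}" by blast
    then show ?thesis by (simp add: finite_keys_eq_zero)
  qed
  moreover have "w \<noteq> 0"
  proof
    assume "w = 0"
    then show False using kw \<open>x0 \<in> S q2\<close> by auto
  qed
  ultimately have "part F g = 0" using laurent_mult_nonzero by blast
  then have "Poly_Mapping.keys g \<inter> F = {}" using keys_part[of F g] by simp
  then have gF: "g \<in> PF F" using g by (simp add: PF_iff)
  have F_eq: "F = {q\<in>Q. (q1 + x0 + s) + q \<notin> Q}" by (simp add: F_def)
  have "x0 \<in> group_gen Q" using x0 v(1) by (auto simp: S_def)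
  then have "q1 + x0 + s \<in> group_gen Q"
    using q1(1) s(1) subset_group_gen[of Q] by (intro group_gen_add) auto
  then show thesis using that[of "q1 + x0 + s"] s(2,3) gF F_eq by simp
qed

text \<open>A socle point \<open>p\<close> bounds the depth by one, because \<open>x\<^sup>p\<close> carries every nonzero \<open>f\<close> of the prime to
  an element of \<open>K[Q]\<close> that lies outside \<open>(f)\<close> and that the prime multiplies into \<open>(f)\<close>.\<close>
lemma socle_local_depth:
  assumes F: "face Q F" and p: "p \<notin> face_localization Q F" "\<And>x. x \<in> Q \<Longrightarrow> x \<notin> F \<Longrightarrow> p + x \<in> Q"
  shows "local_depth (localization_at (subring_of A) (PF F)) \<le> 1"
proof -
  interpret localized_domain A "PF F" by unfold_locales (rule PF_prime[OF F])
  have shift: "monom p * f \<in> A" if "f \<in> PF F" for f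
    using that p(2) unfolding PF_def mem_Collect_eq keys_monom_mult by blast
  show ?thesis
  proof (rule local_depth_le_one)
    fix f assume f: "f \<in> PF F" "f \<noteq> 0"
    show "\<exists>h\<in>A. (\<forall>u\<in>S. \<forall>c\<in>A. u * h \<noteq> c * f) \<and> (\<forall>g\<in>PF F. \<exists>c\<in>A. g * h = c * f)"
    proof (rule bexI[of _ "monom p * f"], intro conjI ballI)
      show "monom p * f \<in> A" by (rule shift[OF f(1)])
    next
      fix u c assume u: "u \<in> S" and c: "c \<in> A"
      show "u * (monom p * f) \<noteq> c * f"
      proof
        assume "u * (monom p * f) = c * f"
        then have "f * (monom p * u) = f * c" by (simp add: ac_simps)
        then have eq: "monom p * u = c" by (rule laurent_mult_cancel[OF f(2)])
        obtain x where x: "x \<in> Poly_Mapping.keys u" "x \<in> F" using u by (auto simp: PF_iff)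
        then have "p + x \<in> Poly_Mapping.keys (monom p * u)" unfolding keys_monom_mult by blast
        then have "p + x \<in> Q" unfolding eq using c by blast
        then show False using p(1) in_face_localization_iff[OF Q' F] x(2) by blast
      qed
    next
      fix g assume g: "g \<in> PF F"
      have "g * (monom p * f) = (monom p * g) * f" by (simp add: ac_simps)
      then show "\<exists>c\<in>A. g * (monom p * f) = c * f" using shift[OF g] by blast
    qed
  qed
qed

section \<open>Primes below a facet\<close>

lemma supported_coset_decomposition:
  fixes H :: "(int ^ 'n) set" and p :: "(int ^ 'n) \<Rightarrow>\<^sub>0 'k"
  assumes "finite X" "Poly_Mapping.keys p \<subseteq> (\<Union>x\<in>X. (+) x ` H)"
  shows "\<exists>c. (\<forall>x\<in>X. c x \<in> supported H) \<and> p = (\<Sum>x\<in>X. c x * monom x)"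
  using assms
proof (induction X arbitrary: p rule: finite_induct)
  case empty
  then show ?case by (auto simp: finite_keys_eq_zero)
next
  case (insert x X)
  let ?p = "part ((+) x ` H) p" and ?r = "part (- (+) x ` H) p"
  have "Poly_Mapping.keys ?r \<subseteq> (\<Union>x\<in>X. (+) x ` H)" using insert.prems by (auto simp: keys_part)
  then obtain c where c: "\<forall>x\<in>X. c x \<in> supported H" "?r = (\<Sum>x\<in>X. c x * monom x)"
    using insert.IH by blast
  define c' where "c' = c(x := monom (- x) * ?p)"
  have "c' x \<in> supported H" unfolding c'_def mem_Collect_eq fun_upd_same keys_monom_mult keys_part by auto
  moreover have "c' y = c y" if "y \<in> X" for y using that insert.hyps(2) by (auto simp: c'_def)
  moreover have "p = (\<Sum>x\<in>insert x X. c' x * monom x)"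
  proof -
    have "(\<Sum>x\<in>insert x X. c' x * monom x) = c' x * monom x + (\<Sum>x\<in>X. c' x * monom x)"
      using insert.hyps by simp
    also have "(\<Sum>x\<in>X. c' x * monom x) = ?r"
      unfolding c(2) by (intro sum.cong) (use insert.hyps(2) in \<open>auto simp: c'_def\<close>)
    also have "c' x * monom x = ?p"
      using monom_cancel(2)[of x ?p] by (simp add: c'_def mult.commute)
    finally show ?thesis using part_split[of p "(+) x ` H"] by simp
  qed
  ultimately show ?case using c(1) by (intro exI[of _ c']) auto
qed

text \<open>Dividing an algebraic relation of \<open>f\<close> by a power of \<open>f\<close> makes its constant term nonzero, and the
  constant term is a multiple of \<open>f\<close>.\<close>
lemma algebraic_relation_constant_term:
  assumes P: "prime_set P" and A0: "subdomain A0" "A0 \<subseteq> A" and f: "f \<in> P" "f \<noteq> 0"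
    and rel: "(\<Sum>i\<le>e. a i * f ^ i) = 0" "\<And>i. i \<le> e \<Longrightarrow> a i \<in> A0" "\<exists>i\<le>e. a i \<noteq> 0"
  shows "\<exists>c\<in>A0 \<inter> P. c \<noteq> 0"
  using rel
proof (induction e arbitrary: a)
  case 0
  then show ?case by simp
next
  case (Suc e)
  have fA: "f \<in> A" using f(1) prime_setD(1)[OF P] by blast
  let ?s = "\<Sum>i\<le>e. a (Suc i) * f ^ i"
  have "(\<Sum>i\<le>Suc e. a i * f ^ i) = a 0 + (\<Sum>i\<le>e. a (Suc i) * f ^ Suc i)"
    by (subst sum.atMost_Suc_shift) simp
  also have "(\<Sum>i\<le>e. a (Suc i) * f ^ Suc i) = f * ?s"
    by (simp add: sum_distrib_left ac_simps)
  finally have eq: "a 0 + f * ?s = 0" using Suc.prems(1) by simp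
  show ?case
  proof (cases "a 0 = 0")
    case True
    then have "?s = 0" using eq laurent_mult_nonzero[OF f(2), of ?s] by auto
    moreover have "\<exists>i\<le>e. a (Suc i) \<noteq> 0" using Suc.prems(3) True by (metis not0_implies_Suc Suc_le_mono)
    ultimately show ?thesis using Suc.IH[of "\<lambda>i. a (Suc i)"] Suc.prems(2) by simp
  next
    case False
    have "a (Suc i) \<in> A" if "i \<le> e" for i using Suc.prems(2)[of "Suc i"] that A0(2) by auto
    then have "?s \<in> A" by (intro sum_in mult_in power_in[OF fA]) auto
    then have "(- ?s) * f \<in> P" by (intro prime_setD(4)[OF P f(1)] uminus_in)
    moreover have "a 0 = (- ?s) * f" using eq by (simp add: eq_neg_iff_add_eq_0 mult.commute)
    ultimately have "a 0 \<in> P" by (simp only:)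
    moreover have "a 0 \<in> A0" using Suc.prems(2)[of 0] by simp
    ultimately show ?thesis using False by (intro bexI[of _ "a 0"]) auto
  qed
qed

text \<open>A prime strictly below the prime of a facet \<open>F\<close> contains no monomial, since no face lies strictly
  between \<open>F\<close> and \<open>Q\<close>. If it is nonzero, it contains a nonzero element of \<open>K[F + \<nat> q]\<close> for a given
  \<open>q \<notin> F\<close>, because \<open>K[Q]\<close> is algebraic over that ring. Divided by the largest possible power of \<open>x\<^sup>q\<close>,
  this element still lies in the prime, but it has a term with exponent in \<open>F\<close>.\<close>
lemma below_facet_prime:
  assumes w: "facet_normal Q w" and P: "prime_set P" "P \<subset> PF (facet Q w)"
  shows "P = {0}"
proof (rule ccontr)
  assume "P \<noteq> {0}"
  then obtain f where f: "f \<in> P" "f \<noteq> 0" using prime_setD(2)[OF P(1)] by auto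
  have fA: "f \<in> A" using f(1) prime_setD(1)[OF P(1)] by blast
  let ?F = "facet Q w"
  note F = facet_face[OF Q' w]
  note FM = face_submonoid[OF Q' F]
  have no_mon: "monom q \<notin> P" if q: "q \<in> Q" for q
  proof
    assume mq: "monom q \<in> P"
    have "mon_face P \<noteq> Q" using mq q by (auto simp: mon_face_def)
    from proper_face_in_facet[OF Q mon_face_face[OF P(1)] this]
    obtain v where v: "facet_normal Q v" "mon_face P \<subseteq> facet Q v" by (elim exE conjE)
    have "?F \<subseteq> mon_face P"
    proof
      fix x assume x: "x \<in> ?F"
      then have "monom x \<notin> PF ?F" using monom_PF_iff[of x] by (auto simp: facet_def)
      then show "x \<in> mon_face P" using P(2) x by (auto simp: mon_face_def facet_def)
    qed
    moreover from this have "?F = facet Q v"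
    proof (intro face_eq_if_rank_eq[OF Q' F facet_face[OF Q' v(1)]])
      show "?F \<subseteq> facet Q v" using \<open>?F \<subseteq> mon_face P\<close> v(2) by (rule order_trans)
      show "group_rank (group_gen ?F) = group_rank (group_gen (facet Q v))"
        using facet_rank[OF Q' w] facet_rank[OF Q' v(1)] by simp
    qed
    ultimately have "mon_face P = ?F" using v(2) by simp
    then have "PF ?F \<subseteq> P" using PF_mon_face[OF P(1)] by simp
    then show False using P(2) by simp
  qed
  obtain q where q: "q \<in> Q" "0 < idot w q" using w by (auto simp: facet_normal_def)
  define M where "M = {x + int n *s q | x n. x \<in> ?F}"
  have MQ: "M \<subseteq> Q"
    unfolding M_def using submonoid_add[OF Q' _ submonoid_smult[OF Q' q(1)]] by (auto simp: facet_def)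
  have M: "add_submonoid M" unfolding add_submonoid_def
  proof (intro conjI ballI)
    have "0 = 0 + int 0 *s q" by simp
    then show "0 \<in> M" unfolding M_def using submonoid_zero[OF FM] by blast
    fix a b assume "a \<in> M" "b \<in> M"
    then obtain x m y n where "a = x + int m *s q" "b = y + int n *s q" "x \<in> ?F" "y \<in> ?F"
      unfolding M_def by blast
    then have "a + b = (x + y) + int (m + n) *s q" "x + y \<in> ?F"
      using submonoid_add[OF FM] by (auto simp: vec_eq_iff algebra_simps)
    then show "a + b \<in> M" unfolding M_def by blast
  qed
  define H where "H = group_gen M"
  have Hg: "add_subgroup H" unfolding H_def by (rule add_subgroup_group_gen)
  note Hm = subgroup_submonoid[OF Hg]
  have FH: "group_gen ?F \<subseteq> H"
  proof -
    have "?F \<subseteq> M"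
    proof
      fix x assume "x \<in> ?F"
      moreover have "x = x + int 0 *s q" by simp
      ultimately show "x \<in> M" unfolding M_def by blast
    qed
    then show ?thesis unfolding H_def by (rule group_gen_mono)
  qed
  have qH: "q \<in> H"
  proof -
    have "q = 0 + int 1 *s q" by simp
    then have "q \<in> M" unfolding M_def using submonoid_zero[OF FM] by blast
    then show ?thesis unfolding H_def using subset_group_gen by blast
  qed
  have sat: "\<exists>n>0. int n *s g \<in> H" if g: "g \<in> Q" for g
  proof -
    let ?y = "idot w q *s g - idot w g *s q"
    have gG: "g \<in> group_gen Q" "q \<in> group_gen Q" using g q(1) subset_group_gen by blast+
    have "?y \<in> group_gen Q" by (intro group_gen_diff group_gen_smult gG)
    moreover have "idot w ?y = 0" by (simp add: idot_simps)
    ultimately obtain n where n: "n > 0" "int n *s ?y \<in> group_gen ?F"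
      using w unfolding facet_normal_def facet_def by blast
    have "int (n * nat (idot w q)) *s g = int n *s ?y + (int n * idot w g) *s q"
      using q(2) by (simp add: vec_eq_iff algebra_simps)
    also have "\<dots> \<in> H" using n(2) FH by (intro submonoid_add[OF Hm] subgroup_smult[OF Hg qH]) auto
    finally show ?thesis using n(1) q(2) by (intro exI[of _ "n * nat (idot w q)"]) auto
  qed
  have "\<exists>n>0. \<forall>g\<in>X. int n *s g \<in> H" if "finite X" "X \<subseteq> Q" for X
    using that
  proof (induction X rule: finite_induct)
    case empty
    then show ?case by (intro exI[of _ 1]) auto
  next
    case (insert x X)
    then obtain n where n: "n > 0" "\<forall>g\<in>X. int n *s g \<in> H" by auto
    obtain m where m: "m > 0" "int m *s x \<in> H" using sat insert.prems by blast
    have "int (n * m) *s g \<in> H" if "g \<in> insert x X" for g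
    proof -
      have "int (n * m) *s g = int m *s (int n *s g)" "int (n * m) *s g = int n *s (int m *s g)"
        by (simp_all add: vec_eq_iff)
      then show ?thesis using that n(2) m(2) subgroup_smult[OF Hg] by (metis insertE)
    qed
    then show ?case using n(1) m(1) by (intro exI[of _ "n * m"]) auto
  qed
  moreover have kf: "Poly_Mapping.keys f \<subseteq> Q" using fA by simp
  ultimately obtain N where N: "N > 0" "\<And>g. g \<in> Poly_Mapping.keys f \<Longrightarrow> int N *s g \<in> H"
    using finite_keys by metis
  define X where "X = (\<lambda>k. \<Sum>g\<in>Poly_Mapping.keys f. int (k g) *s g) ` (PiE (Poly_Mapping.keys f) (\<lambda>_. {..<N}))"
  have finX: "finite X" unfolding X_def by (intro finite_imageI finite_PiE) auto
  have cover: "add_submonoid hull (Poly_Mapping.keys f) \<subseteq> (\<Union>x\<in>X. (+) x ` H)"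
  proof
    fix y assume "y \<in> add_submonoid hull (Poly_Mapping.keys f)"
    then obtain k where k: "y = (\<Sum>g\<in>Poly_Mapping.keys f. int (k g) *s g)"
      using hull_finite_repr[OF finite_keys] by blast
    define k' where "k' = restrict (\<lambda>g. k g mod N) (Poly_Mapping.keys f)"
    define x where "x = (\<Sum>g\<in>Poly_Mapping.keys f. int (k' g) *s g)"
    define h where "h = (\<Sum>g\<in>Poly_Mapping.keys f. int (k g div N) *s (int N *s g))"
    have "x \<in> X" unfolding X_def x_def by (rule imageI) (use N(1) in \<open>auto simp: k'_def\<close>)
    moreover have "h \<in> H" unfolding h_def by (intro submonoid_sum[OF Hm] subgroup_smult[OF Hg] N(2))
    moreover have "y = x + h"
      unfolding k x_def h_def sum.distrib[symmetric]
    proof (rule sum.cong[OF refl])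
      fix g assume "g \<in> Poly_Mapping.keys f"
      then have "int (k g) = int (k' g) + int (k g div N) * int N"
        by (simp add: k'_def) (metis add.commute div_mult_mod_eq of_nat_add of_nat_mult)
      then show "int (k g) *s g = int (k' g) *s g + int (k g div N) *s (int N *s g)"
        by (simp only: vector_sadd_rdistrib vector_smult_assoc)
    qed
    ultimately show "y \<in> (\<Union>x\<in>X. (+) x ` H)" by blast
  qed
  have pow: "Poly_Mapping.keys (f ^ i) \<subseteq> (\<Union>x\<in>X. (+) x ` H)" for i
  proof -
    interpret S: subdomain "supported (add_submonoid hull (Poly_Mapping.keys f)) :: ((int ^ 'n) \<Rightarrow>\<^sub>0 'k) set"
      by (rule subdomain_supported[OF add_submonoid_hull])
    have "f \<in> supported (add_submonoid hull (Poly_Mapping.keys f))" by (simp add: hull_subset)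
    then have "f ^ i \<in> supported (add_submonoid hull (Poly_Mapping.keys f))" by (rule S.power_in)
    then show ?thesis using cover by blast
  qed
  have "\<forall>i. \<exists>c. (\<forall>x\<in>X. c x \<in> supported H) \<and> f ^ i = (\<Sum>x\<in>X. c x * monom x)"
    using supported_coset_decomposition[OF finX pow] by blast
  then obtain c where c: "\<And>i x. x \<in> X \<Longrightarrow> c i x \<in> supported H" "\<And>i. f ^ i = (\<Sum>x\<in>X. c i x * monom x)"
    unfolding choice_iff by (elim exE) blast
  interpret H: subdomain "supported H :: ((int ^ 'n) \<Rightarrow>\<^sub>0 'k) set" by (rule subdomain_supported[OF Hm])
  define e where "e = card X"
  have "\<exists>a. (\<forall>i\<in>{..e}. a i \<in> supported H) \<and> (\<exists>i\<in>{..e}. a i \<noteq> 0) \<and> (\<forall>x\<in>X. (\<Sum>i\<in>{..e}. a i * c i x) = 0)"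
    by (rule more_vectors_than_coordinates_dependent[OF H.one_in H.diff_in H.mult_in H.zero_divisor_free finX])
       (use c(1) in \<open>auto simp: e_def\<close>)
  then obtain a where a: "\<And>i. i \<le> e \<Longrightarrow> a i \<in> supported H" "\<exists>i\<le>e. a i \<noteq> 0"
    "\<And>x. x \<in> X \<Longrightarrow> (\<Sum>i\<le>e. a i * c i x) = 0" by auto
  have rel: "(\<Sum>i\<le>e. a i * f ^ i) = 0"
  proof -
    have "(\<Sum>i\<le>e. a i * f ^ i) = (\<Sum>i\<le>e. \<Sum>x\<in>X. a i * c i x * monom x)"
      by (simp add: c(2) sum_distrib_left mult.assoc)
    also have "\<dots> = (\<Sum>x\<in>X. \<Sum>i\<le>e. a i * c i x * monom x)" by (rule sum.swap)
    also have "\<dots> = (\<Sum>x\<in>X. (\<Sum>i\<le>e. a i * c i x) * monom x)" by (simp add: sum_distrib_right)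
    also have "\<dots> = 0" using a(3) by simp
    finally show ?thesis .
  qed
  have "\<exists>m\<in>M. \<forall>s\<in>(\<Union>i\<in>{..e}. Poly_Mapping.keys (a i)). m + s \<in> M"
  proof (rule common_shift[OF M M order_refl])
    fix s assume "s \<in> (\<Union>i\<in>{..e}. Poly_Mapping.keys (a i))"
    then have "s \<in> H" using a(1) by blast
    then show "\<exists>q\<in>M. \<exists>f\<in>M. s = q - f" unfolding H_def group_gen_eq_diff[OF M] by blast
  qed auto
  then obtain m where m: "m \<in> M" "\<And>i s. i \<le> e \<Longrightarrow> s \<in> Poly_Mapping.keys (a i) \<Longrightarrow> m + s \<in> M" by auto
  define b where "b i = monom m * a i" for i
  have bM: "b i \<in> supported M" if "i \<le> e" for i
    unfolding b_def mem_Collect_eq keys_monom_mult using m(2)[OF that] by blast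
  have "(\<Sum>i\<le>e. b i * f ^ i) = monom m * (\<Sum>i\<le>e. a i * f ^ i)"
    by (simp add: b_def sum_distrib_left mult.assoc)
  then have "(\<Sum>i\<le>e. b i * f ^ i) = 0" using rel by simp
  moreover have "\<exists>i\<le>e. b i \<noteq> 0"
    using a(2) laurent_mult_nonzero[OF monom_nonzero] unfolding b_def by blast
  moreover have "supported M \<subseteq> A" using MQ by auto
  ultimately have "\<exists>z\<in>supported M \<inter> P. z \<noteq> 0"
    by (intro algebraic_relation_constant_term[OF P(1) subdomain_supported[OF M] _ f, of b e] bM)
  then obtain z where z: "z \<in> supported M" "z \<in> P" "z \<noteq> 0" by blast
  have "Poly_Mapping.keys z \<noteq> {}" using z(3) by (simp add: finite_keys_eq_zero)
  then obtain y where y: "y \<in> Poly_Mapping.keys z" "\<And>y'. y' \<in> Poly_Mapping.keys z \<Longrightarrow> idot w y \<le> idot w y'"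
    using arg_min_if_finite[OF finite_keys, of z "idot w"] by (metis not_less)
  have "y \<in> M" using y(1) z(1) by blast
  then obtain x k where xk: "y = x + int k *s q" "x \<in> ?F" unfolding M_def by blast
  define u where "u = monom (- (int k *s q)) * z"
  have F0: "idot w x = 0" if "x \<in> ?F" for x using that by (simp add: facet_def)
  have "Poly_Mapping.keys u \<subseteq> Q"
  proof
    fix s assume "s \<in> Poly_Mapping.keys u"
    then obtain y' where y': "s = - (int k *s q) + y'" "y' \<in> Poly_Mapping.keys z"
      unfolding u_def keys_monom_mult by blast
    then have "y' \<in> M" using z(1) by blast
    then obtain x' k' where xk': "y' = x' + int k' *s q" "x' \<in> ?F" unfolding M_def by blast
    have "int k * idot w q \<le> int k' * idot w q"
      using y(2)[OF y'(2)] by (simp add: xk xk' idot_simps F0)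
    then have "k \<le> k'" using q(2) by simp
    then have "s = x' + int (k' - k) *s q" unfolding y'(1) xk'(1) by (simp add: vec_eq_iff algebra_simps of_nat_diff)
    also have "\<dots> \<in> M" unfolding M_def using xk'(2) by blast
    finally show "s \<in> Q" using MQ by blast
  qed
  then have uA: "u \<in> A" by simp
  have "x \<in> Poly_Mapping.keys u" unfolding u_def keys_monom_mult using y(1) xk(1) by (auto intro!: image_eqI[of _ _ y])
  then have "u \<notin> PF ?F" using xk(2) by (auto simp: PF_iff)
  then have uP: "u \<notin> P" using P(2) by blast
  have kq: "int k *s q \<in> Q" by (rule submonoid_smult[OF Q' q(1)])
  have "monom (int k *s q) * u \<in> P" unfolding u_def using z(2) by (simp only: monom_cancel)
  then show False using prime_setD(6)[OF P(1) monom_A[OF kq] uA] no_mon[OF kq] uP by blast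
qed

lemma facet_height:
  "facet_normal Q w \<Longrightarrow> height (subring_of A) (PF (facet Q w)) \<le> enat 1"
  by (rule height_le_oneI) (rule below_facet_prime)

end

section \<open>Prime avoidance\<close>

lemma (in subdomain) prod_prime_set_iff:
  assumes "prime_set p" "finite I" "\<And>i. i \<in> I \<Longrightarrow> f i \<in> A"
  shows "prod f I \<in> A" "prod f I \<in> p \<longleftrightarrow> (\<exists>i\<in>I. f i \<in> p)"
proof -
  have "prod f I \<in> A \<and> (prod f I \<in> p \<longleftrightarrow> (\<exists>i\<in>I. f i \<in> p))" using assms(2,3)
  proof (induction I rule: finite_induct)
    case empty
    then show ?case using one_in prime_setD(5)[OF assms(1)] by simp
  next
    case (insert i I)
    then have IH: "prod f I \<in> A" "prod f I \<in> p \<longleftrightarrow> (\<exists>i\<in>I. f i \<in> p)" and fi: "f i \<in> A" by auto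
    have "f i * prod f I \<in> p \<longleftrightarrow> f i \<in> p \<or> prod f I \<in> p"
      using prime_setD(6)[OF assms(1) fi IH(1)] prime_setD(4)[OF assms(1) _ fi, of "prod f I"]
        prime_setD(4)[OF assms(1) _ IH(1), of "f i"] by (auto simp: mult.commute)
    then show ?case using insert.hyps IH mult_in[OF fi IH(1)] by simp
  qed
  then show "prod f I \<in> A" "prod f I \<in> p \<longleftrightarrow> (\<exists>i\<in>I. f i \<in> p)" by blast+
qed

text \<open>Induction on the number of primes: an element \<open>x p\<close> of \<open>P\<close> lying in \<open>p\<close> and in no other prime
  exists for every \<open>p\<close>, unless one avoids them all; then \<open>x p0\<close> plus the product of the others lies
  in none.\<close>
lemma (in subdomain) prime_avoidance:
  assumes "finite \<P>" "\<And>p. p \<in> \<P> \<Longrightarrow> prime_set p" "\<And>p. p \<in> \<P> \<Longrightarrow> \<not> P \<subseteq> p" "prime_set P"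
  shows "\<exists>g\<in>P. \<forall>p\<in>\<P>. g \<notin> p"
  using assms(1-3)
proof (induction "card \<P>" arbitrary: \<P> rule: less_induct)
  case less
  show ?case
  proof (rule ccontr)
    assume no: "\<not> ?thesis"
    note P = prime_setD[OF assms(4)]
    have "\<exists>x. x \<in> P \<and> x \<in> p \<and> (\<forall>p'\<in>\<P> - {p}. x \<notin> p')" if p: "p \<in> \<P>" for p
    proof -
      have "card (\<P> - {p}) < card \<P>" using p less.prems(1) by (rule card_Diff1_less[rotated])
      then have "\<exists>g\<in>P. \<forall>p'\<in>\<P> - {p}. g \<notin> p'" by (rule less.hyps) (use less.prems in auto)
      then obtain x where x: "x \<in> P" "\<forall>p'\<in>\<P> - {p}. x \<notin> p'" by blast
      then have "x \<in> p" using no by auto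
      then show ?thesis using x by blast
    qed
    then have "\<forall>p\<in>\<P>. \<exists>x. x \<in> P \<and> x \<in> p \<and> (\<forall>p'\<in>\<P> - {p}. x \<notin> p')" by simp
    then have "\<exists>x. \<forall>p\<in>\<P>. x p \<in> P \<and> x p \<in> p \<and> (\<forall>p'\<in>\<P> - {p}. x p \<notin> p')" by (rule bchoice)
    then obtain x where "\<forall>p\<in>\<P>. x p \<in> P \<and> x p \<in> p \<and> (\<forall>p'\<in>\<P> - {p}. x p \<notin> p')" by (elim exE)
    then have x: "\<And>p. p \<in> \<P> \<Longrightarrow> x p \<in> P" "\<And>p. p \<in> \<P> \<Longrightarrow> x p \<in> p"
      "\<And>p p'. p \<in> \<P> \<Longrightarrow> p' \<in> \<P> \<Longrightarrow> p' \<noteq> p \<Longrightarrow> x p \<notin> p'" by auto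
    have xA: "x p \<in> A" if "p \<in> \<P>" for p using x(1)[OF that] P(1) by blast
    have "\<P> \<noteq> {}" using no P(2) by auto
    then obtain p0 where p0: "p0 \<in> \<P>" by auto
    let ?I = "\<P> - {p0}"
    have finI: "finite ?I" using less.prems(1) by simp
    show False
    proof (cases "?I = {}")
      case True
      then have "\<P> = {p0}" using p0 by auto
      then show False using no less.prems(3)[OF p0] by auto
    next
      case False
      let ?z = "prod x ?I"
      have z: "?z \<in> p \<longleftrightarrow> (\<exists>i\<in>?I. x i \<in> p)" if "prime_set p" for p
        by (rule prod_prime_set_iff(2)[OF that finI]) (use xA in auto)
      have "?z \<in> P" using z[OF assms(4)] False x(1) by auto
      then have "x p0 + ?z \<in> P" using P(3) x(1)[OF p0] by blast
      moreover have "x p0 + ?z \<notin> p" if p: "p \<in> \<P>" for p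
      proof
        assume sum: "x p0 + ?z \<in> p"
        note pr = less.prems(2)[OF p]
        have neg: "- y \<in> p" if "y \<in> p" for y
          using prime_setD(4)[OF pr that uminus_in[OF one_in]] by simp
        show False
        proof (cases "p = p0")
          case True
          then have "x p0 + ?z + - x p0 \<in> p" using prime_setD(3)[OF pr sum neg[OF x(2)[OF p]]] by simp
          then have "?z \<in> p" by simp
          then obtain i where "i \<in> ?I" "x i \<in> p" using z[OF pr] by blast
          then show False using x(3)[of i p] p True by auto
        next
          case False
          then have "?z \<in> p" using z[OF pr] x(2)[OF p] p by blast
          then have "x p0 + ?z + - ?z \<in> p" using prime_setD(3)[OF pr sum neg] by blast
          then have "x p0 \<in> p" by simp
          then show False using x(3)[OF p0 p False] by blast
        qed
      qed
      ultimately show False using no by blast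
    qed
  qed
qed

context affine_algebra
begin

section \<open>Primes without monomials\<close>

text \<open>Monomials are units of the factorial ring \<open>K[\<int>Q]\<close>. So a nonzero element of \<open>P\<close> is a product of
  prime elements of that ring, each of which can be moved into \<open>K[Q]\<close> by a monomial, and one of
  them lies in \<open>P\<close>.\<close>
lemma laurent_prime_element:
  assumes P: "prime_set P" "P \<noteq> {0}" and nm: "\<forall>q\<in>Q. monom q \<notin> P"
  shows "\<exists>\<pi>\<in>P. G.prime_in \<pi>"
proof -
  have no_mon: "\<And>q. q \<in> Q \<Longrightarrow> monom q \<notin> P" using nm by blast
  have main: "\<exists>\<pi>\<in>P. G.prime_in \<pi>" if "G.factors n a" "q \<in> Q" "monom q * a \<in> P" for n a q
    using that
  proof (induction n arbitrary: a q)
    case 0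
    then obtain v where v: "v \<in> KG" "a * v = 1" using G.unit_inverse[of a] by (auto simp del: mem_Collect_eq)
    obtain r where r: "r \<in> Q" "monom r * v \<in> A" using KG_shift[OF v(1)] .
    have "(monom r * v) * (monom q * a) \<in> P" by (rule prime_setD(4)[OF P(1) 0(3) r(2)])
    also have "(monom r * v) * (monom q * a) = monom r * monom q * (a * v)" by (simp only: ac_simps)
    also have "\<dots> = monom (r + q)" using v(2) by (simp add: monom_mult)
    finally show ?case using no_mon submonoid_add[OF Q' r(1) 0(2)] by blast
  next
    case (Suc n)
    then obtain p b where p: "G.prime_in p" "b \<in> KG" "a = p * b" "G.factors n b"
      by (auto simp del: mem_Collect_eq)
    obtain r where r: "r \<in> Q" "monom r * p \<in> A" using KG_shift[OF G.prime_in_D(1)[OF p(1)]] .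
    obtain s where s: "s \<in> Q" "monom s * b \<in> A" using KG_shift[OF p(2)] .
    have sq: "s + q \<in> Q" by (rule submonoid_add[OF Q' s(1) Suc.prems(2)])
    have sb: "monom (s + q) * b \<in> A"
    proof -
      have "monom q * (monom s * b) \<in> A" by (rule mult_in[OF monom_A[OF Suc.prems(2)] s(2)])
      also have "monom q * (monom s * b) = monom (s + q) * b"
        by (simp add: mult.assoc[symmetric] monom_mult add.commute)
      finally show ?thesis .
    qed
    have "monom (r + s) * (monom q * a) \<in> P"
      by (rule prime_setD(4)[OF P(1) Suc.prems(3) monom_A[OF submonoid_add[OF Q' r(1) s(1)]]])
    also have "monom (r + s) * (monom q * a) = (monom r * p) * (monom (s + q) * b)"
      unfolding p(3) monom_mult[symmetric] by (simp only: ac_simps)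
    finally consider "monom r * p \<in> P" | "monom (s + q) * b \<in> P" using prime_setD(6)[OF P(1) r(2) sb] by blast
    then show ?case
    proof cases
      case 1
      have "G.prime_in (monom r * p)" unfolding G.prime_in_def
      proof (intro conjI ballI impI)
        show "monom r * p \<in> KG" using r(2) A_KG by blast
        show "monom r * p \<noteq> 0" by (rule laurent_mult_nonzero[OF monom_nonzero G.prime_in_D(2)[OF p(1)]])
        show "\<not> monom r * p dvd 1" using G.prime_in_D(3)[OF p(1)] dvd_mult_right by blast
        have eq: "monom r * p dvd c \<longleftrightarrow> p dvd c" for c
        proof
          show "p dvd c" if "monom r * p dvd c" using that by (rule dvd_mult_right)
          assume "p dvd c"
          then obtain d where "c = p * d" by (rule dvdE)
          then have "c = (monom r * p) * (monom (- r) * d)"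
            using monom_cancel(2)[of r "p * d"] by (simp add: ac_simps)
          then show "monom r * p dvd c" by simp
        qed
        fix c d assume "c \<in> KG" "d \<in> KG" "monom r * p dvd c * d"
        then show "monom r * p dvd c \<or> monom r * p dvd d"
          using G.prime_in_D(4)[OF p(1)] unfolding eq by blast
      qed
      then show ?thesis using 1 by blast
    next
      case 2
      show ?thesis by (rule Suc.IH[OF p(4) sq 2])
    qed
  qed
  obtain a where a: "a \<in> P" "a \<noteq> 0" using P(2) prime_setD(2)[OF P(1)] by auto
  then have "a \<in> KG" using prime_setD(1)[OF P(1)] A_KG by blast
  then obtain n where "G.factors n a"
    using laurent_factorial[OF add_subgroup_group_gen, of Q, where 'k = 'k] a(2)
    unfolding G.factorial_def by blast
  moreover have "monom 0 * a \<in> P" using a(1) by simp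
  ultimately show ?thesis using main submonoid_zero[OF Q'] by blast
qed

lemma laurent_prime_trace:
  assumes P: "prime_set P" and nm: "\<forall>q\<in>Q. monom q \<notin> P"
    and pi: "\<pi> \<in> P" "G.prime_in \<pi>"
  shows "prime_set {a\<in>A. \<pi> dvd a}" "{a\<in>A. \<pi> dvd a} \<subseteq> P"
    "\<And>a. a \<in> A \<Longrightarrow> \<pi> dvd a \<Longrightarrow> \<exists>q\<in>Q. \<exists>c\<in>A. monom q * a = c * \<pi>"
proof -
  have no_mon: "\<And>q. q \<in> Q \<Longrightarrow> monom q \<notin> P" using nm by blast
  have piA: "\<pi> \<in> A" using pi(1) prime_setD(1)[OF P] by blast
  show *: "\<exists>q\<in>Q. \<exists>c\<in>A. monom q * a = c * \<pi>" if a: "a \<in> A" "\<pi> dvd a" for a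
  proof -
    obtain c where c: "a = \<pi> * c" using a(2) by (rule dvdE)
    have "a \<in> KG" using a(1) A_KG by blast
    then have "c \<in> KG" using G.dvd_closed[OF G.prime_in_D(1)[OF pi(2)] G.prime_in_D(2)[OF pi(2)]] c by blast
    then obtain q where q: "q \<in> Q" "monom q * c \<in> A" by (rule KG_shift)
    have "monom q * a = (monom q * c) * \<pi>" using c by (simp add: ac_simps)
    then show ?thesis using q by blast
  qed
  show "{a\<in>A. \<pi> dvd a} \<subseteq> P"
  proof
    fix a assume "a \<in> {a\<in>A. \<pi> dvd a}"
    then have a: "a \<in> A" "\<pi> dvd a" by auto
    obtain q c where qc: "q \<in> Q" "c \<in> A" "monom q * a = c * \<pi>" using *[OF a] by blast
    then have "monom q * a \<in> P" using prime_setD(4)[OF P pi(1)] by simp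
    then show "a \<in> P" using prime_setD(6)[OF P monom_A[OF qc(1)] a(1)] no_mon[OF qc(1)] by blast
  qed
  show "prime_set {a\<in>A. \<pi> dvd a}" unfolding prime_set_def
  proof (intro conjI ballI impI)
    show "1 \<notin> {a\<in>A. \<pi> dvd a}" using G.prime_in_D(3)[OF pi(2)] by simp
    show "a + b \<in> {a\<in>A. \<pi> dvd a}" if "a \<in> {a\<in>A. \<pi> dvd a}" "b \<in> {a\<in>A. \<pi> dvd a}" for a b
      using that add_in[of a b] by (simp add: dvd_add)
    show "c * a \<in> {a\<in>A. \<pi> dvd a}" if "a \<in> {a\<in>A. \<pi> dvd a}" "c \<in> A" for a c
      using that mult_in[of c a] by simp
    fix a b assume ab: "a \<in> A" "b \<in> A" "a * b \<in> {a\<in>A. \<pi> dvd a}"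
    then have "\<pi> dvd a \<or> \<pi> dvd b" using G.prime_in_D(4)[OF pi(2)] A_KG by blast
    then show "a \<in> {a\<in>A. \<pi> dvd a} \<or> b \<in> {a\<in>A. \<pi> dvd a}" using ab by blast
  qed (use zero_in in auto)
qed

lemma extract_prime_power:
  assumes "G.prime_in \<pi>" "G.factors n a"
  shows "\<exists>k b. a = \<pi> ^ k * b \<and> \<not> \<pi> dvd b \<and> b \<in> KG"
  using assms(2)
proof (induction n arbitrary: a rule: less_induct)
  case (less n)
  note aG = G.factors_in[OF less.prems]
  show ?case
  proof (cases "\<pi> dvd a")
    case False
    then show ?thesis using aG by (intro exI[of _ 0] exI[of _ a]) simp
  next
    case True
    then obtain c where c: "a = \<pi> * c" by (rule dvdE)
    then have cG: "c \<in> KG" using G.dvd_closed[OF G.prime_in_D(1)[OF assms(1)] G.prime_in_D(2)[OF assms(1)]] aG by blast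
    have "\<exists>m. n = Suc m \<and> G.factors m c" by (rule G.factors_cancel[OF _ assms(1) cG]) (use less.prems c in simp)
    then obtain m where "n = Suc m" "G.factors m c" by blast
    then obtain k b where kb: "c = \<pi> ^ k * b" "\<not> \<pi> dvd b" "b \<in> KG" using less.IH[of m c] by blast
    have "a = \<pi> ^ Suc k * b" using c kb(1) by (simp add: ac_simps)
    then show ?thesis using kb by blast
  qed
qed

text \<open>Splitting off all factors \<open>\<pi>\<close> writes an element as a power of \<open>\<pi>\<close> times one that \<open>\<pi>\<close> does not divide;
  the monomials needed to stay in \<open>K[Q]\<close> are units of the localization.\<close>
lemma laurent_prime_dvr:
  assumes P: "prime_set P" and nm: "\<forall>q\<in>Q. monom q \<notin> P"
    and pi: "\<pi> \<in> P" "G.prime_in \<pi>" and eq: "P = {a\<in>A. \<pi> dvd a}"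
  shows "regular_local_ring (localization_at (subring_of A) P)" "height (subring_of A) P \<le> enat 1"
proof -
  have no_mon: "\<And>q. q \<in> Q \<Longrightarrow> monom q \<notin> P" using nm by blast
  interpret loc: localized_domain A P by unfold_locales (rule P)
  have *: "\<exists>k. \<exists>s\<in>loc.S. \<exists>b\<in>loc.S. s * a = \<pi> ^ k * b" if a: "a \<in> A" "a \<noteq> 0" for a
  proof -
    have "a \<in> KG" using a(1) A_KG by blast
    then obtain n where "G.factors n a"
      using laurent_factorial[OF add_subgroup_group_gen, of Q, where 'k = 'k] a(2)
      unfolding G.factorial_def by blast
    then obtain k b where kb: "a = \<pi> ^ k * b" "\<not> \<pi> dvd b" "b \<in> KG"
      using extract_prime_power[OF pi(2)] by blast
    obtain q where q: "q \<in> Q" "monom q * b \<in> A" using KG_shift[OF kb(3)] .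
    have "monom q \<in> loc.S" using monom_A[OF q(1)] no_mon[OF q(1)] by blast
    moreover have "monom q * b \<in> loc.S"
    proof -
      have "\<not> \<pi> dvd monom q * b"
      proof
        assume "\<pi> dvd monom q * b"
        then have "\<pi> dvd monom (- q) * (monom q * b)" by (rule dvd_mult)
        then show False using kb(2) by (simp only: monom_cancel)
      qed
      then show ?thesis using q(2) eq by blast
    qed
    moreover have "monom q * a = \<pi> ^ k * (monom q * b)" using kb(1) by (simp add: ac_simps)
    ultimately show ?thesis by blast
  qed
  have "\<pi> \<noteq> 0" by (rule G.prime_in_D(2)[OF pi(2)])
  from loc.dvr_criterion[OF pi(1) this *]
  show "regular_local_ring (localization_at (subring_of A) P)" "height (subring_of A) P \<le> enat 1" by blast+
qed

section \<open>Primes of facets\<close>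

text \<open>Up to a nonnegative multiple of an element of \<open>Q\<close> of positive height, some multiple of \<open>p\<close> lies in the group of the
  facet; so \<open>p\<close> lies in the normalization of the localization.\<close>
lemma normal_facet_half_space:
  assumes w: "facet_normal Q w" and nor: "normalization Q \<subseteq> face_localization Q (facet Q w)"
    and p: "p \<in> group_gen Q" "0 \<le> idot w p"
  shows "p \<in> face_localization Q (facet Q w)"
proof -
  let ?F = "facet Q w"
  note F = facet_face[OF Q' w]
  note FM = face_submonoid[OF Q' F]
  obtain q where q: "q \<in> Q" "0 < idot w q" using w by (auto simp: facet_normal_def)
  let ?y = "idot w q *s p - idot w p *s q"
  have "q \<in> group_gen Q" using q(1) subset_group_gen by blast
  then have "?y \<in> group_gen Q" using p(1) by (intro group_gen_diff group_gen_smult)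
  moreover have "idot w ?y = 0" by (simp add: idot_simps)
  ultimately obtain n where n: "n > 0" "int n *s ?y \<in> group_gen ?F"
    using w unfolding facet_normal_def facet_def by blast
  then obtain f g where fg: "int n *s ?y = f - g" "f \<in> ?F" "g \<in> ?F"
    unfolding group_gen_eq_diff[OF FM] by blast
  define N where "N = n * nat (idot w q)"
  have "int N *s p = int n *s ?y + (int n * idot w p) *s q"
    using q(2) by (simp add: N_def vec_eq_iff algebra_simps)
  also have "\<dots> = (f + (int n * idot w p) *s q) - g" unfolding fg(1) by simp
  also have "\<dots> \<in> face_localization Q ?F"
  proof -
    have "f + (int n * idot w p) *s q \<in> Q"
      using fg(2) p(2) faceD(1)[OF F]
      by (intro submonoid_add[OF Q'] submonoid_smult_int[OF Q' q(1)]) auto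
    then show ?thesis unfolding face_localization_def using fg(3) by blast
  qed
  finally have "int N *s p \<in> face_localization Q ?F" .
  moreover have "N > 0" using n(1) q(2) by (simp add: N_def)
  ultimately have "p \<in> normalization (face_localization Q ?F)"
    unfolding normalization_eq[OF face_localization_affine[OF Q F]] group_gen_face_localization[OF Q' F]
    using p(1) by blast
  moreover have "normal_monoid (face_localization Q ?F)"
    using nor normal_face_localization_iff[OF Q F] by blast
  ultimately show ?thesis unfolding normal_monoid_def by simp
qed

text \<open>The localization at the facet contains all lattice points of nonnegative height, in particular
  some \<open>q\<close> of least positive height. Each element is a power of \<open>x\<^sup>q\<close> times one with a term of height
  zero, and the latter is a unit of the localization.\<close>
lemma normal_facet_dvr:
  assumes w: "facet_normal Q w" and nor: "normalization Q \<subseteq> face_localization Q (facet Q w)"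
  shows "regular_local_ring (localization_at (subring_of A) (PF (facet Q w)))"
proof -
  let ?F = "facet Q w"
  note F = facet_face[OF Q' w]
  note FM = face_submonoid[OF Q' F]
  interpret loc: localized_domain A "PF ?F" by unfold_locales (rule PF_prime[OF F])
  obtain q0 where q0: "q0 \<in> Q" "0 < idot w q0" using w by (auto simp: facet_normal_def)
  have q0G: "q0 \<in> group_gen Q" using q0(1) subset_group_gen by blast
  define m where "m = (LEAST m. \<exists>p\<in>group_gen Q. 0 < idot w p \<and> nat (idot w p) = m)"
  have "\<exists>p\<in>group_gen Q. 0 < idot w p \<and> nat (idot w p) = m" unfolding m_def
    by (rule LeastI[of _ "nat (idot w q0)"]) (use q0(2) q0G in blast)
  then obtain p where p: "p \<in> group_gen Q" "0 < idot w p" "nat (idot w p) = m" by blast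
  have m_le: "m \<le> nat (idot w x)" if "x \<in> group_gen Q" "0 < idot w x" for x
    unfolding m_def by (rule Least_le) (use that in blast)
  have "p \<in> face_localization Q ?F" using normal_facet_half_space[OF w nor p(1)] p(2) by simp
  then obtain f where f: "f \<in> ?F" "p + f \<in> Q" using in_face_localization_iff[OF Q' F] by blast
  define q where "q = p + f"
  have q: "q \<in> Q" "idot w q = idot w p" using f by (simp_all add: q_def idot_simps facet_def)
  have lev: "\<exists>k. idot w x = int k * idot w q" if x: "x \<in> Q" for x
  proof -
    let ?k = "idot w x div idot w q"
    have wx: "0 \<le> idot w x" using w x by (simp add: facet_normal_def)
    have "x - ?k *s q \<in> group_gen Q"
      using x q(1) subset_group_gen[of Q] by (intro group_gen_diff group_gen_smult) auto
    moreover have eq: "idot w (x - ?k *s q) = idot w x mod idot w q"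
      by (simp add: idot_simps minus_div_mult_eq_mod)
    moreover have "0 \<le> idot w x mod idot w q" "idot w x mod idot w q < idot w q"
      using p(2) q(2) by simp_all
    ultimately have "idot w x mod idot w q = 0"
      using m_le[of "x - ?k *s q"] p(3) q(2) by (cases "idot w x mod idot w q = 0") auto
    then have "idot w x = ?k * idot w q" by (metis add.right_neutral div_mult_mod_eq)
    moreover have "0 \<le> ?k" using wx p(2) q(2) by (simp add: pos_imp_zdiv_nonneg_iff)
    ultimately show ?thesis by (intro exI[of _ "nat ?k"]) simp
  qed
  show ?thesis
  proof (rule loc.dvr_criterion(1))
    have "q \<notin> ?F" using q(2) p(2) by (simp add: facet_def)
    then show "monom q \<in> PF ?F" using monom_PF_iff[OF q(1)] by blast
    show "monom q \<noteq> (0 :: (int ^ 'n) \<Rightarrow>\<^sub>0 'k)" by (rule monom_nonzero)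
    fix a assume a: "a \<in> A" "a \<noteq> 0"
    then have "Poly_Mapping.keys a \<noteq> {}" by (simp add: finite_keys_eq_zero)
    then obtain y where y: "y \<in> Poly_Mapping.keys a" "\<And>y'. y' \<in> Poly_Mapping.keys a \<Longrightarrow> idot w y \<le> idot w y'"
      using arg_min_if_finite[OF finite_keys, of a "idot w"] by (metis not_less)
    have yQ: "y \<in> Q" using y(1) a(1) by blast
    obtain k where k: "idot w y = int k * idot w q" using lev[OF yQ] by blast
    define b where "b = monom (- (int k *s q)) * a"
    have "\<exists>c\<in>?F. \<forall>s\<in>Poly_Mapping.keys b. c + s \<in> Q"
    proof (rule common_shift[OF Q' FM faceD(1)[OF F] finite_keys])
      fix s assume "s \<in> Poly_Mapping.keys b"
      then obtain y' where y': "s = - (int k *s q) + y'" "y' \<in> Poly_Mapping.keys a"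
        unfolding b_def keys_monom_mult by blast
      have "y' \<in> group_gen Q" "q \<in> group_gen Q" using y'(2) a(1) q(1) subset_group_gen by blast+
      then have "s \<in> group_gen Q" unfolding y'(1) by (intro group_gen_add group_gen_uminus group_gen_smult)
      moreover have "0 \<le> idot w s" using y(2)[OF y'(2)] k by (simp add: y'(1) idot_simps)
      ultimately have "s \<in> face_localization Q ?F" by (rule normal_facet_half_space[OF w nor])
      then show "\<exists>q\<in>Q. \<exists>f\<in>?F. s = q - f" unfolding face_localization_def by blast
    qed
    then obtain c where c: "c \<in> ?F" "\<And>s. s \<in> Poly_Mapping.keys b \<Longrightarrow> c + s \<in> Q" by blast
    have cQ: "c \<in> Q" using c(1) faceD(1)[OF F] by blast
    have "monom c \<in> loc.S" using monom_A[OF cQ] monom_PF_iff[OF cQ, of ?F] c(1) by blast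
    moreover have "monom c * b \<in> loc.S"
    proof -
      have "monom c * b \<in> A" unfolding mem_Collect_eq keys_monom_mult using c(2) by blast
      moreover have "c + (y - int k *s q) \<in> Poly_Mapping.keys (monom c * b)"
        unfolding keys_monom_mult b_def using y(1) by (auto intro!: image_eqI[of _ _ y])
      moreover have "c + (y - int k *s q) \<in> ?F"
        using calculation c(1) k by (auto simp: facet_def idot_simps)
      ultimately show ?thesis by (auto simp: PF_iff)
    qed
    moreover have "monom c * a = monom q ^ k * (monom c * b)"
    proof -
      have "a = monom (int k *s q) * b" unfolding b_def by (simp only: monom_cancel)
      then show ?thesis unfolding monom_power by (simp add: ac_simps)
    qed
    ultimately show "\<exists>k. \<exists>s\<in>loc.S. \<exists>b\<in>loc.S. s * a = monom q ^ k * b" by blast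
  qed
qed

text \<open>Let \<open>q \<in> Q\<close> have least positive height. As a product of two elements of the prime has larger
  heights, \<open>x\<^sup>q\<close> generates the maximal ideal as well. Hence every \<open>x \<in> Q\<close> outside the facet is \<open>q\<close> plus an
  element of the localization, and repeating this, \<open>x\<close> is a multiple of \<open>q\<close> modulo the group of the facet.\<close>
lemma regular_facet_normal:
  assumes w: "facet_normal Q w"
    and reg: "regular_local_ring (localization_at (subring_of A) (PF (facet Q w)))"
  shows "normalization Q \<subseteq> face_localization Q (facet Q w)"
proof -
  let ?F = "facet Q w"
  note F = facet_face[OF Q' w]
  note FM = face_submonoid[OF Q' F]
  interpret loc: localized_domain A "PF ?F" by unfold_locales (rule PF_prime[OF F])
  have pos: "0 \<le> idot w x" if "x \<in> Q" for x using w that by (simp add: facet_normal_def)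
  obtain x0 where x0: "x0 \<in> Q" "0 < idot w x0" using w by (auto simp: facet_normal_def)
  define m where "m = (LEAST m. \<exists>x\<in>Q. 0 < idot w x \<and> nat (idot w x) = m)"
  have "\<exists>x\<in>Q. 0 < idot w x \<and> nat (idot w x) = m" unfolding m_def
    by (rule LeastI[of _ "nat (idot w x0)"]) (use x0 in blast)
  then obtain q where q: "q \<in> Q" "0 < idot w q" "nat (idot w q) = m" by blast
  have min: "idot w q \<le> idot w x" if x: "x \<in> Q" "x \<notin> ?F" for x
  proof -
    have px: "0 < idot w x" using pos[OF x(1)] x by (auto simp: facet_def order_less_le)
    have "m \<le> nat (idot w x)" unfolding m_def by (rule Least_le) (use x(1) px in blast)
    then show ?thesis using q(2,3) px by linarith
  qed
  have qF: "q \<notin> ?F" using q(2) by (simp add: facet_def)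
  have "monom q \<in> PF ?F" using monom_PF_iff[OF q(1)] qF by blast
  then have "PF ?F \<noteq> {0}" using monom_nonzero[of q] by blast
  from loc.regular_imp_principal[OF reg facet_height[OF w] this]
  obtain \<pi> where pi: "\<pi> \<in> PF ?F" "\<And>a. a \<in> PF ?F \<Longrightarrow> \<exists>u\<in>loc.S. \<exists>c\<in>A. u * a = c * \<pi>" by metis
  obtain u0 c0 where u0: "u0 \<in> loc.S" "c0 \<in> A" "u0 * monom q = c0 * \<pi>"
    using pi(2)[OF \<open>monom q \<in> PF ?F\<close>] by blast
  have c0: "c0 \<notin> PF ?F"
  proof
    assume c0: "c0 \<in> PF ?F"
    obtain x where x: "x \<in> Poly_Mapping.keys u0" "x \<in> ?F" using u0(1) by (auto simp: PF_iff)
    have "q + x \<in> Poly_Mapping.keys (monom q * u0)" unfolding keys_monom_mult using x(1) by blast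
    also have "monom q * u0 = c0 * \<pi>" using u0(3) by (simp add: mult.commute)
    finally obtain a b where ab: "q + x = a + b" "a \<in> Poly_Mapping.keys c0" "b \<in> Poly_Mapping.keys \<pi>"
      using keys_mult[of c0 \<pi>] by blast
    have "idot w q \<le> idot w a" "idot w q \<le> idot w b" using min ab(2,3) c0 pi(1) by (auto simp: PF_def)
    then have "idot w q + idot w q \<le> idot w (q + x)" unfolding ab(1) by (simp add: idot_simps)
    then show False using x(2) q(2) by (simp add: idot_simps facet_def)
  qed
  have step: "\<exists>z\<in>Q. \<exists>y\<in>?F. x + y = q + z" if x: "x \<in> Q" "x \<notin> ?F" for x
  proof -
    have "monom x \<in> PF ?F" using monom_PF_iff[OF x(1)] x(2) by blast
    then obtain u c where u: "u \<in> loc.S" "c \<in> A" "u * monom x = c * \<pi>" using pi(2) by blast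
    have "monom x * (u * c0) = (u * monom x) * c0" by (simp add: ac_simps)
    also have "\<dots> = c * (c0 * \<pi>)" unfolding u(3) by (simp add: ac_simps)
    also have "\<dots> = monom q * (c * u0)" unfolding u0(3)[symmetric] by (simp add: ac_simps)
    finally have eq: "monom x * (u * c0) = monom q * (c * u0)" .
    have "u * c0 \<in> loc.S" using loc.mult_S[OF u(1)] u0(2) c0 by blast
    then obtain y where y: "y \<in> Poly_Mapping.keys (u * c0)" "y \<in> ?F" by (auto simp: PF_iff)
    have "x + y \<in> Poly_Mapping.keys (monom q * (c * u0))"
      unfolding eq[symmetric] keys_monom_mult using y(1) by blast
    then obtain z where z: "x + y = q + z" "z \<in> Poly_Mapping.keys (c * u0)" unfolding keys_monom_mult by blast
    have "c * u0 \<in> A" using mult_in[OF u(2)] u0(1) by blast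
    then have "z \<in> Q" using z(2) by blast
    then show ?thesis using z(1) y(2) by blast
  qed
  have gen: "\<exists>k :: nat. x - int k *s q \<in> group_gen ?F" if "x \<in> Q" for x
    using that
  proof (induction "nat (idot w x)" arbitrary: x rule: less_induct)
    case less
    show ?case
    proof (cases "x \<in> ?F")
      case True
      then show ?thesis using subset_group_gen[of ?F] by (intro exI[of _ 0]) auto
    next
      case False
      obtain z y where zy: "z \<in> Q" "y \<in> ?F" "x + y = q + z" using step[OF less.prems False] by blast
      have "idot w x = idot w q + idot w z"
        using arg_cong[OF zy(3), of "idot w"] zy(2) by (simp add: idot_simps facet_def)
      then have "nat (idot w z) < nat (idot w x)" using q(2) pos[OF zy(1)] by linarith
      then obtain k where k: "z - int k *s q \<in> group_gen ?F" using less.hyps zy(1) by blast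
      have "x = q + z - y" using zy(3) by (simp add: algebra_simps)
      then have "x - int (Suc k) *s q = (z - int k *s q) - y" by (simp add: vec_eq_iff algebra_simps)
      also have "\<dots> \<in> group_gen ?F" by (rule group_gen_diff[OF k subsetD[OF subset_group_gen zy(2)]])
      finally show ?thesis by blast
    qed
  qed
  show ?thesis
  proof
    fix p assume "p \<in> normalization Q"
    then obtain n where n: "p \<in> group_gen Q" "n > 0" "int n *s p \<in> Q"
      unfolding normalization_eq[OF Q] by blast
    have wp: "0 \<le> idot w p" using pos[OF n(3)] n(2) by (simp add: idot_simps zero_le_mult_iff)
    obtain a b where ab: "p = a - b" "a \<in> Q" "b \<in> Q" using n(1) group_gen_eq_diff[OF Q'] by blast
    obtain k l where kl: "a - int k *s q \<in> group_gen ?F" "b - int l *s q \<in> group_gen ?F"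
      using gen[OF ab(2)] gen[OF ab(3)] by blast
    then have "(a - int k *s q) - (b - int l *s q) \<in> group_gen ?F" by (rule group_gen_diff)
    also have "(a - int k *s q) - (b - int l *s q) = p - (int k - int l) *s q"
      unfolding ab(1) by (simp add: vec_eq_iff algebra_simps)
    finally obtain f g where fg: "p - (int k - int l) *s q = f - g" "f \<in> ?F" "g \<in> ?F"
      unfolding group_gen_eq_diff[OF FM] by blast
    have "idot w p - (int k - int l) * idot w q = 0"
      using arg_cong[OF fg(1), of "idot w"] fg(2,3) by (simp add: idot_simps facet_def algebra_simps)
    then have "0 \<le> (int k - int l) * idot w q" using wp by (simp add: algebra_simps)
    then have kl0: "0 \<le> int k - int l" using q(2) by (simp add: zero_le_mult_iff)
    have "p = (f + (int k - int l) *s q) - g" using fg(1) by (simp add: algebra_simps)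
    moreover have "f + (int k - int l) *s q \<in> Q"
      using fg(2) faceD(1)[OF F] by (intro submonoid_add[OF Q'] submonoid_smult_int[OF Q' q(1) kl0]) auto
    ultimately show "p \<in> face_localization Q ?F" unfolding face_localization_def using fg(3) by blast
  qed
qed

section \<open>Depth\<close>

lemma graded_max_ideal_eq: "graded_max_ideal K Q = PF (min_face Q)"
  by (simp add: graded_max_ideal_def PF_def)

lemma star_depth_ge_one:
  assumes "min_face Q \<noteq> Q" shows "1 \<le> star_depth K Q"
proof -
  note F = face_min_face[OF Q']
  have id: "ideal (PF (min_face Q)) (subring_of A)" "1 \<notin> PF (min_face Q)"
    using PF_prime[OF F] unfolding primeideal_iff_prime_set[symmetric] R.primeideal_iff by auto
  obtain q where q: "q \<in> Q" "q \<notin> min_face Q" using assms faceD(1)[OF F] by blast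
  show ?thesis unfolding star_depth_def monoid_algebra_eq graded_max_ideal_eq
  proof (rule R.one_le_grade[OF id(1), of "monom q"])
    show "\<one>\<^bsub>subring_of A\<^esub> \<notin> PF (min_face Q)" using id(2) by simp
    show "monom q \<in> PF (min_face Q)" using monom_PF_iff[OF q(1)] q(2) by blast
    fix a assume "a \<in> carrier (subring_of A)" "monom q \<otimes>\<^bsub>subring_of A\<^esub> a = \<zero>\<^bsub>subring_of A\<^esub>"
    then have "monom q * a = 0" by simp
    then have "a = 0" using laurent_mult_nonzero[OF monom_nonzero[of q], of a] by blast
    then show "a = \<zero>\<^bsub>subring_of A\<^esub>" by simp
  qed
qed

lemma star_depth_le_one:
  assumes p: "p \<notin> Q" "\<And>x. x \<in> Q \<Longrightarrow> x \<notin> min_face Q \<Longrightarrow> p + x \<in> Q"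
  shows "star_depth K Q \<le> 1"
  unfolding star_depth_def monoid_algebra_eq graded_max_ideal_eq
proof (rule R.grade_le_one)
  show "\<one>\<^bsub>subring_of A\<^esub> \<noteq> \<zero>\<^bsub>subring_of A\<^esub>" by simp
  have shift: "monom p * f \<in> A" if "f \<in> PF (min_face Q)" for f
    using that p(2) unfolding PF_def mem_Collect_eq keys_monom_mult by blast
  fix f assume f: "f \<in> PF (min_face Q)" "f \<in> carrier (subring_of A)" "f \<noteq> \<zero>\<^bsub>subring_of A\<^esub>"
  have f0: "f \<noteq> 0" using f(3) by simp
  show "\<exists>h\<in>carrier (subring_of A). h \<notin> genideal (subring_of A) {f} \<and>
    (\<forall>g\<in>PF (min_face Q). g \<otimes>\<^bsub>subring_of A\<^esub> h \<in> genideal (subring_of A) {f})"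
  proof (rule bexI[of _ "monom p * f"], intro conjI ballI)
    show "monom p * f \<in> carrier (subring_of A)" using shift[OF f(1)] by simp
    show "monom p * f \<notin> genideal (subring_of A) {f}"
    proof
      assume "monom p * f \<in> genideal (subring_of A) {f}"
      then obtain c where c: "c \<in> A" "monom p * f = c * f"
        unfolding R.in_genideal_single_iff[OF f(2)] by auto
      have "f * monom p = f * c" using c(2) by (simp only: mult.commute)
      then have "monom p = c" by (rule laurent_mult_cancel[OF f0])
      then have "monom p \<in> A" using c(1) by simp
      then show False using p(1) by simp
    qed
    fix g assume g: "g \<in> PF (min_face Q)"
    have "g * (monom p * f) = (monom p * g) * f" by (simp only: ac_simps)
    then show "g \<otimes>\<^bsub>subring_of A\<^esub> (monom p * f) \<in> genideal (subring_of A) {f}"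
      unfolding R.in_genideal_single_iff[OF f(2)] using shift[OF g] by auto
  qed
qed

text \<open>If \<open>g b\<close> is a multiple of \<open>x\<^sup>a\<close>, then \<open>g\<close> carries \<open>x\<^sup>-\<^sup>a b\<close> into \<open>K[Q]\<close>.\<close>
lemma monom_nonzerodivisor_mod:
  assumes "g \<in> A" "a \<in> Q" "b \<in> A" "c \<in> A" "g * b = c * monom a"
    and "\<And>p. p \<in> group_gen Q \<Longrightarrow> p \<notin> Q \<Longrightarrow> face Q {q\<in>Q. p + q \<notin> Q} \<Longrightarrow> g \<notin> PF {q\<in>Q. p + q \<notin> Q}"
  shows "\<exists>v\<in>A. b = v * monom a"
proof -
  define v where "v = monom (- a) * b"
  have b: "b = v * monom a" unfolding v_def using monom_cancel(2)[of a b] by (simp add: mult.commute)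
  have "g * v = monom (- a) * (g * b)" by (simp add: v_def ac_simps)
  also have "\<dots> = monom (- a) * (monom a * c)" unfolding assms(5) by (simp only: mult.commute)
  finally have gv: "g * v \<in> A" using assms(4) by (simp only: monom_cancel)
  have vG: "v \<in> KG"
  proof -
    have "y \<in> group_gen Q" if y: "y \<in> Poly_Mapping.keys v" for y
    proof -
      obtain x where x: "y = - a + x" "x \<in> Poly_Mapping.keys b"
        using y unfolding v_def keys_monom_mult by blast
      have "x \<in> group_gen Q" "a \<in> group_gen Q" using x(2) assms(2,3) subset_group_gen[of Q] by auto
      then show ?thesis unfolding x(1) by (intro group_gen_add group_gen_uminus)
    qed
    then show ?thesis by blast
  qed
  have "v \<in> A"
  proof (rule ccontr)
    assume "v \<notin> A"
    show False
    proof (rule zero_divisor_socle[OF assms(1) vG \<open>v \<notin> A\<close> gv])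
      fix p assume p: "p \<in> group_gen Q" "p \<notin> Q" "face Q {q\<in>Q. p + q \<notin> Q}" "g \<in> PF {q\<in>Q. p + q \<notin> Q}"
      show False using assms(6)[OF p(1,2,3)] p(4) by (rule notE)
    qed
  qed
  then show ?thesis using b by blast
qed

text \<open>The sum of all noninvertible generators lies in no prime of a face other than the minimal one,
  hence is a nonzerodivisor modulo any monomial.\<close>
lemma star_depth_ge_two:
  assumes ne: "min_face Q \<noteq> Q"
    and no: "\<And>p. p \<in> group_gen Q \<Longrightarrow> p \<notin> Q \<Longrightarrow> \<exists>x\<in>Q. x \<notin> min_face Q \<and> p + x \<notin> Q"
  shows "2 \<le> star_depth K Q"
proof -
  let ?E = "min_face Q"
  note F = face_min_face[OF Q']
  have id: "ideal (PF ?E) (subring_of A)" "1 \<notin> PF ?E"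
    using PF_prime[OF F] unfolding primeideal_iff_prime_set[symmetric] R.primeideal_iff by auto
  obtain a where a: "a \<in> Q" "a \<notin> ?E" using ne faceD(1)[OF F] by blast
  obtain G where G: "finite G" "Q = add_submonoid hull G" using Q affine_monoid_def by blast
  have GQ: "G \<subseteq> Q" using G(2) by (simp add: hull_subset)
  define g where "g = (\<Sum>h\<in>G - ?E. monom h :: (int ^ 'n) \<Rightarrow>\<^sub>0 'k)"
  have lg: "Poly_Mapping.lookup g x = (if x \<in> G - ?E then 1 else 0)" for x
    unfolding g_def lookup_sum using G(1) by (simp add: lookup_single when_def)
  have kg: "Poly_Mapping.keys g = G - ?E" unfolding in_keys_iff set_eq_iff lg by simp
  have gP: "g \<in> PF ?E" unfolding PF_def using kg GQ by auto
  then have gA: "g \<in> A" by (simp add: PF_iff)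
  have aP: "monom a \<in> PF ?E" using monom_PF_iff[OF a(1)] a(2) by blast
  show ?thesis unfolding star_depth_def monoid_algebra_eq graded_max_ideal_eq
  proof (rule R.two_le_grade[OF id(1) _ aP gP])
    show "\<one>\<^bsub>subring_of A\<^esub> \<notin> PF ?E" using id(2) by simp
    show "b = \<zero>\<^bsub>subring_of A\<^esub>" if "b \<in> carrier (subring_of A)"
      "monom a \<otimes>\<^bsub>subring_of A\<^esub> b = \<zero>\<^bsub>subring_of A\<^esub>" for b
      using that laurent_mult_nonzero[OF monom_nonzero[of a], of b] by auto
    have aR: "monom a \<in> carrier (subring_of A)" using a(1) by simp
    fix b assume b: "b \<in> carrier (subring_of A)"
      "g \<otimes>\<^bsub>subring_of A\<^esub> b \<in> genideal (subring_of A) {monom a}"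
    then obtain c where c: "c \<in> A" "g * b = c * monom a"
      unfolding R.in_genideal_single_iff[OF aR] by auto
    have "\<exists>v\<in>A. b = v * monom a"
    proof (rule monom_nonzerodivisor_mod[OF gA a(1) _ c])
      show "b \<in> A" using b(1) by simp
      fix p assume p: "p \<in> group_gen Q" "p \<notin> Q" "face Q {q\<in>Q. p + q \<notin> Q}"
      let ?F = "{q\<in>Q. p + q \<notin> Q}"
      from no[OF p(1,2)] obtain x where x: "x \<in> Q" "x \<notin> ?E" "p + x \<notin> Q" by (elim bexE conjE)
      have "\<exists>h\<in>G - ?E. h \<in> ?F"
      proof -
        obtain h y where hy: "h \<in> G - ?E" "y \<in> Q" "x = h + y"
          using generator_outside_face[OF G(2) F x(1,2)] by blast
        have "h + y \<in> ?F" using x hy(3) by simp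
        then have "h \<in> ?F" using faceD(2)[OF p(3), of h y] hy GQ by blast
        then show ?thesis using hy(1) by blast
      qed
      then show "g \<notin> PF ?F" using kg by (auto simp: PF_def)
    qed
    then show "b \<in> genideal (subring_of A) {monom a}"
      unfolding R.in_genideal_single_iff[OF aR] by auto
  qed
qed

text \<open>A facet normal that is negative at \<open>p\<close> stays negative at \<open>p + x\<close> for \<open>x\<close> in its facet, and for \<open>d \<ge> 2\<close>
  the facet is larger than the minimal face.\<close>
lemma socle_point_normalization:
  assumes d: "2 \<le> star_dim Q Q" and p: "p \<in> group_gen Q" "\<And>x. x \<in> Q \<Longrightarrow> x \<notin> min_face Q \<Longrightarrow> p + x \<in> Q"
  shows "p \<in> normalization Q"
proof (rule ccontr)
  assume "p \<notin> normalization Q"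
  then have "\<not> (\<exists>n>0. int n *s p \<in> Q)" using p(1) unfolding normalization_eq[OF Q] by simp
  from exists_facet_normal[OF Q p(1) this]
  obtain w where w: "facet_normal Q w" "idot w p < 0" by (elim exE conjE)
  note F = facet_face[OF Q' w(1)]
  have "star_dim Q (facet Q w) = star_dim Q Q - 1"
    using star_dim_eq_codim_one_iff[OF Q F] w(1) by blast
  then have "facet Q w \<noteq> min_face Q" using d star_dim_eq_0_iff[OF Q' F] by auto
  then obtain x where x: "x \<in> facet Q w" "x \<notin> min_face Q" using min_face_subset[OF Q' F] by blast
  then have "p + x \<in> Q" using p(2) by (simp add: facet_def)
  then have "0 \<le> idot w (p + x)" using w(1) by (simp add: facet_normal_def)
  then show False using w(2) x(1) by (simp add: idot_simps facet_def)
qed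

theorem star_depth_eq_one_iff:
  assumes d: "2 \<le> star_dim Q Q"
  shows "star_depth K Q = 1 \<longleftrightarrow> (\<exists>A. family_of_holes_dim Q 0 A)"
proof -
  let ?E = "min_face Q"
  note F0 = face_min_face[OF Q']
  have ne: "?E \<noteq> Q"
  proof
    assume "?E = Q"
    then have "star_dim Q Q = 0" using star_dim_eq_0_iff[OF Q' face_whole[OF Q']] by simp
    then show False using d by simp
  qed
  have socle: "star_depth K Q = 1 \<longleftrightarrow>
      (\<exists>p\<in>group_gen Q. p \<notin> Q \<and> (\<forall>x\<in>Q. x \<notin> ?E \<longrightarrow> p + x \<in> Q))" (is "_ \<longleftrightarrow> ?socle")
  proof
    assume one: "star_depth K Q = 1"
    show ?socle
    proof (rule ccontr)
      assume "\<not> ?socle"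
      then have "2 \<le> star_depth K Q" by (intro star_depth_ge_two[OF ne]) blast
      then show False using one by (simp add: one_enat_def numeral_eq_enat)
    qed
  next
    assume ?socle
    then obtain p where p: "p \<notin> Q" "\<And>x. x \<in> Q \<Longrightarrow> x \<notin> ?E \<Longrightarrow> p + x \<in> Q" by blast
    show "star_depth K Q = 1" by (rule antisym[OF star_depth_le_one[OF p] star_depth_ge_one[OF ne]])
  qed
  also have "?socle \<longleftrightarrow> (\<exists>A. family_of_holes_dim Q 0 A)"
  proof
    assume ?socle
    then obtain p where p: "p \<in> group_gen Q" "p \<notin> Q" "\<And>x. x \<in> Q \<Longrightarrow> x \<notin> ?E \<Longrightarrow> p + x \<in> Q" by blast
    have pn: "p \<in> normalization Q" by (rule socle_point_normalization[OF d p(1,3)])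
    have "p \<notin> face_localization Q ?E" using p(2) face_localization_min_face[OF Q'] by simp
    then obtain F where F: "face Q F" "?E \<subseteq> F" "family_of_holes Q ((+) p ` group_gen F)"
      "p \<notin> face_localization Q F" by (rule family_through[OF Q F0 pn])
    have "F = ?E"
    proof (rule ccontr)
      assume "F \<noteq> ?E"
      then obtain x where x: "x \<in> F" "x \<notin> ?E" using F(2) by blast
      then have "p + x \<in> Q" using p(3) faceD(1)[OF F(1)] by blast
      then show False using F(4) in_face_localization_iff[OF Q' F(1)] x(1) by blast
    qed
    then have "star_dim Q F = 0" using star_dim_eq_0_iff[OF Q' F(1)] by simp
    then show "\<exists>A. family_of_holes_dim Q 0 A"
      unfolding family_of_holes_dim_def using F(1,3) pn by (intro exI conjI) auto
  next
    assume "\<exists>A. family_of_holes_dim Q 0 A"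
    then obtain B q F where *: "family_of_holes Q B" "q \<in> normalization Q" "face Q F"
      "B = (+) q ` group_gen F" "star_dim Q F = 0"
      unfolding family_of_holes_dim_def by (elim exE conjE)
    have F: "F = ?E" using *(5) star_dim_eq_0_iff[OF Q' *(3)] by simp
    from family_socle_point[OF Q *(1,3,4,2)]
    obtain p where p: "p \<in> group_gen Q" "p \<notin> face_localization Q F" "\<forall>x\<in>Q. x \<notin> F \<longrightarrow> p + x \<in> Q"
      by (elim bexE conjE)
    then show ?socle using face_localization_min_face[OF Q'] F by auto
  qed
  finally show ?thesis .
qed

section \<open>Serre's conditions\<close>

text \<open>A prime of height at most one is zero, free of monomials, or the prime of a facet. The first two
  kinds always have regular localizations.\<close>
theorem serre_R1_iff:
  "serre_R 1 (monoid_algebra K Q) \<longleftrightarrow> \<not> (\<exists>A. family_of_holes_dim Q (star_dim Q Q - 1) A)"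
proof -
  have "serre_R 1 (subring_of A) \<longleftrightarrow>
    (\<forall>w. facet_normal Q w \<longrightarrow> normalization Q \<subseteq> face_localization Q (facet Q w))"
  proof
    assume R1: "serre_R 1 (subring_of A)"
    show "\<forall>w. facet_normal Q w \<longrightarrow> normalization Q \<subseteq> face_localization Q (facet Q w)"
    proof (intro allI impI)
      fix w assume w: "facet_normal Q w"
      have "primeideal (PF (facet Q w)) (subring_of A)"
        unfolding primeideal_iff_prime_set by (rule PF_prime[OF facet_face[OF Q' w]])
      then have "regular_local_ring (localization_at (subring_of A) (PF (facet Q w)))"
        using R1 facet_height[OF w] unfolding serre_R_def by simp
      then show "normalization Q \<subseteq> face_localization Q (facet Q w)" by (rule regular_facet_normal[OF w])
    qed
  next
    assume nor: "\<forall>w. facet_normal Q w \<longrightarrow> normalization Q \<subseteq> face_localization Q (facet Q w)"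
    show "serre_R 1 (subring_of A)" unfolding serre_R_def
    proof (intro allI impI, elim conjE)
      fix P assume "primeideal P (subring_of A)" and ht: "height (subring_of A) P \<le> enat 1"
      then have P: "prime_set P" unfolding primeideal_iff_prime_set by simp
      show "regular_local_ring (localization_at (subring_of A) P)"
      proof (cases "P = {0}")
        case True
        interpret loc: localized_domain A P by unfold_locales (rule P)
        show ?thesis by (rule loc.regular_at_zero[OF True])
      next
        case False
        show ?thesis
        proof (cases "mon_face P = Q")
          case True
          then have no_mon: "\<forall>q\<in>Q. monom q \<notin> P" by (auto simp: mon_face_def)
          obtain \<pi> where pi: "\<pi> \<in> P" "G.prime_in \<pi>"
            using laurent_prime_element[OF P False no_mon] by blast
          note tr = laurent_prime_trace[OF P no_mon pi]
          have "\<pi> \<in> {a\<in>A. \<pi> dvd a}" using pi(1) prime_setD(1)[OF P] by auto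
          then have "{a\<in>A. \<pi> dvd a} \<noteq> {0}" using G.prime_in_D(2)[OF pi(2)] by auto
          then have "\<not> {a\<in>A. \<pi> dvd a} \<subset> P" using height_le_oneD[OF ht P tr(1)] by (rule contrapos_nn)
          then have "P = {a\<in>A. \<pi> dvd a}" using tr(2) by (simp only: psubset_eq) simp
          then show ?thesis by (rule laurent_prime_dvr(1)[OF P no_mon pi])
        next
          case mon: False
          from proper_face_in_facet[OF Q mon_face_face[OF P] mon]
          obtain w where w: "facet_normal Q w" "mon_face P \<subseteq> facet Q w" by (elim exE conjE)
          note F = facet_face[OF Q' w(1)]
          have sub: "PF (facet Q w) \<subseteq> P"
            using w(2) PF_mon_face[OF P] unfolding PF_def by blast
          obtain q where q: "q \<in> Q" "q \<notin> facet Q w" using facet_neq[OF w(1)] faceD(1)[OF F] by blast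
          have "monom q \<in> PF (facet Q w)" using monom_PF_iff[OF q(1)] q(2) by blast
          then have "PF (facet Q w) \<noteq> {0}" using monom_nonzero[of q] by blast
          then have "\<not> PF (facet Q w) \<subset> P" using height_le_oneD[OF ht P PF_prime[OF F]] by (rule contrapos_nn)
          then have "P = PF (facet Q w)" using sub by (simp only: psubset_eq) simp
          then show ?thesis using normal_facet_dvr[OF w(1)] nor w(1) by simp
        qed
      qed
    qed
  qed
  then show ?thesis unfolding monoid_algebra_eq codim_one_family_iff[OF Q] by blast
qed

text \<open>If the families are parallel to facets, then the associated primes of a monomial are
  primes of facets. These have height one, so none of them contains \<open>P\<close>, and prime avoidance provides a
  nonzerodivisor. A prime without monomials is treated in the factorial ring of Laurent polynomials.\<close>
lemma local_depth_ge_two: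
  assumes fam: "\<And>A. family_of_holes Q A \<Longrightarrow> family_of_holes_dim Q (star_dim Q Q - 1) A"
    and P: "prime_set P" "P \<noteq> {0}" and ht: "\<not> height (subring_of A) P \<le> enat 1"
  shows "2 \<le> local_depth (localization_at (subring_of A) P)"
proof -
  interpret loc: localized_domain A P by unfold_locales (rule P(1))
  show ?thesis
  proof (cases "mon_face P = Q")
    case True
    then have no_mon: "\<forall>q\<in>Q. monom q \<notin> P" by (auto simp: mon_face_def)
    obtain \<pi> where pi: "\<pi> \<in> P" "G.prime_in \<pi>"
      using laurent_prime_element[OF P no_mon] by blast
    note tr = laurent_prime_trace[OF P(1) no_mon pi]
    define T where "T = {a\<in>A. \<pi> dvd a}"
    have "P \<noteq> T"
    proof
      assume "P = T"
      then have eq: "P = {a\<in>A. \<pi> dvd a}" unfolding T_def .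
      from laurent_prime_dvr(2)[OF P(1) no_mon pi(1) pi(2) eq] show False using ht by simp
    qed
    moreover have "T \<subseteq> P" unfolding T_def by (rule tr(2))
    ultimately obtain g where g: "g \<in> P" "g \<notin> T" by blast
    have gA: "g \<in> A" using g(1) prime_setD(1)[OF P(1)] by blast
    then have ng: "\<not> \<pi> dvd g" using g(2) by (simp add: T_def)
    show ?thesis
    proof (rule loc.two_le_local_depth[OF pi(1) g(1) G.prime_in_D(2)[OF pi(2)]])
      fix a c assume a: "a \<in> A" "c \<in> A" "g * a = c * \<pi>"
      then have "\<pi> dvd g * a" by simp
      moreover have "g \<in> KG" "a \<in> KG" using gA a(1) A_KG by blast+
      ultimately have "\<pi> dvd a" using G.prime_in_D(4)[OF pi(2), of g a] ng by simp
      then obtain q c' where q: "q \<in> Q" "c' \<in> A" "monom q * a = c' * \<pi>" using tr(3)[OF a(1)] by blast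
      then show "\<exists>u\<in>loc.S. \<exists>c\<in>A. u * a = c * \<pi>" using monom_A[OF q(1)] no_mon q(1) by blast
    qed
  next
    case False
    then obtain a where a: "a \<in> Q" "monom a \<in> P" by (auto simp: mon_face_def)
    define \<P> where "\<P> = PF ` {F. \<exists>w. facet_normal Q w \<and> F = facet Q w}"
    have "{F. \<exists>w. facet_normal Q w \<and> F = facet Q w} \<subseteq> {F. face Q F}"
      using facet_face[OF Q'] by auto
    then have fin: "finite \<P>" unfolding \<P>_def using finite_faces[OF Q] by (meson finite_imageI finite_subset)
    have pr: "prime_set p" if "p \<in> \<P>" for p
      using that PF_prime[OF facet_face[OF Q']] unfolding \<P>_def by blast
    have av: "\<not> P \<subseteq> p" if "p \<in> \<P>" for p
    proof
      assume sub: "P \<subseteq> p"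
      obtain w where w: "facet_normal Q w" "p = PF (facet Q w)" using \<open>p \<in> \<P>\<close> unfolding \<P>_def by blast
      show False
      proof (cases "P = p")
        case True then show ?thesis using facet_height[OF w(1)] w(2) ht by simp
      next
        case False
        then show ?thesis using below_facet_prime[OF w(1) P(1)] sub w(2) P(2) by blast
      qed
    qed
    obtain g where g: "g \<in> P" "\<And>p. p \<in> \<P> \<Longrightarrow> g \<notin> p"
      using prime_avoidance[OF fin pr av P(1)] by blast
    have gA: "g \<in> A" using g(1) prime_setD(1)[OF P(1)] by blast
    show ?thesis
    proof (rule loc.two_le_local_depth[OF a(2) g(1) monom_nonzero])
      fix b c assume b: "b \<in> A" "c \<in> A" "g * b = c * monom a"
      have "\<exists>v\<in>A. b = v * monom a"
      proof (rule monom_nonzerodivisor_mod[OF gA a(1) b])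
        fix p assume p: "p \<in> group_gen Q" "p \<notin> Q" "face Q {q\<in>Q. p + q \<notin> Q}"
        let ?F = "{q\<in>Q. p + q \<notin> Q}"
        obtain x y where xy: "p = x - y" "x \<in> Q" "y \<in> Q"
          using p(1) unfolding group_gen_eq_diff[OF Q'] by blast
        then have "p + y \<in> Q" by simp
        then have "y \<notin> ?F" by simp
        then have "?F \<noteq> Q" using xy(3) by metis
        then have "\<exists>w. facet_normal Q w \<and> ?F = facet Q w"
          by (rule socle_face_is_facet[OF Q p(3) _ p(1,2) _ fam]) simp_all
        then have "PF ?F \<in> \<P>" unfolding \<P>_def by (intro imageI) simp
        then show "g \<notin> PF ?F" by (rule g(2))
      qed
      then obtain v where v: "v \<in> A" "b = v * monom a" by blast
      then have "1 * b = v * monom a" by simp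
      then show "\<exists>u\<in>loc.S. \<exists>c\<in>A. u * b = c * monom a" using loc.one_S v(1) by blast
    qed
  qed
qed

text \<open>For a family along a face that is not a facet, the prime of that face has height at least two but
  depth at most one.\<close>
theorem serre_S2_iff:
  "serre_S 2 (monoid_algebra K Q) \<longleftrightarrow>
    (\<forall>A. family_of_holes Q A \<longrightarrow> family_of_holes_dim Q (star_dim Q Q - 1) A)"
  unfolding monoid_algebra_eq
proof
  assume S2: "serre_S 2 (subring_of A)"
  show "\<forall>A. family_of_holes Q A \<longrightarrow> family_of_holes_dim Q (star_dim Q Q - 1) A"
  proof (intro allI impI)
    fix B assume B: "family_of_holes Q B"
    then obtain q F where qF: "q \<in> normalization Q" "face Q F" "B = (+) q ` group_gen F"
      unfolding family_of_holes_iff[OF Q] hole_coset_def by blast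
    from family_socle_point[OF Q B qF(2,3,1)]
    obtain p where p: "p \<in> group_gen Q" "p \<notin> face_localization Q F" "\<forall>x\<in>Q. x \<notin> F \<longrightarrow> p + x \<in> Q"
      by (elim bexE conjE)
    have "F \<noteq> Q"
    proof
      assume "F = Q"
      then show False using p(1,2) unfolding group_gen_eq_diff[OF Q'] face_localization_def by simp
    qed
    from proper_face_in_facet[OF Q qF(2) this]
    obtain w where w: "facet_normal Q w" "F \<subseteq> facet Q w" by (elim exE conjE)
    note W = facet_face[OF Q' w(1)]
    note P = PF_prime[OF qF(2)]
    interpret loc: localized_domain A "PF F" by unfold_locales (rule P)
    have "F = facet Q w"
    proof (rule ccontr)
      assume neq: "F \<noteq> facet Q w"
      \<comment> \<open>then the prime of \<open>F\<close> has height at least two\<close>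
      have "PF (facet Q w) \<subset> PF F"
      proof
        show "PF (facet Q w) \<subseteq> PF F" using w(2) unfolding PF_def by blast
        show "PF (facet Q w) \<noteq> PF F" using PF_inj[OF W qF(2)] PF_inj[OF qF(2) W] neq by blast
      qed
      moreover obtain x where x: "x \<in> Q" "x \<notin> facet Q w" using facet_neq[OF w(1)] faceD(1)[OF W] by blast
      moreover have "monom x \<in> PF (facet Q w)" using monom_PF_iff[OF x(1)] x(2) by blast
      then have "PF (facet Q w) \<noteq> {0}" using monom_nonzero[of x] by blast
      ultimately have "\<not> height (subring_of A) (PF F) \<le> enat 1"
        using height_le_oneD[OF _ P PF_prime[OF W]] by blast
      then have "enat 2 \<le> krull_dim (localization_at (subring_of A) (PF F))"
        unfolding loc.krull_dim_L
        by (metis Suc_1 Suc_ile_eq not_le)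
      moreover have "primeideal (PF F) (subring_of A)" using P unfolding primeideal_iff_prime_set .
      ultimately have "enat 2 \<le> local_depth (localization_at (subring_of A) (PF F))"
        using S2 unfolding serre_S_def by (metis min_absorb1)
      moreover have "local_depth (localization_at (subring_of A) (PF F)) \<le> 1"
        by (rule socle_local_depth[OF qF(2) p(2)]) (use p(3) in simp)
      ultimately have "enat 2 \<le> 1" by (rule order_trans)
      then show False by (simp add: one_enat_def)
    qed
    then have "star_dim Q F = star_dim Q Q - 1" using star_dim_eq_codim_one_iff[OF Q qF(2)] w(1) by blast
    then show "family_of_holes_dim Q (star_dim Q Q - 1) B"
      unfolding family_of_holes_dim_def using B qF by (intro conjI exI) auto
  qed
next
  assume fam: "\<forall>A. family_of_holes Q A \<longrightarrow> family_of_holes_dim Q (star_dim Q Q - 1) A"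
  show "serre_S 2 (subring_of A)" unfolding serre_S_def
  proof (intro allI impI)
    fix P assume "primeideal P (subring_of A)"
    then have P: "prime_set P" unfolding primeideal_iff_prime_set by simp
    interpret loc: localized_domain A P by unfold_locales (rule P)
    show "min (enat 2) (krull_dim (localization_at (subring_of A) P))
      \<le> local_depth (localization_at (subring_of A) P)" (is "min _ ?k \<le> ?d")
    proof (cases "P = {0}")
      case True
      have "?k = 0" unfolding loc.krull_dim_L by (rule loc.height_zero[OF True])
      then show ?thesis by simp
    next
      case nz: False
      show ?thesis
      proof (cases "height (subring_of A) P \<le> enat 1")
        case True
        then have "min (enat 2) ?k \<le> 1" unfolding loc.krull_dim_L by (simp add: one_enat_def min.coboundedI2)
        also have "1 \<le> ?d" by (rule loc.one_le_local_depth[OF nz])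
        finally show ?thesis .
      next
        case False
        have "2 \<le> ?d" by (rule local_depth_ge_two[OF _ P nz False]) (use fam in blast)
        then show ?thesis by (simp add: numeral_eq_enat min.coboundedI1)
      qed
    qed
  qed
qed

end

theorem theorem5p2:
  fixes Q :: "(int ^ 'n) set" and d :: int
  assumes "affine_monoid Q"
    and "star_dim Q Q = d"
  shows "(d \<ge> 2 \<longrightarrow>
            (star_depth TYPE('k::field) Q = 1 \<longleftrightarrow> (\<exists>A. family_of_holes_dim Q 0 A))) \<and>
         (locally_normal Q \<longleftrightarrow> \<not> (\<exists>A j. j > 0 \<and> family_of_holes_dim Q j A)) \<and>
         (serre_R 1 (monoid_algebra TYPE('k) Q) \<longleftrightarrow> \<not> (\<exists>A. family_of_holes_dim Q (d - 1) A)) \<and>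
         (serre_S 2 (monoid_algebra TYPE('k) Q) \<longleftrightarrow>
            (\<forall>A. family_of_holes Q A \<longrightarrow> family_of_holes_dim Q (d - 1) A))"
proof -
  interpret affine_algebra Q "TYPE('k)" by unfold_locales (rule assms(1))
  show ?thesis
    using star_depth_eq_one_iff locally_normal_iff[OF assms(1)] serre_R1_iff serre_S2_iff
    unfolding assms(2) by blast
qed

end
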